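(* Let $\Omega=\Omega_+\setminus\overline{\Omega_-}\subset\mathbb{R}^2$ be an annulus and let $f=\partial_\tau g$, where $g:\partial\Omega\to\mathbb{R}$ satisfies conditions (H1), (H2), (H3), (H4) and (H5) listed in the context. Assume that there is a unique optimal transport plan $\gamma$ between $f^+$ and $f^-$ and let $\sigma$ be the corresponding transport density. If $F_i^+$ is a flat part (i.e. $g_+$ is constant on $F_i^+$) for each $i$, then for all $p\in[1,\infty]$: $\sigma\in L^p(\Omega)$ as soon as $f\in L^p(\partial\Omega)$. Moreover, if there is some $i$ such that $F_i^+$ is not a flat part, then the same result holds for every $p\in[1,2]$ as soon as the exterior domain $\Omega_+$ is uniformly convex.
   Context: Annulus: $\Omega=\Omega_+\setminus\overline{\Omega_-}$, where $\Omega_\pm\subset\mathbb{R}^2$ are open bounded strictly convex sets with $\Omega_-\subset\subset\Omega_+$; $g_\pm=g|_{\partial\Omega_\pm}$. $\nu$ is the outward unit normal to $\Omega$, $\tau=R_{-\frac{\pi}{2}}\nu$ with $R_{\frac{\pi}{2}}(x_1,x_2)=(-x_2,x_1)$ (so $\tau$ runs clockwise on $\partial\Omega_+$ and counterclockwise on $\partial\Omega_-$), and $\partial_\tau g=f$ means $\int_{\partial\Omega}\phi\,\mathrm{d}f=-\int_{\partial\Omega}g\,\partial_\tau\phi\,\mathrm{d}\mathcal{H}^1$ for $\phi\in C^1(\overline\Omega)$. $f^+,f^-$ are the positive and negative parts of $f$. An optimal transport plan between $f^+$ and $f^-$ is a minimizer of $\int|x-y|\,\mathrm{d}\gamma$ among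 nonnegative Borel measures $\gamma$ on $\overline\Omega\times\overline\Omega$ with first marginal $f^+$ and second marginal $f^-$. The transport density is the nonnegative measure $\sigma$ on $\overline\Omega$ given by $$\langle\sigma,\varphi\rangle=\int_{\overline\Omega\times\overline\Omega}\int_0^1\varphi((1-t)x+ty)\,|x-y|\,\mathrm{d}t\,\mathrm{d}\gamma(x,y),\qquad\varphi\in C(\overline\Omega).$$ Conditions on $g$. In (H2), "increasing/decreasing" refers to the clockwise orientation on both $\partial\Omega_+$ and $\partial\Omega_-$ (so that $f^+$ is carried by $\Lambda^+$ and $f^-$ by $\Lambda^-$ below). $TV(g|_A)$ is the total variation of $g$ on $A\subset\partial\Omega$. (H1) $g\in BV(\partial\Omega)$. (H2) $\partial\Omega_\pm$ can be decomposed into parts (arcs) $(\chi_i^\pm)_i$, $(\Gamma_i^\pm)_i$, $(F_i^\pm)_i$ such that: on each $\chi_i^\pm$ (resp. $\Gamma_i^\pm$) $g$ is increasing (resp. decreasing), with $TV(g|_{\chi_i^+})=TV(g|_{\chi_i^-})$ and $TV(g|_{\Gamma_i^+})=TV(g|_{\Gamma_i^-})$; for every $i$, $[\partial_\tau g_+](F_i^+)=0$, meaning that either $F_i^+$ is a flat part ($g_+$ constant on $F_i^+$; then $F_i^{++}=F_i^{+-}=\emptyset$ and conditions on these sets are void), or $F_i^+=F_i^{++}\cup F_i^{+-}$ with $g$ increasing on $F_i^{++}$, decreasing on $F_i^{+-}$ and $TV(g|_{F_i^{++}})=TV(g|_{F_i^{+-}})$; $g_-$ is constant on $F_i^-$;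 and between each two curves $\chi_i^\pm$ and $\Gamma_i^\pm$ there is a part $F_i^\pm$. (H3) For every $i$, $\chi_i^+$ is visible from $\chi_i^-$, $\Gamma_i^+$ is visible from $\Gamma_i^-$, and $F_i^{++}$ is visible from $F_i^{+-}$. Here an arc $A$ is visible from an arc $B$ if $[x,y]\subset\overline\Omega$ for all $x\in A$, $y\in B$. (H4) With $\Lambda^+=\bigcup_i\chi_i^+\cup\Gamma_i^-\cup F_i^{++}$ and $\Lambda^-=\bigcup_i\chi_i^-\cup\Gamma_i^+\cup F_i^{+-}$, for every $i$: $$d_M(\chi_i^+,\chi_i^-)+d_M(\Lambda^+\setminus\chi_i^+,\Lambda^-\setminus\chi_i^-)<\mathrm{dist}(\chi_i^+,\Lambda^-\setminus\chi_i^-)+\mathrm{dist}(\chi_i^-,\Lambda^+\setminus\chi_i^+),$$ $$d_M(\Gamma_i^+,\Gamma_i^-)+d_M(\Lambda^+\setminus\Gamma_i^-,\Lambda^-\setminus\Gamma_i^+)<\mathrm{dist}(\Gamma_i^+,\Lambda^+\setminus\Gamma_i^-)+\mathrm{dist}(\Gamma_i^-,\Lambda^-\setminus\Gamma_i^+),$$ $$d_M(F_i^{++},F_i^{+-})+d_M(\Lambda^+\setminus F_i^{++},\Lambda^-\setminus F_i^{+-})<\mathrm{dist}(F_i^{++},\Lambda^-\setminus F_i^{+-})+\mathrm{dist}(F_i^{+-},\Lambda^+\setminus F_i^{++}),$$ where $d_M(A,B)=\sup\{|x-y|:x\in A,y\in B\}$ is the maximal distance and $\mathrm{dist}(A,B)$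 the minimal distance. (H5) There exists $c>0$ such that for every $i$ and all $x\in\chi_i^-$ (resp. $\Gamma_i^-$), $y\in\chi_i^+$ (resp. $\Gamma_i^+$): $(y-x)\cdot n(x)\ge c$, where $n(x)$ is the outward unit normal to $\Omega_-$ at $x\in\partial\Omega_-$. *)

theory Defs
  imports "HOL-Analysis.Analysis"
begin

type_synonym plane = "real ^ 2"

definition strictly_convex :: "plane set \<Rightarrow> bool" where
  "strictly_convex S \<longleftrightarrow> convex S \<and>
     (\<forall>x\<in>closure S. \<forall>y\<in>closure S. x \<noteq> y \<longrightarrow> open_segment x y \<subseteq> interior S)"

definition annulus_data :: "plane set \<Rightarrow> plane set \<Rightarrow> bool" where
  "annulus_data Op Om \<longleftrightarrow>
     open Op \<and> bounded Op \<and> strictly_convex Op \<and>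
     open Om \<and> bounded Om \<and> strictly_convex Om \<and>
     Om \<noteq> {} \<and> closure Om \<subseteq> Op"

definition annulus :: "plane set \<Rightarrow> plane set \<Rightarrow> plane set" where
  "annulus Op Om = Op - closure Om"


text \<open>One-dimensional Hausdorff measure. The covering sets are required to be bounded because
  \<^const>\<open>diameter\<close> is unspecified on unbounded sets.\<close>

definition hausdorff1_outer :: "plane set \<Rightarrow> ennreal" where
  "hausdorff1_outer A =
     (SUP \<delta>\<in>{0::real<..}.
        INF U\<in>{U :: nat \<Rightarrow> plane set. A \<subseteq> (\<Union>n. U n) \<and>
                   (\<forall>n. bounded (U n) \<and> diameter (U n) \<le> \<delta>)}.
          (\<Sum>n. ennreal (diameter (U n))))"

definition hausdorff1 :: "plane measure" where
  "hausdorff1 = measure_of UNIV (sets borel) hausdorff1_outer"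

definition boundary_measure :: "plane set \<Rightarrow> plane measure" where
  "boundary_measure \<Omega> = restrict_space hausdorff1 (frontier \<Omega>)"


text \<open>Outward unit normals to a convex set. The boundaries are not assumed to be \<open>C\<^sup>1\<close>: the normal
  is unique at all but countably many boundary points, hence \<open>H\<^sup>1\<close>-almost everywhere, and
  \<open>unit_normal\<close> is meaningful only where it is unique.\<close>

definition outward_unit_normal :: "plane set \<Rightarrow> plane \<Rightarrow> plane \<Rightarrow> bool" where
  "outward_unit_normal S x n \<longleftrightarrow> norm n = 1 \<and> (\<forall>y\<in>S. (y - x) \<bullet> n \<le> 0)"

definition unit_normal :: "plane set \<Rightarrow> plane \<Rightarrow> plane" where
  "unit_normal S x = (THE n. outward_unit_normal S x n)"

text \<open>The outward normal to the annulus points into \<open>Om\<close> on the inner boundary.\<close>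

definition annulus_normal :: "plane set \<Rightarrow> plane set \<Rightarrow> plane \<Rightarrow> plane" where
  "annulus_normal Op Om x =
     (if x \<in> frontier Op then unit_normal Op x else - unit_normal Om x)"

definition rot_minus_half_pi :: "plane \<Rightarrow> plane" where
  "rot_minus_half_pi v = vector [v $ 2, - (v $ 1)]"

definition tangent :: "plane set \<Rightarrow> plane set \<Rightarrow> plane \<Rightarrow> plane" where
  "tangent Op Om x = rot_minus_half_pi (annulus_normal Op Om x)"


text \<open>A finite signed Borel measure \<open>f\<close> is represented by its Jordan decomposition, i.e. by the
  (unique) pair \<open>(fp, fm)\<close> of mutually singular finite positive measures with \<open>f = fp - fm\<close>;
  \<open>fp\<close> is \<open>f\<^sup>+\<close> and \<open>fm\<close> is \<open>f\<^sup>-\<close>.\<close>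

definition jordan_parts :: "plane measure \<Rightarrow> plane measure \<Rightarrow> bool" where
  "jordan_parts fp fm \<longleftrightarrow>
     finite_measure fp \<and> finite_measure fm \<and> sets fp = sets borel \<and> sets fm = sets borel \<and>
     (\<exists>P\<in>sets borel. emeasure fp (- P) = 0 \<and> emeasure fm P = 0)"

text \<open>\<open>\<phi>\<close> is in \<open>C\<^sup>1\<close> of the closure of \<open>\<Omega>\<close>, and \<open>G\<close> is the continuous extension of its gradient.\<close>

definition C1_closure :: "plane set \<Rightarrow> (plane \<Rightarrow> real) \<Rightarrow> (plane \<Rightarrow> plane) \<Rightarrow> bool" where
  "C1_closure \<Omega> \<phi> G \<longleftrightarrow>
     continuous_on (closure \<Omega>) \<phi> \<and> continuous_on (closure \<Omega>) G \<and>
     (\<forall>x\<in>\<Omega>. GDERIV \<phi> x :> G x)"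

text \<open>\<open>\<partial>\<^sub>\<tau> g = fp - fm\<close> as a finite signed measure on the boundary.\<close>

definition tangential_derivative ::
    "plane set \<Rightarrow> plane set \<Rightarrow> (plane \<Rightarrow> real) \<Rightarrow> plane measure \<Rightarrow> plane measure \<Rightarrow> bool" where
  "tangential_derivative Op Om g fp fm \<longleftrightarrow>
     (let \<Omega> = annulus Op Om in
      jordan_parts fp fm \<and>
      emeasure fp (- frontier \<Omega>) = 0 \<and> emeasure fm (- frontier \<Omega>) = 0 \<and>
      (\<forall>\<phi> G. C1_closure \<Omega> \<phi> G \<longrightarrow>
         (LINT x:frontier \<Omega>|fp. \<phi> x) - (LINT x:frontier \<Omega>|fm. \<phi> x)
           = - (LINT x|boundary_measure \<Omega>. g x * (G x \<bullet> tangent Op Om x))))"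

definition H1 :: "plane set \<Rightarrow> plane set \<Rightarrow> (plane \<Rightarrow> real) \<Rightarrow> bool" where
  "H1 Op Om g \<longleftrightarrow>
     integrable (boundary_measure (annulus Op Om)) g \<and>
     (\<exists>fp fm. tangential_derivative Op Om g fp fm)"

text \<open>Total variation of \<open>g\<close> on \<open>A\<close>, i.e. \<open>\<bar>\<partial>\<^sub>\<tau> g\<bar>(A)\<close> for \<open>\<partial>\<^sub>\<tau> g = fp - fm\<close>.\<close>

definition TV :: "plane measure \<Rightarrow> plane measure \<Rightarrow> plane set \<Rightarrow> ennreal" where
  "TV fp fm A = emeasure fp A + emeasure fm A"


definition cross2 :: "plane \<Rightarrow> plane \<Rightarrow> real" where
  "cross2 u v = u $ 1 * v $ 2 - u $ 2 * v $ 1"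

text \<open>Boundary parts are closed nondegenerate arcs. A whole boundary curve is admitted as well:
  \<^const>\<open>simple_path\<close> allows the two endpoints to coincide.\<close>

definition boundary_arc :: "plane set \<Rightarrow> plane set \<Rightarrow> bool" where
  "boundary_arc S A \<longleftrightarrow> A \<subseteq> frontier S \<and> (\<exists>c. simple_path c \<and> path_image c = A)"

text \<open>A path in the boundary of a strictly convex set runs clockwise iff any three successive
  points on it form a negatively oriented triangle.\<close>

definition clockwise_arc :: "plane set \<Rightarrow> (real \<Rightarrow> plane) \<Rightarrow> bool" where
  "clockwise_arc S c \<longleftrightarrow> arc c \<and> path_image c \<subseteq> frontier S \<and>
     (\<forall>s t u. 0 \<le> s \<and> s < t \<and> t < u \<and> u \<le> 1 \<longrightarrow> cross2 (c t - c s) (c u - c s) < 0)"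

definition increasing_arc :: "(plane \<Rightarrow> real) \<Rightarrow> plane set \<Rightarrow> plane set \<Rightarrow> bool" where
  "increasing_arc g S A \<longleftrightarrow>
     (\<exists>c. clockwise_arc S c \<and> path_image c = A \<and> mono_on {0..1} (g \<circ> c))"

definition decreasing_arc :: "(plane \<Rightarrow> real) \<Rightarrow> plane set \<Rightarrow> plane set \<Rightarrow> bool" where
  "decreasing_arc g S A \<longleftrightarrow>
     (\<exists>c. clockwise_arc S c \<and> path_image c = A \<and> antimono_on {0..1} (g \<circ> c))"


text \<open>The arcs of the decomposition, indexed by at most countable families. The suffixes \<open>p\<close>, \<open>m\<close>
  refer to the outer and the inner boundary; \<open>Fpp i\<close> and \<open>Fpm i\<close> are \<open>F\<^sub>i\<^sup>+\<^sup>+\<close> and \<open>F\<^sub>i\<^sup>+\<^sup>-\<close>.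
  The arcs \<open>F\<^sub>i\<^sup>+\<close> and \<open>F\<^sub>i\<^sup>-\<close> are not paired, so they have separate index sets.\<close>

record decomposition =
  IX :: "nat set"
  IG :: "nat set"
  IFp :: "nat set"
  IFm :: "nat set"
  Xp :: "nat \<Rightarrow> plane set"
  Xm :: "nat \<Rightarrow> plane set"
  Gp :: "nat \<Rightarrow> plane set"
  Gm :: "nat \<Rightarrow> plane set"
  Fp :: "nat \<Rightarrow> plane set"
  Fm :: "nat \<Rightarrow> plane set"
  Fpp :: "nat \<Rightarrow> plane set"
  Fpm :: "nat \<Rightarrow> plane set"

text \<open>Decomposition of one boundary curve. Closed nondegenerate arcs of a Jordan curve have
  finite intersection iff they share at most endpoints.\<close>

definition decomposes ::
    "plane set \<Rightarrow> nat set \<Rightarrow> (nat \<Rightarrow> plane set) \<Rightarrow> nat set \<Rightarrow> (nat \<Rightarrow> plane set) \<Rightarrow>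
     nat set \<Rightarrow> (nat \<Rightarrow> plane set) \<Rightarrow> bool" where
  "decomposes S I X J G K F \<longleftrightarrow>
     frontier S = (\<Union>i\<in>I. X i) \<union> (\<Union>j\<in>J. G j) \<union> (\<Union>k\<in>K. F k) \<and>
     (\<forall>i\<in>I. \<forall>i'\<in>I. i \<noteq> i' \<longrightarrow> finite (X i \<inter> X i')) \<and>
     (\<forall>j\<in>J. \<forall>j'\<in>J. j \<noteq> j' \<longrightarrow> finite (G j \<inter> G j')) \<and>
     (\<forall>k\<in>K. \<forall>k'\<in>K. k \<noteq> k' \<longrightarrow> finite (F k \<inter> F k')) \<and>
     (\<forall>i\<in>I. \<forall>j\<in>J. finite (X i \<inter> G j)) \<and>
     (\<forall>i\<in>I. \<forall>k\<in>K. finite (X i \<inter> F k)) \<and>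
     (\<forall>j\<in>J. \<forall>k\<in>K. finite (G j \<inter> F k))"

definition separated_by ::
    "plane set \<Rightarrow> nat set \<Rightarrow> (nat \<Rightarrow> plane set) \<Rightarrow> nat set \<Rightarrow> (nat \<Rightarrow> plane set) \<Rightarrow>
     nat set \<Rightarrow> (nat \<Rightarrow> plane set) \<Rightarrow> bool" where
  "separated_by S I X J G K F \<longleftrightarrow>
     (\<forall>i\<in>I. \<forall>j\<in>J. \<forall>c. arc c \<and> path_image c \<subseteq> frontier S \<and>
        pathstart c \<in> X i \<and> pathfinish c \<in> G j \<longrightarrow> (\<exists>k\<in>K. F k \<subseteq> path_image c))"

definition H2 ::
    "plane set \<Rightarrow> plane set \<Rightarrow> (plane \<Rightarrow> real) \<Rightarrow> plane measure \<Rightarrow> plane measure \<Rightarrow>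
     decomposition \<Rightarrow> bool" where
  "H2 Op Om g fp fm D \<longleftrightarrow>
     decomposes Op (IX D) (Xp D) (IG D) (Gp D) (IFp D) (Fp D) \<and>
     decomposes Om (IX D) (Xm D) (IG D) (Gm D) (IFm D) (Fm D) \<and>
     (\<forall>i\<in>IX D. increasing_arc g Op (Xp D i) \<and> increasing_arc g Om (Xm D i) \<and>
        TV fp fm (Xp D i) = TV fp fm (Xm D i)) \<and>
     (\<forall>i\<in>IG D. decreasing_arc g Op (Gp D i) \<and> decreasing_arc g Om (Gm D i) \<and>
        TV fp fm (Gp D i) = TV fp fm (Gm D i)) \<and>
     (\<forall>i\<in>IFp D. boundary_arc Op (Fp D i) \<and>
        (if g constant_on Fp D i then Fpp D i = {} \<and> Fpm D i = {}
         else Fp D i = Fpp D i \<union> Fpm D i \<and>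
              increasing_arc g Op (Fpp D i) \<and> decreasing_arc g Op (Fpm D i) \<and>
              TV fp fm (Fpp D i) = TV fp fm (Fpm D i))) \<and>
     (\<forall>i\<in>IFm D. boundary_arc Om (Fm D i) \<and> g constant_on Fm D i) \<and>
     separated_by Op (IX D) (Xp D) (IG D) (Gp D) (IFp D) (Fp D) \<and>
     separated_by Om (IX D) (Xm D) (IG D) (Gm D) (IFm D) (Fm D)"


definition visible_from :: "plane set \<Rightarrow> plane set \<Rightarrow> plane set \<Rightarrow> bool" where
  "visible_from \<Omega> A B \<longleftrightarrow> (\<forall>x\<in>A. \<forall>y\<in>B. closed_segment x y \<subseteq> closure \<Omega>)"

definition H3 :: "plane set \<Rightarrow> plane set \<Rightarrow> decomposition \<Rightarrow> bool" where
  "H3 Op Om D \<longleftrightarrow>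
     (\<forall>i\<in>IX D. visible_from (annulus Op Om) (Xp D i) (Xm D i)) \<and>
     (\<forall>i\<in>IG D. visible_from (annulus Op Om) (Gp D i) (Gm D i)) \<and>
     (\<forall>i\<in>IFp D. visible_from (annulus Op Om) (Fpp D i) (Fpm D i))"


text \<open>Both distances take values in \<^typ>\<open>ennreal\<close>, so that the maximal distance involving an empty
  set is \<open>0\<close> and the minimal distance involving an empty set is \<open>\<infinity>\<close>
  (\<^const>\<open>setdist\<close> would give \<open>0\<close>).\<close>

definition max_dist :: "plane set \<Rightarrow> plane set \<Rightarrow> ennreal" where
  "max_dist A B = (SUP x\<in>A. SUP y\<in>B. ennreal (dist x y))"

definition min_dist :: "plane set \<Rightarrow> plane set \<Rightarrow> ennreal" where
  "min_dist A B = (INF x\<in>A. INF y\<in>B. ennreal (dist x y))"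

definition Lambda_pos :: "decomposition \<Rightarrow> plane set" where
  "Lambda_pos D = (\<Union>i\<in>IX D. Xp D i) \<union> (\<Union>i\<in>IG D. Gm D i) \<union> (\<Union>i\<in>IFp D. Fpp D i)"

definition Lambda_neg :: "decomposition \<Rightarrow> plane set" where
  "Lambda_neg D = (\<Union>i\<in>IX D. Xm D i) \<union> (\<Union>i\<in>IG D. Gp D i) \<union> (\<Union>i\<in>IFp D. Fpm D i)"

definition H4 :: "(plane \<Rightarrow> real) \<Rightarrow> decomposition \<Rightarrow> bool" where
  "H4 g D \<longleftrightarrow>
     (let Lp = Lambda_pos D; Lm = Lambda_neg D in
      (\<forall>i\<in>IX D.
         max_dist (Xp D i) (Xm D i) + max_dist (Lp - Xp D i) (Lm - Xm D i)
           < min_dist (Xp D i) (Lm - Xm D i) + min_dist (Xm D i) (Lp - Xp D i)) \<and>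
      (\<forall>i\<in>IG D.
         max_dist (Gp D i) (Gm D i) + max_dist (Lp - Gm D i) (Lm - Gp D i)
           < min_dist (Gp D i) (Lp - Gm D i) + min_dist (Gm D i) (Lm - Gp D i)) \<and>
      (\<forall>i\<in>IFp D. \<not> g constant_on Fp D i \<longrightarrow>
         max_dist (Fpp D i) (Fpm D i) + max_dist (Lp - Fpp D i) (Lm - Fpm D i)
           < min_dist (Fpp D i) (Lm - Fpm D i) + min_dist (Fpm D i) (Lp - Fpp D i)))"


text \<open>The condition is imposed at those points of the inner boundary where the normal exists
  (i.e. is unique).\<close>

definition H5 :: "plane set \<Rightarrow> decomposition \<Rightarrow> bool" where
  "H5 Om D \<longleftrightarrow>
     (\<exists>c>0.
        (\<forall>i\<in>IX D. \<forall>x\<in>Xm D i. \<forall>y\<in>Xp D i.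
           (\<exists>!n. outward_unit_normal Om x n) \<longrightarrow> (y - x) \<bullet> unit_normal Om x \<ge> c) \<and>
        (\<forall>i\<in>IG D. \<forall>x\<in>Gm D i. \<forall>y\<in>Gp D i.
           (\<exists>!n. outward_unit_normal Om x n) \<longrightarrow> (y - x) \<bullet> unit_normal Om x \<ge> c))"


definition transport_plan ::
    "plane set \<Rightarrow> plane measure \<Rightarrow> plane measure \<Rightarrow> (plane \<times> plane) measure \<Rightarrow> bool" where
  "transport_plan \<Omega> fp fm \<gamma> \<longleftrightarrow>
     sets \<gamma> = sets borel \<and> emeasure \<gamma> (- (closure \<Omega> \<times> closure \<Omega>)) = 0 \<and>
     distr \<gamma> borel fst = fp \<and> distr \<gamma> borel snd = fm"

definition transport_cost :: "(plane \<times> plane) measure \<Rightarrow> ennreal" where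
  "transport_cost \<gamma> = (\<integral>\<^sup>+ z. ennreal (dist (fst z) (snd z)) \<partial>\<gamma>)"

definition optimal_plan ::
    "plane set \<Rightarrow> plane measure \<Rightarrow> plane measure \<Rightarrow> (plane \<times> plane) measure \<Rightarrow> bool" where
  "optimal_plan \<Omega> fp fm \<gamma> \<longleftrightarrow>
     transport_plan \<Omega> fp fm \<gamma> \<and>
     (\<forall>\<gamma>'. transport_plan \<Omega> fp fm \<gamma>' \<longrightarrow> transport_cost \<gamma> \<le> transport_cost \<gamma>')"

text \<open>The test functions range over \<open>C(\<real>\<^sup>2)\<close>, whose restrictions to the compact closure of
  \<open>\<Omega>\<close> are exactly the continuous functions on it (Tietze). This keeps the right-hand side
  measurable: the annulus is not convex, so a segment between two of its points may leave it.\<close>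

definition transport_density ::
    "plane set \<Rightarrow> (plane \<times> plane) measure \<Rightarrow> plane measure \<Rightarrow> bool" where
  "transport_density \<Omega> \<gamma> \<sigma> \<longleftrightarrow>
     finite_measure \<sigma> \<and> sets \<sigma> = sets borel \<and> emeasure \<sigma> (- closure \<Omega>) = 0 \<and>
     (\<forall>\<phi> :: plane \<Rightarrow> real. continuous_on UNIV \<phi> \<longrightarrow>
        (LINT x|\<sigma>. \<phi> x) =
        (LINT z|\<gamma>. (LINT t:{0..1}|lborel.
            \<phi> ((1 - t) *\<^sub>R fst z + t *\<^sub>R snd z) * dist (fst z) (snd z))))"


text \<open>The exponent \<open>p\<close> ranges over \<open>[1, \<infinity>]\<close>.\<close>

definition in_Lp :: "'a measure \<Rightarrow> ennreal \<Rightarrow> ('a \<Rightarrow> real) \<Rightarrow> bool" where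
  "in_Lp M p h \<longleftrightarrow> h \<in> borel_measurable M \<and>
     (if p = \<infinity> then (\<exists>C. AE x in M. \<bar>h x\<bar> \<le> C)
      else integrable M (\<lambda>x. \<bar>h x\<bar> powr enn2real p))"

text \<open>The signed measure \<open>\<mu>\<close> on the plane is \<open>h M\<close> with \<open>h\<close> in \<open>L\<^sup>p(M)\<close>. Here \<open>M\<close> is a finite measure on a
  subset of the plane, so integrability of \<open>h\<close> is implied for \<open>p \<ge> 1\<close>.\<close>

definition has_Lp_density :: "plane measure \<Rightarrow> ennreal \<Rightarrow> (plane set \<Rightarrow> real) \<Rightarrow> bool" where
  "has_Lp_density M p \<mu> \<longleftrightarrow>
     (\<exists>h. in_Lp M p h \<and> integrable M h \<and>
        (\<forall>A\<in>sets borel. \<mu> A = (LINT x|M. indicator A x * h x)))"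

definition boundary_Lp ::
    "plane set \<Rightarrow> ennreal \<Rightarrow> plane measure \<Rightarrow> plane measure \<Rightarrow> bool" where
  "boundary_Lp \<Omega> p fp fm \<longleftrightarrow>
     has_Lp_density (boundary_measure \<Omega>) p (\<lambda>A. measure fp A - measure fm A)"

text \<open>In particular \<open>\<sigma>\<close> does not charge the boundary of \<open>\<Omega>\<close>.\<close>

definition interior_Lp :: "plane set \<Rightarrow> ennreal \<Rightarrow> plane measure \<Rightarrow> bool" where
  "interior_Lp \<Omega> p \<sigma> \<longleftrightarrow> has_Lp_density (restrict_space lborel \<Omega>) p (measure \<sigma>)"


text \<open>Uniform convexity: the curvature of the boundary is bounded below by \<open>1/R\<close>, in the form valid
  for nonsmooth boundaries: the set is contained in every disc of radius \<open>R\<close> that shares an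
  outward normal with it at a common boundary point.\<close>

definition uniformly_convex :: "plane set \<Rightarrow> bool" where
  "uniformly_convex S \<longleftrightarrow> convex S \<and>
     (\<exists>R>0. \<forall>x\<in>frontier S. \<forall>n. outward_unit_normal S x n \<longrightarrow> S \<subseteq> cball (x - R *\<^sub>R n) R)"

end

theory Submission
  imports Defs "HOL-Probability.Distribution_Functions"
begin

text \<open>The support of the optimal plan \<open>\<gamma>\<close> is a monotone set: two of its transport rays can cross only if
  they are collinear. Testing \<open>f = \<partial>\<^sub>\<tau> g\<close> against bumps gives the sign of \<open>f\<close> on each arc, and (H4) then
  pairs the arcs, so that by (H5), by the distance between the two boundaries and by uniform
  convexity almost every ray \<open>[x, y]\<close> is transversal to the boundary at both ends: \<open>\<bar>n \<bullet> (y - x)\<bar> \<ge> w\<close>,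
  where \<open>w\<close> is a constant, or a multiple of \<open>\<bar>x - y\<bar>\<^sup>2\<close> for rays with both ends on the outer boundary.
  On the first half of the rays the starting point is a Lipschitz function of the point where a
  transversal line is crossed; hence, with \<open>f\<^sup>+ = \<rho> H\<^sup>1\<close>, the image of \<open>(w / \<rho>(x)) \<gamma> \<otimes> dt\<close> on these
  halves is bounded by a multiple of Lebesgue measure. The second halves are treated by exchanging
  the roles of \<open>f\<^sup>+\<close> and \<open>f\<^sup>-\<close>. By duality the density of \<open>\<sigma>\<close> is in \<open>L\<^sup>p\<close> as soon as
  \<open>\<integral> \<bar>x - y\<bar> (\<rho>(x) \<bar>x - y\<bar> / w)\<^bsup>p-1\<^esup> d\<gamma>\<close> and its analogue for \<open>f\<^sup>-\<close> are finite, and for \<open>w = c \<bar>x - y\<bar>\<^sup>2\<close>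
  the powers of \<open>\<bar>x - y\<bar>\<close> combine to \<open>\<bar>x - y\<bar>\<^bsup>2-p\<^esup>\<close>, which is bounded exactly for \<open>p \<le> 2\<close>.\<close>

section \<open>Measures\<close>

text \<open>Two degeneracies shape the argument. First, \<open>w\<close> may tend to 0 along short
  rays, so no axis, slope or height suits all rays at once. The rays are sorted into pieces with a
  fixed axis \<open>e\<close>, a bound \<open>a\<close> for the tilt of the normal and a minimal
  height \<open>l\<close>. On a piece the Lipschitz constant is of order \<open>1 / a\<close>, the
  change from the ray parameter to the height costs \<open>1 / l\<close>, and the pieces are chosen
  with \<open>w\<close> at most \<open>4 * (a * l)\<close>: the losses cancel against the weight,
  and the final constant is absolute. Second, rays may overlap along a common line, so the bounds
  for the pieces cannot just be added; each is confined to the region swept by its rays, and strict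
  convexity limits the overlaps. The factor \<open>1 / \<rho>\<close> in the weight turns the first
  marginal into a measure below \<open>H^1\<close>, which separates the geometry from the
  integrability of \<open>f\<close>. The boundaries may have corners, and (H5) speaks only of points
  with a unique normal; corners are countable and \<open>f\<close> has a density with respect to
  \<open>H^1\<close>, so they carry no mass.\<close>

definition add_measure :: "'a measure \<Rightarrow> 'a measure \<Rightarrow> 'a measure" where
  "add_measure M N = measure_of (space M) (sets M) (\<lambda>A. emeasure M A + emeasure N A)"

lemma sets_add_measure [simp, measurable_cong]: "sets (add_measure M N) = sets M"
  by (simp add: add_measure_def)

lemma space_add_measure [simp]: "space (add_measure M N) = space M"
  by (simp add: add_measure_def)

lemma emeasure_add_measure:
  assumes "sets N = sets M" "A \<in> sets M"
  shows "emeasure (add_measure M N) A = emeasure M A + emeasure N A"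
  unfolding add_measure_def
proof (rule emeasure_measure_of_sigma)
  show "sigma_algebra (space M) (sets M)" ..
  show "positive (sets M) (\<lambda>A. emeasure M A + emeasure N A)"
    by (simp add: positive_def)
  show "countably_additive (sets M) (\<lambda>A. emeasure M A + emeasure N A)"
  proof (rule countably_additiveI)
    fix F :: "nat \<Rightarrow> 'a set"
    assume F: "range F \<subseteq> sets M" "disjoint_family F"
    have "(\<Sum>i. emeasure M (F i) + emeasure N (F i)) = (\<Sum>i. emeasure M (F i)) + (\<Sum>i. emeasure N (F i))"
      by (rule suminf_add[symmetric]) auto
    also have "\<dots> = emeasure M (\<Union>i. F i) + emeasure N (\<Union>i. F i)"
      using F assms(1) by (simp add: suminf_emeasure)
    finally show "(\<Sum>i. emeasure M (F i) + emeasure N (F i)) = emeasure M (\<Union>i. F i) + emeasure N (\<Union>i. F i)" .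
  qed
  show "A \<in> sets M" by fact
qed

lemma nn_integral_add_measure:
  assumes N: "sets N = sets M" and f: "f \<in> borel_measurable M"
  shows "(\<integral>\<^sup>+x. f x \<partial>add_measure M N) = (\<integral>\<^sup>+x. f x \<partial>M) + (\<integral>\<^sup>+x. f x \<partial>N)"
  using f
proof (induction rule: borel_measurable_induct)
  case (cong f g)
  have "integral\<^sup>N K f = integral\<^sup>N K g" if "space K = space M" for K
    using that cong by (intro nn_integral_cong) auto
  then show ?case
    using cong sets_eq_imp_space_eq[OF N] by simp
next
  case (set A)
  then show ?case using N by (simp add: emeasure_add_measure)
next
  case (mult u c)
  moreover have "u \<in> borel_measurable N" using N mult by (simp cong: measurable_cong_sets)
  moreover have "u \<in> borel_measurable (add_measure M N)" using mult by (simp cong: measurable_cong_sets)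
  ultimately show ?case by (simp add: nn_integral_cmult distrib_left)
next
  case (add u v)
  moreover have "u \<in> borel_measurable N" "v \<in> borel_measurable N" using N add by (simp_all cong: measurable_cong_sets)
  moreover have "u \<in> borel_measurable (add_measure M N)" "v \<in> borel_measurable (add_measure M N)"
    using add by (simp_all cong: measurable_cong_sets)
  ultimately show ?case by (simp add: nn_integral_add ac_simps)
next
  case (seq U)
  have U: "U i \<in> borel_measurable N" "U i \<in> borel_measurable (add_measure M N)" for i
    using N seq by (simp_all cong: measurable_cong_sets)
  have m: "(SUP i. integral\<^sup>N M (U i)) + (SUP i. integral\<^sup>N N (U i)) = (SUP i. integral\<^sup>N M (U i) + integral\<^sup>N N (U i))"
    using seq by (intro ennreal_SUP_add[symmetric] ) (auto simp: incseq_def le_fun_def intro!: nn_integral_mono)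
  have "(\<integral>\<^sup>+x. (SUP i. U i x) \<partial>K) = (SUP i. integral\<^sup>N K (U i))" if "\<And>i. U i \<in> borel_measurable K" for K
    using seq that by (intro nn_integral_monotone_convergence_SUP) auto
  with seq U show ?case by (simp add: SUP_apply image_comp m)
qed

text \<open>The difference of the two distribution functions is increasing and right continuous,
  hence the distribution function of a measure \<open>I\<close>. Then \<open>N\<close> and
  \<open>add_measure M I\<close> agree on half-open intervals, which generate the Borel sets and are
  stable under intersection.\<close>

lemma emeasure_le_if_Ioc_le:
  fixes M N :: "real measure"
  assumes fin: "finite_measure M" "finite_measure N"
    and sets: "sets M = sets borel" "sets N = sets borel"
    and le: "\<And>a b. a < b \<Longrightarrow> emeasure M {a<..b} \<le> emeasure N {a<..b}"
    and A: "A \<in> sets borel"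
  shows "emeasure M A \<le> emeasure N A"
proof -
  interpret M: finite_borel_measure M using fin sets by (simp add: finite_borel_measure_def finite_borel_measure_axioms_def)
  interpret N: finite_borel_measure N using fin sets by (simp add: finite_borel_measure_def finite_borel_measure_axioms_def)
  define F where "F x = cdf N x - cdf M x" for x
  have mono: "F x \<le> F y" if "x \<le> y" for x y
  proof (cases "x = y")
    case False
    with that have "x < y" by simp
    have "measure M {x<..y} \<le> measure N {x<..y}"
      using le[OF \<open>x < y\<close>] by (simp add: M.emeasure_eq_measure N.emeasure_eq_measure)
    then show ?thesis
      using M.cdf_diff_eq[OF \<open>x < y\<close>] N.cdf_diff_eq[OF \<open>x < y\<close>] by (simp add: F_def)
  qed simp
  have rc: "continuous (at_right a) F" for a
    unfolding F_def by (intro continuous_diff M.cdf_is_right_cont N.cdf_is_right_cont)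
  define I where "I = interval_measure F"
  have sI: "sets I = sets M" by (simp add: I_def sets)
  have Ioc: "emeasure N {a<..b} = emeasure M {a<..b} + emeasure I {a<..b}" if "a \<le> b" for a b
  proof (cases "a = b")
    case False
    with that have "a < b" by simp
    have *: "emeasure I {a<..b} = ennreal (F b - F a)"
      unfolding I_def by (intro emeasure_interval_measure_Ioc that mono rc)
    have "measure N {a<..b} = measure M {a<..b} + (F b - F a)"
      using M.cdf_diff_eq[OF \<open>a < b\<close>] N.cdf_diff_eq[OF \<open>a < b\<close>] by (simp add: F_def)
    moreover have "F b - F a \<ge> 0" using mono[OF that] by simp
    ultimately show ?thesis
      unfolding * by (simp add: M.emeasure_eq_measure N.emeasure_eq_measure ennreal_plus[symmetric] del: ennreal_plus)
  qed simp
  have S: "sets (borel :: real measure) = sigma_sets UNIV (range (\<lambda>(a::real,b). {a<..b}))"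
    by (subst borel_sigma_sets_Ioc) (simp add: sets_measure_of)
  have "N = add_measure M I"
  proof (rule measure_eqI_generator_eq[where \<Omega>=UNIV and E="range (\<lambda>(a::real,b). {a<..b})" and A="\<lambda>i. {- real i<..real i}"])
    show "Int_stable (range (\<lambda>(a::real,b). {a<..b}))"
    proof (rule Int_stableI)
      fix a b assume "a \<in> range (\<lambda>(a::real,b). {a<..b})" "b \<in> range (\<lambda>(a::real,b). {a<..b})"
      then obtain p q r s where "a = {p<..q}" "b = {r<..s}" by auto
      then have "a \<inter> b = {max p r<..min q s}" by auto
      then show "a \<inter> b \<in> range (\<lambda>(a::real,b). {a<..b})" by (intro image_eqI[of _ _ "(max p r, min q s)"]) auto
    qed
    fix X assume "X \<in> range (\<lambda>(a::real,b). {a<..b})"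
    then obtain a b where X: "X = {a<..b}" by auto
    show "emeasure N X = emeasure (add_measure M I) X"
      using Ioc[of a b] by (cases "a \<le> b") (auto simp: X emeasure_add_measure sI sets)
  next
    show "sets N = sigma_sets UNIV (range (\<lambda>(a::real,b). {a<..b}))"
      using sets sI S by simp
    show "sets (add_measure M I) = sigma_sets UNIV (range (\<lambda>(a::real,b). {a<..b}))"
      using sets sI S by simp
    show "(\<Union>i. {- real i<..real i}) = UNIV"
    proof safe
      fix x :: real
      obtain n where "\<bar>x\<bar> < real n" using reals_Archimedean2 by blast
      then show "x \<in> (\<Union>i. {- real i<..real i})" by (intro UN_I[of n]) auto
    qed auto
    show "emeasure N {- real i<..real i} \<noteq> \<infinity>" for i by (simp add: N.emeasure_eq_measure)
  qed auto
  then show ?thesis using A by (simp add: emeasure_add_measure sI sets)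
qed

text \<open>The bound on sets puts the image of \<open>density M W\<close> under \<open>Z\<close>
  below \<open>scale_measure C lborel\<close>, and nonnegative integrals are monotone in the
  measure.\<close>

lemma nn_integral_weighted_pushforward_le:
  fixes Z :: "'a \<Rightarrow> 'b::euclidean_space" and W :: "'a \<Rightarrow> ennreal"
  assumes Z [measurable]: "Z \<in> borel_measurable M" and W [measurable]: "W \<in> borel_measurable M"
    and bd: "\<And>B. B \<in> sets borel \<Longrightarrow> (\<integral>\<^sup>+\<omega>. W \<omega> * indicator B (Z \<omega>) \<partial>M) \<le> C * emeasure lborel B"
    and f [measurable]: "f \<in> borel_measurable borel"
  shows "(\<integral>\<^sup>+\<omega>. W \<omega> * f (Z \<omega>) \<partial>M) \<le> C * (\<integral>\<^sup>+z. f z \<partial>lborel)"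
proof -
  let ?N = "distr (density M W) borel Z"
  have le: "?N \<le> scale_measure C lborel"
  proof (subst le_measure)
    show "\<forall>A\<in>sets ?N. emeasure ?N A \<le> emeasure (scale_measure C lborel) A"
    proof
      fix A assume "A \<in> sets ?N"
      then have A [measurable]: "A \<in> sets borel" by simp
      have "emeasure ?N A = (\<integral>\<^sup>+z. indicator A z \<partial>?N)" by simp
      also have "\<dots> = (\<integral>\<^sup>+\<omega>. indicator A (Z \<omega>) \<partial>density M W)"
        by (rule nn_integral_distr) auto
      also have "\<dots> = (\<integral>\<^sup>+\<omega>. W \<omega> * indicator A (Z \<omega>) \<partial>M)"
        by (rule nn_integral_density) auto
      finally show "emeasure ?N A \<le> emeasure (scale_measure C lborel) A"
        using bd[OF A] by simp
    qed
  qed simp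
  have "(\<integral>\<^sup>+\<omega>. W \<omega> * f (Z \<omega>) \<partial>M) = (\<integral>\<^sup>+z. f z \<partial>?N)"
    by (simp add: nn_integral_distr nn_integral_density)
  also have "\<dots> \<le> (\<integral>\<^sup>+z. f z \<partial>scale_measure C lborel)"
    by (rule nn_integral_mono_measure) (use le in auto)
  also have "\<dots> = C * (\<integral>\<^sup>+z. f z \<partial>lborel)"
    by (rule nn_integral_scale_measure) simp
  finally show ?thesis .
qed

text \<open>The bound with weight \<^term>\<open>1 / V\<close> says that \<^term>\<open>V\<close> dominates the density up to averaging;
  comparing \<^term>\<open>h\<close> with \<^term>\<open>2 * C * V\<close> turns it into an \<open>L\<^sup>p\<close> bound.\<close>

lemma pushforward_Lp_density:
  fixes Z :: "'a \<Rightarrow> 'b::euclidean_space" and V :: "'a \<Rightarrow> real"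
  assumes M: "finite_measure M"
    and Z [measurable]: "Z \<in> borel_measurable M" and V [measurable]: "V \<in> borel_measurable M"
    and pos: "AE \<omega> in M. V \<omega> > 0" and C: "C > 0"
    and bd: "\<And>B. B \<in> sets borel \<Longrightarrow>
      (\<integral>\<^sup>+\<omega>. ennreal (1 / V \<omega>) * indicator B (Z \<omega>) \<partial>M) \<le> ennreal C * emeasure lborel B"
  obtains h where "h \<in> borel_measurable borel" "\<And>z. h z \<ge> 0"
    "distr M borel Z = density lborel (\<lambda>z. ennreal (h z))"
    "\<And>p. p \<ge> 1 \<Longrightarrow> (\<integral>\<^sup>+\<omega>. ennreal (V \<omega> powr (p - 1)) \<partial>M) < \<infinity> \<Longrightarrow> (\<integral>\<^sup>+z. ennreal (h z powr p) \<partial>lborel) < \<infinity>"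
    "\<And>K. K \<ge> 0 \<Longrightarrow> AE \<omega> in M. V \<omega> \<le> K \<Longrightarrow> AE z in lborel. h z \<le> C * K"
proof -
  interpret M: finite_measure M by fact
  let ?N = "distr M borel Z"
  have N: "finite_measure ?N" by (intro M.finite_measure_distr) simp
  \<comment> \<open>The weight \<open>1 / V\<close> is positive almost everywhere, so a set whose
    preimage has weighted mass 0 has a null preimage.\<close>
  have ac: "absolutely_continuous lborel ?N"
    unfolding absolutely_continuous_def
  proof safe
    fix A :: "'b set" assume "A \<in> null_sets lborel"
    then have A [measurable]: "A \<in> sets borel" and A0: "emeasure lborel A = 0" by auto
    have "(\<integral>\<^sup>+\<omega>. ennreal (1 / V \<omega>) * indicator A (Z \<omega>) \<partial>M) = 0"
      using bd[OF A] A0 by simp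
    then have "AE \<omega> in M. ennreal (1 / V \<omega>) * indicator A (Z \<omega>) = 0"
      by (subst (asm) nn_integral_0_iff_AE) auto
    then have "AE \<omega> in M. Z \<omega> \<notin> A"
      using pos by eventually_elim (auto simp: indicator_def split: if_splits)
    then have "emeasure M (Z -` A \<inter> space M) = 0"
      by (subst (asm) AE_iff_measurable[OF _ refl]) (auto simp: vimage_def Int_def conj_commute)
    then show "A \<in> null_sets ?N" by (auto simp: null_sets_def emeasure_distr)
  qed
  obtain h where h [measurable]: "h \<in> borel_measurable lborel"
    and h_RN: "AE x in lborel. RN_deriv lborel ?N x = ennreal (h x)"
    and h0: "\<And>x. 0 \<le> h x"
    using sigma_finite_measure.real_RN_deriv[OF lborel.sigma_finite_measure_axioms N ac] by auto
  have hb [measurable]: "h \<in> borel_measurable borel" using h by simp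
  have "?N = density lborel (RN_deriv lborel ?N)"
    by (rule sigma_finite_measure.density_RN_deriv[OF lborel.sigma_finite_measure_axioms ac, symmetric]) simp
  also have "\<dots> = density lborel (\<lambda>z. ennreal (h z))"
    by (rule density_cong) (use h_RN in auto)
  finally have dens: "?N = density lborel (\<lambda>z. ennreal (h z))" .
  have push: "(\<integral>\<^sup>+\<omega>. f (Z \<omega>) \<partial>M) = (\<integral>\<^sup>+z. ennreal (h z) * f z \<partial>lborel)"
    if [measurable]: "f \<in> borel_measurable borel" for f
  proof -
    have "(\<integral>\<^sup>+\<omega>. f (Z \<omega>) \<partial>M) = (\<integral>\<^sup>+z. f z \<partial>?N)" by (simp add: nn_integral_distr)
    also have "\<dots> = (\<integral>\<^sup>+z. f z \<partial>density lborel (\<lambda>z. ennreal (h z)))" using dens by simp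
    also have "\<dots> = (\<integral>\<^sup>+z. ennreal (h z) * f z \<partial>lborel)" by (simp add: nn_integral_density)
    finally show ?thesis .
  qed
  have wpush: "(\<integral>\<^sup>+\<omega>. ennreal (1 / V \<omega>) * f (Z \<omega>) \<partial>M) \<le> ennreal C * (\<integral>\<^sup>+z. f z \<partial>lborel)"
    if [measurable]: "f \<in> borel_measurable borel" for f
    by (rule nn_integral_weighted_pushforward_le) (use bd in auto)
  have 1: "(\<integral>\<^sup>+z. ennreal (h z powr p) \<partial>lborel) < \<infinity>"
    if p: "p \<ge> 1" and K: "(\<integral>\<^sup>+\<omega>. ennreal (V \<omega> powr (p - 1)) \<partial>M) < \<infinity>" for p
  proof -
    \<comment> \<open>The truncation at height \<open>n\<close> keeps the integral of
      \<open>\<psi> n\<close> along \<open>Z\<close> finite, so that half of it can be absorbed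
      below; monotone convergence removes it at the end.\<close>
    define \<psi> where "\<psi> n z = (if h z \<le> real n then h z powr (p - 1) else 0)" for n z
    have \<psi> [measurable]: "\<psi> n \<in> borel_measurable borel" for n
      unfolding \<psi>_def by measurable
    have \<psi>0: "\<psi> n z \<ge> 0" for n z by (simp add: \<psi>_def)
    define Y where "Y = (\<integral>\<^sup>+\<omega>. ennreal ((2 * C * V \<omega>) powr (p - 1)) \<partial>M)"
    have "Y = (\<integral>\<^sup>+\<omega>. ennreal ((2 * C) powr (p - 1)) * ennreal (V \<omega> powr (p - 1)) \<partial>M)"
      unfolding Y_def
    proof (rule nn_integral_cong_AE, use pos in eventually_elim)
      fix \<omega> assume "0 < V \<omega>"
      then show "ennreal ((2 * C * V \<omega>) powr (p - 1)) = ennreal ((2 * C) powr (p - 1)) * ennreal (V \<omega> powr (p - 1))"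
        using C by (simp add: powr_mult ennreal_mult'[symmetric])
    qed
    also have "\<dots> = ennreal ((2 * C) powr (p - 1)) * (\<integral>\<^sup>+\<omega>. ennreal (V \<omega> powr (p - 1)) \<partial>M)"
      by (rule nn_integral_cmult) simp
    finally have Yfin: "Y < \<infinity>" using K by (simp add: ennreal_mult_less_top)
    have X: "(\<integral>\<^sup>+\<omega>. ennreal (\<psi> n (Z \<omega>)) \<partial>M) \<le> 2 * Y" for n
    proof -
      define X where "X = (\<integral>\<^sup>+\<omega>. ennreal (\<psi> n (Z \<omega>)) \<partial>M)"
      have "X \<le> (\<integral>\<^sup>+\<omega>. ennreal (real n powr (p - 1)) \<partial>M)"
        unfolding X_def using p h0
        by (intro nn_integral_mono ennreal_leI) (auto simp: \<psi>_def intro!: powr_mono2)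
      also have "\<dots> < \<infinity>" by (simp add: ennreal_mult_less_top M.emeasure_eq_measure)
      finally have Xfin: "X < \<infinity>" .
      have "X \<le> (\<integral>\<^sup>+\<omega>. ennreal ((2 * C * V \<omega>) powr (p - 1)) +
                  ennreal (1 / (2 * C)) * (ennreal (1 / V \<omega>) * ennreal (\<psi> n (Z \<omega>) * h (Z \<omega>))) \<partial>M)"
        unfolding X_def
      proof (rule nn_integral_mono_AE, use pos in eventually_elim)
        fix \<omega> assume V0: "0 < V \<omega>"
        \<comment> \<open>Where \<open>h\<close> exceeds \<open>2 * C * V\<close>, the quotient
          \<open>h / (2 * C * V)\<close> is at least 1 and can be inserted as a factor. The weighted
          bound then returns \<open>X\<close> itself with the factor 1/2, which is the reason for
          the 2.\<close>
        have "\<psi> n (Z \<omega>) \<le> (2 * C * V \<omega>) powr (p - 1) + 1 / (2 * C) * (1 / V \<omega> * (\<psi> n (Z \<omega>) * h (Z \<omega>)))"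
        proof (cases "h (Z \<omega>) \<le> 2 * C * V \<omega>")
          case True
          then have "\<psi> n (Z \<omega>) \<le> (2 * C * V \<omega>) powr (p - 1)"
            using p h0 by (auto simp: \<psi>_def intro!: powr_mono2)
          then show ?thesis using V0 C \<psi>0[of n "Z \<omega>"] h0[of "Z \<omega>"]
            by (smt (verit) divide_nonneg_nonneg mult_nonneg_nonneg)
        next
          case False
          then have "1 \<le> h (Z \<omega>) / (2 * C * V \<omega>)" using V0 C by (simp add: field_simps)
          then have "\<psi> n (Z \<omega>) * 1 \<le> \<psi> n (Z \<omega>) * (h (Z \<omega>) / (2 * C * V \<omega>))"
            by (intro mult_left_mono \<psi>0)
          also have "\<dots> = 1 / (2 * C) * (1 / V \<omega> * (\<psi> n (Z \<omega>) * h (Z \<omega>)))" by simp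
          finally show ?thesis by (smt (verit) powr_ge_zero)
        qed
        then have "ennreal (\<psi> n (Z \<omega>)) \<le>
          ennreal ((2 * C * V \<omega>) powr (p - 1) + 1 / (2 * C) * (1 / V \<omega> * (\<psi> n (Z \<omega>) * h (Z \<omega>))))"
          by (rule ennreal_leI)
        also have "\<dots> = ennreal ((2 * C * V \<omega>) powr (p - 1)) +
                  ennreal (1 / (2 * C)) * (ennreal (1 / V \<omega>) * ennreal (\<psi> n (Z \<omega>) * h (Z \<omega>)))"
          using V0 C \<psi>0[of n "Z \<omega>"] h0[of "Z \<omega>"]
          by (subst ennreal_plus) (auto simp: ennreal_mult'[symmetric])
        finally show "ennreal (\<psi> n (Z \<omega>)) \<le> ennreal ((2 * C * V \<omega>) powr (p - 1)) +
                  ennreal (1 / (2 * C)) * (ennreal (1 / V \<omega>) * ennreal (\<psi> n (Z \<omega>) * h (Z \<omega>)))" .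
      qed
      also have "\<dots> = Y + ennreal (1 / (2 * C)) * (\<integral>\<^sup>+\<omega>. ennreal (1 / V \<omega>) * ennreal (\<psi> n (Z \<omega>) * h (Z \<omega>)) \<partial>M)"
        unfolding Y_def by (subst nn_integral_add) (auto simp: nn_integral_cmult)
      also have "\<dots> \<le> Y + ennreal (1 / (2 * C)) * (ennreal C * (\<integral>\<^sup>+z. ennreal (\<psi> n z * h z) \<partial>lborel))"
        by (intro add_left_mono mult_left_mono wpush) auto
      also have "(\<integral>\<^sup>+z. ennreal (\<psi> n z * h z) \<partial>lborel) = X"
        unfolding X_def by (subst push) (auto simp: ennreal_mult'' h0 \<psi>0 mult.commute)
      also have "ennreal (1 / (2 * C)) * (ennreal C * X) = ennreal (1 / 2) * X"
        using C by (simp add: mult.assoc[symmetric] ennreal_mult'[symmetric])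
      finally have *: "X \<le> Y + ennreal (1 / 2) * X" .
      \<comment> \<open>\<open>X\<close> is finite, so \<open>X \<le> Y + X / 2\<close> can be
        rearranged among real numbers.\<close>
      obtain x where x: "X = ennreal x" "x \<ge> 0" using Xfin by (cases X) auto
      obtain y where y: "Y = ennreal y" "y \<ge> 0" using Yfin by (cases Y) auto
      have "ennreal (1 / 2) * ennreal x = ennreal (1 / 2 * x)" by (rule ennreal_mult'[symmetric]) simp
      then have "ennreal x \<le> ennreal (y + 1 / 2 * x)"
        using * x y by (subst ennreal_plus) auto
      then have "x \<le> y + 1 / 2 * x" using x y by (subst (asm) ennreal_le_iff) auto
      then have "x \<le> 2 * y" by simp
      then have "ennreal x \<le> ennreal 2 * ennreal y" by (subst ennreal_mult'[symmetric]) (auto intro!: ennreal_leI simp del: ennreal_numeral)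
      then show ?thesis unfolding X_def[symmetric] x y by simp
    qed
    have pw: "ennreal (h z powr p) = (SUP n. ennreal (h z) * ennreal (\<psi> n z))" for z
    proof (rule antisym)
      obtain n where n: "h z \<le> real n" using real_arch_simple by blast
      have "h z powr p = h z * h z powr (p - 1)"
        using h0[of z] powr_mult_base[of "h z" "p - 1"] by simp
      then have "ennreal (h z powr p) \<le> ennreal (h z) * ennreal (\<psi> n z)"
        using n h0[of z] by (simp add: \<psi>_def ennreal_mult'[symmetric])
      also have "\<dots> \<le> (SUP n. ennreal (h z) * ennreal (\<psi> n z))" by (rule SUP_upper) simp
      finally show "ennreal (h z powr p) \<le> (SUP n. ennreal (h z) * ennreal (\<psi> n z))" .
      show "(SUP n. ennreal (h z) * ennreal (\<psi> n z)) \<le> ennreal (h z powr p)"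
        using h0[of z] powr_mult_base[of "h z" "p - 1"]
        by (intro SUP_least) (auto simp: \<psi>_def ennreal_mult'[symmetric])
    qed
    have "(\<integral>\<^sup>+z. ennreal (h z powr p) \<partial>lborel) = (SUP n. \<integral>\<^sup>+z. ennreal (h z) * ennreal (\<psi> n z) \<partial>lborel)"
      unfolding pw
    proof (rule nn_integral_monotone_convergence_SUP)
      show "incseq (\<lambda>n z. ennreal (h z) * ennreal (\<psi> n z))"
        by (rule incseq_SucI, rule le_funI) (auto simp: \<psi>_def intro!: mult_left_mono)
    qed simp
    also have "\<dots> \<le> 2 * Y"
      using X by (intro SUP_least) (subst push[symmetric], auto)
    also have "\<dots> < \<infinity>" using Yfin by (simp add: ennreal_mult_less_top)
    finally show ?thesis .
  qed
  have 2: "AE z in lborel. h z \<le> C * K" if K0: "K \<ge> 0" and K: "AE \<omega> in M. V \<omega> \<le> K" for K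
  proof -
    have "AE z in lborel. z \<in> cball 0 (real n) \<longrightarrow> h z \<le> C * K" for n
    proof -
      \<comment> \<open>On the set where \<open>h\<close> exceeds \<open>C * K\<close> the weighted
        bound allows at most \<open>C * K\<close> on average, so the excess integrates to 0. The
        ball keeps the measure of the set finite, as the subtraction requires.\<close>
      define B where "B = {z. C * K < h z} \<inter> cball 0 (real n)"
      have B [measurable]: "B \<in> sets borel" unfolding B_def by measurable
      have "emeasure lborel B \<le> emeasure lborel (cball (0::'b) (real n))"
        by (intro emeasure_mono) (auto simp: B_def)
      then have fin: "emeasure lborel B < \<infinity>"
        using emeasure_bounded_finite[of "cball (0::'b) (real n)"] by (metis bounded_cball infinity_ennreal_def le_less_trans)
      have "(\<integral>\<^sup>+z. ennreal (h z) * indicator B z \<partial>lborel) = (\<integral>\<^sup>+\<omega>. indicator B (Z \<omega>) \<partial>M)"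
        by (rule push[symmetric]) simp
      also have "\<dots> \<le> (\<integral>\<^sup>+\<omega>. ennreal (1 / V \<omega>) * (ennreal K * indicator B (Z \<omega>)) \<partial>M)"
      proof (rule nn_integral_mono_AE, use pos K in eventually_elim)
        fix \<omega> assume "0 < V \<omega>" "V \<omega> \<le> K"
        then have "ennreal 1 \<le> ennreal (1 / V \<omega>) * ennreal K"
          by (simp add: ennreal_mult'[symmetric] del: ennreal_1)
        then show "indicator B (Z \<omega>) \<le> ennreal (1 / V \<omega>) * (ennreal K * indicator B (Z \<omega>))"
          by (auto simp: indicator_def)
      qed
      also have "\<dots> \<le> ennreal C * (\<integral>\<^sup>+z. ennreal K * indicator B z \<partial>lborel)"
        by (rule wpush) simp
      also have "\<dots> = (\<integral>\<^sup>+z. ennreal (C * K) * indicator B z \<partial>lborel)"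
        using C K0 by (simp add: nn_integral_cmult ennreal_mult' mult.assoc)
      finally have le: "(\<integral>\<^sup>+z. ennreal (h z) * indicator B z \<partial>lborel) \<le> (\<integral>\<^sup>+z. ennreal (C * K) * indicator B z \<partial>lborel)" .
      have CK: "0 \<le> C * K" using C K0 by simp
      have "(\<integral>\<^sup>+z. ennreal (h z) * indicator B z \<partial>lborel) =
            (\<integral>\<^sup>+z. ennreal (C * K) * indicator B z + ennreal (h z - C * K) * indicator B z \<partial>lborel)"
        using CK by (intro nn_integral_cong) (auto simp: B_def indicator_def ennreal_plus[symmetric] simp del: ennreal_plus)
      also have "\<dots> = (\<integral>\<^sup>+z. ennreal (C * K) * indicator B z \<partial>lborel) + (\<integral>\<^sup>+z. ennreal (h z - C * K) * indicator B z \<partial>lborel)"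
        by (rule nn_integral_add) auto
      finally have eq: "(\<integral>\<^sup>+z. ennreal (h z) * indicator B z \<partial>lborel) =
        (\<integral>\<^sup>+z. ennreal (C * K) * indicator B z \<partial>lborel) + (\<integral>\<^sup>+z. ennreal (h z - C * K) * indicator B z \<partial>lborel)" .
      have "(\<integral>\<^sup>+z. ennreal (C * K) * indicator B z \<partial>lborel) < \<infinity>"
        using fin by (simp add: nn_integral_cmult ennreal_mult_less_top)
      moreover have "b = 0" if "a + b \<le> a" "a < \<infinity>" for a b :: ennreal
        using that ennreal_add_left_cancel_le[of a b 0] by (auto simp: less_top[symmetric])
      ultimately have "(\<integral>\<^sup>+z. ennreal (h z - C * K) * indicator B z \<partial>lborel) = 0"
        using le unfolding eq by blast
      then have "AE z in lborel. ennreal (h z - C * K) * indicator B z = 0"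
        by (subst (asm) nn_integral_0_iff_AE) auto
      then show ?thesis
        by eventually_elim (auto simp: B_def indicator_def ennreal_eq_0_iff split: if_splits)
    qed
    then have "AE z in lborel. \<forall>n. z \<in> cball 0 (real n) \<longrightarrow> h z \<le> C * K"
      by (subst AE_all_countable) blast
    then show ?thesis
    proof eventually_elim
      case (elim z)
      obtain n where "norm z \<le> real n" using real_arch_simple by blast
      with elim show ?case by auto
    qed
  qed
  show ?thesis using that[OF hb h0 dens 1 2] by blast
qed

section \<open>One-dimensional Hausdorff measure\<close>

definition hausdorff1_pre :: "real \<Rightarrow> plane set \<Rightarrow> ennreal" where
  "hausdorff1_pre \<delta> A = (INF U\<in>{U :: nat \<Rightarrow> plane set. A \<subseteq> (\<Union>n. U n) \<and> (\<forall>n. bounded (U n) \<and> diameter (U n) \<le> \<delta>)}.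
          (\<Sum>n. ennreal (diameter (U n))))"

lemma hausdorff1_outer_eq_SUP: "hausdorff1_outer A = (SUP \<delta>\<in>{0<..}. hausdorff1_pre \<delta> A)"
  unfolding hausdorff1_outer_def hausdorff1_pre_def ..

lemma hausdorff1_pre_le_outer: "\<delta> > 0 \<Longrightarrow> hausdorff1_pre \<delta> A \<le> hausdorff1_outer A"
  unfolding hausdorff1_outer_eq_SUP by (rule SUP_upper) simp

lemma hausdorff1_outer_mono: "A \<subseteq> B \<Longrightarrow> hausdorff1_outer A \<le> hausdorff1_outer B"
  unfolding hausdorff1_outer_def by (intro SUP_mono' INF_superset_mono) auto

lemma hausdorff1_outer_leI:
  assumes "\<And>\<delta>. \<delta> > 0 \<Longrightarrow> \<exists>U :: nat \<Rightarrow> plane set. A \<subseteq> (\<Union>n. U n) \<and> (\<forall>n. bounded (U n) \<and> diameter (U n) \<le> \<delta>)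
             \<and> (\<Sum>n. ennreal (diameter (U n))) \<le> C"
  shows "hausdorff1_outer A \<le> C"
  unfolding hausdorff1_outer_eq_SUP
proof (rule SUP_least)
  fix \<delta> :: real assume "\<delta> \<in> {0<..}"
  then obtain U :: "nat \<Rightarrow> plane set" where U: "A \<subseteq> (\<Union>n. U n)" "\<forall>n. bounded (U n) \<and> diameter (U n) \<le> \<delta>"
    "(\<Sum>n. ennreal (diameter (U n))) \<le> C" using assms[of \<delta>] by auto
  show "hausdorff1_pre \<delta> A \<le> C"
    unfolding hausdorff1_pre_def by (rule INF_lower2[of U]) (use U in auto)
qed

lemma hausdorff1_outer_cover:
  assumes fin: "hausdorff1_outer A < \<infinity>" and "\<delta> > 0" "e > 0"
  obtains U :: "nat \<Rightarrow> plane set" where "A \<subseteq> (\<Union>n. U n)" "\<And>n. bounded (U n)" "\<And>n. diameter (U n) \<le> \<delta>"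
    "(\<Sum>n. ennreal (diameter (U n))) \<le> hausdorff1_outer A + ennreal e"
proof -
  have "hausdorff1_pre \<delta> A \<le> hausdorff1_outer A" using assms by (intro hausdorff1_pre_le_outer)
  also have "\<dots> < hausdorff1_outer A + ennreal e"
    using fin \<open>e > 0\<close> by (metis add.right_neutral ennreal_add_left_cancel_less ennreal_less_zero_iff infinity_ennreal_def less_irrefl)
  finally obtain U where "A \<subseteq> (\<Union>n. U n)" "\<forall>n. bounded (U n) \<and> diameter (U n) \<le> \<delta>"
    "(\<Sum>n. ennreal (diameter (U n))) < hausdorff1_outer A + ennreal e"
    unfolding hausdorff1_pre_def INF_less_iff by auto
  then show ?thesis by (intro that[of U]) auto
qed

text \<open>Closures have the same diameters, so the intersection over \<open>m\<close> of the
  closed coverings at scale \<open>1 / Suc m\<close> is a Borel set of no larger outer measure. It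
  will enclose sets of starting points that need not be Borel.\<close>

lemma hausdorff1_outer_borel_hull:
  obtains F where "F \<in> sets borel" "A \<subseteq> F" "hausdorff1_outer F = hausdorff1_outer A"
proof (cases "hausdorff1_outer A < \<infinity>")
  case False
  then have "hausdorff1_outer UNIV = hausdorff1_outer A"
    using hausdorff1_outer_mono[of A UNIV] by (auto simp: less_top[symmetric] top_unique)
  then show ?thesis by (intro that[of UNIV]) auto
next
  case True
  have "\<exists>U :: nat \<Rightarrow> plane set. A \<subseteq> (\<Union>n. U n) \<and> (\<forall>n. bounded (U n) \<and> diameter (U n) \<le> 1 / Suc m) \<and>
    (\<Sum>n. ennreal (diameter (U n))) \<le> hausdorff1_outer A + ennreal (1 / Suc m)" for m
    by (rule hausdorff1_outer_cover[OF True, of "1 / Suc m" "1 / Suc m"]) auto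
  then have "\<exists>U. \<forall>m. A \<subseteq> (\<Union>n. U m n) \<and> (\<forall>n. bounded (U m n) \<and> diameter (U m n) \<le> 1 / Suc m) \<and>
    (\<Sum>n. ennreal (diameter (U m n))) \<le> hausdorff1_outer A + ennreal (1 / Suc m)" by (intro choice allI)
  then obtain U :: "nat \<Rightarrow> nat \<Rightarrow> plane set" where U':
    "\<forall>m. A \<subseteq> (\<Union>n. U m n) \<and> (\<forall>n. bounded (U m n) \<and> diameter (U m n) \<le> 1 / Suc m) \<and>
    (\<Sum>n. ennreal (diameter (U m n))) \<le> hausdorff1_outer A + ennreal (1 / Suc m)" by (rule exE)
  note U = U'[THEN spec, THEN conjunct1] U'[THEN spec, THEN conjunct2, THEN conjunct1, THEN spec, THEN conjunct1]
    U'[THEN spec, THEN conjunct2, THEN conjunct1, THEN spec, THEN conjunct2] U'[THEN spec, THEN conjunct2, THEN conjunct2]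
  define F where "F = (\<Inter>m. \<Union>n. closure (U m n))"
  have AF: "A \<subseteq> F" 
    unfolding F_def
  proof (rule INT_greatest)
    show "A \<subseteq> (\<Union>n. closure (U m n))" for m
      using U(1)[of m] by (rule order_trans) (intro UN_mono closure_subset order_refl)
  qed
  have "hausdorff1_outer F \<le> hausdorff1_outer A"
  proof (rule ennreal_le_epsilon)
    fix e :: real assume e: "e > 0"
    show "hausdorff1_outer F \<le> hausdorff1_outer A + ennreal e"
    proof (rule hausdorff1_outer_leI)
      fix \<delta> :: real assume "\<delta> > 0"
      then obtain m where m: "1 / Suc m < min \<delta> e"
        using e nat_approx_posE[of "min \<delta> e"] by auto
      have d: "diameter (closure (U m n)) = diameter (U m n)" for n
        using U(2) by (rule diameter_closure)
      have "F \<subseteq> (\<Union>n. closure (U m n))" unfolding F_def by auto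
      moreover have "bounded (closure (U m n)) \<and> diameter (closure (U m n)) \<le> \<delta>" for n
        using U(2)[of m n] U(3)[of m n] m unfolding d by auto
      moreover have "(\<Sum>n. ennreal (diameter (closure (U m n)))) \<le> hausdorff1_outer A + ennreal e"
        unfolding d using U(4)[of m] m by (meson add_left_mono ennreal_leI less_imp_le min_less_iff_conj order_trans)
      ultimately show "\<exists>V :: nat \<Rightarrow> plane set. F \<subseteq> (\<Union>n. V n) \<and> (\<forall>n. bounded (V n) \<and> diameter (V n) \<le> \<delta>)
             \<and> (\<Sum>n. ennreal (diameter (V n))) \<le> hausdorff1_outer A + ennreal e"
        by (intro exI[of _ "\<lambda>n. closure (U m n)"]) auto
    qed
  qed
  moreover have "F \<in> sets borel" unfolding F_def by measurable
  ultimately show ?thesis using AF hausdorff1_outer_mono[OF AF] by (intro that[of F]) auto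
qed

text \<open>The inverse of \<open>q\<close> on \<open>E\<close> is \<open>L\<close>-Lipschitz, so
  cutting \<open>{a..b}\<close> into \<open>N\<close> equal intervals gives preimages of diameter at
  most \<open>L * (b - a) / N\<close>, and \<open>N\<close> of these add up to the bound.\<close>

lemma hausdorff1_outer_le_expanding:
  fixes q :: "plane \<Rightarrow> real"
  assumes L: "L \<ge> 0" and ab: "a \<le> b" and q: "q ` E \<subseteq> {a..b}"
    and exp: "\<And>x y. x \<in> E \<Longrightarrow> y \<in> E \<Longrightarrow> dist x y \<le> L * \<bar>q x - q y\<bar>"
  shows "hausdorff1_outer E \<le> ennreal (L * (b - a))"
proof (rule hausdorff1_outer_leI)
  fix \<delta> :: real assume \<delta>: "\<delta> > 0"
  obtain N0 where N0: "L * (b - a) / \<delta> < real N0" using reals_Archimedean2 by blast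
  define N where "N = Suc N0"
  have N: "N > 0" "L * (b - a) / real N \<le> \<delta>"
    using N0 \<delta> by (auto simp: N_def field_simps)
  define h where "h = (b - a) / real N"
  have h: "h \<ge> 0" using ab by (simp add: h_def)
  have bNh: "b = a + real N * h" using N by (simp add: h_def)
  define U where "U n = (if n < N then {x \<in> E. q x \<in> {a + real n * h..a + real (Suc n) * h}} else {})" for n
  have Ud: "dist x y \<le> L * h" if "x \<in> U n" "y \<in> U n" for x y n
  proof -
    have "\<bar>q x - q y\<bar> \<le> h" using that by (auto simp: U_def algebra_simps split: if_splits)
    then have "L * \<bar>q x - q y\<bar> \<le> L * h" using L by (intro mult_left_mono)
    moreover have "dist x y \<le> L * \<bar>q x - q y\<bar>" using that by (intro exp) (auto simp: U_def split: if_splits)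
    ultimately show ?thesis by simp
  qed
  have Ub: "bounded (U n)" for n
  proof (cases "U n = {}")
    case False
    then obtain x where "x \<in> U n" by auto
    then have "U n \<subseteq> cball x (L * h)" using Ud by auto
    then show ?thesis using bounded_subset bounded_cball by blast
  qed auto
  have diam: "diameter (U n) \<le> L * h" for n
    using Ud L h by (intro diameter_le) (auto simp: dist_norm)
  have Lh: "L * h \<le> \<delta>" using N by (simp add: h_def)
  have "E \<subseteq> (\<Union>n. U n)"
  proof
    fix x assume x: "x \<in> E"
    then have qx: "a \<le> q x" "q x \<le> b" using q by auto
    show "x \<in> (\<Union>n. U n)"
    proof (cases "q x < b")
      case False
      \<comment> \<open>The floor that serves the other points would give the index \<open>N\<close>
        here; the last closed interval, of index \<open>N0\<close>, takes the endpoint.\<close>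
      then have "q x = b" using qx by simp
      then have "x \<in> U N0" using x h bNh by (auto simp: U_def N_def algebra_simps)
      then show ?thesis by auto
    next
      case True
      then have h0: "h > 0" using h qx bNh by (cases "h = 0") auto
      define n where "n = nat \<lfloor>(q x - a) / h\<rfloor>"
      have n: "real n \<le> (q x - a) / h" "(q x - a) / h < real n + 1"
        using qx h0 unfolding n_def by (auto simp: of_nat_nat floor_less_cancel) 
      have "real n * h \<le> q x - a" "q x - a < (real n + 1) * h" using n h0 by (auto simp: field_simps)
      moreover have "n < N"
      proof -
        have "real n * h < real N * h" using calculation True bNh by linarith
        then show ?thesis using h0 by (simp add: mult_less_cancel_right)
      qed
      ultimately have "x \<in> U n" using x by (auto simp: U_def algebra_simps)
      then show ?thesis by auto
    qed
  qed
  moreover have "(\<Sum>n. ennreal (diameter (U n))) \<le> ennreal (L * (b - a))"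
  proof -
    have "(\<Sum>n. ennreal (diameter (U n))) = (\<Sum>n<N. ennreal (diameter (U n)))"
      by (rule suminf_finite) (auto simp: U_def)
    also have "\<dots> \<le> (\<Sum>n<N. ennreal (L * h))" by (intro sum_mono ennreal_leI diam)
    also have "\<dots> = ennreal (real N * (L * h))" using L h by (simp add: ennreal_of_nat_eq_real_of_nat ennreal_mult'[symmetric])
    also have "real N * (L * h) = L * (b - a)" using bNh by simp
    finally show ?thesis .
  qed
  ultimately show "\<exists>U :: nat \<Rightarrow> plane set. E \<subseteq> (\<Union>n. U n) \<and> (\<forall>n. bounded (U n) \<and> diameter (U n) \<le> \<delta>)
             \<and> (\<Sum>n. ennreal (diameter (U n))) \<le> ennreal (L * (b - a))"
    using Ub diam Lh by (intro exI[of _ U]) (auto intro: order_trans)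
qed

text \<open>Each covering set meets \<open>E\<close> in a set whose image under the contraction
  \<open>\<zeta>\<close> fits into an interval as long as the diameter. These intervals cover
  \<open>{a<..b}\<close>, and Lebesgue measure is countably subadditive.\<close>

lemma le_hausdorff1_outer_contracting:
  fixes \<zeta> :: "plane \<Rightarrow> real"
  assumes lip: "\<And>x y. x \<in> E \<Longrightarrow> y \<in> E \<Longrightarrow> \<bar>\<zeta> x - \<zeta> y\<bar> \<le> dist x y" and ab: "{a<..b} \<subseteq> \<zeta> ` E" "a \<le> b"
  shows "ennreal (b - a) \<le> hausdorff1_outer E"
proof (cases "hausdorff1_outer E < \<infinity>")
  case False then show ?thesis by (simp add: less_top[symmetric])
next
  case True
  show ?thesis
  proof (rule ennreal_le_epsilon)
    fix e :: real assume e: "e > 0"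
    obtain U :: "nat \<Rightarrow> plane set" where U: "E \<subseteq> (\<Union>n. U n)" "\<And>n. bounded (U n)"
      "(\<Sum>n. ennreal (diameter (U n))) \<le> hausdorff1_outer E + ennreal e"
      using hausdorff1_outer_cover[OF True zero_less_one e] by metis
    define J where "J n = (if U n \<inter> E = {} then {} else {Inf (\<zeta> ` (U n \<inter> E))..Inf (\<zeta> ` (U n \<inter> E)) + diameter (U n)})" for n
    have sub: "\<zeta> ` (U n \<inter> E) \<subseteq> J n" for n
    proof
      fix s assume "s \<in> \<zeta> ` (U n \<inter> E)"
      then obtain x where x: "x \<in> U n" "x \<in> E" "s = \<zeta> x" by auto
      have b: "\<zeta> x - diameter (U n) \<le> \<zeta> y" if "y \<in> U n" "y \<in> E" for y
        using lip[OF x(2) that(2)] diameter_bounded_bound[OF U(2) x(1) that(1)] by linarith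
      have "Inf (\<zeta> ` (U n \<inter> E)) \<le> \<zeta> x" using x b by (intro cINF_lower bdd_belowI2) auto
      moreover have "\<zeta> x - diameter (U n) \<le> Inf (\<zeta> ` (U n \<inter> E))" using x b by (intro cINF_greatest) auto
      ultimately show "s \<in> J n" using x by (auto simp: J_def)
    qed
    have Jm: "J n \<in> sets borel" for n by (auto simp: J_def)
    have "{a<..b} \<subseteq> (\<Union>n. J n)"
    proof
      fix s assume "s \<in> {a<..b}"
      then obtain x where "x \<in> E" "s = \<zeta> x" using ab by auto
      moreover then obtain n where "x \<in> U n" using U(1) by auto
      ultimately have "s \<in> J n" using sub by auto
      then show "s \<in> (\<Union>n. J n)" by auto
    qed
    then have "emeasure lborel {a<..b} \<le> emeasure lborel (\<Union>n. J n)" using Jm by (intro emeasure_mono) auto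
    also have "\<dots> \<le> (\<Sum>n. emeasure lborel (J n))" using Jm by (intro emeasure_subadditive_countably) auto
    also have "\<dots> \<le> (\<Sum>n. ennreal (diameter (U n)))"
      by (intro suminf_le) (auto simp: J_def diameter_ge_0 U(2))
    also have "\<dots> \<le> hausdorff1_outer E + ennreal e" by fact
    finally show "ennreal (b - a) \<le> hausdorff1_outer E + ennreal e" using ab by simp
  qed
qed

lemma hausdorff1_outer_countable:
  assumes "countable A" shows "hausdorff1_outer A = 0"
proof -
  obtain f :: "nat \<Rightarrow> plane" where f: "A \<subseteq> range f"
    using assms by (metis range_from_nat_into empty_subsetI order_refl)
  have "hausdorff1_outer A \<le> 0"
  proof (rule hausdorff1_outer_leI)
    fix \<delta> :: real assume "\<delta> > 0"
    then show "\<exists>U :: nat \<Rightarrow> plane set. A \<subseteq> (\<Union>n. U n) \<and> (\<forall>n. bounded (U n) \<and> diameter (U n) \<le> \<delta>)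
             \<and> (\<Sum>n. ennreal (diameter (U n))) \<le> 0"
      using f by (intro exI[of _ "\<lambda>n. {f n}"]) auto
  qed
  then show ?thesis by simp
qed

text \<open>\<^const>\<open>measure_of\<close> returns the zero measure if its argument is not countably additive. Keeping this
  junk case, in which everything is trivial, avoids the Caratheodory construction.\<close>

lemma emeasure_hausdorff1_cases:
  obtains (zero) "\<And>A. emeasure hausdorff1 A = 0"
  | (measure) "\<And>A. A \<in> sets borel \<Longrightarrow> emeasure hausdorff1 A = hausdorff1_outer A"
proof (cases "measure_space UNIV (sets borel) hausdorff1_outer")
  case True
  have "emeasure hausdorff1 A = hausdorff1_outer A" if "A \<in> sets borel" for A
    unfolding hausdorff1_def using True that
    by (intro emeasure_measure_of_sigma) (auto simp: measure_space_def)
  then show ?thesis by (rule measure)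
next
  case False
  have "emeasure hausdorff1 A = 0" for A
  proof (cases "A \<in> sets hausdorff1")
    case A: True
    then show ?thesis using False unfolding hausdorff1_def 
      by (simp add: emeasure_measure_of_conv sets.sigma_sets_eq[of "borel :: plane measure", simplified])
  qed (rule emeasure_notin_sets)
  then show ?thesis by (rule zero)
qed

lemma sets_hausdorff1 [simp, measurable_cong]: "sets hausdorff1 = sets borel"
  unfolding hausdorff1_def using sets.sigma_sets_eq[of "borel :: plane measure"] by simp

lemma space_hausdorff1 [simp]: "space hausdorff1 = UNIV"
  unfolding hausdorff1_def by (simp add: space_measure_of_conv)

section \<open>Normals of planar convex sets\<close>

lemma inner_plane: "(u::plane) \<bullet> v = u $ 1 * v $ 1 + u $ 2 * v $ 2"
  by (simp add: inner_vec_def sum_2)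

lemma plane_eq_iff: "(u::plane) = v \<longleftrightarrow> u $ 1 = v $ 1 \<and> u $ 2 = v $ 2"
  by (simp add: vec_eq_iff forall_2)

lemma rot_simps [simp]: "rot_minus_half_pi v $ 1 = v $ 2" "rot_minus_half_pi v $ 2 = - (v $ 1)"
  by (simp_all add: rot_minus_half_pi_def)

lemma rot_inner [simp]: "rot_minus_half_pi u \<bullet> rot_minus_half_pi v = u \<bullet> v"
  by (simp add: inner_plane)

lemma rot_orthogonal [simp]: "u \<bullet> rot_minus_half_pi u = 0" "rot_minus_half_pi u \<bullet> u = 0"
  by (simp_all add: inner_plane)

lemma norm_rot [simp]: "norm (rot_minus_half_pi u) = norm u"
  by (simp add: norm_eq_sqrt_inner)

lemma rot_uminus: "rot_minus_half_pi (- v) = - rot_minus_half_pi v"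
  by (simp add: plane_eq_iff)

lemma rot_frame_expansion:
  fixes e v :: plane
  assumes "norm e = 1"
  shows "v = (v \<bullet> e) *\<^sub>R e + (v \<bullet> rot_minus_half_pi e) *\<^sub>R rot_minus_half_pi e"
proof -
  have "(e $ 1)\<^sup>2 + (e $ 2)\<^sup>2 = 1" using assms by (simp add: norm_eq_sqrt_inner inner_plane power2_eq_square)
  then have 1: "e $ 2 * e $ 2 = 1 - e $ 1 * e $ 1" by (simp add: power2_eq_square algebra_simps)
  have "e $ 1 * (e $ 2 * v $ 2) + (e $ 1 * (e $ 1 * v $ 1) + (e $ 2 * (e $ 2 * v $ 1) - e $ 2 * (e $ 1 * v $ 2))) = v $ 1"
    using arg_cong[OF 1, of "\<lambda>t. t * v $ 1"] by (simp add: algebra_simps)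
  moreover have "e $ 2 * (e $ 1 * v $ 1) + (e $ 2 * (e $ 2 * v $ 2)) - e $ 1 * (e $ 2 * v $ 1) + e $ 1 * (e $ 1 * v $ 2) = v $ 2"
    using arg_cong[OF 1, of "\<lambda>t. t * v $ 2"] by (simp add: algebra_simps)
  ultimately show ?thesis by (simp add: plane_eq_iff inner_plane algebra_simps)
qed

lemma rot_frame_eqI:
  fixes e v :: plane
  assumes "norm e = 1" "u \<bullet> e = v \<bullet> e" "u \<bullet> rot_minus_half_pi e = v \<bullet> rot_minus_half_pi e"
  shows "u = v"
  using rot_frame_expansion[OF assms(1), of u] rot_frame_expansion[OF assms(1), of v] assms by simp

lemma rot_frame_norm:
  fixes e v :: plane
  assumes "norm e = 1"
  shows "(norm v)\<^sup>2 = (v \<bullet> e)\<^sup>2 + (v \<bullet> rot_minus_half_pi e)\<^sup>2"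
proof -
  have "v \<bullet> v = ((v \<bullet> e) *\<^sub>R e + (v \<bullet> rot_minus_half_pi e) *\<^sub>R rot_minus_half_pi e) \<bullet> v"
    using rot_frame_expansion[OF assms, of v] by simp
  also have "\<dots> = (v \<bullet> e)\<^sup>2 + (v \<bullet> rot_minus_half_pi e)\<^sup>2"
    by (simp add: inner_add_left power2_eq_square inner_commute[of e v] inner_commute[of "rot_minus_half_pi e" v])
  finally show ?thesis by (simp add: power2_norm_eq_inner)
qed

lemma normal_le_closure:
  assumes "outward_unit_normal S x n" "y \<in> closure S"
  shows "(y - x) \<bullet> n \<le> 0"
proof -
  have "closed {y. (y - x) \<bullet> n \<le> 0}" by (intro closed_Collect_le continuous_intros)
  then have "closure S \<subseteq> {y. (y - x) \<bullet> n \<le> 0}"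
    using assms(1) by (intro closure_minimal) (auto simp: outward_unit_normal_def)
  then show ?thesis using assms(2) by auto
qed

text \<open>\<open>p + r *\<^sub>R n\<close> is a point of the ball, hence of \<open>S\<close>, and
  obeys the support inequality at \<open>x\<close>. Every lower bound on a normal that comes from an
  interior ball has this source.\<close>

lemma normal_ball_bound:
  assumes n: "outward_unit_normal S x n" and b: "cball p r \<subseteq> S" and r: "r \<ge> 0"
  shows "(x - p) \<bullet> n \<ge> r"
proof -
  have n1: "norm n = 1" using n by (simp add: outward_unit_normal_def)
  have "p + r *\<^sub>R n \<in> S" using b r n1 by (auto simp: subset_iff dist_norm)
  then have "(p + r *\<^sub>R n - x) \<bullet> n \<le> 0" using n by (simp add: outward_unit_normal_def)
  moreover have "n \<bullet> n = 1" using n1 by (simp add: norm_eq_1)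
  ultimately show ?thesis by (simp add: inner_diff_left inner_add_left)
qed

lemma outward_unit_normal_exists:
  assumes S: "convex S" "open S" "S \<noteq> {}" and x: "x \<in> frontier S"
  obtains n where "outward_unit_normal S x n"
proof -
  have "x \<notin> S" using x S(2) by (simp add: frontier_def interior_open)
  then obtain a b where ab: "a \<noteq> 0" "a \<bullet> x \<le> b" "\<forall>y\<in>S. a \<bullet> y \<ge> b"
    using separating_hyperplane_set_0[of "(\<lambda>y. y - x) ` S"] S
    by (metis (no_types, lifting) separating_hyperplane_sets[of "{x}" S] convex_singleton disjoint_insert(1) empty_iff insert_iff inf_bot_left insert_not_empty singletonD insertI1 disjoint_iff)
  have "outward_unit_normal S x (- sgn a)"
    unfolding outward_unit_normal_def
  proof (intro conjI ballI)
    show "norm (- sgn a) = 1" using ab by (simp add: norm_sgn)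
    fix y assume "y \<in> S"
    then have "a \<bullet> (y - x) \<ge> 0" using ab by (auto simp: inner_diff_right)
    then show "(y - x) \<bullet> - sgn a \<le> 0" by (simp add: sgn_div_norm inner_commute)
  qed
  then show ?thesis by (rule that)
qed

lemma closed_normal_pairs:
  "closed {(x, n). outward_unit_normal S x n}"
proof -
  have "{(x, n). outward_unit_normal S x n} = {z. norm (snd z) = 1} \<inter> (\<Inter>y\<in>S. {z. (y - fst z) \<bullet> snd z \<le> 0})"
    by (auto simp: outward_unit_normal_def)
  also have "closed \<dots>"
    by (intro closed_Int closed_INT ballI closed_Collect_eq closed_Collect_le continuous_intros)
  finally show ?thesis .
qed

text \<open>Unit normals have a convergent subsequence, and a limit of normals is a normal at the
  limit point. Closedness makes \<open>ray_piece\<close> closed and \<open>\<nu>\<close> Borel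
  without a measurable selection of normals.\<close>

lemma closed_normal_points:
  "closed {x. \<exists>n. outward_unit_normal S x n \<and> s * (n \<bullet> e) \<ge> a}"
  unfolding closed_sequential_limits
proof (intro allI impI, elim conjE)
  fix X l assume X: "\<forall>k. X k \<in> {x. \<exists>n. outward_unit_normal S x n \<and> s * (n \<bullet> e) \<ge> a}" and lim: "X \<longlonglongrightarrow> l"
  then have "\<forall>k. \<exists>n. outward_unit_normal S (X k) n \<and> s * (n \<bullet> e) \<ge> a" by simp
  from choice[OF this] obtain N where N: "\<forall>k. outward_unit_normal S (X k) (N k) \<and> s * (N k \<bullet> e) \<ge> a" ..
  have "\<forall>k. N k \<in> sphere 0 1" using N by (auto simp: outward_unit_normal_def)
  with compact_sphere[of "0::plane" 1] have "\<exists>n\<in>sphere 0 1. \<exists>r. strict_mono r \<and> (N \<circ> r) \<longlonglongrightarrow> n"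
    unfolding compact_def by simp
  then obtain n r where r: "strict_mono r" and limn: "(N \<circ> r) \<longlonglongrightarrow> n"
    by blast
  have limX: "(X \<circ> r) \<longlonglongrightarrow> l" using lim r by (rule LIMSEQ_subseq_LIMSEQ)
  have "(l, n) \<in> {(x, n). outward_unit_normal S x n}"
  proof (rule closed_sequentially[OF closed_normal_pairs[of S]])
    show "(\<lambda>k. ((X \<circ> r) k, (N \<circ> r) k)) \<longlonglongrightarrow> (l, n)" using limX limn by (rule tendsto_Pair)
    show "((X \<circ> r) k, (N \<circ> r) k) \<in> {(x, n). outward_unit_normal S x n}" for k using N by simp
  qed
  moreover have "(\<lambda>k. s * ((N \<circ> r) k \<bullet> e)) \<longlonglongrightarrow> s * (n \<bullet> e)"
    using limn by (intro tendsto_intros)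
  then have "s * (n \<bullet> e) \<ge> a" by (rule LIMSEQ_le_const) (use N in auto)
  ultimately show "l \<in> {x. \<exists>n. outward_unit_normal S x n \<and> s * (n \<bullet> e) \<ge> a}" by auto
qed

text \<open>Distinct parallel unit normals are opposite and would confine \<open>S\<close> to a
  line, against the ball inside it.\<close>

lemma normals_independent:
  assumes S: "open S" "S \<noteq> {}" and n: "outward_unit_normal S x n" "outward_unit_normal S x n'" "n \<noteq> n'"
  shows "cross2 n n' \<noteq> 0"
proof
  assume c: "cross2 n n' = 0"
  obtain p where "p \<in> S" using S by auto
  then obtain r where r: "r > 0" "cball p r \<subseteq> S" using S open_contains_cball by blast
  have 1: "(x - p) \<bullet> n \<ge> r" "(x - p) \<bullet> n' \<ge> r" using normal_ball_bound[OF n(1) r(2)] normal_ball_bound[OF n(2) r(2)] r by auto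
  have u: "n $ 1 * n $ 1 + n $ 2 * n $ 2 = 1" "n' $ 1 * n' $ 1 + n' $ 2 * n' $ 2 = 1"
    using n by (auto simp: outward_unit_normal_def norm_eq_1 inner_plane)
  have "n' = (n \<bullet> n') *\<^sub>R n"
    using rot_frame_expansion[of n n'] c n(1)
    by (simp add: outward_unit_normal_def inner_plane cross2_def algebra_simps)
  moreover then have "\<bar>n \<bullet> n'\<bar> = 1"
    using n by (metis mult.right_neutral norm_scaleR outward_unit_normal_def)
  ultimately have "n' = - n" using n(3) by (auto simp: abs_if split: if_splits)
  then show False using 1 r by simp
qed

text \<open>The positive combinations of two normals at a corner form an open cone. A vector
  \<open>q\<close> of a countable dense set in this cone is maximized over \<open>closure S\<close>
  at the corner alone, so different corners get different \<open>q\<close>.\<close>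

lemma countable_corners:
  assumes S: "open S" "S \<noteq> {}"
  shows "countable {x \<in> closure S. \<exists>n n'. n \<noteq> n' \<and> outward_unit_normal S x n \<and> outward_unit_normal S x n'}"
    (is "countable ?C")
proof -
  obtain D :: "plane set" where D: "countable D" "\<And>X. open X \<Longrightarrow> X \<noteq> {} \<Longrightarrow> \<exists>d\<in>D. d \<in> X"
    using countable_dense_exists by metis
  have ex: "\<exists>q\<in>D. \<forall>y\<in>closure S. y \<noteq> x \<longrightarrow> (y - x) \<bullet> q < 0" if x: "x \<in> ?C" for x
  proof -
    obtain m m' where m: "outward_unit_normal S x m" "outward_unit_normal S x m'" "m \<noteq> m'" using x by blast
    have "cross2 m m' > 0 \<or> cross2 m' m > 0"
    proof -
      have "cross2 m' m = - cross2 m m'" by (simp add: cross2_def)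
      then show ?thesis using normals_independent[OF S m] by linarith
    qed
    then obtain n n' where n: "outward_unit_normal S x n" "outward_unit_normal S x n'" "cross2 n n' > 0"
      using m by auto
    define U where "U = {q. cross2 q n' > 0} \<inter> {q. cross2 n q > 0}"
    have "open U" unfolding U_def cross2_def
      by (intro open_Int open_Collect_less continuous_intros)
    moreover have "n + n' \<in> U" using n(3) by (auto simp: U_def cross2_def algebra_simps)
    ultimately obtain q where q: "q \<in> D" "q \<in> U" using D(2) by blast
    \<comment> \<open>Cramer's rule. Both coefficients on the right are positive, so
      \<open>q\<close> is a positive combination of the two normals.\<close>
    have id: "cross2 n n' *\<^sub>R q = cross2 q n' *\<^sub>R n + cross2 n q *\<^sub>R n'"
      by (simp add: plane_eq_iff cross2_def algebra_simps)
    have "(y - x) \<bullet> q < 0" if y: "y \<in> closure S" "y \<noteq> x" for y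
    proof (rule ccontr)
      assume neg: "\<not> (y - x) \<bullet> q < 0"
      have a: "(y - x) \<bullet> n \<le> 0" "(y - x) \<bullet> n' \<le> 0" using normal_le_closure n y by auto
      have "cross2 n n' * ((y - x) \<bullet> q) = cross2 q n' * ((y - x) \<bullet> n) + cross2 n q * ((y - x) \<bullet> n')"
        using arg_cong[OF id, of "\<lambda>v. (y - x) \<bullet> v"] by (simp add: inner_add_right)
      moreover have "cross2 n n' * ((y - x) \<bullet> q) \<ge> 0" using neg n by simp
      moreover have "cross2 q n' * ((y - x) \<bullet> n) \<le> 0" "cross2 n q * ((y - x) \<bullet> n') \<le> 0"
        using a q by (auto simp: U_def mult_nonneg_nonpos)
      ultimately have "cross2 q n' * ((y - x) \<bullet> n) = 0" "cross2 n q * ((y - x) \<bullet> n') = 0" by linarith+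
      then have z: "(y - x) \<bullet> n = 0" "(y - x) \<bullet> n' = 0" using q by (auto simp: U_def)
      define v where "v = y - x"
      have "cross2 n n' * v $ 1 = 0" "cross2 n n' * v $ 2 = 0"
      proof -
        have "cross2 n n' * v $ 1 = (v \<bullet> n) * n' $ 2 - (v \<bullet> n') * n $ 2"
          "cross2 n n' * v $ 2 = (v \<bullet> n') * n $ 1 - (v \<bullet> n) * n' $ 1"
          by (simp_all add: cross2_def inner_plane algebra_simps)
        then show "cross2 n n' * v $ 1 = 0" "cross2 n n' * v $ 2 = 0" using z by (simp_all add: v_def)
      qed
      then have "v = 0" using n(3) by (simp add: plane_eq_iff)
      then show False using y by (simp add: v_def)
    qed
    then show ?thesis using q by auto
  qed
  define f where "f x = (SOME q. q \<in> D \<and> (\<forall>y\<in>closure S. y \<noteq> x \<longrightarrow> (y - x) \<bullet> q < 0))" for x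
  have f: "f x \<in> D" "\<And>y. y \<in> closure S \<Longrightarrow> y \<noteq> x \<Longrightarrow> (y - x) \<bullet> f x < 0" if "x \<in> ?C" for x
    using someI_ex[of "\<lambda>q. q \<in> D \<and> (\<forall>y\<in>closure S. y \<noteq> x \<longrightarrow> (y - x) \<bullet> q < 0)"] ex[OF that]
    unfolding f_def by blast+
  have "inj_on f ?C"
  proof (rule inj_onI, rule ccontr)
    fix x y assume xy: "x \<in> ?C" "y \<in> ?C" "f x = f y" "x \<noteq> y"
    have "(y - x) \<bullet> f x < 0" "(x - y) \<bullet> f y < 0" using f(2)[of x y] f(2)[of y x] xy by auto
    then show False using xy(3) by (simp add: inner_diff_left)
  qed
  moreover have "f ` ?C \<subseteq> D" using f(1) by auto
  ultimately show ?thesis using D(1) by (meson countable_image_inj_on countable_subset)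
qed

lemma unit_normal_eqI:
  assumes "outward_unit_normal S x n" "\<And>n'. outward_unit_normal S x n' \<Longrightarrow> n' = n"
  shows "unit_normal S x = n"
  unfolding unit_normal_def using assms by blast

text \<open>Expanding the squared distance from \<open>y\<close> to the centre of the disc turns
  containment into this inequality. It is the origin of the quadratic weight for rays with both ends
  on the outer boundary.\<close>

lemma uniformly_convex_bound:
  assumes n: "outward_unit_normal S x n" and sub: "S \<subseteq> cball (x - R *\<^sub>R n) R" and y: "y \<in> closure S"
  shows "(norm (y - x))\<^sup>2 \<le> 2 * R * ((x - y) \<bullet> n)"
proof -
  have "closure S \<subseteq> cball (x - R *\<^sub>R n) R" using sub by (rule closure_minimal) simp
  then have "norm (y - x + R *\<^sub>R n) \<le> R" using y by (auto simp: dist_norm norm_minus_commute algebra_simps)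
  then have "(norm (y - x + R *\<^sub>R n))\<^sup>2 \<le> R\<^sup>2" by (intro power_mono) auto
  moreover have "(norm (y - x + R *\<^sub>R n))\<^sup>2 = (norm (y - x))\<^sup>2 + 2 * R * ((y - x) \<bullet> n) + R\<^sup>2 * (n \<bullet> n)"
    unfolding power2_norm_eq_inner
    by (simp add: inner_add_left inner_add_right inner_diff_left inner_diff_right inner_commute power2_eq_square algebra_simps)
  moreover have "n \<bullet> n = 1" using n by (simp add: outward_unit_normal_def norm_eq_1)
  ultimately show ?thesis by (simp add: inner_diff_left algebra_simps)
qed

section \<open>Monotonicity of optimal plans\<close>

definition msupport :: "'a::topological_space measure \<Rightarrow> 'a set" where
  "msupport M = {z. \<forall>U. open U \<and> z \<in> U \<longrightarrow> emeasure M U \<noteq> 0}"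

lemma closed_msupport: "closed (msupport M)"
proof -
  have "- msupport M = \<Union>{U. open U \<and> emeasure M U = 0}" by (auto simp: msupport_def)
  then have "open (- msupport M)" by auto
  then show ?thesis by (simp add: closed_def)
qed

text \<open>The complement of the support is a union of basic open sets of measure 0, and the basis
  is countable.\<close>

lemma AE_msupport:
  fixes M :: "'a::second_countable_topology measure"
  assumes sets: "sets M = sets borel"
  shows "AE z in M. z \<in> msupport M"
proof -
  obtain B :: "'a set set" where B: "countable B" "topological_basis B"
    using ex_countable_basis by blast
  have "AE z in M. \<forall>U\<in>{U\<in>B. emeasure M U = 0}. z \<notin> U"
  proof (subst AE_ball_countable)
    show "countable {U \<in> B. emeasure M U = 0}" using B by simp
    show "\<forall>U\<in>{U \<in> B. emeasure M U = 0}. AE z in M. z \<notin> U"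
    proof
      fix U assume U: "U \<in> {U \<in> B. emeasure M U = 0}"
      then have "open U" using B topological_basis_open by auto
      then have "U \<in> null_sets M" using U sets by (auto simp: null_sets_def)
      then show "AE z in M. z \<notin> U" by (rule AE_not_in)
    qed
  qed
  then show ?thesis
  proof (rule AE_mp, intro AE_I2 impI)
    fix z assume z: "\<forall>U\<in>{U \<in> B. emeasure M U = 0}. z \<notin> U"
    show "z \<in> msupport M"
      unfolding msupport_def
    proof safe
      fix U assume U: "open U" "z \<in> U" and 0: "emeasure M U = 0"
      obtain V where V: "V \<in> B" "z \<in> V" "V \<subseteq> U" using topological_basisE[OF B(2) U] by blast
      have "emeasure M V \<le> emeasure M U" using V U sets by (intro emeasure_mono) auto
      then show False using 0 z V by auto
    qed
  qed
qed

lemma ennreal_add_le: "ennreal (a + b) \<le> ennreal a + ennreal b"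
proof -
  consider "a \<ge> 0" "b \<ge> 0" | "a < 0" | "b < 0" by linarith
  then show ?thesis
  proof cases
    case 1 then show ?thesis by simp
  next
    case 2
    then have "ennreal (a + b) \<le> ennreal b" by (intro ennreal_leI) simp
    then show ?thesis using 2 by (simp add: ennreal_neg)
  next
    case 3
    then have "ennreal (a + b) \<le> ennreal a" by (intro ennreal_leI) simp
    then show ?thesis using 3 by (simp add: ennreal_neg)
  qed
qed

text \<open>If two points of the support violated the inequality, a little mass near them could
  exchange targets: it is removed from \<open>\<gamma>\<close> on the neighbourhoods
  \<open>B1\<close> and \<open>B2\<close> and put back as products of the crossed marginals. The
  marginals stay the same and the cost drops.\<close>

lemma optimal_plan_monotone:
  assumes opt: "optimal_plan \<Omega> fp fm \<gamma>" and fin: "finite_measure fp" and bdd: "bounded \<Omega>"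
    and s1: "(x1, y1) \<in> msupport \<gamma>" and s2: "(x2, y2) \<in> msupport \<gamma>"
  shows "dist x1 y1 + dist x2 y2 \<le> dist x1 y2 + dist x2 y1"
proof (rule ccontr)
  assume neg: "\<not> ?thesis"
  have plan: "transport_plan \<Omega> fp fm \<gamma>" using opt by (simp add: optimal_plan_def)
  have sets [measurable_cong]: "sets \<gamma> = sets (borel \<Otimes>\<^sub>M borel)" and supp: "emeasure \<gamma> (- (closure \<Omega> \<times> closure \<Omega>)) = 0"
    and fst_m: "distr \<gamma> borel fst = fp" and snd_m: "distr \<gamma> borel snd = fm"
    using plan unfolding transport_plan_def borel_prod by blast+
  have sp: "space \<gamma> = UNIV" using sets_eq_imp_space_eq[OF sets] by (simp add: space_pair_measure)
  have msupp: "- (closure \<Omega> \<times> closure \<Omega>) \<in> sets (borel \<Otimes>\<^sub>M borel)"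
    unfolding borel_prod by (intro borel_open open_Compl closed_Times closed_closure)
  interpret FP: finite_measure fp by fact
  have "emeasure \<gamma> UNIV = emeasure (distr \<gamma> borel fst) UNIV" by (simp add: emeasure_distr sp)
  also have "\<dots> < \<infinity>" unfolding fst_m by (simp add: FP.emeasure_eq_measure)
  finally have "finite_measure \<gamma>" by (intro finite_measureI) (auto simp: sp)
  then interpret G: finite_measure \<gamma> .
  \<comment> \<open>Within balls of radius \<open>e\<close> each of the four distances changes by at
    most \<open>2 * e\<close>, in total by \<open>8 * e\<close>, so a ninth of the gap leaves a
    strict gain.\<close>
  define e where "e = (dist x1 y1 + dist x2 y2 - dist x1 y2 - dist x2 y1) / 9"
  have e: "e > 0" using neg by (simp add: e_def)
  define B1 where "B1 = ball x1 e \<times> ball y1 e"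
  define B2 where "B2 = ball x2 e \<times> ball y2 e"
  have [measurable]: "B1 \<in> sets (borel \<Otimes>\<^sub>M borel)" "B2 \<in> sets (borel \<Otimes>\<^sub>M borel)"
    unfolding B1_def B2_def by auto
  have open12: "open B1" "open B2" "(x1,y1) \<in> B1" "(x2,y2) \<in> B2"
    using e by (auto simp: B1_def B2_def open_Times)
  define m1 where "m1 = measure \<gamma> B1"
  define m2 where "m2 = measure \<gamma> B2"
  have m: "m1 > 0" "m2 > 0"
    using s1 s2 open12 by (auto simp: msupport_def m1_def m2_def G.emeasure_eq_measure zero_less_measure_iff)
  have em: "emeasure \<gamma> B1 = ennreal m1" "emeasure \<gamma> B2 = ennreal m2"
    by (auto simp: m1_def m2_def G.emeasure_eq_measure)
  \<comment> \<open>Half of the smaller mass: at most half of \<open>\<gamma>\<close> is removed on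
    each of \<open>B1\<close> and \<open>B2\<close>, so \<open>w\<close> is nonnegative even where
    they overlap.\<close>
  define \<alpha> where "\<alpha> = min m1 m2 / 2"
  have \<alpha>: "\<alpha> > 0" "\<alpha> / m1 \<le> 1/2" "\<alpha> / m2 \<le> 1/2" using m by (auto simp: \<alpha>_def field_simps)
  define w where "w z = 1 - \<alpha> / m1 * indicator B1 z - \<alpha> / m2 * indicator B2 z" for z :: "plane \<times> plane"
  have w0: "w z \<ge> 0" for z
  proof -
    have "\<alpha> / m1 * indicator B1 z \<le> 1 / 2 * 1" "\<alpha> / m2 * indicator B2 z \<le> 1 / 2 * 1"
      by (intro mult_mono \<alpha>; simp add: indicator_def)+
    then show ?thesis unfolding w_def by linarith
  qed
  have [measurable]: "w \<in> borel_measurable (borel \<Otimes>\<^sub>M borel)" unfolding w_def by measurable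
  define mu1 where "mu1 = distr (density \<gamma> (indicator B1)) borel fst"
  define nu1 where "nu1 = distr (density \<gamma> (indicator B1)) borel snd"
  define mu2 where "mu2 = distr (density \<gamma> (indicator B2)) borel fst"
  define nu2 where "nu2 = distr (density \<gamma> (indicator B2)) borel snd"
  have push: "(\<integral>\<^sup>+x. f x \<partial>distr (density \<gamma> (indicator B)) borel p) = (\<integral>\<^sup>+z. indicator B z * f (p z) \<partial>\<gamma>)"
    if [measurable]: "f \<in> borel_measurable borel" "p \<in> borel_measurable (borel \<Otimes>\<^sub>M borel)" "B \<in> sets (borel \<Otimes>\<^sub>M borel)"
    for f and p :: "plane \<times> plane \<Rightarrow> plane" and B
    by (subst nn_integral_distr) (auto simp: nn_integral_density)
  have tot: "emeasure (distr (density \<gamma> (indicator B)) borel p) UNIV = emeasure \<gamma> B"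
    if [measurable]: "p \<in> borel_measurable (borel \<Otimes>\<^sub>M borel)" "B \<in> sets (borel \<Otimes>\<^sub>M borel)"
    for p :: "plane \<times> plane \<Rightarrow> plane" and B
    using push[of "\<lambda>_. 1" p B] sets by simp
  have fin4: "finite_measure mu1" "finite_measure nu1" "finite_measure mu2" "finite_measure nu2"
    unfolding mu1_def nu1_def mu2_def nu2_def by (auto intro!: finite_measureI simp: tot)
  interpret mu1: finite_measure mu1 by fact
  interpret nu1: finite_measure nu1 by fact
  interpret mu2: finite_measure mu2 by fact
  interpret nu2: finite_measure nu2 by fact
  have s4 [simp, measurable_cong]: "sets mu1 = sets borel" "sets nu1 = sets borel" "sets mu2 = sets borel" "sets nu2 = sets borel"
    by (auto simp: mu1_def nu1_def mu2_def nu2_def)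
  have t4: "emeasure mu1 UNIV = m1" "emeasure nu1 UNIV = m1" "emeasure mu2 UNIV = m2" "emeasure nu2 UNIV = m2"
    by (auto simp: mu1_def nu1_def mu2_def nu2_def tot em)
  \<comment> \<open>The total mass of \<open>nu2\<close> is \<open>m2\<close>, so the first marginal
    of \<open>X\<close> is \<open>\<alpha> / m1\<close> times \<open>mu1\<close>, exactly what
    \<open>w\<close> removes on \<open>B1\<close>. The other three marginals match likewise.\<close>
  define c where "c = ennreal (\<alpha> / (m1 * m2))"
  define X where "X = scale_measure c (mu1 \<Otimes>\<^sub>M nu2)"
  define Y where "Y = scale_measure c (mu2 \<Otimes>\<^sub>M nu1)"
  define \<gamma>' where "\<gamma>' = add_measure (add_measure (density \<gamma> w) X) Y"
  have sXY [measurable_cong]: "sets X = sets \<gamma>" "sets Y = sets \<gamma>"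
    by (auto simp: X_def Y_def sets cong: sets_pair_measure_cong)
  have s' : "sets \<gamma>' = sets (borel \<Otimes>\<^sub>M borel)" by (simp add: \<gamma>'_def sets)
  have int: "(\<integral>\<^sup>+z. f z \<partial>\<gamma>') = (\<integral>\<^sup>+z. ennreal (w z) * f z \<partial>\<gamma>) + c * (\<integral>\<^sup>+x. \<integral>\<^sup>+y. f (x, y) \<partial>nu2 \<partial>mu1) + c * (\<integral>\<^sup>+x. \<integral>\<^sup>+y. f (x, y) \<partial>nu1 \<partial>mu2)"
    if f [measurable]: "f \<in> borel_measurable (borel \<Otimes>\<^sub>M borel)" for f
  proof -
    have "(\<integral>\<^sup>+z. f z \<partial>\<gamma>') = (\<integral>\<^sup>+z. f z \<partial>density \<gamma> w) + (\<integral>\<^sup>+z. f z \<partial>X) + (\<integral>\<^sup>+z. f z \<partial>Y)"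
      unfolding \<gamma>'_def by (subst nn_integral_add_measure; (subst nn_integral_add_measure)?) (auto simp: sXY sets cong: measurable_cong_sets)
    moreover have "(\<integral>\<^sup>+z. f z \<partial>X) = c * (\<integral>\<^sup>+x. \<integral>\<^sup>+y. f (x, y) \<partial>nu2 \<partial>mu1)"
      unfolding X_def by (subst nn_integral_scale_measure) (auto simp: nu2.nn_integral_fst)
    moreover have "(\<integral>\<^sup>+z. f z \<partial>Y) = c * (\<integral>\<^sup>+x. \<integral>\<^sup>+y. f (x, y) \<partial>nu1 \<partial>mu2)"
      unfolding Y_def by (subst nn_integral_scale_measure) (auto simp: nu1.nn_integral_fst)
    ultimately show ?thesis by (simp add: nn_integral_density)
  qed
  have cm: "c * ennreal m2 = ennreal (\<alpha> / m1)" "c * ennreal m1 = ennreal (\<alpha> / m2)"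
    using m \<alpha> by (auto simp: c_def ennreal_mult'[symmetric])
  have split: "(\<integral>\<^sup>+z. ennreal (w z) * f z \<partial>\<gamma>) + ennreal (\<alpha> / m1) * (\<integral>\<^sup>+z. indicator B1 z * f z \<partial>\<gamma>) + ennreal (\<alpha> / m2) * (\<integral>\<^sup>+z. indicator B2 z * f z \<partial>\<gamma>) = (\<integral>\<^sup>+z. f z \<partial>\<gamma>)"
    if f [measurable]: "f \<in> borel_measurable (borel \<Otimes>\<^sub>M borel)" for f
  proof -
    have "ennreal (w z) * f z + ennreal (\<alpha> / m1) * (indicator B1 z * f z) + ennreal (\<alpha> / m2) * (indicator B2 z * f z) = f z" for z
    proof -
      have "ennreal (w z) + ennreal (\<alpha> / m1 * indicator B1 z) + ennreal (\<alpha> / m2 * indicator B2 z) = ennreal 1"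
      proof -
        have "0 \<le> \<alpha> / m1 * indicator B1 z" "0 \<le> \<alpha> / m2 * indicator B2 z" using \<alpha> m by auto
        then have "ennreal (w z) + ennreal (\<alpha> / m1 * indicator B1 z) + ennreal (\<alpha> / m2 * indicator B2 z) =
          ennreal (w z + \<alpha> / m1 * indicator B1 z + \<alpha> / m2 * indicator B2 z)"
          using w0[of z] by (simp only: ennreal_plus add_nonneg_nonneg)
        then show ?thesis unfolding w_def by simp
      qed
      then have "(ennreal (w z) + ennreal (\<alpha> / m1 * indicator B1 z) + ennreal (\<alpha> / m2 * indicator B2 z)) * f z = f z" by simp
      moreover have "ennreal (a * indicator B z) = ennreal a * indicator B z" for a and B :: "(plane \<times> plane) set"
        by (simp add: indicator_def)
      ultimately show ?thesis by (simp only: distrib_right mult.assoc)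
    qed
    then have "(\<integral>\<^sup>+z. f z \<partial>\<gamma>) = (\<integral>\<^sup>+z. ennreal (w z) * f z + ennreal (\<alpha> / m1) * (indicator B1 z * f z) + ennreal (\<alpha> / m2) * (indicator B2 z * f z) \<partial>\<gamma>)" by simp
    also have "\<dots> = (\<integral>\<^sup>+z. ennreal (w z) * f z \<partial>\<gamma>) + ennreal (\<alpha> / m1) * (\<integral>\<^sup>+z. indicator B1 z * f z \<partial>\<gamma>) + ennreal (\<alpha> / m2) * (\<integral>\<^sup>+z. indicator B2 z * f z \<partial>\<gamma>)"
      by (simp add: nn_integral_add nn_integral_cmult)
    finally show ?thesis ..
  qed
  have fst': "(\<integral>\<^sup>+z. f (fst z) \<partial>\<gamma>') = (\<integral>\<^sup>+z. f (fst z) \<partial>\<gamma>)" if [measurable]: "f \<in> borel_measurable borel" for f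
  proof -
    have "(\<integral>\<^sup>+z. f (fst z) \<partial>\<gamma>') = (\<integral>\<^sup>+z. ennreal (w z) * f (fst z) \<partial>\<gamma>) + (c * ennreal m2) * (\<integral>\<^sup>+x. f x \<partial>mu1) + (c * ennreal m1) * (\<integral>\<^sup>+x. f x \<partial>mu2)"
      by (subst int) (auto simp: t4 nn_integral_multc nn_integral_cmult mult_ac sets_eq_imp_space_eq[OF s4(2)] sets_eq_imp_space_eq[OF s4(4)])
    also have "\<dots> = (\<integral>\<^sup>+z. f (fst z) \<partial>\<gamma>)"
      unfolding cm mu1_def mu2_def by (simp add: push split)
    finally show ?thesis .
  qed
  have snd': "(\<integral>\<^sup>+z. f (snd z) \<partial>\<gamma>') = (\<integral>\<^sup>+z. f (snd z) \<partial>\<gamma>)" if [measurable]: "f \<in> borel_measurable borel" for f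
  proof -
    have "(\<integral>\<^sup>+z. f (snd z) \<partial>\<gamma>') = (\<integral>\<^sup>+z. ennreal (w z) * f (snd z) \<partial>\<gamma>) + (c * ennreal m2) * (\<integral>\<^sup>+x. f x \<partial>nu1) + (c * ennreal m1) * (\<integral>\<^sup>+x. f x \<partial>nu2)"
      by (subst int) (auto simp: t4 mult_ac sets_eq_imp_space_eq[OF s4(1)] sets_eq_imp_space_eq[OF s4(3)])
    also have "\<dots> = (\<integral>\<^sup>+z. f (snd z) \<partial>\<gamma>)"
      unfolding cm nu1_def nu2_def by (simp add: push split)
    finally show ?thesis .
  qed
  have d': "distr \<gamma>' borel fst = fp" "distr \<gamma>' borel snd = fm"
  proof -
    have "emeasure (distr \<gamma>' borel p) A = emeasure (distr \<gamma> borel p) A"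
      if A: "A \<in> sets borel" and p [measurable]: "p \<in> borel_measurable (borel \<Otimes>\<^sub>M borel)"
        and eq: "\<And>f. f \<in> borel_measurable borel \<Longrightarrow> (\<integral>\<^sup>+z. f (p z) \<partial>\<gamma>') = (\<integral>\<^sup>+z. f (p z) \<partial>\<gamma>)"
      for p :: "plane \<times> plane \<Rightarrow> plane" and A
    proof -
      have [measurable]: "p \<in> \<gamma>' \<rightarrow>\<^sub>M borel" using p s' by (simp cong: measurable_cong_sets)
      have "emeasure (distr \<gamma>' borel p) A = (\<integral>\<^sup>+x. indicator A x \<partial>distr \<gamma>' borel p)" using A by simp
      also have "\<dots> = (\<integral>\<^sup>+z. indicator A (p z) \<partial>\<gamma>')" using A by (intro nn_integral_distr) auto
      also have "\<dots> = (\<integral>\<^sup>+z. indicator A (p z) \<partial>\<gamma>)" using A by (intro eq) auto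
      also have "\<dots> = (\<integral>\<^sup>+x. indicator A x \<partial>distr \<gamma> borel p)" using A by (intro nn_integral_distr[symmetric]) auto
      also have "\<dots> = emeasure (distr \<gamma> borel p) A" using A by simp
      finally show ?thesis .
    qed
    from this[of _ fst] this[of _ snd] show "distr \<gamma>' borel fst = fp" "distr \<gamma>' borel snd = fm"
      unfolding fst_m[symmetric] snd_m[symmetric] using fst' snd' by (auto intro!: measure_eqI)
  qed
  have "transport_plan \<Omega> fp fm \<gamma>'"
    unfolding transport_plan_def
  proof (intro conjI d')
    show "sets \<gamma>' = sets borel" using s' unfolding borel_prod .
    define C where "C = - closure \<Omega>"
    have C [measurable]: "C \<in> sets borel" by (simp add: C_def)
    have "(\<integral>\<^sup>+z. indicator C (fst z) \<partial>\<gamma>) = 0" "(\<integral>\<^sup>+z. indicator C (snd z) \<partial>\<gamma>) = 0"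
    proof -
      have "AE z in \<gamma>. z \<in> closure \<Omega> \<times> closure \<Omega>"
        by (rule AE_I[OF _ supp]) (use msupp sets in auto)
      then show "(\<integral>\<^sup>+z. indicator C (fst z) \<partial>\<gamma>) = 0" "(\<integral>\<^sup>+z. indicator C (snd z) \<partial>\<gamma>) = 0"
        by (auto simp: nn_integral_0_iff_AE C_def elim!: eventually_mono)
    qed
    then have "(\<integral>\<^sup>+z. indicator C (fst z) \<partial>\<gamma>') = 0" "(\<integral>\<^sup>+z. indicator C (snd z) \<partial>\<gamma>') = 0"
      by (auto simp: fst' snd')
    then have "AE z in \<gamma>'. fst z \<notin> C" "AE z in \<gamma>'. snd z \<notin> C"
      by (subst (asm) nn_integral_0_iff_AE; force simp: s' indicator_def split: if_splits cong: measurable_cong_sets)+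
    then have "AE z in \<gamma>'. z \<notin> - (closure \<Omega> \<times> closure \<Omega>)"
      by eventually_elim (auto simp: C_def)
    moreover have "- (closure \<Omega> \<times> closure \<Omega>) \<in> sets \<gamma>'" using msupp by (simp add: s')
    ultimately show "emeasure \<gamma>' (- (closure \<Omega> \<times> closure \<Omega>)) = 0"
      using AE_iff_null_sets by blast
  qed
  then have le: "transport_cost \<gamma> \<le> transport_cost \<gamma>'" using opt by (simp add: optimal_plan_def)
  define d where "d z = ennreal (dist (fst z) (snd z))" for z :: "plane \<times> plane"
  have [measurable]: "d \<in> borel_measurable (borel \<Otimes>\<^sub>M borel)" unfolding d_def by measurable
  define W where "W = (\<integral>\<^sup>+z. ennreal (w z) * d z \<partial>\<gamma>)"
  have cross: "c * (\<integral>\<^sup>+x. \<integral>\<^sup>+y. d (x, y) \<partial>\<nu> \<partial>\<mu>) \<le> ennreal (\<alpha> * (dist a b + 2 * e))"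
    if \<mu>: "\<mu> = distr (density \<gamma> (indicator A)) borel fst" "emeasure \<gamma> A = ennreal mA" "A = ball a e \<times> ball a' e"
     and \<nu>: "\<nu> = distr (density \<gamma> (indicator B)) borel snd" "emeasure \<gamma> B = ennreal mB" "B = ball b' e \<times> ball b e"
     and mm: "mA * mB = m1 * m2" "mA > 0" "mB > 0" for \<mu> \<nu> A B mA mB a a' b b'
  proof -
    have [measurable]: "A \<in> sets (borel \<Otimes>\<^sub>M borel)" "B \<in> sets (borel \<Otimes>\<^sub>M borel)" unfolding that by auto
    have x: "AE x in \<mu>. x \<in> ball a e"
      unfolding \<mu>(1) by (subst AE_distr_iff) (auto simp: AE_density \<mu>(3) indicator_def)
    have y: "AE y in \<nu>. y \<in> ball b e"
      unfolding \<nu>(1) by (subst AE_distr_iff) (auto simp: AE_density \<nu>(3) indicator_def)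
    have "(\<integral>\<^sup>+x. \<integral>\<^sup>+y. d (x, y) \<partial>\<nu> \<partial>\<mu>) \<le> (\<integral>\<^sup>+x. \<integral>\<^sup>+y. ennreal (dist a b + 2 * e) \<partial>\<nu> \<partial>\<mu>)"
    proof (intro nn_integral_mono_AE, use x in eventually_elim)
      fix x assume x: "x \<in> ball a e"
      show "(\<integral>\<^sup>+y. d (x, y) \<partial>\<nu>) \<le> (\<integral>\<^sup>+y. ennreal (dist a b + 2 * e) \<partial>\<nu>)"
      proof (intro nn_integral_mono_AE, use y in eventually_elim)
        fix y assume "y \<in> ball b e"
        then have "dist x y \<le> dist a b + 2 * e"
          using x dist_triangle[of x y a] dist_triangle[of a y b] by (auto simp: dist_commute)
        then show "d (x, y) \<le> ennreal (dist a b + 2 * e)" by (auto simp: d_def intro: ennreal_leI)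
      qed
    qed
    also have "\<dots> = ennreal (dist a b + 2 * e) * ennreal mB * ennreal mA"
      using tot[of fst A] tot[of snd B] by (simp add: that(1,4) \<mu>(2) \<nu>(2))
    finally have "c * (\<integral>\<^sup>+x. \<integral>\<^sup>+y. d (x, y) \<partial>\<nu> \<partial>\<mu>) \<le> c * (ennreal (dist a b + 2 * e) * ennreal mB * ennreal mA)"
      by (rule mult_left_mono) simp
    also have "\<dots> = ennreal (\<alpha> / (m1 * m2) * ((dist a b + 2 * e) * mB * mA))"

    proof -
      have gen: "ennreal p * (ennreal q * ennreal r * ennreal s) = ennreal (p * (q * r * s))"
        if "0 \<le> p" "0 \<le> q" "0 \<le> r" "0 \<le> s" for p q r s
        using that by (simp add: ennreal_mult)
      show ?thesis unfolding c_def using m \<alpha> e mm by (intro gen) auto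
    qed
    also have "\<alpha> / (m1 * m2) * ((dist a b + 2 * e) * mB * mA) = \<alpha> / (m1 * m2) * (mA * mB) * (dist a b + 2 * e)" by simp
    also have "\<dots> = \<alpha> * (dist a b + 2 * e)" unfolding mm using m by simp
    finally show ?thesis .
  qed
  have "transport_cost \<gamma>' = W + c * (\<integral>\<^sup>+x. \<integral>\<^sup>+y. d (x, y) \<partial>nu2 \<partial>mu1) + c * (\<integral>\<^sup>+x. \<integral>\<^sup>+y. d (x, y) \<partial>nu1 \<partial>mu2)"
    unfolding transport_cost_def W_def d_def[symmetric] by (rule int) simp
  also have "\<dots> \<le> W + ennreal (\<alpha> * (dist x1 y2 + 2 * e)) + ennreal (\<alpha> * (dist x2 y1 + 2 * e))"
    by (intro add_mono order_refl cross[OF mu1_def em(1) B1_def nu2_def em(2) B2_def] cross[OF mu2_def em(2) B2_def nu1_def em(1) B1_def])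
       (auto simp: m mult.commute)
  also have "\<dots> = W + ennreal (\<alpha> * (dist x1 y2 + dist x2 y1 + 4 * e))"
    using \<alpha> e by (simp add: add.assoc ennreal_plus[symmetric] algebra_simps del: ennreal_plus)
  finally have up: "transport_cost \<gamma>' \<le> W + ennreal (\<alpha> * (dist x1 y2 + dist x2 y1 + 4 * e))" .
  have low: "ennreal (\<alpha> * (dist a b - 2 * e)) \<le> ennreal (\<alpha> / mA) * (\<integral>\<^sup>+z. indicator A z * d z \<partial>\<gamma>)"
    if A: "A = ball a e \<times> ball b e" "emeasure \<gamma> A = ennreal mA" "mA > 0" for A mA a b
  proof -
    have [measurable]: "A \<in> sets (borel \<Otimes>\<^sub>M borel)" unfolding that by auto
    have "(\<integral>\<^sup>+z. ennreal (dist a b - 2 * e) * indicator A z \<partial>\<gamma>) \<le> (\<integral>\<^sup>+z. indicator A z * d z \<partial>\<gamma>)"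
    proof (rule nn_integral_mono)
      fix z
      have "dist a b - 2 * e \<le> dist (fst z) (snd z)" if "z \<in> A"
        using that dist_triangle[of a b "fst z"] dist_triangle[of "fst z" b "snd z"] by (auto simp: A dist_commute)
      then show "ennreal (dist a b - 2 * e) * indicator A z \<le> indicator A z * d z"
        by (auto simp: d_def indicator_def intro: ennreal_leI)
    qed
    also have "(\<integral>\<^sup>+z. ennreal (dist a b - 2 * e) * indicator A z \<partial>\<gamma>) = ennreal (dist a b - 2 * e) * ennreal mA"
      using A by (simp add: nn_integral_cmult sets)
    finally have "ennreal (\<alpha> / mA) * (ennreal (dist a b - 2 * e) * ennreal mA) \<le> ennreal (\<alpha> / mA) * (\<integral>\<^sup>+z. indicator A z * d z \<partial>\<gamma>)"
      by (rule mult_left_mono) simp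
    moreover have "ennreal (\<alpha> / mA) * (ennreal (dist a b - 2 * e) * ennreal mA) = ennreal (\<alpha> * (dist a b - 2 * e))"
      using \<alpha> A by (simp add: ennreal_mult''[symmetric] ennreal_mult'[symmetric])
    ultimately show ?thesis by simp
  qed
  have "W + ennreal (\<alpha> * (dist x1 y2 + dist x2 y1 + 5 * e)) = W + ennreal (\<alpha> * (dist x1 y1 - 2 * e) + \<alpha> * (dist x2 y2 - 2 * e))"
  proof -
    have "dist x1 y2 + dist x2 y1 + 5 * e = (dist x1 y1 - 2 * e) + (dist x2 y2 - 2 * e)"
    proof -
      have "9 * e = dist x1 y1 + dist x2 y2 - dist x1 y2 - dist x2 y1" by (simp add: e_def)
      then show ?thesis by linarith
    qed
    then show ?thesis by (simp only: distrib_left)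
  qed
  also have "\<dots> \<le> W + (ennreal (\<alpha> * (dist x1 y1 - 2 * e)) + ennreal (\<alpha> * (dist x2 y2 - 2 * e)))"
    by (intro add_left_mono ennreal_add_le)
  also have "\<dots> \<le> W + (ennreal (\<alpha> / m1) * (\<integral>\<^sup>+z. indicator B1 z * d z \<partial>\<gamma>) + ennreal (\<alpha> / m2) * (\<integral>\<^sup>+z. indicator B2 z * d z \<partial>\<gamma>))"
    by (intro add_mono order_refl low[OF B1_def em(1)] low[OF B2_def em(2)] m)
  also have "\<dots> = transport_cost \<gamma>"
    unfolding transport_cost_def W_def d_def[symmetric] using split[of d] by (simp add: add.assoc)
  finally have "W + ennreal (\<alpha> * (dist x1 y2 + dist x2 y1 + 5 * e)) \<le> W + ennreal (\<alpha> * (dist x1 y2 + dist x2 y1 + 4 * e))"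
    using le up by (meson order_trans)
  \<comment> \<open>\<open>W\<close> stands on both sides of the inequality and has to be finite to
    be cancelled.\<close>
  moreover have "W < \<infinity>"
  proof -
    obtain K where K: "\<And>x y. x \<in> closure \<Omega> \<Longrightarrow> y \<in> closure \<Omega> \<Longrightarrow> dist x y \<le> K"
      using bdd bounded_closure bounded_two_points by metis
    have "W \<le> (\<integral>\<^sup>+z. ennreal K \<partial>\<gamma>)"
      unfolding W_def
    proof (rule nn_integral_mono_AE)
      have "AE z in \<gamma>. z \<in> closure \<Omega> \<times> closure \<Omega>"
        by (rule AE_I[OF _ supp]) (use msupp sets in auto)
      then show "AE z in \<gamma>. ennreal (w z) * d z \<le> ennreal K"
      proof eventually_elim
        fix z assume z: "z \<in> closure \<Omega> \<times> closure \<Omega>"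
        have "w z * dist (fst z) (snd z) \<le> 1 * dist (fst z) (snd z)"
        proof (rule mult_right_mono)
          have "0 \<le> \<alpha> / m1 * indicator B1 z" "0 \<le> \<alpha> / m2 * indicator B2 z" using \<alpha> m by auto
          then show "w z \<le> 1" unfolding w_def by linarith
        qed simp
        also have "\<dots> \<le> K" using K z by auto
        finally show "ennreal (w z) * d z \<le> ennreal K"
          unfolding d_def using w0[of z] by (simp add: ennreal_mult'[symmetric] ennreal_leI)
      qed
    qed
    also have "\<dots> < \<infinity>" by (simp add: ennreal_mult_less_top G.emeasure_eq_measure)
    finally show ?thesis .
  qed
  ultimately have "ennreal (\<alpha> * (dist x1 y2 + dist x2 y1 + 5 * e)) \<le> ennreal (\<alpha> * (dist x1 y2 + dist x2 y1 + 4 * e))"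
    using ennreal_add_left_cancel_le by (auto simp: less_top[symmetric])
  then have "\<alpha> * (dist x1 y2 + dist x2 y1 + 5 * e) \<le> \<alpha> * (dist x1 y2 + dist x2 y1 + 4 * e)"
    using \<alpha> e by (subst (asm) ennreal_le_iff) auto
  then show False using \<alpha> e by simp
qed

section \<open>Transport rays\<close>

lemma rot_frame_inner:
  fixes e u v :: plane
  assumes "norm e = 1"
  shows "u \<bullet> v = (u \<bullet> e) * (v \<bullet> e) + (u \<bullet> rot_minus_half_pi e) * (v \<bullet> rot_minus_half_pi e)"
proof -
  have "u \<bullet> v = ((u \<bullet> e) *\<^sub>R e + (u \<bullet> rot_minus_half_pi e) *\<^sub>R rot_minus_half_pi e) \<bullet> v"
    using rot_frame_expansion[OF assms, of u] by simp
  then show ?thesis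
    by (simp add: inner_add_left inner_commute[of e v] inner_commute[of "rot_minus_half_pi e" v])
qed

lemma rot_frame_inner_simps [simp]:
  fixes e :: plane
  assumes "norm e = 1"
  shows "e \<bullet> e = 1" "rot_minus_half_pi e \<bullet> rot_minus_half_pi e = 1"
  using assms by (simp_all add: norm_eq_1)

lemma measurable_vector_2 [measurable]: "(\<lambda>(r, s). vector [r, s] :: plane) \<in> borel_measurable (lborel \<Otimes>\<^sub>M lborel)"
proof -
    have "(\<lambda>z. vector [fst z, snd z] :: plane) = (\<lambda>z. fst z *\<^sub>R axis 1 1 + snd z *\<^sub>R axis 2 1)"
      by (rule ext) (simp add: plane_eq_iff axis_def)
    then have "continuous_on UNIV (\<lambda>z::real \<times> real. vector [fst z, snd z] :: plane)"
      by (simp only:) (intro continuous_intros)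
    then have "(\<lambda>z::real \<times> real. vector [fst z, snd z] :: plane) \<in> borel_measurable borel"
      by (rule borel_measurable_continuous_onI)
    then show ?thesis by (simp add: case_prod_beta borel_prod[symmetric] cong: measurable_cong_sets)
qed

lemma lborel_plane_eq: "distr (lborel \<Otimes>\<^sub>M lborel) borel (\<lambda>(r, s). vector [r, s] :: plane) = lborel"
proof (rule lborel_eqI[symmetric])
  fix l u :: plane assume le: "\<And>b. b \<in> Basis \<Longrightarrow> l \<bullet> b \<le> u \<bullet> b"
  have B: "(Basis :: plane set) = {axis 1 1, axis 2 1}"
    unfolding Basis_vec_def by (auto simp: exhaust_2) (metis exhaust_2)
  have ne: "axis 1 (1::real) \<noteq> (axis 2 1 :: plane)" by (simp add: axis_eq_axis)
  have i: "v \<bullet> axis k 1 = v $ k" for v :: plane and k by (simp add: inner_axis)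
  have "(\<lambda>(r, s). vector [r, s] :: plane) -` box l u = {l $ 1<..<u $ 1} \<times> {l $ 2<..<u $ 2}"
    by (auto simp: mem_box B i)
  then have "emeasure (distr (lborel \<Otimes>\<^sub>M lborel) borel (\<lambda>(r, s). vector [r, s] :: plane)) (box l u)
      = emeasure (lborel \<Otimes>\<^sub>M lborel) ({l $ 1<..<u $ 1} \<times> {l $ 2<..<u $ 2})"
    by (subst emeasure_distr) (auto simp: space_pair_measure)
  also have "\<dots> = emeasure lborel {l $ 1<..<u $ 1} * emeasure lborel {l $ 2<..<u $ 2}"
    by (rule lborel.emeasure_pair_measure_Times) auto
  also have "\<dots> = ennreal (\<Prod>b\<in>Basis. (u - l) \<bullet> b)"
    using le[of "axis 1 1"] le[of "axis 2 1"] ne by (simp add: B i ennreal_mult)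
  finally show "emeasure (distr (lborel \<Otimes>\<^sub>M lborel) borel (\<lambda>(r, s). vector [r, s] :: plane)) (box l u)
      = ennreal (\<Prod>b\<in>Basis. (u - l) \<bullet> b)" .
qed simp

lemma lborel_rot_frame:
  fixes e :: plane
  assumes e: "norm e = 1"
  shows "distr lborel borel (\<lambda>v::plane. (v $ 1) *\<^sub>R e + (v $ 2) *\<^sub>R rot_minus_half_pi e) = lborel"
    (is "distr lborel borel ?T = lborel")
proof (rule lborel_eqI[symmetric])
  fix l u :: plane assume le: "\<And>b. b \<in> Basis \<Longrightarrow> l \<bullet> b \<le> u \<bullet> b"
  define T' where "T' z = (vector [z \<bullet> e, z \<bullet> rot_minus_half_pi e] :: plane)" for z
  have TT': "?T (T' z) = z" for z using rot_frame_expansion[OF e, of z] by (simp add: T'_def)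
  have T'T: "T' (?T v) = v" for v
    using e by (simp add: T'_def plane_eq_iff inner_add_left)
  have [measurable]: "?T \<in> borel_measurable borel"
    by (intro borel_measurable_continuous_onI continuous_intros)
  have orth: "orthogonal_transformation T'"
    unfolding orthogonal_transformation_def
  proof
    show "linear T'" by (rule linearI) (simp_all add: T'_def plane_eq_iff inner_add_left)
    show "\<forall>v w. T' v \<bullet> T' w = v \<bullet> w"
    proof (intro allI)
      fix v w
      have "T' v \<bullet> T' w = (v \<bullet> e) * (w \<bullet> e) + (v \<bullet> rot_minus_half_pi e) * (w \<bullet> rot_minus_half_pi e)"
        unfolding inner_plane[of "T' v"] by (simp add: T'_def)
      then show "T' v \<bullet> T' w = v \<bullet> w" by (simp only: rot_frame_inner[OF e, of v w])
    qed
  qed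
  have eqT: "?T -` box l u = T' ` box l u"
  proof (intro set_eqI iffI)
    fix v assume "v \<in> ?T -` box l u"
    then have "?T v \<in> box l u" by (rule vimageD)
    then show "v \<in> T' ` box l u" using T'T[of v, symmetric] by (rule rev_image_eqI)
  next
    fix v assume "v \<in> T' ` box l u"
    then obtain z where "z \<in> box l u" "v = T' z" by blast
    then show "v \<in> ?T -` box l u" using TT'[of z] by (intro vimageI2) simp
  qed
  have "emeasure (distr lborel borel ?T) (box l u) = emeasure lborel (T' ` box l u)"
    using eqT by (subst emeasure_distr) auto
  also have "\<dots> = emeasure lebesgue (T' ` box l u)"
  proof -
    have "?T -` box l u \<inter> space borel \<in> sets borel" by (rule measurable_sets[of _ _ borel]) auto
    then have "T' ` box l u \<in> sets lborel" using eqT by simp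
    then show ?thesis by simp
  qed
  also have "\<dots> = ennreal (measure lebesgue (T' ` box l u))"
    using measurable_orthogonal_image[OF orth, of "box l u"] by (simp add: emeasure_eq_measure2)
  also have "\<dots> = ennreal (measure lebesgue (box l u))"
    using measure_orthogonal_image[OF orth, of "box l u"] by simp
  also have "\<dots> = ennreal (\<Prod>b\<in>Basis. (u - l) \<bullet> b)" using le by (simp add: measure_lborel_box_eq)
  finally show "emeasure (distr lborel borel ?T) (box l u) = ennreal (\<Prod>b\<in>Basis. (u - l) \<bullet> b)" .
qed simp

text \<open>Rotation invariance followed by Tonelli. The slices are the lines orthogonal to
  \<open>e\<close>, which rays close to the direction \<open>e\<close> cross transversally.\<close>

lemma emeasure_plane_slices:
  fixes e :: plane
  assumes e: "norm e = 1" and B: "B \<in> sets borel"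
  shows "emeasure lborel B = (\<integral>\<^sup>+r. emeasure lborel {s. r *\<^sub>R e + s *\<^sub>R rot_minus_half_pi e \<in> B} \<partial>lborel)"
proof -
  let ?V = "\<lambda>(r, s). vector [r, s] :: plane" and ?T = "\<lambda>v::plane. (v $ 1) *\<^sub>R e + (v $ 2) *\<^sub>R rot_minus_half_pi e"
  have [measurable]: "?T \<in> borel_measurable borel"
    by (intro borel_measurable_continuous_onI continuous_intros)
  have V [measurable]: "?V \<in> borel_measurable (lborel \<Otimes>\<^sub>M lborel)" by (rule measurable_vector_2)
  have [measurable]: "?V \<in> lborel \<Otimes>\<^sub>M lborel \<rightarrow>\<^sub>M lborel" by measurable
  note B [measurable]
  have A: "{z \<in> space (lborel \<Otimes>\<^sub>M lborel). ?T (?V z) \<in> B} \<in> sets (lborel \<Otimes>\<^sub>M lborel)" by measurable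
  have "emeasure lborel B = emeasure (distr lborel borel ?T) B" using lborel_rot_frame[OF e] by simp
  also have "\<dots> = emeasure lborel (?T -` B)" by (subst emeasure_distr) auto
  also have "\<dots> = emeasure (distr (lborel \<Otimes>\<^sub>M lborel) borel ?V) (?T -` B)" by (simp add: lborel_plane_eq)
  also have "\<dots> = emeasure (lborel \<Otimes>\<^sub>M lborel) {z \<in> space (lborel \<Otimes>\<^sub>M lborel). ?T (?V z) \<in> B}"
  proof (subst emeasure_distr[OF V])
    have "?T -` B \<inter> space borel \<in> sets borel" by (rule measurable_sets[of _ _ borel]) auto
    then show "?T -` B \<in> sets borel" by simp
  qed (simp add: vimage_def Int_def conj_commute)
  also have "\<dots> = (\<integral>\<^sup>+r. emeasure lborel (Pair r -` {z \<in> space (lborel \<Otimes>\<^sub>M lborel). ?T (?V z) \<in> B}) \<partial>lborel)"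
    by (rule lborel.emeasure_pair_measure_alt[OF A])
  finally show ?thesis by (simp add: vimage_def space_pair_measure)
qed

section \<open>Geometry of rays that do not cross\<close>

text \<open>At the crossing point monotonicity forces equality in the triangle inequality for the
  path from \<open>x1\<close> over \<open>z\<close> to \<open>y2\<close>. So \<open>z\<close> lies
  on \<open>[x1, y2]\<close>, which puts \<open>y2\<close>, and then \<open>x2\<close>, on the line
  of the first ray.\<close>

lemma crossing_collinear:
  fixes x1 y1 x2 y2 z :: plane
  assumes mono: "dist x1 y1 + dist x2 y2 \<le> dist x1 y2 + dist x2 y1"
    and z1: "z \<in> open_segment x1 y1" and z2: "z \<in> open_segment x2 y2"
  obtains c d where "x2 = z + c *\<^sub>R (y1 - x1)" "y2 = z + d *\<^sub>R (y1 - x1)"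
proof -
  obtain s where s: "0 < s" "s < 1" "z = (1 - s) *\<^sub>R x1 + s *\<^sub>R y1" using z1 by (auto simp: in_segment)
  obtain t where t: "0 < t" "t < 1" "z = (1 - t) *\<^sub>R x2 + t *\<^sub>R y2" using z2 by (auto simp: in_segment)
  have "between (x1, y1) z" "between (x2, y2) z"
    using z1 z2 by (auto simp: between_mem_segment open_segment_def)
  then have "dist x1 y1 = dist x1 z + dist z y1" "dist x2 y2 = dist x2 z + dist z y2"
    by (auto simp: between)
  then have "dist x1 y2 = dist x1 z + dist z y2"
    using mono dist_triangle[of x1 y2 z] dist_triangle[of x2 y1 z] by linarith
  then have "z \<in> closed_segment x1 y2" by (simp add: between[symmetric] between_mem_segment)
  then obtain u where u: "z = (1 - u) *\<^sub>R x1 + u *\<^sub>R y2" by (auto simp: in_segment)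
  have ne: "z \<noteq> x1" using z1 by (auto simp: open_segment_def)
  have u0: "u \<noteq> 0" using u ne by auto
  define v where "v = y1 - x1"
  have zx: "z - x1 = s *\<^sub>R v" using s(3) by (simp add: algebra_simps v_def)
  have "u *\<^sub>R (y2 - x1) = s *\<^sub>R v" using u unfolding zx[symmetric] by (simp add: algebra_simps)
  then have "(1 / u) *\<^sub>R (u *\<^sub>R (y2 - x1)) = (1 / u) *\<^sub>R (s *\<^sub>R v)" by simp
  then have "y2 - x1 = (s / u) *\<^sub>R v" using u0 by simp
  then have "(y2 - x1) - (z - x1) = (s / u) *\<^sub>R v - s *\<^sub>R v" by (simp only: zx)
  then have "y2 - z = (s / u) *\<^sub>R v - s *\<^sub>R v" by simp
  then have yz: "y2 - z = (s / u - s) *\<^sub>R v" by (simp add: scaleR_diff_left)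
  have "(1 - t) *\<^sub>R (x2 - z) = - (t *\<^sub>R (y2 - z))" using t(3) by (simp add: algebra_simps)
  then have "(1 / (1 - t)) *\<^sub>R ((1 - t) *\<^sub>R (x2 - z)) = (1 / (1 - t)) *\<^sub>R (- (t *\<^sub>R (y2 - z)))" by simp
  then have "x2 - z = (1 / (1 - t)) *\<^sub>R (- (t *\<^sub>R (y2 - z)))" using t(1,2) by simp
  then have xz: "x2 - z = (- (1 / (1 - t) * (t * (s / u - s)))) *\<^sub>R v" unfolding yz by simp
  have x2: "x2 = z + (- (1 / (1 - t) * (t * (s / u - s)))) *\<^sub>R (y1 - x1)"
    unfolding v_def[symmetric] xz[symmetric] by simp
  have y2: "y2 = z + (s / u - s) *\<^sub>R (y1 - x1)"
    unfolding v_def[symmetric] yz[symmetric] by simp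
  show ?thesis using that[OF x2 y2] .
qed

definition ray_height :: "plane \<Rightarrow> plane \<times> plane \<Rightarrow> real" where
  "ray_height e z = (snd z - fst z) \<bullet> e"

definition ray_slope :: "plane \<Rightarrow> plane \<times> plane \<Rightarrow> real" where
  "ray_slope e z = ((snd z - fst z) \<bullet> rot_minus_half_pi e) / ray_height e z"

text \<open>The coordinate orthogonal to \<open>e\<close> of the point where the line through the
  ray reaches height \<open>r\<close> along \<open>e\<close>.\<close>

definition ray_offset :: "plane \<Rightarrow> real \<Rightarrow> plane \<times> plane \<Rightarrow> real" where
  "ray_offset e r z = fst z \<bullet> rot_minus_half_pi e + ray_slope e z * (r - fst z \<bullet> e)"

definition seg :: "plane \<times> plane \<Rightarrow> real \<Rightarrow> plane" where
  "seg z t = (1 - t) *\<^sub>R fst z + t *\<^sub>R snd z"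

lemma seg_ray:
  assumes e: "norm e = 1" and h: "ray_height e z \<noteq> 0"
  shows "r *\<^sub>R e + ray_offset e r z *\<^sub>R rot_minus_half_pi e = seg z ((r - fst z \<bullet> e) / ray_height e z)"
proof (rule rot_frame_eqI[OF e])
  obtain x y where z: "z = (x, y)" by (metis surj_pair)
  have h': "(y - x) \<bullet> e \<noteq> 0" using h by (simp add: z ray_height_def)
  have g: "seg z t \<bullet> v = x \<bullet> v + t * ((y - x) \<bullet> v)" for t v
    by (simp add: seg_def z inner_add_left inner_diff_left algebra_simps)
  show "(r *\<^sub>R e + ray_offset e r z *\<^sub>R rot_minus_half_pi e) \<bullet> e = seg z ((r - fst z \<bullet> e) / ray_height e z) \<bullet> e"
    unfolding g using e h' by (simp add: inner_add_left z ray_height_def)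
  show "(r *\<^sub>R e + ray_offset e r z *\<^sub>R rot_minus_half_pi e) \<bullet> rot_minus_half_pi e
      = seg z ((r - fst z \<bullet> e) / ray_height e z) \<bullet> rot_minus_half_pi e"
    unfolding g using e h' by (simp add: inner_add_left z ray_height_def ray_offset_def ray_slope_def)
qed

text \<open>The gap between the offsets of the two rays is an affine function of the height. Where
  the later ray starts it is still at least half of the initial gap \<open>D\<close>; where the
  first of them ends it is not negative, as the rays do not cross; and \<open>r\<close> lies in the
  first half of this range. Interpolation leaves \<open>D / 4\<close>.\<close>

lemma noncrossing_gap:
  fixes e :: plane
  assumes e: "norm e = 1"
    and mono: "dist (fst p) (snd p) + dist (fst q) (snd q) \<le> dist (fst p) (snd q) + dist (fst q) (snd p)"
    and h: "ray_height e p > 0" "ray_height e q > 0"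
    and sl: "\<bar>ray_slope e p\<bar> \<le> \<eta>" "\<bar>ray_slope e q\<bar> \<le> \<eta>"
    and L: "\<bar>fst p \<bullet> e - fst q \<bullet> e\<bar> \<le> L * \<bar>fst p \<bullet> rot_minus_half_pi e - fst q \<bullet> rot_minus_half_pi e\<bar>"
    and \<eta>L: "\<eta> * L \<le> 1 / 2"
    and r: "fst p \<bullet> e < r" "r \<le> fst p \<bullet> e + ray_height e p / 2"
      "fst q \<bullet> e < r" "r \<le> fst q \<bullet> e + ray_height e q / 2"
  shows "\<bar>fst p \<bullet> rot_minus_half_pi e - fst q \<bullet> rot_minus_half_pi e\<bar> \<le> 4 * \<bar>ray_offset e r p - ray_offset e r q\<bar>"
proof -
  have *: "fst q \<bullet> rot_minus_half_pi e - fst p \<bullet> rot_minus_half_pi e \<le> 4 * (ray_offset e r q - ray_offset e r p)"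
    if lt: "fst p \<bullet> rot_minus_half_pi e < fst q \<bullet> rot_minus_half_pi e"
      and mono: "dist (fst p) (snd p) + dist (fst q) (snd q) \<le> dist (fst p) (snd q) + dist (fst q) (snd p)"
      and h: "ray_height e p > 0" "ray_height e q > 0"
      and sl: "\<bar>ray_slope e p\<bar> \<le> \<eta>" "\<bar>ray_slope e q\<bar> \<le> \<eta>"
      and L: "\<bar>fst p \<bullet> e - fst q \<bullet> e\<bar> \<le> L * (fst q \<bullet> rot_minus_half_pi e - fst p \<bullet> rot_minus_half_pi e)"
      and r: "fst p \<bullet> e < r" "r \<le> fst p \<bullet> e + ray_height e p / 2"
        "fst q \<bullet> e < r" "r \<le> fst q \<bullet> e + ray_height e q / 2" for p q
  proof -
    define D where "D = fst q \<bullet> rot_minus_half_pi e - fst p \<bullet> rot_minus_half_pi e"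
    have D: "D > 0" using lt by (simp add: D_def)
    define k where "k = ray_slope e q - ray_slope e p"
    define G where "G t = ray_offset e t q - ray_offset e t p" for t
    have G: "G t' - G t = k * (t' - t)" for t t'
      by (simp add: G_def k_def ray_offset_def algebra_simps)
    define lo where "lo = max (fst p \<bullet> e) (fst q \<bullet> e)"
    define hi where "hi = min (fst p \<bullet> e + ray_height e p) (fst q \<bullet> e + ray_height e q)"
    have lohi: "lo < r" "r < hi" using r h by (auto simp: lo_def hi_def)
    have \<eta>: "\<eta> \<ge> 0" using sl by linarith
    have \<eta>b: "\<eta> * \<bar>fst p \<bullet> e - fst q \<bullet> e\<bar> \<le> D / 2"
    proof -
      have "\<eta> * \<bar>fst p \<bullet> e - fst q \<bullet> e\<bar> \<le> \<eta> * (L * D)" using L \<eta> by (auto simp: D_def intro: mult_left_mono)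
      also have "\<dots> = (\<eta> * L) * D" by simp
      also have "\<dots> \<le> 1 / 2 * D" using \<eta>L D by (intro mult_right_mono) auto
      finally show ?thesis by simp
    qed
    \<comment> \<open>Between the two starting heights a slope of at most \<open>\<eta>\<close> acts
      over a height of at most \<open>L * D\<close>, which costs at most \<open>D / 2\<close>
      because \<open>\<eta> * L \<le> 1 / 2\<close>.\<close>
    have Glo: "G lo \<ge> D / 2"
    proof (cases "fst p \<bullet> e \<le> fst q \<bullet> e")
      case True
      have "ray_slope e p * (lo - fst p \<bullet> e) \<le> \<eta> * \<bar>fst p \<bullet> e - fst q \<bullet> e\<bar>"
        using True sl by (auto simp: lo_def intro: mult_right_mono)
      then show ?thesis using \<eta>b True by (simp add: G_def ray_offset_def D_def lo_def)
    next
      case False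
      have "- ray_slope e q * (lo - fst q \<bullet> e) \<le> \<eta> * \<bar>fst p \<bullet> e - fst q \<bullet> e\<bar>"
        using False sl by (intro mult_mono) (auto simp: lo_def)
      then show ?thesis using \<eta>b False by (simp add: G_def ray_offset_def D_def lo_def)
    qed
    \<comment> \<open>A negative value would put a zero \<open>t\<close> of the affine gap strictly
      inside both rays. Crossing rays are collinear and have equal slopes, whereas the gap is not
      constant.\<close>
    have Ghi: "G hi \<ge> 0"
    proof (rule ccontr)
      assume neg: "\<not> G hi \<ge> 0"
      have k: "k \<noteq> 0" using G[of hi lo] neg Glo D by auto
      define t where "t = lo - G lo / k"
      have Gt: "G t = 0" using G[of t lo] k by (simp add: t_def)
      have kneg: "k < 0"
      proof -
        have "k * (hi - lo) < 0" using G[of hi lo] neg Glo D by linarith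
        then show ?thesis using lohi by (simp add: mult_less_0_iff)
      qed
      have "k * (t - lo) < 0" using G[of t lo] Gt Glo D by linarith
      then have t1: "lo < t" using kneg by (simp add: mult_less_0_iff)
      have "k * (hi - t) < 0" using G[of hi t] Gt neg by linarith
      then have t2: "t < hi" using kneg by (simp add: mult_less_0_iff)
      define z where "z = t *\<^sub>R e + ray_offset e t p *\<^sub>R rot_minus_half_pi e"
      have zp: "z = seg p ((t - fst p \<bullet> e) / ray_height e p)" unfolding z_def using e h by (intro seg_ray) auto
      have "ray_offset e t p = ray_offset e t q" using Gt by (simp add: G_def)
      then have zq: "z = seg q ((t - fst q \<bullet> e) / ray_height e q)" unfolding z_def using e h by (simp add: seg_ray)
      have ne: "fst p \<noteq> snd p" "fst q \<noteq> snd q" using h by (auto simp: ray_height_def)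
      have "z \<in> open_segment (fst p) (snd p)"
        unfolding in_segment using zp t1 t2 h ne
        by (auto simp: seg_def lo_def hi_def intro!: exI[of _ "(t - fst p \<bullet> e) / ray_height e p"])
      moreover have "z \<in> open_segment (fst q) (snd q)"
        unfolding in_segment using zq t1 t2 h ne
        by (auto simp: seg_def lo_def hi_def intro!: exI[of _ "(t - fst q \<bullet> e) / ray_height e q"])
      ultimately obtain c d where cd: "fst q = z + c *\<^sub>R (snd p - fst p)" "snd q = z + d *\<^sub>R (snd p - fst p)"
        using crossing_collinear[OF mono] by blast
      then have "snd q - fst q = (d - c) *\<^sub>R (snd p - fst p)" by (simp add: algebra_simps)
      then have "ray_slope e q = ray_slope e p"
        using h by (auto simp: ray_slope_def ray_height_def inner_scaleR_left)
      then show False using k by (simp add: k_def)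
    qed
    have half: "r - lo \<le> hi - r" using r by (auto simp: lo_def hi_def)
    have "D / 4 \<le> G r"
    proof (cases "k \<ge> 0")
      case True
      then have "k * (r - lo) \<ge> 0" using lohi by simp
      then show ?thesis using G[of r lo] Glo D by linarith
    next
      case False
      then have "- k * (r - lo) \<le> - k * (hi - r)" using half by (intro mult_left_mono) auto
      then show ?thesis using G[of r lo] G[of hi r] Glo Ghi D by (simp add: algebra_simps)
    qed
    then show ?thesis by (simp add: D_def G_def)
  qed
  consider "fst p \<bullet> rot_minus_half_pi e < fst q \<bullet> rot_minus_half_pi e"
    | "fst q \<bullet> rot_minus_half_pi e < fst p \<bullet> rot_minus_half_pi e"
    | "fst p \<bullet> rot_minus_half_pi e = fst q \<bullet> rot_minus_half_pi e" by linarith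
  then show ?thesis
  proof cases
    case 1
    have "fst q \<bullet> rot_minus_half_pi e - fst p \<bullet> rot_minus_half_pi e \<le> 4 * (ray_offset e r q - ray_offset e r p)"
      using 1 L by (intro *[OF 1 mono h sl _ r]) auto
    moreover have "ray_offset e r q - ray_offset e r p \<le> \<bar>ray_offset e r p - ray_offset e r q\<bar>" by simp
    moreover have "\<bar>fst p \<bullet> rot_minus_half_pi e - fst q \<bullet> rot_minus_half_pi e\<bar>
        = fst q \<bullet> rot_minus_half_pi e - fst p \<bullet> rot_minus_half_pi e" using 1 by simp
    ultimately show ?thesis by simp
  next
    case 2
    have "fst p \<bullet> rot_minus_half_pi e - fst q \<bullet> rot_minus_half_pi e \<le> 4 * (ray_offset e r p - ray_offset e r q)"
      using 2 L mono by (intro *[OF 2 _ h(2,1) sl(2,1) _ r(3,4,1,2)]) (auto simp: abs_minus_commute)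
    moreover have "ray_offset e r p - ray_offset e r q \<le> \<bar>ray_offset e r p - ray_offset e r q\<bar>" by simp
    moreover have "\<bar>fst p \<bullet> rot_minus_half_pi e - fst q \<bullet> rot_minus_half_pi e\<bar>
        = fst p \<bullet> rot_minus_half_pi e - fst q \<bullet> rot_minus_half_pi e" using 2 by simp
    ultimately show ?thesis by simp
  qed auto
qed


lemma ray_measurable [measurable]:
  "ray_height e \<in> borel_measurable borel" "ray_slope e \<in> borel_measurable borel" "ray_offset e r \<in> borel_measurable borel"
proof -
  show 1 [measurable]: "ray_height e \<in> borel_measurable borel"
    unfolding ray_height_def by (intro borel_measurable_continuous_onI continuous_intros)
  have [measurable]: "(\<lambda>z::plane \<times> plane. (snd z - fst z) \<bullet> rot_minus_half_pi e) \<in> borel_measurable borel"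
    "(\<lambda>z::plane \<times> plane. fst z \<bullet> rot_minus_half_pi e) \<in> borel_measurable borel"
    "(\<lambda>z::plane \<times> plane. fst z \<bullet> e) \<in> borel_measurable borel"
    by (intro borel_measurable_continuous_onI continuous_intros)+
  show 2 [measurable]: "ray_slope e \<in> borel_measurable borel" unfolding ray_slope_def by measurable
  show "ray_offset e r \<in> borel_measurable borel" unfolding ray_offset_def by measurable
qed

text \<open>Near the starting points of these rays the boundary of \<open>S\<close> is a graph with slope at most \<open>1 / a\<close> over the
  axis orthogonal to \<open>e\<close> (\<open>s\<close> tells on which side of it \<open>S\<close> lies), while the rays deviate from \<open>e\<close> by a
  slope of at most \<open>a / 2\<close>, hence stay transversal to it.\<close>

definition ray_piece :: "plane set \<Rightarrow> plane \<Rightarrow> real \<Rightarrow> real \<Rightarrow> real \<Rightarrow> (plane \<times> plane) set" where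
  "ray_piece S e s a l = {z. fst z \<in> closure S \<and> (\<exists>n. outward_unit_normal S (fst z) n \<and> s * (n \<bullet> e) \<ge> a) \<and>
     ray_height e z \<ge> l \<and> \<bar>(snd z - fst z) \<bullet> rot_minus_half_pi e\<bar> \<le> a / 2 * ray_height e z}"

lemma closed_ray_piece: "closed (ray_piece S e s a l)"
proof -
  have "ray_piece S e s a l = fst -` closure S \<inter> fst -` {x. \<exists>n. outward_unit_normal S x n \<and> s * (n \<bullet> e) \<ge> a} \<inter>
     {z. ray_height e z \<ge> l} \<inter> {z. \<bar>(snd z - fst z) \<bullet> rot_minus_half_pi e\<bar> \<le> a / 2 * ray_height e z}"
    by (auto simp: ray_piece_def)
  also have "closed \<dots>"
    unfolding ray_height_def
    by (intro closed_Int closed_vimage_fst closed_closure closed_normal_points closed_Collect_le continuous_intros)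
  finally show ?thesis .
qed

lemma ray_piece_slope:
  assumes "z \<in> ray_piece S e s a l" "l > 0"
  shows "ray_height e z > 0" "\<bar>ray_slope e z\<bar> \<le> a / 2"
proof -
  show h: "ray_height e z > 0" using assms by (auto simp: ray_piece_def)
  have "\<bar>(snd z - fst z) \<bullet> rot_minus_half_pi e\<bar> \<le> a / 2 * ray_height e z" using assms by (auto simp: ray_piece_def)
  then show "\<bar>ray_slope e z\<bar> \<le> a / 2" using h by (simp add: ray_slope_def pos_divide_le_eq)
qed

text \<open>Each starting point lies on the inner side of the support line at the other one. Both
  normals have component at least \<open>a\<close> along \<open>s *\<^sub>R e\<close>, so the
  support inequality at the point that is lower in this direction bounds the height difference by
  the transverse distance.\<close>

lemma ray_piece_graph:
  assumes e: "norm e = 1" and s: "s = 1 \<or> s = -1" and a: "a > 0"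
    and p: "p \<in> ray_piece S e s a l" and q: "q \<in> ray_piece S e s a l"
  shows "\<bar>fst p \<bullet> e - fst q \<bullet> e\<bar> \<le> (1 / a) * \<bar>fst p \<bullet> rot_minus_half_pi e - fst q \<bullet> rot_minus_half_pi e\<bar>"
proof -
  define dr where "dr = fst q \<bullet> e - fst p \<bullet> e"
  define dx where "dx = fst q \<bullet> rot_minus_half_pi e - fst p \<bullet> rot_minus_half_pi e"
  obtain n where n: "outward_unit_normal S (fst p) n" "s * (n \<bullet> e) \<ge> a" using p by (auto simp: ray_piece_def)
  obtain m where m: "outward_unit_normal S (fst q) m" "s * (m \<bullet> e) \<ge> a" using q by (auto simp: ray_piece_def)
  have b: "\<bar>u \<bullet> rot_minus_half_pi e\<bar> \<le> 1" if "norm u = 1" for u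
    using Cauchy_Schwarz_ineq2[of u "rot_minus_half_pi e"] that e by simp
  have 1: "dr * (n \<bullet> e) \<le> \<bar>dx\<bar>"
  proof -
    have "(fst q - fst p) \<bullet> n \<le> 0" using n q by (intro normal_le_closure) (auto simp: ray_piece_def)
    then have "dr * (n \<bullet> e) + dx * (n \<bullet> rot_minus_half_pi e) \<le> 0"
      unfolding rot_frame_inner[OF e, of "fst q - fst p" n] by (simp add: dr_def dx_def inner_diff_left)
    moreover have "\<bar>dx * (n \<bullet> rot_minus_half_pi e)\<bar> \<le> \<bar>dx\<bar> * 1"
      unfolding abs_mult using b[of n] n by (intro mult_left_mono) (auto simp: outward_unit_normal_def)
    ultimately show ?thesis by linarith
  qed
  have 2: "- dr * (m \<bullet> e) \<le> \<bar>dx\<bar>"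
  proof -
    have "(fst p - fst q) \<bullet> m \<le> 0" using m p by (intro normal_le_closure) (auto simp: ray_piece_def)
    then have "- dr * (m \<bullet> e) - dx * (m \<bullet> rot_minus_half_pi e) \<le> 0"
      unfolding rot_frame_inner[OF e, of "fst p - fst q" m] by (simp add: dr_def dx_def inner_diff_left algebra_simps)
    moreover have "\<bar>dx * (m \<bullet> rot_minus_half_pi e)\<bar> \<le> \<bar>dx\<bar> * 1"
      unfolding abs_mult using b[of m] m by (intro mult_left_mono) (auto simp: outward_unit_normal_def)
    ultimately show ?thesis by linarith
  qed
  have "a * \<bar>dr\<bar> \<le> \<bar>dx\<bar>"
  proof (cases "s * dr \<ge> 0")
    case True
    show ?thesis
    proof (cases "s = 1")
      case s1: True
      then have "a * dr \<le> (n \<bullet> e) * dr" using True n by (intro mult_right_mono) auto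
      then show ?thesis using 1 True s1 by (simp add: mult.commute)
    next
      case False
      then have s1: "s = -1" using s by auto
      have "a * (- dr) \<le> (- (n \<bullet> e)) * (- dr)" using True n s1 by (intro mult_right_mono) auto
      then show ?thesis using 1 True s1 by (simp add: mult.commute abs_if split: if_splits)
    qed
  next
    case False
    show ?thesis
    proof (cases "s = 1")
      case s1: True
      then have "a * (- dr) \<le> (m \<bullet> e) * (- dr)" using False m by (intro mult_right_mono) auto
      moreover have "a * \<bar>dr\<bar> = a * (- dr)" using False s1 by simp
      moreover have "(m \<bullet> e) * (- dr) = - dr * (m \<bullet> e)" by simp
      ultimately show ?thesis using 2 by linarith
    next
      case s2: False
      then have s1: "s = -1" using s by auto
      then have "a * dr \<le> (- (m \<bullet> e)) * dr" using False m by (intro mult_right_mono) auto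
      then show ?thesis using 2 False s1 by (simp add: mult.commute)
    qed
  qed
  then have "\<bar>dr\<bar> \<le> (1 / a) * \<bar>dx\<bar>" using a by (simp add: field_simps)
  then show ?thesis by (simp add: dr_def dx_def abs_minus_commute)
qed

text \<open>The slopes of the rays are at most \<open>a / 2\<close> and the graph constant is
  \<open>1 / a\<close>; their product is exactly the \<open>1 / 2\<close> that
  \<open>noncrossing_gap\<close> allows. The factor 8 is the 4 from there times 2 for adding the two
  coordinates, both at most \<open>dx / a\<close> because \<open>a \<le> 1\<close>.\<close>

lemma ray_piece_expanding:
  assumes e: "norm e = 1" and s: "s = 1 \<or> s = -1" and a: "a > 0" "a \<le> 1" and l: "l > 0"
    and p: "p \<in> ray_piece S e s a l" and q: "q \<in> ray_piece S e s a l"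
    and mono: "dist (fst p) (snd p) + dist (fst q) (snd q) \<le> dist (fst p) (snd q) + dist (fst q) (snd p)"
    and r: "fst p \<bullet> e < r" "r \<le> fst p \<bullet> e + ray_height e p / 2"
      "fst q \<bullet> e < r" "r \<le> fst q \<bullet> e + ray_height e q / 2"
  shows "dist (fst p) (fst q) \<le> (8 / a) * \<bar>ray_offset e r p - ray_offset e r q\<bar>"
proof -
  define dr where "dr = \<bar>fst p \<bullet> e - fst q \<bullet> e\<bar>"
  define dx where "dx = \<bar>fst p \<bullet> rot_minus_half_pi e - fst q \<bullet> rot_minus_half_pi e\<bar>"
  have 1: "dr \<le> (1 / a) * dx" unfolding dr_def dx_def by (rule ray_piece_graph[OF e s a(1) p q])
  have 2: "dx \<le> 4 * \<bar>ray_offset e r p - ray_offset e r q\<bar>"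
    unfolding dx_def
    by (rule noncrossing_gap[OF e mono ray_piece_slope(1)[OF p l] ray_piece_slope(1)[OF q l]
          ray_piece_slope(2)[OF p l] ray_piece_slope(2)[OF q l] ray_piece_graph[OF e s a(1) p q] _ r])
       (use a in simp)
  have dx0: "dx \<ge> 0" by (simp add: dx_def)
  have "(dist (fst p) (fst q))\<^sup>2 = dr\<^sup>2 + dx\<^sup>2"
    using rot_frame_norm[OF e, of "fst p - fst q"] by (simp add: dist_norm dr_def dx_def inner_diff_left)
  also have "\<dots> \<le> (dr + dx)\<^sup>2" using dx0 by (simp add: power2_sum dr_def)
  finally have "dist (fst p) (fst q) \<le> dr + dx" by (rule power2_le_imp_le) (simp add: dr_def dx_def)
  also have "\<dots> \<le> (1 / a) * dx + (1 / a) * dx"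
    using 1 a dx0 mult_right_mono[of 1 "1 / a" dx] by (intro add_mono) auto
  also have "\<dots> = (2 / a) * dx" by simp
  also have "\<dots> \<le> (2 / a) * (4 * \<bar>ray_offset e r p - ray_offset e r q\<bar>)"
    using 2 a by (intro mult_left_mono) auto
  finally show ?thesis by simp
qed

text \<open>Only the first half of a ray is used: two rays that do not cross may meet at their ends, where the
  starting point is no longer a Lipschitz function of the slice.\<close>

definition visible_slab :: "plane \<Rightarrow> real \<Rightarrow> (plane \<times> plane) set" where
  "visible_slab e r = {z. fst z \<bullet> e < r \<and> r \<le> fst z \<bullet> e + ray_height e z / 2}"

lemma fst_inner_measurable [measurable]: "(\<lambda>z::plane \<times> plane. fst z \<bullet> e) \<in> borel_measurable borel"
  by (intro borel_measurable_continuous_onI continuous_intros)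

lemma visible_slab_sets [measurable]: "visible_slab e r \<in> sets borel"
  unfolding visible_slab_def by measurable

text \<open>On one slice the starting point is a Lipschitz function of the offset, so the starting
  points of rays with offset in an interval form a set of length at most \<open>8 / a\<close> times
  that of the interval, and the marginal bound applies. Comparison on half-open intervals extends to
  Borel sets.\<close>

lemma slice_measure_le:
  fixes \<gamma>' :: "(plane \<times> plane) measure"
  assumes sets [measurable_cong]: "sets \<gamma>' = sets borel"
    and marg: "\<And>F. F \<in> sets borel \<Longrightarrow> emeasure \<gamma>' (F \<times> UNIV) \<le> hausdorff1_outer F"
    and e: "norm e = 1" and s: "s = 1 \<or> s = -1" and a: "a > 0" "a \<le> 1" and l: "l > 0"
    and Q [measurable]: "Q \<in> sets borel" and sub: "Q \<subseteq> ray_piece S e s a l" and bdd: "bounded Q"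
    and mono: "\<And>p q. p \<in> Q \<Longrightarrow> q \<in> Q \<Longrightarrow> dist (fst p) (snd p) + dist (fst q) (snd q) \<le> dist (fst p) (snd q) + dist (fst q) (snd p)"
    and B [measurable]: "B \<in> sets borel"
  shows "emeasure \<gamma>' (Q \<inter> visible_slab e r \<inter> ray_offset e r -` B) \<le> ennreal (8 / a) * emeasure lborel B"
proof -
  define R where "R = Q \<inter> visible_slab e r"
  have R [measurable]: "R \<in> sets borel" by (simp add: R_def)
  define \<kappa> where "\<kappa> = distr (density \<gamma>' (indicator R)) borel (ray_offset e r)"
  have \<kappa>: "emeasure \<kappa> A = emeasure \<gamma>' (R \<inter> ray_offset e r -` A)" if [measurable]: "A \<in> sets borel" for A
  proof -
    have "emeasure \<kappa> A = (\<integral>\<^sup>+z. indicator A z \<partial>\<kappa>)" by (simp add: \<kappa>_def)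
    also have "\<dots> = (\<integral>\<^sup>+z. indicator A (ray_offset e r z) \<partial>density \<gamma>' (indicator R))"
      unfolding \<kappa>_def by (rule nn_integral_distr) auto
    also have "\<dots> = (\<integral>\<^sup>+z. indicator R z * indicator A (ray_offset e r z) \<partial>\<gamma>')"
      by (rule nn_integral_density) auto
    also have "\<dots> = (\<integral>\<^sup>+z. indicator (R \<inter> ray_offset e r -` A) z \<partial>\<gamma>')"
      by (intro nn_integral_cong) (auto simp: indicator_def)
    also have "\<dots> = emeasure \<gamma>' (R \<inter> ray_offset e r -` A)"
    proof (rule nn_integral_indicator)
      have "ray_offset e r -` A \<inter> space borel \<in> sets borel" by (rule measurable_sets[of _ _ borel]) auto
      then show "R \<inter> ray_offset e r -` A \<in> sets \<gamma>'" by (simp add: sets sets.Int)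
    qed
    finally show ?thesis .
  qed
  have ivl: "emeasure \<kappa> {b<..c} \<le> ennreal (8 / a * (c - b))" if bc: "b \<le> c" for b c
  proof -
    define R' where "R' = R \<inter> ray_offset e r -` {b<..c}"
    \<comment> \<open>Several rays may leave the same point; one is chosen, as only the set of
      starting points is measured.\<close>
    define g where "g x = (SOME z. z \<in> R' \<and> fst z = x)" for x
    have g: "g x \<in> R'" "fst (g x) = x" if "x \<in> fst ` R'" for x
    proof -
      have "\<exists>z. z \<in> R' \<and> fst z = x" using that by (elim imageE) auto
      from someI_ex[OF this] show "g x \<in> R'" "fst (g x) = x" unfolding g_def by blast+
    qed
    have "hausdorff1_outer (fst ` R') \<le> ennreal (8 / a * (c - b))"
    proof (rule hausdorff1_outer_le_expanding[where q="\<lambda>x. ray_offset e r (g x)"])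
      show "(\<lambda>x. ray_offset e r (g x)) ` fst ` R' \<subseteq> {b..c}"
        using g(1) by (force simp: R'_def)
      fix x y assume xy: "x \<in> fst ` R'" "y \<in> fst ` R'"
      have gx: "g x \<in> Q" "g x \<in> visible_slab e r" and gy: "g y \<in> Q" "g y \<in> visible_slab e r"
        using g(1)[OF xy(1)] g(1)[OF xy(2)] by (auto simp: R'_def R_def)
      have "dist (fst (g x)) (fst (g y)) \<le> 8 / a * \<bar>ray_offset e r (g x) - ray_offset e r (g y)\<bar>"
        by (rule ray_piece_expanding[OF e s a l])
           (use gx gy sub mono in \<open>auto simp: visible_slab_def\<close>)
      then show "dist x y \<le> 8 / a * \<bar>ray_offset e r (g x) - ray_offset e r (g y)\<bar>"
        using g(2)[OF xy(1)] g(2)[OF xy(2)] by simp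
    qed (use a bc in auto)
    \<comment> \<open>The set of starting points is a projection and need not be Borel; the marginal
      bound is applied to a Borel hull of the same length.\<close>
    moreover obtain F where F: "F \<in> sets borel" "fst ` R' \<subseteq> F" "hausdorff1_outer F = hausdorff1_outer (fst ` R')"
      by (rule hausdorff1_outer_borel_hull[of "fst ` R'"])
    moreover have "emeasure \<kappa> {b<..c} \<le> emeasure \<gamma>' (F \<times> UNIV)"
    proof -
      have "emeasure \<kappa> {b<..c} = emeasure \<gamma>' R'" unfolding R'_def by (rule \<kappa>) simp
      also have "\<dots> \<le> emeasure \<gamma>' (F \<times> UNIV)"
      proof (rule emeasure_mono)
        show "R' \<subseteq> F \<times> UNIV" using F(2) by (auto simp: image_subset_iff)
        show "F \<times> UNIV \<in> sets \<gamma>'" unfolding sets borel_prod[symmetric] using F(1) by (intro pair_measureI) auto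
      qed
      finally show ?thesis .
    qed
    ultimately show ?thesis using marg[OF F(1)] by (metis order_trans)
  qed
  obtain K where K: "\<And>z. z \<in> Q \<Longrightarrow> norm z \<le> K" "K > 0" using bdd by (metis bounded_pos)
  \<comment> \<open>At the slice the offset is a coordinate of a point on a bounded ray. This
    confines both measures to a bounded interval and makes them finite.\<close>
  have off: "\<bar>ray_offset e r z\<bar> < K + 1" if z: "z \<in> R" for z
  proof -
    have zQ: "z \<in> Q" and h: "ray_height e z > 0" and r: "fst z \<bullet> e < r" "r \<le> fst z \<bullet> e + ray_height e z / 2"
      using z sub ray_piece_slope(1)[OF _ l] by (auto simp: R_def visible_slab_def)
    define t where "t = (r - fst z \<bullet> e) / ray_height e z"
    have t: "0 \<le> t" "t \<le> 1" using r h by (auto simp: t_def field_simps)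
    have nz: "norm (fst z) \<le> K" "norm (snd z) \<le> K"
      using K(1)[OF zQ] norm_fst_le[of "fst z" "snd z"] norm_snd_le[of "snd z" "fst z"] by auto
    have "ray_offset e r z = (r *\<^sub>R e + ray_offset e r z *\<^sub>R rot_minus_half_pi e) \<bullet> rot_minus_half_pi e"
      using e by (simp add: inner_add_left)
    also have "\<dots> = seg z t \<bullet> rot_minus_half_pi e" using seg_ray[OF e, of z r] h by (simp add: t_def)
    finally have "\<bar>ray_offset e r z\<bar> \<le> norm (seg z t)"
      using Cauchy_Schwarz_ineq2[of "seg z t" "rot_minus_half_pi e"] e by simp
    also have "\<dots> \<le> (1 - t) * norm (fst z) + t * norm (snd z)"
      unfolding seg_def using t by (intro norm_triangle_le) (auto simp: )
    also have "\<dots> \<le> (1 - t) * K + t * K" using nz t by (intro add_mono mult_left_mono) auto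
    finally show ?thesis by (simp add: algebra_simps)
  qed
  define N where "N = density lborel (\<lambda>x. ennreal (8 / a) * indicator {-(K+1)..K+1} x)"
  have N: "emeasure N A = ennreal (8 / a) * emeasure lborel ({-(K+1)..K+1} \<inter> A)" if [measurable]: "A \<in> sets borel" for A
  proof -
    have "emeasure N A = (\<integral>\<^sup>+x. (ennreal (8 / a) * indicator {-(K+1)..K+1} x) * indicator A x \<partial>lborel)"
      unfolding N_def by (rule emeasure_density) auto
    also have "\<dots> = (\<integral>\<^sup>+x. ennreal (8 / a) * indicator ({-(K+1)..K+1} \<inter> A) x \<partial>lborel)"
      by (intro nn_integral_cong) (auto simp: indicator_def)
    also have "\<dots> = ennreal (8 / a) * emeasure lborel ({-(K+1)..K+1} \<inter> A)"
      by (subst nn_integral_cmult) auto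
    finally show ?thesis .
  qed
  have ivl': "emeasure \<kappa> {b<..c} \<le> emeasure N {b<..c}" if "b < c" for b c
  proof -
    define b' where "b' = max b (-(K+1))"
    define c' where "c' = min c (K+1)"
    have eq: "R \<inter> ray_offset e r -` {b<..c} = R \<inter> ray_offset e r -` {b'<..c'}"
      using off by (force simp: b'_def c'_def)
    show ?thesis
    proof (cases "b' \<le> c'")
      case True
      have "emeasure \<kappa> {b<..c} = emeasure \<kappa> {b'<..c'}" using eq by (simp add: \<kappa>)
      also have "\<dots> \<le> ennreal (8 / a * (c' - b'))" by (rule ivl[OF True])
      also have "\<dots> = ennreal (8 / a) * ennreal (c' - b')" using a by (intro ennreal_mult') simp
      also have "ennreal (c' - b') = emeasure lborel {b'<..c'}" using True by simp
      also have "ennreal (8 / a) * emeasure lborel {b'<..c'} \<le> ennreal (8 / a) * emeasure lborel ({-(K+1)..K+1} \<inter> {b<..c})"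
        by (intro mult_left_mono emeasure_mono) (auto simp: b'_def c'_def)
      finally show ?thesis by (simp add: N)
    next
      case False
      then have "emeasure \<kappa> {b<..c} = 0" using eq by (simp add: \<kappa>)
      then show ?thesis by simp
    qed
  qed
  have fin: "finite_measure \<kappa>" "finite_measure N"
  proof -
    have "R \<inter> ray_offset e r -` UNIV = R \<inter> ray_offset e r -` {-(K+1)<..K+1}" using off by force
    then have "emeasure \<kappa> UNIV = emeasure \<kappa> {-(K+1)<..K+1}" by (simp add: \<kappa>)
    also have "\<dots> \<le> ennreal (8 / a * ((K+1) - (-(K+1))))" using K(2) by (intro ivl) simp
    finally have "emeasure \<kappa> UNIV < \<infinity>" by (simp add: order_le_less_trans)
    then show "finite_measure \<kappa>" by (intro finite_measureI) (auto simp: \<kappa>_def)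
    have "emeasure N UNIV \<noteq> \<infinity>"
      using K(2) by (simp add: N emeasure_lborel_Icc_eq ennreal_mult_eq_top_iff)
    then show "finite_measure N" by (intro finite_measureI) (simp add: N_def)
  qed
  have "emeasure \<kappa> B \<le> emeasure N B"
    by (rule emeasure_le_if_Ioc_le[OF fin _ _ ivl' B]) (auto simp: \<kappa>_def N_def)
  also have "\<dots> \<le> ennreal (8 / a) * emeasure lborel B"
    unfolding N[OF B] by (intro mult_left_mono emeasure_mono) auto
  finally show ?thesis using \<kappa>[OF B] by (simp add: R_def)
qed

section \<open>Mass on the first halves of the rays of one piece\<close>

lemma seg_measurable [measurable]:
  "(\<lambda>(z, t). seg z t) \<in> borel_measurable (borel \<Otimes>\<^sub>M borel)" "(\<lambda>(t, z). seg z t) \<in> borel_measurable (borel \<Otimes>\<^sub>M borel)"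
proof -
  have "continuous_on UNIV (\<lambda>p::(plane \<times> plane) \<times> real. seg (fst p) (snd p))"
    "continuous_on UNIV (\<lambda>p::real \<times> (plane \<times> plane). seg (snd p) (fst p))"
    unfolding seg_def by (intro continuous_intros)+
  then show "(\<lambda>(z, t). seg z t) \<in> borel_measurable (borel \<Otimes>\<^sub>M borel)" "(\<lambda>(t, z). seg z t) \<in> borel_measurable (borel \<Otimes>\<^sub>M borel)"
    unfolding case_prod_beta borel_prod by (auto intro: borel_measurable_continuous_onI)
qed

text \<open>The start is left out and the midpoint kept: every point counted is interior to a
  nondegenerate ray, as \<open>ray_multiplicity\<close> requires, and the range agrees with
  \<open>visible_slab\<close>.\<close>

definition half_mass :: "plane set \<Rightarrow> plane \<times> plane \<Rightarrow> ennreal" where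
  "half_mass B z = (\<integral>\<^sup>+t. indicator {0<..1/2} t * indicator B (seg z t) \<partial>lborel)"

lemma half_mass_measurable [measurable]:
  assumes [measurable]: "B \<in> sets borel"
  shows "half_mass B \<in> borel_measurable borel"
  unfolding half_mass_def by measurable

text \<open>The substitution \<open>r = fst z \<bullet> e + t * ray_height e z\<close> replaces the
  ray parameter by the height along \<open>e\<close>.\<close>

lemma half_mass_slices:
  assumes e: "norm e = 1" and h: "ray_height e z > 0" and B [measurable]: "B \<in> sets borel"
  shows "half_mass B z = ennreal (1 / ray_height e z) *
    (\<integral>\<^sup>+r. indicator (visible_slab e r) z * indicator {s. r *\<^sub>R e + s *\<^sub>R rot_minus_half_pi e \<in> B} (ray_offset e r z) \<partial>lborel)"
proof -
  define d where "d = ray_height e z"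
  have d: "d > 0" using h by (simp add: d_def)
  define f where "f t = indicator {0<..1/2} t * (indicator B (seg z t) :: ennreal)" for t
  have [measurable]: "f \<in> borel_measurable borel" unfolding f_def by measurable
  have "half_mass B z = (\<integral>\<^sup>+t. f t \<partial>lborel)" by (simp add: half_mass_def f_def)
  also have "\<dots> = ennreal \<bar>1 / d\<bar> * (\<integral>\<^sup>+r. f (- (fst z \<bullet> e) / d + (1 / d) * r) \<partial>lborel)"
    using d by (intro nn_integral_real_affine) auto
  also have "(\<integral>\<^sup>+r. f (- (fst z \<bullet> e) / d + (1 / d) * r) \<partial>lborel) =
    (\<integral>\<^sup>+r. indicator (visible_slab e r) z * indicator {s. r *\<^sub>R e + s *\<^sub>R rot_minus_half_pi e \<in> B} (ray_offset e r z) \<partial>lborel)"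
  proof (intro nn_integral_cong)
    fix r
    have t: "- (fst z \<bullet> e) / d + (1 / d) * r = (r - fst z \<bullet> e) / d" using d by (simp add: field_simps)
    have "(r - fst z \<bullet> e) / d \<in> {0<..1/2} \<longleftrightarrow> z \<in> visible_slab e r"
      using d by (auto simp: visible_slab_def d_def[symmetric] field_simps)
    moreover have "seg z ((r - fst z \<bullet> e) / d) = r *\<^sub>R e + ray_offset e r z *\<^sub>R rot_minus_half_pi e"
      unfolding d_def using h by (intro seg_ray[OF e, symmetric]) simp
    ultimately show "f (- (fst z \<bullet> e) / d + (1 / d) * r) =
      indicator (visible_slab e r) z * indicator {s. r *\<^sub>R e + s *\<^sub>R rot_minus_half_pi e \<in> B} (ray_offset e r z)"
      unfolding f_def t by (simp add: indicator_def)
  qed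
  finally show ?thesis using d by (simp add: d_def)
qed

text \<open>Tonelli exchanges rays and slices. Passing from the ray parameter to the height costs
  \<open>1 / l\<close>, each slice costs \<open>8 / a\<close>, and the slices of \<open>B\<close>
  reassemble to its area.\<close>

lemma piece_mass_le:
  fixes \<gamma>' :: "(plane \<times> plane) measure"
  assumes sf: "sigma_finite_measure \<gamma>'" and sets [measurable_cong]: "sets \<gamma>' = sets borel"
    and marg: "\<And>F. F \<in> sets borel \<Longrightarrow> emeasure \<gamma>' (F \<times> UNIV) \<le> hausdorff1_outer F"
    and e: "norm e = 1" and s: "s = 1 \<or> s = -1" and a: "a > 0" "a \<le> 1" and l: "l > 0"
    and Q [measurable]: "Q \<in> sets borel" and sub: "Q \<subseteq> ray_piece S e s a l" and bdd: "bounded Q"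
    and mono: "\<And>p q. p \<in> Q \<Longrightarrow> q \<in> Q \<Longrightarrow> dist (fst p) (snd p) + dist (fst q) (snd q) \<le> dist (fst p) (snd q) + dist (fst q) (snd p)"
    and B [measurable]: "B \<in> sets borel"
  shows "(\<integral>\<^sup>+z. indicator Q z * half_mass B z \<partial>\<gamma>') \<le> ennreal (8 / (a * l)) * emeasure lborel B"
proof -
  interpret G: sigma_finite_measure \<gamma>' by fact
  interpret P: pair_sigma_finite \<gamma>' "lborel :: real measure" ..
  define J where "J r z = (indicator (visible_slab e r) z * indicator {s. r *\<^sub>R e + s *\<^sub>R rot_minus_half_pi e \<in> B} (ray_offset e r z) :: ennreal)" for r z
  have J [measurable]: "(\<lambda>(z, r). indicator Q z * J r z) \<in> borel_measurable (\<gamma>' \<Otimes>\<^sub>M lborel)"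
  proof -
    have [measurable]: "(\<lambda>p::(plane \<times> plane) \<times> real. fst (fst p) \<bullet> e) \<in> borel_measurable (borel \<Otimes>\<^sub>M borel)"
      "(\<lambda>p::(plane \<times> plane) \<times> real. fst (fst p) \<bullet> rot_minus_half_pi e) \<in> borel_measurable (borel \<Otimes>\<^sub>M borel)"
      unfolding borel_prod by (intro borel_measurable_continuous_onI continuous_intros)+
    have "(\<lambda>(z, r). indicator Q z * J r z) = (\<lambda>p. indicator Q (fst p) *
       (if fst (fst p) \<bullet> e < snd p \<and> snd p \<le> fst (fst p) \<bullet> e + ray_height e (fst p) / 2 then 1 else 0) *
       indicator B (snd p *\<^sub>R e + (fst (fst p) \<bullet> rot_minus_half_pi e + ray_slope e (fst p) * (snd p - fst (fst p) \<bullet> e)) *\<^sub>R rot_minus_half_pi e) :: ennreal)"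
      by (auto simp: J_def visible_slab_def indicator_def ray_offset_def fun_eq_iff)
    also have "\<dots> \<in> borel_measurable (borel \<Otimes>\<^sub>M borel)" by measurable
    finally show ?thesis by (simp cong: measurable_cong_sets)
  qed
  have "(\<integral>\<^sup>+z. indicator Q z * half_mass B z \<partial>\<gamma>') \<le> (\<integral>\<^sup>+z. ennreal (1 / l) * (\<integral>\<^sup>+r. indicator Q z * J r z \<partial>lborel) \<partial>\<gamma>')"
  proof (rule nn_integral_mono)
    fix z
    show "indicator Q z * half_mass B z \<le> ennreal (1 / l) * (\<integral>\<^sup>+r. indicator Q z * J r z \<partial>lborel)"
    proof (cases "z \<in> Q")
      case True
      then have h: "ray_height e z > 0" "ray_height e z \<ge> l"
        using subsetD[OF sub True] ray_piece_slope(1)[OF subsetD[OF sub True] l] unfolding ray_piece_def by blast+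
      have "half_mass B z = ennreal (1 / ray_height e z) * (\<integral>\<^sup>+r. J r z \<partial>lborel)"
        unfolding J_def by (rule half_mass_slices[OF e h(1) B])
      also have "\<dots> \<le> ennreal (1 / l) * (\<integral>\<^sup>+r. J r z \<partial>lborel)"
        using h l by (intro mult_right_mono ennreal_leI divide_left_mono) auto
      finally show ?thesis using True by simp
    qed simp
  qed
  also have "\<dots> = ennreal (1 / l) * (\<integral>\<^sup>+z. (\<integral>\<^sup>+r. indicator Q z * J r z \<partial>lborel) \<partial>\<gamma>')"
    by (rule nn_integral_cmult) measurable
  also have "(\<integral>\<^sup>+z. (\<integral>\<^sup>+r. indicator Q z * J r z \<partial>lborel) \<partial>\<gamma>') = (\<integral>\<^sup>+r. (\<integral>\<^sup>+z. indicator Q z * J r z \<partial>\<gamma>') \<partial>lborel)"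
    using P.Fubini'[OF J] by simp
  also have "\<dots> \<le> (\<integral>\<^sup>+r. ennreal (8 / a) * emeasure lborel {s. r *\<^sub>R e + s *\<^sub>R rot_minus_half_pi e \<in> B} \<partial>lborel)"
  proof (rule nn_integral_mono)
    fix r
    define B' where "B' = {s. r *\<^sub>R e + s *\<^sub>R rot_minus_half_pi e \<in> B}"
    have B' [measurable]: "B' \<in> sets borel"
    proof -
      have "(\<lambda>s::real. r *\<^sub>R e + s *\<^sub>R rot_minus_half_pi e) \<in> borel_measurable borel"
        by (intro borel_measurable_continuous_onI continuous_intros)
      from measurable_sets[OF this B] show ?thesis by (simp add: B'_def vimage_def)
    qed
    have "(\<integral>\<^sup>+z. indicator Q z * J r z \<partial>\<gamma>') = (\<integral>\<^sup>+z. indicator (Q \<inter> visible_slab e r \<inter> ray_offset e r -` B') z \<partial>\<gamma>')"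
      by (intro nn_integral_cong) (auto simp: J_def B'_def indicator_def)
    also have "\<dots> = emeasure \<gamma>' (Q \<inter> visible_slab e r \<inter> ray_offset e r -` B')"
    proof (rule nn_integral_indicator)
      have "ray_offset e r -` B' \<inter> space borel \<in> sets borel" by (rule measurable_sets[of _ _ borel]) auto
      then show "Q \<inter> visible_slab e r \<inter> ray_offset e r -` B' \<in> sets \<gamma>'" by (auto simp: sets)
    qed
    also have "\<dots> \<le> ennreal (8 / a) * emeasure lborel B'"
      by (rule slice_measure_le[OF sets marg e s a l Q sub bdd mono B'])
    finally show "(\<integral>\<^sup>+z. indicator Q z * J r z \<partial>\<gamma>') \<le> ennreal (8 / a) * emeasure lborel {s. r *\<^sub>R e + s *\<^sub>R rot_minus_half_pi e \<in> B}"
      by (simp add: B'_def)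
  qed
  also have "\<dots> = ennreal (8 / a) * emeasure lborel B"
  proof (subst nn_integral_cmult)
    have "(\<lambda>p::real \<times> real. fst p *\<^sub>R e + snd p *\<^sub>R rot_minus_half_pi e) \<in> borel_measurable (borel \<Otimes>\<^sub>M borel)"
      unfolding borel_prod by (intro borel_measurable_continuous_onI continuous_intros)
    then have [measurable]: "(\<lambda>p::real \<times> real. fst p *\<^sub>R e + snd p *\<^sub>R rot_minus_half_pi e) \<in> borel_measurable (lborel \<Otimes>\<^sub>M lborel)"
      by (simp cong: measurable_cong_sets)
    have A: "{p \<in> space (lborel \<Otimes>\<^sub>M lborel). fst p *\<^sub>R e + snd p *\<^sub>R rot_minus_half_pi e \<in> B} \<in> sets (lborel \<Otimes>\<^sub>M (lborel :: real measure))"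
      by measurable
    from lborel.measurable_emeasure_Pair[OF A]
    show "(\<lambda>r. emeasure lborel {s. r *\<^sub>R e + s *\<^sub>R rot_minus_half_pi e \<in> B}) \<in> borel_measurable lborel"
      by (simp add: vimage_def space_pair_measure)
    show "ennreal (8 / a) * (\<integral>\<^sup>+r. emeasure lborel {s. r *\<^sub>R e + s *\<^sub>R rot_minus_half_pi e \<in> B} \<partial>lborel) = ennreal (8 / a) * emeasure lborel B"
      unfolding emeasure_plane_slices[OF e B] ..
  qed
  finally have "(\<integral>\<^sup>+z. indicator Q z * half_mass B z \<partial>\<gamma>') \<le> ennreal (1 / l) * (ennreal (8 / a) * emeasure lborel B)"
    by (simp add: mult_left_mono)
  also have "\<dots> = ennreal (8 / (a * l)) * emeasure lborel B"
  proof -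
    have "ennreal (1 / l) * ennreal (8 / a) = ennreal (1 / l * (8 / a))" using l by (intro ennreal_mult'[symmetric]) simp
    then have "ennreal (1 / l) * (ennreal (8 / a) * X) = ennreal (1 / l * (8 / a)) * X" for X
      by (simp only: mult.assoc[symmetric])
    moreover have "1 / l * (8 / a) = 8 / (a * l)" by simp
    ultimately show ?thesis by (simp only:)
  qed
  finally show ?thesis .
qed

section \<open>Multiplicity of overlapping rays\<close>

text \<open>Of three frontier points on a line the middle one would be interior by strict
  convexity.\<close>

lemma strictly_convex_line_frontier:
  assumes S: "strictly_convex S" and v: "v \<noteq> 0"
  shows "finite {c. z + c *\<^sub>R v \<in> frontier S}" "card {c. z + c *\<^sub>R v \<in> frontier S} \<le> 2"
proof -
  define C where "C = {c. z + c *\<^sub>R v \<in> frontier S}"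
  have no3: False if c: "a < b" "b < c" "a \<in> C" "b \<in> C" "c \<in> C" for a b c
  proof -
    define k where "k = (b - a) / (c - a)"
    have k: "0 < k" "k < 1" "a + k * (c - a) = b" using c by (auto simp: k_def)
    have "(1 - k) *\<^sub>R (z + a *\<^sub>R v) + k *\<^sub>R (z + c *\<^sub>R v) = z + (a + k * (c - a)) *\<^sub>R v"
      by (simp add: algebra_simps)
    moreover have "z + a *\<^sub>R v \<noteq> z + c *\<^sub>R v" using c v by auto
    ultimately have "z + b *\<^sub>R v \<in> open_segment (z + a *\<^sub>R v) (z + c *\<^sub>R v)"
      unfolding in_segment using k by metis
    moreover have "z + a *\<^sub>R v \<in> closure S" "z + c *\<^sub>R v \<in> closure S" "z + a *\<^sub>R v \<noteq> z + c *\<^sub>R v"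
      using c v by (auto simp: C_def frontier_def)
    ultimately have "z + b *\<^sub>R v \<in> interior S" using S unfolding strictly_convex_def by blast
    then show False using c by (auto simp: C_def frontier_def)
  qed
  have no: "card B \<noteq> 3" if "B \<subseteq> C" "finite B" for B
  proof
    assume B: "card B = 3"
    define x where "x = Min B"
    define y where "y = Max B"
    have ne: "B \<noteq> {}" using B by auto
    have xy: "x \<in> B" "y \<in> B" using that ne by (auto simp: x_def y_def)
    have "card {x, y} < card B" using B card_insert_le_m1[of 2 "{y}" x] by (simp add: card_insert_if)
    then have "\<not> B \<subseteq> {x, y}" by (meson card_mono finite.emptyI finite.insertI leD)
    then obtain b where b: "b \<in> B" "b \<noteq> x" "b \<noteq> y" by auto
    have "x < b" "b < y" using b that by (auto simp: x_def y_def order_less_le)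
    then show False using no3[of x b y] xy b that by auto
  qed
  show 1: "finite {c. z + c *\<^sub>R v \<in> frontier S}"
    unfolding C_def[symmetric] using no infinite_arbitrarily_large[of C 3] by blast
  show "card {c. z + c *\<^sub>R v \<in> frontier S} \<le> 2"
    unfolding C_def[symmetric]
  proof (rule ccontr)
    assume "\<not> card C \<le> 2"
    then have "3 \<le> card C" by simp
    then obtain B where "B \<subseteq> C" "card B = 3" using obtain_subset_with_card_n by metis
    then show False using no[of B] 1 finite_subset by (auto simp: C_def)
  qed
qed

lemma line_frontiers:
  assumes "strictly_convex S" "strictly_convex S'" "v \<noteq> 0"
  shows "finite (range (\<lambda>c. z + c *\<^sub>R v) \<inter> (frontier S \<union> frontier S'))"
    "card (range (\<lambda>c. z + c *\<^sub>R v) \<inter> (frontier S \<union> frontier S')) \<le> 4"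
proof -
  define C where "C S = {c. z + c *\<^sub>R v \<in> frontier S}" for S
  have eq: "range (\<lambda>c. z + c *\<^sub>R v) \<inter> (frontier S \<union> frontier S') = (\<lambda>c. z + c *\<^sub>R v) ` (C S \<union> C S')"
    by (auto simp: C_def)
  have fin: "finite (C S)" "finite (C S')" "card (C S) \<le> 2" "card (C S') \<le> 2"
    unfolding C_def using strictly_convex_line_frontier assms by auto
  show "finite (range (\<lambda>c. z + c *\<^sub>R v) \<inter> (frontier S \<union> frontier S'))" unfolding eq using fin by auto
  have "card ((\<lambda>c. z + c *\<^sub>R v) ` (C S \<union> C S')) \<le> card (C S \<union> C S')" using fin by (intro card_image_le) auto
  also have "\<dots> \<le> card (C S) + card (C S')" by (rule card_Un_le)
  finally show "card (range (\<lambda>c. z + c *\<^sub>R v) \<inter> (frontier S \<union> frontier S')) \<le> 4" unfolding eq using fin by linarith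
qed

text \<open>A point interior to two crossing rays forces them onto a common line, and a line meets the
  two frontiers in at most four points.\<close>

lemma ray_multiplicity:
  fixes Q :: "nat \<Rightarrow> (plane \<times> plane) set"
  assumes S: "strictly_convex S" "strictly_convex S'"
    and \<Gamma>: "\<Gamma> \<subseteq> (frontier S \<union> frontier S') \<times> (frontier S \<union> frontier S')"
    and mono: "\<And>p q. p \<in> \<Gamma> \<Longrightarrow> q \<in> \<Gamma> \<Longrightarrow> dist (fst p) (snd p) + dist (fst q) (snd q) \<le> dist (fst p) (snd q) + dist (fst q) (snd p)"
    and Q: "\<And>j. Q j \<subseteq> \<Gamma>" "disjoint_family Q" "\<And>j p. p \<in> Q j \<Longrightarrow> fst p \<noteq> snd p"
  shows "card {j \<in> {..<n}. \<exists>p\<in>Q j. z \<in> open_segment (fst p) (snd p)} \<le> 16"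
proof -
  define J where "J = {j \<in> {..<n}. \<exists>p\<in>Q j. z \<in> open_segment (fst p) (snd p)}"
  define P where "P j = (SOME p. p \<in> Q j \<and> z \<in> open_segment (fst p) (snd p))" for j
  have P: "P j \<in> Q j" "z \<in> open_segment (fst (P j)) (snd (P j))" if "j \<in> J" for j
  proof -
    have "\<exists>p. p \<in> Q j \<and> z \<in> open_segment (fst p) (snd p)" using that unfolding J_def by blast
    from someI_ex[OF this] show "P j \<in> Q j" "z \<in> open_segment (fst (P j)) (snd (P j))"
      unfolding P_def by blast+
  qed
  show ?thesis unfolding J_def[symmetric]
  proof (cases "J = {}")
    case False
    then obtain k where k: "k \<in> J" by auto
    define v where "v = snd (P k) - fst (P k)"
    have v: "v \<noteq> 0" using Q(3)[OF P(1)[OF k]] by (simp add: v_def)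
    define L where "L = range (\<lambda>c. z + c *\<^sub>R v) \<inter> (frontier S \<union> frontier S')"
    have L: "finite L" "card L \<le> 4" unfolding L_def using line_frontiers[OF S v] by auto
    have PL: "P j \<in> L \<times> L" if j: "j \<in> J" for j
    proof -
      have G: "P k \<in> \<Gamma>" "P j \<in> \<Gamma>" using P(1)[OF k] P(1)[OF j] Q(1) by auto
      obtain c d where "fst (P j) = z + c *\<^sub>R (snd (P k) - fst (P k))" "snd (P j) = z + d *\<^sub>R (snd (P k) - fst (P k))"
        using crossing_collinear[OF mono[OF G] P(2)[OF k] P(2)[OF j]] by blast
      then show ?thesis using G(2) \<Gamma> by (cases "P j") (auto simp: L_def v_def)
    qed
    \<comment> \<open>The sets \<open>Q j\<close> are disjoint, so the chosen rays are different.
      Their ends are among the at most four points of \<open>L\<close>, which leaves 16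
      pairs.\<close>
    have "inj_on P J"
    proof (rule inj_onI, rule ccontr)
      fix i j assume ij: "i \<in> J" "j \<in> J" "P i = P j" "i \<noteq> j"
      then have "Q i \<inter> Q j = {}" using Q(2) by (auto simp: disjoint_family_on_def)
      then show False using P(1)[OF ij(1)] P(1)[OF ij(2)] ij(3) by auto
    qed
    then have "card J = card (P ` J)" by (simp add: card_image)
    also have "\<dots> \<le> card (L \<times> L)" by (intro card_mono finite_cartesian_product image_subsetI L PL)
    also have "\<dots> \<le> 4 * 4" unfolding card_cartesian_product using L by (intro mult_le_mono) auto
    finally show "card J \<le> 16" by simp
  qed simp
qed

text \<open>A compact set cut with an open set is a countable union of compact sets, and so is the
  half-open parameter interval; hence so is the image. The disjoint pieces of the covering below
  have this form.\<close>

lemma seg_image_borel: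
  assumes K: "compact K" and U: "open U"
  shows "(\<lambda>(z, t). seg z t) ` ((K \<inter> U) \<times> {0<..1/2}) \<in> sets borel"
proof -
  have "fsigma_in euclidean U" using U by (intro open_imp_fsigma_in metrizable_space_euclidean) auto
  then obtain C :: "nat \<Rightarrow> (plane \<times> plane) set" where C: "\<And>n. closed (C n)" "U = (\<Union>n. C n)"
    unfolding fsigma_in_ascending by auto
  have "(\<lambda>(z, t). seg z t) ` ((K \<inter> U) \<times> {0<..1/2}) = (\<Union>n m. (\<lambda>(z, t). seg z t) ` ((K \<inter> C n) \<times> {1 / Suc m..1/2}))"
  proof (intro equalityI subsetI)
    fix y assume "y \<in> (\<lambda>(z, t). seg z t) ` ((K \<inter> U) \<times> {0<..1/2})"
    then obtain z t where zt: "z \<in> K" "z \<in> U" "0 < t" "t \<le> 1/2" "y = seg z t" by auto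
    obtain n where n: "z \<in> C n" using zt C by auto
    obtain m where m: "1 / Suc m < t" using nat_approx_posE[OF zt(3)] by auto
    show "y \<in> (\<Union>n m. (\<lambda>(z, t). seg z t) ` ((K \<inter> C n) \<times> {1 / Suc m..1/2}))"
      using zt n m by (intro UN_I[of n] UN_I[of m] image_eqI[of _ _ "(z, t)"]) auto
  next
    fix y assume "y \<in> (\<Union>n m. (\<lambda>(z, t). seg z t) ` ((K \<inter> C n) \<times> {1 / Suc m..1/2}))"
    then obtain n m z t where zt: "z \<in> K" "z \<in> C n" "1 / Suc m \<le> t" "t \<le> 1/2" "y = seg z t" by auto
    moreover have "0 < t"
    proof -
      have "(0::real) < 1 / Suc m" by simp
      then show ?thesis using zt(3) by linarith
    qed
    ultimately show "y \<in> (\<lambda>(z, t). seg z t) ` ((K \<inter> U) \<times> {0<..1/2})"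
      using C(2) by (intro image_eqI[of _ _ "(z, t)"]) (auto intro: less_le_trans)
  qed
  also have "\<dots> \<in> sets borel"
  proof (intro sets.countable_UN'' borel_compact)
    fix n m
    have "continuous_on ((K \<inter> C n) \<times> {1 / Suc m..1/2}) (\<lambda>(z, t). seg z t)"
      unfolding case_prod_beta seg_def by (intro continuous_intros)
    then show "compact ((\<lambda>(z, t). seg z t) ` ((K \<inter> C n) \<times> {1 / Suc m..1/2}))"
      using K C by (intro compact_continuous_image compact_Times compact_Int_closed) auto
  qed auto
  finally show ?thesis .
qed

section \<open>Covering of the rays by countably many pieces\<close>

text \<open>\<open>\<omega>\<close> is the absolute cosine between ray and normal and
  \<open>\<rho>\<close> the length of the ray. An axis \<open>e\<close> within
  \<open>\<omega> / 8\<close> of the ray direction keeps at least three quarters of both, so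
  \<open>a\<close> and \<open>l\<close> fit between one half and three quarters of
  \<open>\<omega>\<close> and \<open>\<rho>\<close>; hence
  \<open>w \<le> \<rho> * \<omega> \<le> 4 * (a * l)\<close>. Rational parameters and
  \<open>d \<in> D\<close> keep the family of pieces countable.\<close>

lemma ray_piece_exists:
  assumes D: "\<And>X. open X \<Longrightarrow> X \<noteq> {} \<Longrightarrow> \<exists>d\<in>D. d \<in> (X :: plane set)"
    and z: "fst z \<in> closure S" "outward_unit_normal S (fst z) n"
    and w: "0 < w" "w \<le> \<bar>n \<bullet> (snd z - fst z)\<bar>"
  obtains d s a l where "d \<in> D" "d \<noteq> 0" "s = 1 \<or> s = -1" "a \<in> \<rat>" "0 < a" "a \<le> 1" "l \<in> \<rat>" "0 < l"
    "z \<in> ray_piece S (sgn d) s a l" "w \<le> 4 * (a * l)"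
proof -
  define v where "v = snd z - fst z"
  define \<rho> where "\<rho> = norm v"
  have v: "v \<noteq> 0" using w by (auto simp: v_def)
  then have \<rho>: "\<rho> > 0" by (simp add: \<rho>_def)
  define u where "u = sgn v"
  have u: "norm u = 1" "v = \<rho> *\<^sub>R u" using v by (auto simp: u_def \<rho>_def norm_sgn sgn_div_norm)
  have n1: "norm n = 1" using z by (simp add: outward_unit_normal_def)
  define \<omega> where "\<omega> = \<bar>n \<bullet> u\<bar>"
  have w\<rho>: "w \<le> \<rho> * \<omega>" using w u(2) \<rho> by (simp add: v_def[symmetric] \<omega>_def abs_mult)
  have \<omega>: "0 < \<omega>" "\<omega> \<le> 1"
  proof -
    have "0 < \<rho> * \<omega>" using w w\<rho> by linarith
    then show "0 < \<omega>" using \<rho> by (simp add: zero_less_mult_iff)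
    show "\<omega> \<le> 1" unfolding \<omega>_def using Cauchy_Schwarz_ineq2[of n u] n1 u by simp
  qed
  have "continuous (at u) (sgn :: plane \<Rightarrow> plane)" using u(1) by (intro continuous_intros) auto
  then obtain \<delta> where \<delta>: "\<delta> > 0" "\<And>d. dist d u < \<delta> \<Longrightarrow> dist (sgn d) (sgn u) < \<omega> / 8"
    using \<omega>(1) unfolding continuous_at_eps_delta by (metis divide_pos_pos zero_less_numeral)
  obtain d where d: "d \<in> D" "d \<in> ball u (min \<delta> (1/2))" 
  proof -
    have "ball u (min \<delta> (1/2)) \<noteq> {}" using \<delta>(1) by simp
    with D[OF open_ball] show ?thesis using that by blast
  qed
  have d0: "d \<noteq> 0" using d u by (auto simp: dist_norm)
  define e where "e = sgn d"
  have e: "norm e = 1" using d0 by (simp add: e_def norm_sgn)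
  have eu: "norm (e - u) < \<omega> / 8"
    using \<delta>(2)[of d] d u(1) by (auto simp: e_def dist_norm norm_minus_commute sgn_div_norm)
  define s where "s = (if n \<bullet> u \<ge> 0 then 1 else -1 :: real)"
  have s: "s = 1 \<or> s = -1" "s * (n \<bullet> u) = \<omega>" by (auto simp: s_def \<omega>_def)
  have "\<bar>s * (n \<bullet> (e - u))\<bar> \<le> norm (e - u)"
    using Cauchy_Schwarz_ineq2[of n "e - u"] n1 s(1) by (auto simp: abs_mult)
  then have ne: "s * (n \<bullet> e) \<ge> 3 / 4 * \<omega>"
    using s(2) eu by (simp add: inner_diff_right right_diff_distrib)
  obtain a where a: "a \<in> \<rat>" "\<omega> / 2 < a" "a < 3 / 4 * \<omega>" using Rats_dense_in_real[of "\<omega> / 2" "3 / 4 * \<omega>"] \<omega> by auto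
  obtain l where l: "l \<in> \<rat>" "\<rho> / 2 < l" "l < 3 / 4 * \<rho>" using Rats_dense_in_real[of "\<rho> / 2" "3 / 4 * \<rho>"] \<rho> by auto
  have ue: "u \<bullet> e \<ge> 3 / 4"
  proof -
    have "\<bar>u \<bullet> (e - u)\<bar> \<le> norm (e - u)" using Cauchy_Schwarz_ineq2[of u "e - u"] u by simp
    moreover have "u \<bullet> u = 1" using u by (simp add: norm_eq_1)
    ultimately show ?thesis using eu \<omega> by (simp add: inner_diff_right)
  qed
  have h: "ray_height e z = \<rho> * (u \<bullet> e)" using u(2) by (simp add: ray_height_def v_def[symmetric])
  have h34: "ray_height e z \<ge> 3 / 4 * \<rho>" unfolding h using mult_left_mono[OF ue, of \<rho>] \<rho> by simp
  have tr: "\<bar>v \<bullet> rot_minus_half_pi e\<bar> \<le> \<rho> * (\<omega> / 8)"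
  proof -
    have "u \<bullet> rot_minus_half_pi e = (u - e) \<bullet> rot_minus_half_pi e" by (simp add: inner_diff_left)
    then have "\<bar>u \<bullet> rot_minus_half_pi e\<bar> \<le> norm (u - e) * norm (rot_minus_half_pi e)"
      using Cauchy_Schwarz_ineq2[of "u - e" "rot_minus_half_pi e"] by simp
    also have "\<dots> \<le> \<omega> / 8" using eu e by (simp add: norm_minus_commute)
    finally show ?thesis unfolding u(2) using \<rho> by (simp add: abs_mult)
  qed
  have "z \<in> ray_piece S e s a l"
    unfolding ray_piece_def
  proof (intro CollectI conjI exI[of _ n])
    show "l \<le> ray_height e z" using l h34 by linarith
    have "\<bar>(snd z - fst z) \<bullet> rot_minus_half_pi e\<bar> \<le> \<rho> * (\<omega> / 8)" using tr unfolding v_def .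
    also have "\<rho> * (\<omega> / 8) \<le> (\<omega> / 4) * (3 / 4 * \<rho>)" using \<rho> \<omega> by simp
    also have "\<dots> \<le> a / 2 * ray_height e z" using a h34 \<omega> \<rho> by (intro mult_mono) auto
    finally show "\<bar>(snd z - fst z) \<bullet> rot_minus_half_pi e\<bar> \<le> a / 2 * ray_height e z" .
  qed (use z ne a in auto)
  moreover have "w \<le> 4 * (a * l)"
  proof -
    have "(\<omega> / 2) * (\<rho> / 2) \<le> a * l" using a l \<omega> \<rho> by (intro mult_mono) auto
    then show ?thesis using w\<rho> by (simp add: mult.commute)
  qed
  ultimately show ?thesis using that[of d s a l] d(1) d0 s(1) a l \<omega> \<rho> by (auto simp: e_def)
qed


text \<open>The set of rays is covered by countably many pieces with \<open>w \<le> 4 a l\<close>, each contributing at most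
  \<open>8 / (a l) * w \<le> 32\<close> times Lebesgue measure, and a point lies on rays of at most 16 of the disjointified pieces.\<close>

lemma transport_mass_le:
  fixes \<gamma>' :: "(plane \<times> plane) measure" and w :: "plane \<times> plane \<Rightarrow> real"
  assumes sf: "sigma_finite_measure \<gamma>'" and sets [measurable_cong]: "sets \<gamma>' = sets borel"
    and marg: "\<And>F. F \<in> sets borel \<Longrightarrow> emeasure \<gamma>' (F \<times> UNIV) \<le> hausdorff1_outer F"
    and S: "strictly_convex S" "strictly_convex S'"
    and \<Gamma>: "compact \<Gamma>" "\<Gamma> \<subseteq> (frontier S \<union> frontier S') \<times> (frontier S \<union> frontier S')"
    and mono: "\<And>p q. p \<in> \<Gamma> \<Longrightarrow> q \<in> \<Gamma> \<Longrightarrow> dist (fst p) (snd p) + dist (fst q) (snd q) \<le> dist (fst p) (snd q) + dist (fst q) (snd p)"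
    and w: "continuous_on UNIV w" "\<And>z. w z \<ge> 0"
    and good: "AE z in \<gamma>'. z \<in> \<Gamma> \<and> (w z > 0 \<longrightarrow> (\<exists>R\<in>{S, S'}. \<exists>n. fst z \<in> closure R \<and> outward_unit_normal R (fst z) n \<and>
        w z \<le> \<bar>n \<bullet> (snd z - fst z)\<bar>))"
    and B [measurable]: "B \<in> sets borel"
  shows "(\<integral>\<^sup>+z. ennreal (w z) * half_mass B z \<partial>\<gamma>') \<le> 512 * emeasure lborel B"
proof -
  obtain D :: "plane set" where D: "countable D" "\<And>X. open X \<Longrightarrow> X \<noteq> {} \<Longrightarrow> \<exists>d\<in>D. d \<in> X"
    using countable_dense_exists by metis
  define I where "I = {S, S'} \<times> ((D - {0}) \<times> ({1, -1::real} \<times> ((\<rat> \<inter> {0<..1::real}) \<times> (\<rat> \<inter> {0::real<..}))))"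
  have cI: "countable I" unfolding I_def using D(1) countable_rat by (intro countable_SIGMA) auto
  define piece where "piece = (\<lambda>(R, d, s, a, l). \<Gamma> \<inter> ray_piece R (sgn d) s a l \<inter> {z. w z \<le> 4 * (a * l)})"
  have neI: "I \<noteq> {}"
  proof -
    obtain d where "d \<in> D" "d \<in> - {0}" using D(2)[of "- {0}"] by (metis open_Compl closed_singleton ComplI UNIV_not_singleton double_complement compl_bot_eq)
    then have "(S, d, 1, 1, 1) \<in> I" by (auto simp: I_def)
    then show ?thesis by auto
  qed
  define en where "en = from_nat_into I"
  have en: "range en = I" "\<And>j. en j \<in> I" unfolding en_def using neI cI by (auto simp: range_from_nat_into from_nat_into)
  define al where "al j = (case en j of (R, d, s, a, l) \<Rightarrow> a * l)" for j
  have al: "al j > 0" for j using en(2)[of j] by (auto simp: al_def I_def)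
  have compact_piece: "compact (piece i)" for i
  proof -
    obtain R d s a l where i: "i = (R, d, s, a, l)" by (metis surj_pair)
    have "closed {z. w z \<le> 4 * (a * l)}" using w(1) by (intro closed_Collect_le continuous_intros) auto
    then show ?thesis unfolding i piece_def
      using \<Gamma>(1) closed_ray_piece[of R "sgn d" s a l] by (auto intro!: compact_Int_closed)
  qed
  \<comment> \<open>Disjointness counts each ray once. Each \<open>Q j\<close> is a compact set
    minus finitely many compact sets, so the region \<open>Im j\<close> swept by its rays is still
    Borel.\<close>
  define Q where "Q = disjointed (\<lambda>j. piece (en j))"
  have QU: "(\<Union>j. Q j) = (\<Union>j. piece (en j))" unfolding Q_def by (rule UN_disjointed_eq)
  have Qdisj: "disjoint_family Q" unfolding Q_def by (rule disjoint_family_disjointed)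
  have Qsub: "Q j \<subseteq> piece (en j)" for j unfolding Q_def by (rule disjointed_subset)
  have Qform: "Q j = piece (en j) \<inter> - (\<Union>i<j. piece (en i))" for j
    unfolding Q_def disjointed_def by (auto simp: atLeast0LessThan)
  have open_compl: "open (- (\<Union>i<j. piece (en i)))" for j
    by (intro open_Compl closed_UN finite_lessThan compact_imp_closed[OF compact_piece] ballI)
  have Qb [measurable]: "Q j \<in> sets borel" for j
    unfolding Qform by (rule sets.Int[OF borel_compact[OF compact_piece] borel_open[OF open_compl]])
  have Q\<Gamma>: "Q j \<subseteq> \<Gamma>" for j
    using Qsub[of j] by (cases "en j") (auto simp: piece_def)
  define Im where "Im j = (\<lambda>(z, t). seg z t) ` (Q j \<times> {0<..1/2})" for j
  have Imb [measurable]: "Im j \<in> sets borel" for j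
    unfolding Im_def Qform by (rule seg_image_borel[OF compact_piece open_compl])
  have ne: "fst p \<noteq> snd p" if "p \<in> Q j" for p j
  proof -
    obtain R d s a l where i: "en j = (R, d, s, a, l)" by (metis surj_pair)
    have "p \<in> ray_piece R (sgn d) s a l" "l > 0"
      using Qsub[of j] that en(2)[of j] by (auto simp: i piece_def I_def)
    from ray_piece_slope(1)[OF this] show ?thesis by (auto simp: ray_height_def)
  qed
  have piece_bound: "(\<integral>\<^sup>+z. indicator (Q j) z * (ennreal (w z) * half_mass B z) \<partial>\<gamma>') \<le> 32 * emeasure lborel (B \<inter> Im j)" for j
  proof -
    obtain R d s a l where i: "en j = (R, d, s, a, l)" by (metis surj_pair)
    have prm: "norm (sgn d) = 1" "s = 1 \<or> s = -1" "0 < a" "a \<le> 1" "0 < l"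
      using en(2)[of j] by (auto simp: i I_def norm_sgn)
    \<comment> \<open>The first halves of rays of \<open>Q j\<close> meet \<open>B\<close> only
      inside \<open>Im j\<close>. Restricting \<open>B\<close> accordingly turns the sum over
      \<open>j\<close> into an integral of overlaps instead of infinitely many copies of
      \<open>B\<close>.\<close>
    have hm: "half_mass B z = half_mass (B \<inter> Im j) z" if "z \<in> Q j" for z
      unfolding half_mass_def using that
      by (intro nn_integral_cong) (auto simp: Im_def indicator_def)
    have "(\<integral>\<^sup>+z. indicator (Q j) z * (ennreal (w z) * half_mass B z) \<partial>\<gamma>') \<le>
      (\<integral>\<^sup>+z. ennreal (4 * (a * l)) * (indicator (Q j) z * half_mass (B \<inter> Im j) z) \<partial>\<gamma>')"
    proof (rule nn_integral_mono)
      fix z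
      show "indicator (Q j) z * (ennreal (w z) * half_mass B z) \<le> ennreal (4 * (a * l)) * (indicator (Q j) z * half_mass (B \<inter> Im j) z)"
      proof (cases "z \<in> Q j")
        case True
        then have "w z \<le> 4 * (a * l)" using Qsub[of j] by (auto simp: i piece_def)
        then show ?thesis using True hm[OF True] by (auto intro!: mult_right_mono ennreal_leI)
      qed simp
    qed
    also have "\<dots> = ennreal (4 * (a * l)) * (\<integral>\<^sup>+z. indicator (Q j) z * half_mass (B \<inter> Im j) z \<partial>\<gamma>')"
      by (rule nn_integral_cmult) measurable
    also have "\<dots> \<le> ennreal (4 * (a * l)) * (ennreal (8 / (a * l)) * emeasure lborel (B \<inter> Im j))"
    proof (intro mult_left_mono piece_mass_le[OF sf sets marg prm Qb])
      show "Q j \<subseteq> ray_piece R (sgn d) s a l" using Qsub[of j] by (auto simp: i piece_def)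
      show "bounded (Q j)" using Q\<Gamma>[of j] \<Gamma>(1) bounded_subset compact_imp_bounded by blast
      show "dist (fst p) (snd p) + dist (fst q) (snd q) \<le> dist (fst p) (snd q) + dist (fst q) (snd p)"
        if "p \<in> Q j" "q \<in> Q j" for p q
        using that Q\<Gamma>[of j] by (intro mono) blast+
    qed auto
    also have "\<dots> = ennreal (4 * (a * l) * (8 / (a * l))) * emeasure lborel (B \<inter> Im j)"
      using prm by (subst ennreal_mult') (auto simp: mult.assoc)
    also have "4 * (a * l) * (8 / (a * l)) = 32" using prm by simp
    finally show ?thesis by simp
  qed
  \<comment> \<open>Rays with \<open>w z = 0\<close> contribute nothing to either side; almost every
    other ray belongs to some piece, hence to exactly one \<open>Q j\<close>.\<close>
  have cov: "AE z in \<gamma>'. ennreal (w z) * half_mass B z = (\<Sum>j. indicator (Q j) z * (ennreal (w z) * half_mass B z))"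
    using good
  proof eventually_elim
    fix z assume z: "z \<in> \<Gamma> \<and> (w z > 0 \<longrightarrow> (\<exists>R\<in>{S, S'}. \<exists>n. fst z \<in> closure R \<and> outward_unit_normal R (fst z) n \<and>
        w z \<le> \<bar>n \<bullet> (snd z - fst z)\<bar>))"
    show "ennreal (w z) * half_mass B z = (\<Sum>j. indicator (Q j) z * (ennreal (w z) * half_mass B z))"
    proof (cases "w z > 0")
      case False
      then have "w z = 0" using w(2)[of z] by simp
      then show ?thesis by simp
    next
      case True
      then obtain R n where Rn: "R \<in> {S, S'}" "fst z \<in> closure R" "outward_unit_normal R (fst z) n" "w z \<le> \<bar>n \<bullet> (snd z - fst z)\<bar>"
        using z by blast
      obtain d s a l where p: "d \<in> D" "d \<noteq> 0" "s = 1 \<or> s = -1" "a \<in> \<rat>" "0 < a" "a \<le> 1" "l \<in> \<rat>" "0 < l"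
        "z \<in> ray_piece R (sgn d) s a l" "w z \<le> 4 * (a * l)"
        using ray_piece_exists[OF D(2) Rn(2,3) True Rn(4)] by metis
      have "(R, d, s, a, l) \<in> I" using p Rn(1) unfolding I_def by auto
      then obtain j where j: "en j = (R, d, s, a, l)" using en(1) by (metis imageE)
      have "z \<in> piece (en j)" using p z by (auto simp: j piece_def)
      then obtain k where k: "z \<in> Q k" using QU by blast
      have "(\<Sum>j. indicator (Q j) z * (ennreal (w z) * half_mass B z)) = (\<Sum>j\<in>{k}. indicator (Q j) z * (ennreal (w z) * half_mass B z))"
      proof (rule suminf_finite)
        fix j assume "j \<notin> {k}"
        then have "Q j \<inter> Q k = {}" using Qdisj by (auto simp: disjoint_family_on_def)
        then have "z \<notin> Q j" using k by blast
        then show "indicator (Q j) z * (ennreal (w z) * half_mass B z) = 0" by simp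
      qed simp
      then show ?thesis using k by simp
    qed
  qed
  have wb [measurable]: "w \<in> borel_measurable borel" using w(1) by (rule borel_measurable_continuous_onI)
  have "(\<integral>\<^sup>+z. ennreal (w z) * half_mass B z \<partial>\<gamma>') = (\<integral>\<^sup>+z. (\<Sum>j. indicator (Q j) z * (ennreal (w z) * half_mass B z)) \<partial>\<gamma>')"
    by (rule nn_integral_cong_AE[OF cov])
  also have "\<dots> = (\<Sum>j. (\<integral>\<^sup>+z. indicator (Q j) z * (ennreal (w z) * half_mass B z) \<partial>\<gamma>'))"
    by (rule nn_integral_suminf) measurable
  also have "\<dots> \<le> (\<Sum>j. 32 * emeasure lborel (B \<inter> Im j))"
    by (intro suminf_le piece_bound) auto
  also have "\<dots> = (\<Sum>j. (\<integral>\<^sup>+z. 32 * indicator (B \<inter> Im j) z \<partial>lborel))"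
    by (subst nn_integral_cmult) auto
  also have "\<dots> = (\<integral>\<^sup>+z. (\<Sum>j. 32 * indicator (B \<inter> Im j) z) \<partial>lborel)"
    by (rule nn_integral_suminf[symmetric]) measurable
  also have "\<dots> \<le> (\<integral>\<^sup>+z. 512 * indicator B z \<partial>lborel)"
  proof (rule nn_integral_mono)
    fix z
    show "(\<Sum>j. 32 * indicator (B \<inter> Im j) z) \<le> (512 * indicator B z :: ennreal)"
    proof (rule suminf_le_const[OF summableI])
      fix n
      have "(\<Sum>j<n. 32 * indicator (B \<inter> Im j) z) = (32 * indicator B z * (\<Sum>j<n. indicator (Im j) z) :: ennreal)"
        by (subst sum_distrib_left) (auto simp: indicator_def intro!: sum.cong)
      also have "(\<Sum>j<n. indicator (Im j) z) = (of_nat (card {j \<in> {..<n}. z \<in> Im j}) :: ennreal)"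
        by (simp add: indicator_def sum.If_cases Int_def)
      \<comment> \<open>A point of \<open>Im j\<close> has its parameter in \<open>{0<..1/2}\<close>
        and is interior to the ray. So at most 16 pieces contribute, and
        \<open>32 * 16 = 512\<close>.\<close>
      also have "card {j \<in> {..<n}. z \<in> Im j} \<le> card {j \<in> {..<n}. \<exists>p\<in>Q j. z \<in> open_segment (fst p) (snd p)}"
      proof (rule card_mono)
        show "{j \<in> {..<n}. z \<in> Im j} \<subseteq> {j \<in> {..<n}. \<exists>p\<in>Q j. z \<in> open_segment (fst p) (snd p)}"
        proof safe
          fix j assume j: "z \<in> Im j"
          then obtain p t where p: "p \<in> Q j" "0 < t" "t \<le> 1/2" "z = seg p t" by (auto simp: Im_def)
          have "z \<in> open_segment (fst p) (snd p)"
            unfolding in_segment using ne[OF p(1)] p by (auto simp: seg_def intro!: exI[of _ t])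
          then show "\<exists>p\<in>Q j. z \<in> open_segment (fst p) (snd p)" using p(1) by blast
        qed
      qed simp
      also have "\<dots> \<le> 16" by (rule ray_multiplicity[OF S \<Gamma>(2) mono Q\<Gamma> Qdisj ne])
      finally have "(\<Sum>j<n. 32 * indicator (B \<inter> Im j) z) \<le> (32 * indicator B z * of_nat 16 :: ennreal)"
        by (simp add: mult_left_mono)
      also have "\<dots> = 512 * indicator B z" by (simp add: indicator_def)
      finally show "(\<Sum>j<n. 32 * indicator (B \<inter> Im j) z) \<le> (512 * indicator B z :: ennreal)" .
    qed
  qed
  also have "\<dots> = 512 * emeasure lborel B" by (subst nn_integral_cmult) auto
  finally show ?thesis .
qed

section \<open>The sign of the tangential derivative\<close>

text \<open>On a partition into \<open>N\<close> equal parts the errors telescope to a multiple of \<open>1 / N\<close>.\<close>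

lemma telescoping_constant:
  fixes D P :: "real \<Rightarrow> real"
  assumes ab: "\<alpha> \<le> \<beta>" and c: "c \<ge> 0"
    and anti: "\<And>s t. \<alpha> \<le> s \<Longrightarrow> s \<le> t \<Longrightarrow> t \<le> \<beta> \<Longrightarrow> P t \<le> P s"
    and D: "\<And>s t. \<alpha> \<le> s \<Longrightarrow> s < t \<Longrightarrow> t \<le> \<beta> \<Longrightarrow> \<bar>D t - D s\<bar> \<le> c * (P s - P t) * (t - s)"
  shows "D \<beta> = D \<alpha>"
proof (cases "\<alpha> = \<beta>")
  case False
  then have lt: "\<alpha> < \<beta>" using ab by simp
  have bound: "\<bar>D \<beta> - D \<alpha>\<bar> \<le> c * (P \<alpha> - P \<beta>) * (\<beta> - \<alpha>) / real (Suc N)" for N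
  proof -
    define h where "h = (\<beta> - \<alpha>) / real (Suc N)"
    have h: "h > 0" using lt by (simp add: h_def)
    have b: "\<alpha> + real (Suc N) * h = \<beta>" by (simp add: h_def)
    have "\<bar>D (\<alpha> + real i * h) - D \<alpha>\<bar> \<le> c * h * (P \<alpha> - P (\<alpha> + real i * h))" if "i \<le> Suc N" for i
      using that
    proof (induction i)
      case (Suc i)
      have le: "\<alpha> + real (Suc i) * h \<le> \<beta>" using Suc.prems h b by (metis add_left_mono less_imp_le mult_right_mono of_nat_mono)
      have lt': "\<alpha> + real i * h < \<alpha> + real (Suc i) * h" using h by (simp add: algebra_simps)
      have "\<bar>D (\<alpha> + real (Suc i) * h) - D (\<alpha> + real i * h)\<bar> \<le>
         c * (P (\<alpha> + real i * h) - P (\<alpha> + real (Suc i) * h)) * (\<alpha> + real (Suc i) * h - (\<alpha> + real i * h))"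
        using h le lt' by (intro D) auto
      also have "\<alpha> + real (Suc i) * h - (\<alpha> + real i * h) = h" by (simp add: algebra_simps)
      finally have 1: "\<bar>D (\<alpha> + real (Suc i) * h) - D (\<alpha> + real i * h)\<bar> \<le> c * h * (P (\<alpha> + real i * h) - P (\<alpha> + real (Suc i) * h))"
        by (simp only: mult_ac)
      have 2: "\<bar>D (\<alpha> + real i * h) - D \<alpha>\<bar> \<le> c * h * (P \<alpha> - P (\<alpha> + real i * h))" using Suc by simp
      have "c * h * (P \<alpha> - P (\<alpha> + real (Suc i) * h)) = c * h * (P (\<alpha> + real i * h) - P (\<alpha> + real (Suc i) * h)) + c * h * (P \<alpha> - P (\<alpha> + real i * h))"
        by (simp only: distrib_left[symmetric]) simp
      then show ?case using 1 2 by linarith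
    qed simp
    from this[of "Suc N"] have "\<bar>D \<beta> - D \<alpha>\<bar> \<le> c * h * (P \<alpha> - P \<beta>)" unfolding b by simp
    then show ?thesis by (simp add: h_def mult_ac)
  qed
  define X where "X = c * (P \<alpha> - P \<beta>) * (\<beta> - \<alpha>)"
  have "(\<lambda>N. X / real (Suc N)) \<longlonglongrightarrow> 0"
    by (rule LIMSEQ_Suc) (rule lim_const_over_n)
  then have "\<bar>D \<beta> - D \<alpha>\<bar> \<le> 0"
    by (rule LIMSEQ_le_const) (use bound in \<open>auto simp: X_def\<close>)
  then show ?thesis by simp
qed simp

section \<open>Differentiable bumps on the line\<close>

lemma DERIV_quadratic_error:
  fixes f :: "real \<Rightarrow> real"
  assumes "\<And>y. \<bar>f y - f x - D * (y - x)\<bar> \<le> (y - x)\<^sup>2"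
  shows "(f has_real_derivative D) (at x)"
proof -
  have "((\<lambda>y. (f y - f x) / (y - x) - D) \<longlongrightarrow> 0) (at x)"
  proof (rule Lim_null_comparison)
    show "\<forall>\<^sub>F y in at x. norm ((f y - f x) / (y - x) - D) \<le> \<bar>y - x\<bar>"
    proof (rule eventually_at_filter[THEN iffD2], rule always_eventually, safe)
      fix y assume ne: "y \<noteq> x"
      have "(f y - f x) / (y - x) - D = (f y - f x - D * (y - x)) / (y - x)" using ne by (simp add: field_simps)
      also have "\<bar>\<dots>\<bar> \<le> (y - x)\<^sup>2 / \<bar>y - x\<bar>" unfolding abs_divide using ne assms by (intro divide_right_mono) auto
      also have "(y - x)\<^sup>2 / \<bar>y - x\<bar> = (\<bar>y - x\<bar> * \<bar>y - x\<bar>) / \<bar>y - x\<bar>"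
        by (simp only: abs_mult_self_eq power2_eq_square)
      also have "\<dots> = \<bar>y - x\<bar>" using ne by (intro nonzero_mult_div_cancel_right) simp
      finally show "norm ((f y - f x) / (y - x) - D) \<le> \<bar>y - x\<bar>" by simp
    qed
    have "((\<lambda>y. \<bar>y - x\<bar>) \<longlongrightarrow> \<bar>x - x\<bar>) (at x)" by (intro tendsto_intros)
    then show "((\<lambda>y. \<bar>y - x\<bar>) \<longlongrightarrow> 0) (at x)" by simp
  qed
  then show ?thesis unfolding has_field_derivative_iff by (simp add: LIM_zero_iff)
qed

lemma DERIV_pos_part_square:
  "((\<lambda>x::real. (max 0 x)\<^sup>2) has_real_derivative 2 * max 0 x) (at x)"
proof (rule DERIV_quadratic_error)
  fix y :: real
  consider "x \<ge> 0" "y \<ge> 0" | "x \<ge> 0" "y < 0" | "x < 0" "y \<ge> 0" | "x < 0" "y < 0" by linarith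
  then show "\<bar>(max 0 y)\<^sup>2 - (max 0 x)\<^sup>2 - 2 * max 0 x * (y - x)\<bar> \<le> (y - x)\<^sup>2"
  proof cases
    case 1
    then have "(max 0 y)\<^sup>2 - (max 0 x)\<^sup>2 - 2 * max 0 x * (y - x) = (y - x)\<^sup>2"
      by (simp add: max_def power2_eq_square algebra_simps)
    then show ?thesis by simp
  next
    case 2
    have "x * y \<le> 0" using 2 by (simp add: mult_nonneg_nonpos)
    moreover have "x * x \<ge> 0" "y * y \<ge> 0" by simp_all
    moreover have "(max 0 y)\<^sup>2 - (max 0 x)\<^sup>2 - 2 * max 0 x * (y - x) = x * x - 2 * (x * y)"
      using 2 by (simp add: max_def power2_eq_square algebra_simps)
    moreover have "(y - x)\<^sup>2 = y * y - 2 * (x * y) + x * x" by (simp add: power2_eq_square algebra_simps)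
    ultimately show ?thesis by linarith
  next
    case 3
    then have "y\<^sup>2 \<le> (y - x)\<^sup>2" by (intro power_mono) auto
    then show ?thesis using 3 by (simp add: max_def)
  qed (simp add: max_def)
qed

text \<open>A continuously differentiable transition from 0 to 1 on the unit interval.\<close>

definition sigmoid :: "real \<Rightarrow> real" where
  "sigmoid x = (max 0 x)\<^sup>2 / ((max 0 x)\<^sup>2 + (max 0 (1 - x))\<^sup>2)"

definition sigmoid' :: "real \<Rightarrow> real" where
  "sigmoid' x = 2 * max 0 x * max 0 (1 - x) * (max 0 x + max 0 (1 - x)) / ((max 0 x)\<^sup>2 + (max 0 (1 - x))\<^sup>2)\<^sup>2"

lemma sigmoid_denom: "(max 0 x)\<^sup>2 + (max 0 (1 - x))\<^sup>2 > (0::real)"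
  by (cases "x > 0") (auto simp: max_def add_pos_nonneg add_nonneg_pos)

lemma DERIV_sigmoid: "(sigmoid has_real_derivative sigmoid' x) (at x)"
proof -
  have b: "((\<lambda>x. (max 0 (1 - x))\<^sup>2) has_real_derivative - (2 * max 0 (1 - x))) (at x)"
  proof -
    have d: "((\<lambda>x. 1 - x) has_real_derivative -1) (at x)" by (auto intro!: derivative_eq_intros)
    show ?thesis
      using DERIV_chain2[where f="\<lambda>x. (max 0 x)\<^sup>2" and g="\<lambda>x. 1 - x" and x=x and s=UNIV, OF DERIV_pos_part_square d]
      by simp
  qed
  have ne: "(max 0 x)\<^sup>2 + (max 0 (1 - x))\<^sup>2 \<noteq> 0" using sigmoid_denom[of x] by linarith
  have "((\<lambda>x. (max 0 x)\<^sup>2 / ((max 0 x)\<^sup>2 + (max 0 (1 - x))\<^sup>2)) has_real_derivative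
    ((2 * max 0 x) * ((max 0 x)\<^sup>2 + (max 0 (1 - x))\<^sup>2) - (max 0 x)\<^sup>2 * (2 * max 0 x + - (2 * max 0 (1 - x)))) /
    (((max 0 x)\<^sup>2 + (max 0 (1 - x))\<^sup>2) * ((max 0 x)\<^sup>2 + (max 0 (1 - x))\<^sup>2))) (at x)"
    by (rule DERIV_divide[OF DERIV_pos_part_square DERIV_add[OF DERIV_pos_part_square b] ne])
  moreover have "((2 * A) * (A\<^sup>2 + B\<^sup>2) - A\<^sup>2 * (2 * A + - (2 * B))) / ((A\<^sup>2 + B\<^sup>2) * (A\<^sup>2 + B\<^sup>2))
    = 2 * A * B * (A + B) / (A\<^sup>2 + B\<^sup>2)\<^sup>2" for A B :: real
    by (simp add: power2_eq_square algebra_simps)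
  ultimately show ?thesis unfolding sigmoid_def[abs_def] sigmoid'_def by simp
qed

lemma sigmoid'_nonneg: "sigmoid' x \<ge> 0"
  unfolding sigmoid'_def by (intro divide_nonneg_nonneg mult_nonneg_nonneg add_nonneg_nonneg) auto

lemma sigmoid_nonneg: "sigmoid x \<ge> 0"
  unfolding sigmoid_def by (intro divide_nonneg_nonneg add_nonneg_nonneg) auto

lemma sigmoid_le_1: "sigmoid x \<le> 1"
  unfolding sigmoid_def using sigmoid_denom[of x] by (simp add: divide_le_eq)

lemma sigmoid_simps:
  "x \<le> 0 \<Longrightarrow> sigmoid x = 0" "x \<le> 0 \<Longrightarrow> sigmoid' x = 0" "x \<ge> 1 \<Longrightarrow> sigmoid x = 1" "x \<ge> 1 \<Longrightarrow> sigmoid' x = 0"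
  by (auto simp: sigmoid_def sigmoid'_def max_def)

lemma continuous_on_sigmoid': "continuous_on A sigmoid'"
  unfolding sigmoid'_def using sigmoid_denom by (intro continuous_intros) (metis less_irrefl power_eq_0_iff)

lemma continuous_on_sigmoid: "continuous_on A sigmoid"
  using DERIV_sigmoid by (meson DERIV_continuous_on has_field_derivative_at_within)

text \<open>A smoothed indicator of \<open>{u<..<v}\<close>: the transition layers, of width
  \<open>1 / n\<close>, start at the two ends and run inwards.\<close>

definition bump :: "real \<Rightarrow> real \<Rightarrow> real \<Rightarrow> real \<Rightarrow> real" where
  "bump n u v s = sigmoid (n * (s - u)) * sigmoid (n * (v - s))"

definition bump' :: "real \<Rightarrow> real \<Rightarrow> real \<Rightarrow> real \<Rightarrow> real" where
  "bump' n u v s = n * (sigmoid' (n * (s - u)) * sigmoid (n * (v - s)) - sigmoid (n * (s - u)) * sigmoid' (n * (v - s)))"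

lemma DERIV_bump: "(bump n u v has_real_derivative bump' n u v s) (at s)"
proof -
  have 1: "((\<lambda>s. sigmoid (n * (s - u))) has_real_derivative sigmoid' (n * (s - u)) * n) (at s)"
    by (rule DERIV_chain2[OF DERIV_sigmoid]) (auto intro!: derivative_eq_intros)
  have 2: "((\<lambda>s. sigmoid (n * (v - s))) has_real_derivative sigmoid' (n * (v - s)) * (- n)) (at s)"
    by (rule DERIV_chain2[OF DERIV_sigmoid]) (auto intro!: derivative_eq_intros)
  have "((\<lambda>s. sigmoid (n * (s - u)) * sigmoid (n * (v - s))) has_real_derivative
     sigmoid' (n * (s - u)) * n * sigmoid (n * (v - s)) + sigmoid' (n * (v - s)) * (- n) * sigmoid (n * (s - u))) (at s)"
    by (rule DERIV_mult[OF 1 2])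
  then show ?thesis unfolding bump_def[abs_def] bump'_def by (simp add: algebra_simps)
qed

lemma bump_bounds: "0 \<le> bump n u v s" "bump n u v s \<le> 1"
  unfolding bump_def using sigmoid_nonneg sigmoid_le_1 by (auto intro: mult_le_one)

lemma bump_zero:
  assumes "n > 0" "s \<le> u \<or> v \<le> s"
  shows "bump n u v s = 0" "bump' n u v s = 0"
proof -
  have "n * (s - u) \<le> 0 \<or> n * (v - s) \<le> 0" using assms by (auto simp: mult_le_0_iff)
  then show "bump n u v s = 0" "bump' n u v s = 0" by (auto simp: bump_def bump'_def sigmoid_simps)
qed

text \<open>The condition \<open>2 \<le> n * (v - u)\<close> keeps the two transition layers on
  different sides of the midpoint, so on each side only one of the two factors varies.\<close>

lemma bump'_sign:
  assumes n: "n > 0" "2 \<le> n * (v - u)"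
  shows "s \<le> (u + v) / 2 \<Longrightarrow> bump' n u v s \<ge> 0" "(u + v) / 2 \<le> s \<Longrightarrow> bump' n u v s \<le> 0"
proof -
  assume "s \<le> (u + v) / 2"
  then have "n * ((v - u) / 2) \<le> n * (v - s)" using n by (intro mult_left_mono) auto
  moreover have "n * ((v - u) / 2) = n * (v - u) / 2" by simp
  ultimately have "1 \<le> n * (v - s)" using n by linarith
  then show "bump' n u v s \<ge> 0"
    using n by (simp add: bump'_def sigmoid_simps sigmoid'_nonneg)
next
  assume "(u + v) / 2 \<le> s"
  then have "n * ((v - u) / 2) \<le> n * (s - u)" using n by (intro mult_left_mono) auto
  moreover have "n * ((v - u) / 2) = n * (v - u) / 2" by simp
  ultimately have "1 \<le> n * (s - u)" using n by linarith
  then show "bump' n u v s \<le> 0"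
    using n by (simp add: bump'_def sigmoid_simps sigmoid'_nonneg)
qed

lemma continuous_on_bump: "continuous_on A (bump n u v)" "continuous_on A (bump' n u v)"
  unfolding bump_def[abs_def] bump'_def[abs_def]
  by (intro continuous_intros continuous_on_compose2[OF continuous_on_sigmoid[of UNIV]]
      continuous_on_compose2[OF continuous_on_sigmoid'[of UNIV]]; simp)+

lemma bump_tendsto:
  "(\<lambda>n. bump (real n) u v s) \<longlonglongrightarrow> indicator {u<..<v} s"
proof (cases "s \<in> {u<..<v}")
  case True
  obtain N where N: "1 / (s - u) < real N" "1 / (v - s) < real N"
    using reals_Archimedean2[of "max (1 / (s - u)) (1 / (v - s))"] by auto
  have "bump (real n) u v s = 1" if "n \<ge> N" for n
  proof -
    have "1 / (s - u) \<le> real n" "1 / (v - s) \<le> real n" using N that by linarith+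
    then have "1 \<le> real n * (s - u)" "1 \<le> real n * (v - s)" using True by (auto simp: field_simps)
    then show ?thesis by (simp add: bump_def sigmoid_simps)
  qed
  then show ?thesis using True by (intro tendsto_eventually) (auto simp: eventually_sequentially)
next
  case False
  have "bump (real n) u v s = 0" for n
  proof (cases "n = 0")
    case True
    then show ?thesis by (simp add: bump_def sigmoid_simps)
  next
    case n: False
    then show ?thesis using False by (intro bump_zero) auto
  qed
  then show ?thesis using False by simp
qed

text \<open>A compact piece \<^term>\<open>k ` {\<alpha>..\<beta>}\<close> of the frontier that is a graph over the tangential axis
  \<^term>\<open>rot_minus_half_pi e\<close>, with slopes bounded by \<^term>\<open>1 / a\<close>.\<close>

locale frontier_graph =
  fixes S :: "plane set" and e :: plane and a \<alpha> \<beta> :: real and k :: "real \<Rightarrow> plane"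
  assumes S: "open S" "convex S" "S \<noteq> {}"
    and e: "norm e = 1" and a: "a > 0" and \<alpha>\<beta>: "\<alpha> < \<beta>"
    and k_cont: "continuous_on {\<alpha>..\<beta>} k"
    and k_inv: "\<And>s. s \<in> {\<alpha>..\<beta>} \<Longrightarrow> k s \<bullet> rot_minus_half_pi e = s"
    and k_frontier: "k ` {\<alpha>..\<beta>} \<subseteq> frontier S"
    and k_normal: "\<And>s n. s \<in> {\<alpha>..\<beta>} \<Longrightarrow> outward_unit_normal S (k s) n \<Longrightarrow> n \<bullet> e \<ge> a"
begin

lemma k_closure: "s \<in> {\<alpha>..\<beta>} \<Longrightarrow> k s \<in> closure S"
  using k_frontier unfolding frontier_def by blast

lemma normal_ex: "s \<in> {\<alpha>..\<beta>} \<Longrightarrow> \<exists>n. outward_unit_normal S (k s) n"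
  using k_frontier outward_unit_normal_exists[OF S(2,1,3), of "k s"] by blast

text \<open>The slope, over the tangential axis, of the support line with normal
  \<open>n\<close>.\<close>

definition slope :: "plane \<Rightarrow> real" where
  "slope n = - (n \<bullet> rot_minus_half_pi e) / (n \<bullet> e)"

text \<open>The length element of a graph of slope \<open>p\<close>.\<close>

definition \<phi> :: "real \<Rightarrow> real" where "\<phi> p = sqrt (1 + p\<^sup>2)"

lemma \<phi>_ge: "\<phi> p \<ge> 1" by (simp add: \<phi>_def)

lemma \<phi>_lip: "\<bar>\<phi> p - \<phi> q\<bar> \<le> \<bar>p - q\<bar>"
proof -
  have n: "\<phi> p = norm (1::real, p)" for p by (simp add: \<phi>_def norm_Pair)
  have "\<bar>norm (1::real, p) - norm (1::real, q)\<bar> \<le> norm ((1::real, p) - (1, q))" by (rule norm_triangle_ineq3)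
  also have "\<dots> = \<bar>p - q\<bar>" by (simp add: norm_Pair)
  finally show ?thesis unfolding n .
qed

lemma normal_frame:
  assumes "s \<in> {\<alpha>..\<beta>}" "outward_unit_normal S (k s) n"
  shows "n \<bullet> e = 1 / \<phi> (slope n)" "n \<bullet> e > 0" "n \<bullet> e \<le> 1"
proof -
  have pos: "n \<bullet> e > 0" using k_normal[OF assms] a by simp
  have "norm n = 1" using assms(2) by (simp add: outward_unit_normal_def)
  then have 1: "(n \<bullet> e)\<^sup>2 + (n \<bullet> rot_minus_half_pi e)\<^sup>2 = 1" using rot_frame_norm[OF e, of n] by simp
  have "1 + (slope n)\<^sup>2 = ((n \<bullet> e)\<^sup>2 + (n \<bullet> rot_minus_half_pi e)\<^sup>2) / (n \<bullet> e)\<^sup>2"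
    using pos by (simp add: slope_def power_divide field_simps)
  also have "\<dots> = (1 / (n \<bullet> e))\<^sup>2" unfolding 1 by (simp add: power_divide)
  finally have "\<phi> (slope n) = 1 / (n \<bullet> e)" using pos by (simp add: \<phi>_def)
  then show "n \<bullet> e = 1 / \<phi> (slope n)" "n \<bullet> e > 0" using pos by auto
  then show "n \<bullet> e \<le> 1" using \<phi>_ge[of "slope n"] by (simp add: divide_le_eq)
qed

text \<open>The support inequality at \<open>k s\<close>, written in the frame and divided by the
  positive number \<open>n \<bullet> e\<close>: the graph is concave and lies below its support
  lines.\<close>

lemma chord_le_slope:
  assumes s: "s \<in> {\<alpha>..\<beta>}" and n: "outward_unit_normal S (k s) n" and t: "t \<in> {\<alpha>..\<beta>}"
  shows "(k t - k s) \<bullet> e \<le> slope n * (t - s)"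
proof -
  have pos: "n \<bullet> e > 0" using normal_frame[OF s n] by simp
  have "k t \<in> closure S" using t by (rule k_closure)
  then have "(k t - k s) \<bullet> n \<le> 0" by (rule normal_le_closure[OF n])
  then have "((k t - k s) \<bullet> e) * (n \<bullet> e) + (t - s) * (n \<bullet> rot_minus_half_pi e) \<le> 0"
    unfolding rot_frame_inner[OF e, of "k t - k s" n] using k_inv[OF s] k_inv[OF t] by (simp add: inner_diff_left)
  then have "((k t - k s) \<bullet> e) * (n \<bullet> e) \<le> (slope n * (t - s)) * (n \<bullet> e)"
  proof -
    have "slope n * (n \<bullet> e) = - (n \<bullet> rot_minus_half_pi e)" using pos by (simp add: slope_def)
    then have "(slope n * (t - s)) * (n \<bullet> e) = - ((t - s) * (n \<bullet> rot_minus_half_pi e))"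
      by (metis mult.assoc mult.commute mult_minus_right)
    then show ?thesis using \<open>(k t - k s) \<bullet> e * (n \<bullet> e) + (t - s) * (n \<bullet> rot_minus_half_pi e) \<le> 0\<close> by linarith
  qed
  then show ?thesis using pos by (simp add: mult_le_cancel_right)
qed

lemma slope_mono:
  assumes "s \<in> {\<alpha>..\<beta>}" "outward_unit_normal S (k s) n" "t \<in> {\<alpha>..\<beta>}" "outward_unit_normal S (k t) m" "s < t"
  shows "slope m * (t - s) \<le> (k t - k s) \<bullet> e" "slope m \<le> slope n"
proof -
  have "(k s - k t) \<bullet> e \<le> slope m * (s - t)" by (rule chord_le_slope[OF assms(3,4,1)])
  then show 1: "slope m * (t - s) \<le> (k t - k s) \<bullet> e" by (simp add: inner_diff_left algebra_simps)
  have "(k t - k s) \<bullet> e \<le> slope n * (t - s)" by (rule chord_le_slope[OF assms(1,2,3)])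
  then have "slope m * (t - s) \<le> slope n * (t - s)" using 1 by linarith
  then show "slope m \<le> slope n" using assms(5) by (simp add: mult_le_cancel_right)
qed

text \<open>A choice among the slopes at each point, which is a real choice only at corners. It acts
  as the derivative of the concave graph: it decreases and bounds the slopes of chords from both
  sides.\<close>

definition P :: "real \<Rightarrow> real" where
  "P s = slope (SOME n. outward_unit_normal S (k s) n)"

lemma P_ex:
  assumes "s \<in> {\<alpha>..\<beta>}" shows "\<exists>n. outward_unit_normal S (k s) n \<and> P s = slope n"
  using someI_ex[OF normal_ex[OF assms]] unfolding P_def by blast

lemma P_anti:
  assumes "\<alpha> \<le> s" "s \<le> t" "t \<le> \<beta>" shows "P t \<le> P s"
proof (cases "s = t")
  case False
  obtain n where n: "outward_unit_normal S (k s) n" "P s = slope n" using P_ex[of s] assms by auto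
  obtain m where m: "outward_unit_normal S (k t) m" "P t = slope m" using P_ex[of t] assms by auto
  show ?thesis using slope_mono(2)[OF _ n(1) _ m(1)] n m assms False by auto
qed simp

text \<open>Open at \<open>\<alpha>\<close> and closed at \<open>\<beta>\<close>, so that it splits
  into disjoint arcs over half-open intervals.\<close>

definition K where "K = k ` {\<alpha><..\<beta>}"

lemma K_ex: "x \<in> K \<Longrightarrow> \<exists>s. s \<in> {\<alpha>..\<beta>} \<and> x = k s"
proof -
  assume "x \<in> K"
  then obtain s where "s \<in> {\<alpha><..\<beta>}" "x = k s" unfolding K_def by blast
  then show ?thesis by (intro exI[of _ s]) auto
qed

lemma k_image_eq:
  assumes "A \<subseteq> {\<alpha>..\<beta>}"
  shows "k ` A = {x \<in> k ` {\<alpha>..\<beta>}. x \<bullet> rot_minus_half_pi e \<in> A}"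
proof (intro equalityI subsetI)
  fix x assume "x \<in> k ` A"
  then obtain s where "s \<in> A" "x = k s" by blast
  then show "x \<in> {x \<in> k ` {\<alpha>..\<beta>}. x \<bullet> rot_minus_half_pi e \<in> A}" using assms k_inv[of s] by auto
next
  fix x assume "x \<in> {x \<in> k ` {\<alpha>..\<beta>}. x \<bullet> rot_minus_half_pi e \<in> A}"
  then obtain s where "s \<in> {\<alpha>..\<beta>}" "x = k s" "k s \<bullet> rot_minus_half_pi e \<in> A" by blast
  then show "x \<in> k ` A" using k_inv[of s] by auto
qed

lemma q_measurable [measurable]: "(\<lambda>x::plane. x \<bullet> rot_minus_half_pi e) \<in> borel_measurable borel"
  by (intro borel_measurable_continuous_onI continuous_intros)

lemma k_image_borel:
  assumes A: "A \<subseteq> {\<alpha>..\<beta>}" "A \<in> sets borel"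
  shows "k ` A \<in> sets borel"
proof -
  have "k ` A = k ` {\<alpha>..\<beta>} \<inter> {x. x \<bullet> rot_minus_half_pi e \<in> A}" using k_image_eq[OF A(1)] by auto
  moreover have "k ` {\<alpha>..\<beta>} \<in> sets borel"
    by (intro borel_compact compact_continuous_image k_cont) simp
  moreover have "{x. x \<bullet> rot_minus_half_pi e \<in> A} \<in> sets borel"
    using measurable_sets[OF q_measurable A(2)] by (simp add: vimage_def)
  ultimately show ?thesis by (simp add: sets.Int)
qed

text \<open>A mean value theorem for the concave graph, with the selected slopes at the two ends in
  place of a derivative.\<close>

lemma chord_slope_bounds:
  assumes "\<alpha> \<le> s" "s < t" "t \<le> \<beta>"
  obtains r where "(k t - k s) \<bullet> e = r * (t - s)" "P t \<le> r" "r \<le> P s"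
proof -
  define r where "r = ((k t - k s) \<bullet> e) / (t - s)"
  obtain n where n: "outward_unit_normal S (k s) n" "P s = slope n" using P_ex[of s] assms by auto
  obtain m where m: "outward_unit_normal S (k t) m" "P t = slope m" using P_ex[of t] assms by auto
  have r: "(k t - k s) \<bullet> e = r * (t - s)" using assms by (simp add: r_def)
  have "slope m * (t - s) \<le> (k t - k s) \<bullet> e" using slope_mono(1)[OF _ n(1) _ m(1)] assms by auto
  moreover have "(k t - k s) \<bullet> e \<le> slope n * (t - s)" using chord_le_slope[OF _ n(1)] assms by auto
  ultimately have "P t \<le> r" "r \<le> P s" unfolding r n m using assms by (auto simp: mult_le_cancel_right)
  then show ?thesis using that r by blast
qed

lemma dist_k:
  assumes "s \<in> {\<alpha>..\<beta>}" "t \<in> {\<alpha>..\<beta>}" "(k t - k s) \<bullet> e = r * (t - s)"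
  shows "norm (k t - k s) = \<phi> r * \<bar>t - s\<bar>"
proof -
  have "(norm (k t - k s))\<^sup>2 = (r * (t - s))\<^sup>2 + (t - s)\<^sup>2"
    using rot_frame_norm[OF e, of "k t - k s"] assms k_inv by (simp add: inner_diff_left)
  also have "\<dots> = (\<phi> r * \<bar>t - s\<bar>)\<^sup>2"
  proof -
    have "(\<phi> r)\<^sup>2 = 1 + r\<^sup>2" by (simp add: \<phi>_def)
    then show ?thesis by (simp add: power_mult_distrib distrib_right)
  qed
  finally show ?thesis by (subst (asm) power2_eq_iff_nonneg) (auto simp: \<phi>_def)
qed

text \<open>From above, \<open>k\<close> expands distances on the axis by at most \<open>C\<close>.
  From below, the orthogonal projection to the chord is a contraction whose image contains an
  interval as long as the chord, and the chord has length \<open>\<phi> r * (t - s)\<close> with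
  \<open>r\<close> between the slopes at the ends.\<close>

lemma hausdorff1_arc_bounds:
  assumes st: "\<alpha> \<le> s" "s < t" "t \<le> \<beta>" and lo: "\<And>p. P t \<le> p \<Longrightarrow> p \<le> P s \<Longrightarrow> c \<le> \<phi> p" and hi: "\<And>p. P t \<le> p \<Longrightarrow> p \<le> P s \<Longrightarrow> \<phi> p \<le> C"
  shows "hausdorff1_outer (k ` {s<..t}) \<le> ennreal (C * (t - s))" "ennreal (c * (t - s)) \<le> hausdorff1_outer (k ` {s<..t})"
proof -
  have C: "C \<ge> 0" using hi[of "P t"] \<phi>_ge[of "P t"] P_anti[of s t] st by auto
  show "hausdorff1_outer (k ` {s<..t}) \<le> ennreal (C * (t - s))"
  proof (rule hausdorff1_outer_le_expanding[where q="\<lambda>x. x \<bullet> rot_minus_half_pi e"])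
    show "(\<lambda>x. x \<bullet> rot_minus_half_pi e) ` k ` {s<..t} \<subseteq> {s..t}" using k_inv st by auto
    have *: "dist (k u) (k v) \<le> C * \<bar>u - v\<bar>" if uv: "s < u" "u < v" "v \<le> t" for u v
    proof -
      obtain r where r: "(k v - k u) \<bullet> e = r * (v - u)" "P v \<le> r" "r \<le> P u"
        using chord_slope_bounds[of u v] uv st by auto
      have "P t \<le> r" "r \<le> P s" using r P_anti[of v t] P_anti[of s u] uv st by auto
      then have "\<phi> r \<le> C" by (rule hi)
      then have "\<phi> r * \<bar>v - u\<bar> \<le> C * \<bar>v - u\<bar>" by (intro mult_right_mono) auto
      then show ?thesis using dist_k[OF _ _ r(1)] uv st by (auto simp: dist_norm norm_minus_commute abs_minus_commute)
    qed
    fix x y assume "x \<in> k ` {s<..t}" "y \<in> k ` {s<..t}"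
    then obtain u v where uv: "u \<in> {s<..t}" "v \<in> {s<..t}" "x = k u" "y = k v" by auto
    have "dist (k u) (k v) \<le> C * \<bar>u - v\<bar>"
      using uv *[of u v] *[of v u] by (cases u v rule: linorder_cases) (auto simp: dist_commute abs_minus_commute)
    then show "dist x y \<le> C * \<bar>x \<bullet> rot_minus_half_pi e - y \<bullet> rot_minus_half_pi e\<bar>"
      using uv st k_inv[of u] k_inv[of v] by auto
  qed (use C st in auto)
  obtain r where r: "(k t - k s) \<bullet> e = r * (t - s)" "P t \<le> r" "r \<le> P s"
    using chord_slope_bounds[of s t] st by auto
  have len: "norm (k t - k s) = \<phi> r * (t - s)" using dist_k[OF _ _ r(1)] st by auto
  define u where "u = sgn (k t - k s)"
  have nz: "k t \<noteq> k s"
  proof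
    assume "k t = k s"
    with k_inv[of s] k_inv[of t] st show False by auto
  qed
  have u: "norm u = 1" using nz by (simp add: u_def norm_sgn)
  have diff: "(k t - k s) \<bullet> u = norm (k t - k s)"
    using nz by (simp add: u_def sgn_div_norm power2_norm_eq_inner[symmetric] power2_eq_square)
  have "ennreal (k t \<bullet> u - k s \<bullet> u) \<le> hausdorff1_outer (k ` {s<..t})"
  proof (rule le_hausdorff1_outer_contracting[where \<zeta>="\<lambda>x. x \<bullet> u"])
    show "\<bar>x \<bullet> u - y \<bullet> u\<bar> \<le> dist x y" for x y
      using Cauchy_Schwarz_ineq2[of "x - y" u] u by (simp add: dist_norm inner_diff_left)
    show "k s \<bullet> u \<le> k t \<bullet> u" using diff by (simp add: inner_diff_left) (metis norm_ge_zero diff_ge_0_iff_ge)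
    show "{k s \<bullet> u<..k t \<bullet> u} \<subseteq> (\<lambda>x. x \<bullet> u) ` k ` {s<..t}"
    proof
      fix y assume y: "y \<in> {k s \<bullet> u<..k t \<bullet> u}"
      have "continuous_on {s..t} (\<lambda>r. k r \<bullet> u)"
        using st by (intro continuous_intros continuous_on_subset[OF k_cont]) auto
      then obtain r where r: "r \<ge> s" "r \<le> t" "k r \<bullet> u = y" using IVT'[of "\<lambda>r. k r \<bullet> u" s y t] y st by auto
      then have "r \<noteq> s" using y by auto
      then show "y \<in> (\<lambda>x. x \<bullet> u) ` k ` {s<..t}" using r by force
    qed
  qed
  moreover have "c * (t - s) \<le> k t \<bullet> u - k s \<bullet> u"
  proof -
    have "c * (t - s) \<le> \<phi> r * (t - s)" using lo[OF r(2,3)] st by (intro mult_right_mono) auto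
    then show ?thesis using diff len by (simp add: inner_diff_left)
  qed
  ultimately show "ennreal (c * (t - s)) \<le> hausdorff1_outer (k ` {s<..t})"
    by (meson ennreal_leI order_trans)
qed

definition corners where
  "corners = {x \<in> closure S. \<exists>n n'. n \<noteq> n' \<and> outward_unit_normal S x n \<and> outward_unit_normal S x n'}"

lemma countable_corners': "countable corners"
  unfolding corners_def by (rule countable_corners[OF S(1,3)])

text \<open>The value 0 is assigned at corners, where \<open>unit_normal\<close> is unspecified;
  they are countable and have length 0.\<close>

definition \<nu> :: "plane \<Rightarrow> real" where
  "\<nu> x = (if x \<in> K - corners then unit_normal S x \<bullet> e else 0)"

lemma normal_noncorner:
  assumes "s \<in> {\<alpha>..\<beta>}" "k s \<notin> corners"
  shows "outward_unit_normal S (k s) (unit_normal S (k s))"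
proof -
  obtain n where n: "outward_unit_normal S (k s) n" using normal_ex[OF assms(1)] by blast
  have "k s \<in> closure S" using assms(1) by (rule k_closure)
  then have "n' = n" if "outward_unit_normal S (k s) n'" for n'
    using assms(2) n that unfolding corners_def by blast
  then show ?thesis using unit_normal_eqI[OF n] n by metis
qed

lemma \<nu>_bounds: "0 \<le> \<nu> x" "\<nu> x \<le> 1"
proof -
  have "0 \<le> \<nu> x \<and> \<nu> x \<le> 1"
  proof (cases "x \<in> K - corners")
    case True
    then obtain s where "s \<in> {\<alpha>..\<beta>}" "x = k s" using K_ex by blast
    then show ?thesis using normal_frame(2,3)[OF _ normal_noncorner[of s]] True by (auto simp: \<nu>_def intro: less_imp_le)
  qed (auto simp: \<nu>_def)
  then show "0 \<le> \<nu> x" "\<nu> x \<le> 1" by auto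
qed

lemma K_borel [measurable]: "K \<in> sets borel"
  unfolding K_def by (intro k_image_borel) auto

lemma corners_borel [measurable]: "corners \<in> sets borel"
proof -
  have "(\<Union>x\<in>corners. {x}) \<in> sets borel" using countable_corners' by (intro sets.countable_UN') auto
  then show ?thesis by simp
qed

text \<open>The points that have a normal with \<open>e\<close>-component at least \<open>b\<close>
  form a closed set, and on \<open>K\<close> off the corners that normal is
  \<open>unit_normal\<close>.\<close>

lemma \<nu>_measurable [measurable]: "\<nu> \<in> borel_measurable borel"
proof (subst borel_measurable_iff_ge, intro allI)
  fix b :: real
  show "{x \<in> space borel. b \<le> \<nu> x} \<in> sets borel"
  proof (cases "b \<le> 0")
    case True
    then have "{x \<in> space borel. b \<le> \<nu> x} = UNIV" using \<nu>_bounds(1) order_trans by auto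
    then show ?thesis by simp
  next
    case False
    have "{x \<in> space borel. b \<le> \<nu> x} = (K - corners) \<inter> {x. \<exists>n. outward_unit_normal S x n \<and> 1 * (n \<bullet> e) \<ge> b}"
    proof (intro equalityI subsetI)
      fix x assume "x \<in> {x \<in> space borel. b \<le> \<nu> x}"
      then have x: "x \<in> K - corners" "b \<le> unit_normal S x \<bullet> e" using False by (auto simp: \<nu>_def split: if_splits)
      then obtain s where "s \<in> {\<alpha>..\<beta>}" "x = k s" using K_ex by blast
      then show "x \<in> (K - corners) \<inter> {x. \<exists>n. outward_unit_normal S x n \<and> 1 * (n \<bullet> e) \<ge> b}"
        using normal_noncorner[of s] x by auto
    next
      fix x assume x: "x \<in> (K - corners) \<inter> {x. \<exists>n. outward_unit_normal S x n \<and> 1 * (n \<bullet> e) \<ge> b}"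
      then obtain n where n: "outward_unit_normal S x n" "n \<bullet> e \<ge> b" by auto
      obtain s where s: "s \<in> {\<alpha>..\<beta>}" "x = k s" using x K_ex by blast
      have "x \<in> closure S" using s k_closure by blast
      then have "unit_normal S x = n" using normal_noncorner[of s] x s n unfolding corners_def by auto
      then show "x \<in> {x \<in> space borel. b \<le> \<nu> x}" using x n by (auto simp: \<nu>_def)
    qed
    moreover have "{x. \<exists>n. outward_unit_normal S x n \<and> 1 * (n \<bullet> e) \<ge> b} \<in> sets borel"
      by (rule borel_closed[OF closed_normal_points])
    ultimately show ?thesis by simp
  qed
qed

context
  assumes H: "\<And>A. A \<in> sets borel \<Longrightarrow> emeasure hausdorff1 A = hausdorff1_outer A"
begin

lemma AE_noncorner: "AE x in hausdorff1. x \<notin> corners"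
proof (rule AE_not_in)
  have "emeasure hausdorff1 corners = 0"
    using H[of corners] hausdorff1_outer_countable[OF countable_corners'] by simp
  then show "corners \<in> null_sets hausdorff1" by (simp add: null_sets_def)
qed

text \<open>The length element of the graph is \<open>ds / (n \<bullet> e)\<close>, so this projection is Lebesgue measure; this lets the
  boundary integral in \<^const>\<open>tangential_derivative\<close> be computed without a parametrization by arc length.\<close>

definition m1 where "m1 = distr (density hausdorff1 (\<lambda>x. ennreal (\<nu> x))) borel (\<lambda>x. x \<bullet> rot_minus_half_pi e)"

lemma q_measurable' [measurable]: "(\<lambda>x. x \<bullet> rot_minus_half_pi e) \<in> borel_measurable hausdorff1"
  using q_measurable by (simp cong: measurable_cong_sets)

lemma m1_eq: "A \<in> sets borel \<Longrightarrow> emeasure m1 A = (\<integral>\<^sup>+x. ennreal (\<nu> x) * indicator A (x \<bullet> rot_minus_half_pi e) \<partial>hausdorff1)"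
proof -
  assume [measurable]: "A \<in> sets borel"
  have "emeasure m1 A = (\<integral>\<^sup>+x. indicator A x \<partial>m1)" by (simp add: m1_def)
  also have "\<dots> = (\<integral>\<^sup>+x. indicator A (x \<bullet> rot_minus_half_pi e) \<partial>density hausdorff1 (\<lambda>x. ennreal (\<nu> x)))"
    unfolding m1_def by (rule nn_integral_distr) auto
  also have "\<dots> = (\<integral>\<^sup>+x. ennreal (\<nu> x) * indicator A (x \<bullet> rot_minus_half_pi e) \<partial>hausdorff1)"
    by (rule nn_integral_density) auto
  finally show ?thesis .
qed

text \<open>\<open>\<omega>\<close> is the turn of the slope along the arc. The length of the arc
  per unit of the axis lies between \<open>lo\<close> and \<open>hi\<close>, \<open>\<nu>\<close>
  lies between their inverses, and \<open>hi - lo \<le> 2 * \<omega>\<close>; as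
  \<open>lo \<ge> 1\<close>, the quotients \<open>hi / lo\<close> and \<open>lo / hi\<close> differ
  from 1 by at most \<open>2 * \<omega>\<close>.\<close>

lemma m1_arc:
  assumes st: "\<alpha> \<le> s" "s < t" "t \<le> \<beta>"
  shows "emeasure m1 {s<..t} \<le> ennreal ((1 + 2 * (P s - P t)) * (t - s))"
    "ennreal ((1 - 2 * (P s - P t)) * (t - s)) \<le> emeasure m1 {s<..t}"
proof -
  define \<omega> where "\<omega> = P s - P t"
  have \<omega>: "\<omega> \<ge> 0" using P_anti[of s t] st by (simp add: \<omega>_def)
  define lo where "lo = max 1 (\<phi> (P s) - \<omega>)"
  define hi where "hi = \<phi> (P s) + \<omega>"
  have lh: "1 \<le> lo" "1 \<le> hi" "hi \<le> lo + 2 * \<omega>" using \<omega> \<phi>_ge[of "P s"] by (auto simp: lo_def hi_def)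
  have rng: "lo \<le> \<phi> p" "\<phi> p \<le> hi" if "P t \<le> p" "p \<le> P s" for p
    using \<phi>_lip[of p "P s"] \<phi>_ge[of p] that by (auto simp: lo_def hi_def \<omega>_def)
  define K' where "K' = k ` {s<..t}"
  have K' [measurable]: "K' \<in> sets borel" unfolding K'_def using st by (intro k_image_borel) auto
  have K'eq: "x \<in> K' \<longleftrightarrow> x \<in> K \<and> x \<bullet> rot_minus_half_pi e \<in> {s<..t}" for x
    unfolding K'_def K_def using k_inv st by auto
  have "hausdorff1_outer K' \<le> ennreal (hi * (t - s))" "ennreal (lo * (t - s)) \<le> hausdorff1_outer K'"
    unfolding K'_def using hausdorff1_arc_bounds[OF st, of lo hi] rng by auto
  then have HK: "emeasure hausdorff1 K' \<le> ennreal (hi * (t - s))" "ennreal (lo * (t - s)) \<le> emeasure hausdorff1 K'"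
    using H[OF K'] by auto
  have \<nu>b: "1 / hi \<le> \<nu> x" "\<nu> x \<le> 1 / lo" if x: "x \<in> K'" "x \<notin> corners" for x
  proof -
    obtain r where r: "r \<in> {s<..t}" "x = k r" using x by (auto simp: K'_def)
    have n: "outward_unit_normal S (k r) (unit_normal S (k r))" using normal_noncorner[of r] r x st by auto
    have "slope (unit_normal S (k r)) \<le> P s"
    proof -
      obtain n where n': "outward_unit_normal S (k s) n" "P s = slope n" using P_ex[of s] st by auto
      show ?thesis using slope_mono(2)[OF _ n'(1) _ n] n' r st by auto
    qed
    moreover have "P t \<le> slope (unit_normal S (k r))"
    \<comment> \<open>\<open>slope_mono\<close> compares slopes at different points only. For
      \<open>r = t\<close> the point is not a corner, so the two normals are the same.\<close>
    proof (cases "r = t")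
      case True
      then have "P t = slope (unit_normal S (k r))"
      proof -
        obtain n' where n': "outward_unit_normal S (k t) n'" "P t = slope n'" using P_ex[of t] st by auto
        have "k r \<in> closure S" using r st by (intro k_closure) auto
        then have "n' = unit_normal S (k r)" using n n' x r True unfolding corners_def by auto
        then show ?thesis using n' by simp
      qed
      then show ?thesis by simp
    next
      case False
      obtain n' where n': "outward_unit_normal S (k t) n'" "P t = slope n'" using P_ex[of t] st by auto
      show ?thesis using slope_mono(2)[OF _ n _ n'(1)] n' r st False by auto
    qed
    ultimately have "lo \<le> \<phi> (slope (unit_normal S (k r)))" "\<phi> (slope (unit_normal S (k r))) \<le> hi" using rng by auto
    moreover have "\<nu> x = 1 / \<phi> (slope (unit_normal S (k r)))"
      using normal_frame(1)[OF _ n] r st x K'eq[of x] by (auto simp: \<nu>_def)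
    ultimately show "1 / hi \<le> \<nu> x" "\<nu> x \<le> 1 / lo" using lh by (auto intro!: divide_left_mono mult_pos_pos)
  qed
  have 0: "emeasure m1 {s<..t} = (\<integral>\<^sup>+x. ennreal (\<nu> x) * indicator K' x \<partial>hausdorff1)"
  proof -
    have "ennreal (\<nu> x) * indicator {s<..t} (x \<bullet> rot_minus_half_pi e) = ennreal (\<nu> x) * indicator K' x" for x
      using K'eq[of x] by (auto simp: \<nu>_def indicator_def)
    then show ?thesis by (simp add: m1_eq)
  qed
  have "(\<integral>\<^sup>+x. ennreal (\<nu> x) * indicator K' x \<partial>hausdorff1) \<le> (\<integral>\<^sup>+x. ennreal (1 / lo) * indicator K' x \<partial>hausdorff1)"
    by (rule nn_integral_mono_AE, rule AE_mp[OF AE_noncorner], intro AE_I2 impI)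
       (use \<nu>b in \<open>auto simp: indicator_def intro!: ennreal_leI\<close>)
  also have "\<dots> = ennreal (1 / lo) * emeasure hausdorff1 K'" by (rule nn_integral_cmult_indicator) simp
  also have "\<dots> \<le> ennreal (1 / lo) * ennreal (hi * (t - s))" by (intro mult_left_mono HK) simp
  also have "\<dots> = ennreal (hi / lo * (t - s))" using lh st by (simp add: ennreal_mult'[symmetric])
  also have "\<dots> \<le> ennreal ((1 + 2 * \<omega>) * (t - s))"
  proof (intro ennreal_leI mult_right_mono)
    have "lo + 2 * \<omega> \<le> lo * (1 + 2 * \<omega>)" using lh(1) \<omega> mult_right_mono[of 1 lo "2 * \<omega>"] by (simp add: algebra_simps)
    then have "hi \<le> (1 + 2 * \<omega>) * lo" using lh(3) by (simp add: mult.commute)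
    then show "hi / lo \<le> 1 + 2 * \<omega>" using lh by (simp add: pos_divide_le_eq)
  qed (use st in simp)
  finally show "emeasure m1 {s<..t} \<le> ennreal ((1 + 2 * (P s - P t)) * (t - s))" unfolding 0 \<omega>_def .
  have "ennreal ((1 - 2 * \<omega>) * (t - s)) \<le> ennreal (lo / hi * (t - s))"
  proof (intro ennreal_leI mult_right_mono)
    have "hi - 2 * \<omega> * hi \<le> lo" using lh \<omega> mult_left_mono[of 1 hi "2 * \<omega>"] by simp
    then have "(1 - 2 * \<omega>) * hi \<le> lo" by (simp add: algebra_simps)
    then show "1 - 2 * \<omega> \<le> lo / hi" using lh by (simp add: pos_le_divide_eq)
  qed (use st in simp)
  also have "\<dots> = ennreal (1 / hi) * ennreal (lo * (t - s))" using lh st by (simp add: ennreal_mult'[symmetric])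
  also have "\<dots> \<le> ennreal (1 / hi) * emeasure hausdorff1 K'" by (intro mult_left_mono HK) simp
  also have "\<dots> = (\<integral>\<^sup>+x. ennreal (1 / hi) * indicator K' x \<partial>hausdorff1)" by (rule nn_integral_cmult_indicator[symmetric]) simp
  also have "\<dots> \<le> (\<integral>\<^sup>+x. ennreal (\<nu> x) * indicator K' x \<partial>hausdorff1)"
    by (rule nn_integral_mono_AE, rule AE_mp[OF AE_noncorner], intro AE_I2 impI)
       (use \<nu>b in \<open>auto simp: indicator_def intro!: ennreal_leI\<close>)
  finally show "ennreal ((1 - 2 * (P s - P t)) * (t - s)) \<le> emeasure m1 {s<..t}" unfolding 0 \<omega>_def .
qed

text \<open>Over \<open>{u<..v}\<close> the deviation of \<open>m1\<close> from Lebesgue measure is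
  at most \<open>2 * (P u - P v) * (v - u)\<close>, a product of two increments, and
  \<open>telescoping_constant\<close> makes it vanish.\<close>

lemma m1_eq_lborel: "m1 = density lborel (indicator {\<alpha>..\<beta>})"
proof -
  have conc: "emeasure m1 A = emeasure m1 (A \<inter> {\<alpha><..\<beta>})" if [measurable]: "A \<in> sets borel" for A
  proof -
    have "ennreal (\<nu> x) * indicator A (x \<bullet> rot_minus_half_pi e) = ennreal (\<nu> x) * indicator (A \<inter> {\<alpha><..\<beta>}) (x \<bullet> rot_minus_half_pi e)" for x
    proof (cases "x \<in> K")
      case True
      then have "x \<bullet> rot_minus_half_pi e \<in> {\<alpha><..\<beta>}" using k_inv by (auto simp: K_def)
      then show ?thesis by (simp add: indicator_def)
    qed (simp add: \<nu>_def)
    then show ?thesis by (simp add: m1_eq)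
  qed
  have fin: "emeasure m1 {\<alpha><..\<beta>} < \<infinity>" using m1_arc(1)[of \<alpha> \<beta>] \<alpha>\<beta> by (simp add: order_le_less_trans)
  have "emeasure m1 UNIV < \<infinity>" using fin conc[of UNIV] by simp
  then interpret m1: finite_measure m1 by (intro finite_measureI) (simp add: m1_def)
  have Ioc: "emeasure m1 {s<..\<beta>} = ennreal (\<beta> - s)" if s: "\<alpha> \<le> s" "s \<le> \<beta>" for s
  proof -
    define D where "D t = measure m1 {s<..t} - (t - s)" for t
    have "D \<beta> = D s"
    proof (rule telescoping_constant[where D=D and P=P and c=2 and \<alpha>=s and \<beta>=\<beta>])
      fix u v assume uv: "s \<le> u" "u < v" "v \<le> \<beta>"
      have "measure m1 {s<..v} = measure m1 {s<..u} + measure m1 {u<..v}"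
        using uv by (subst m1.finite_measure_Union[symmetric]) (auto simp: m1_def intro!: arg_cong[where f="measure _"])
      then have "D v - D u = measure m1 {u<..v} - (v - u)" by (simp add: D_def)
      moreover have \<omega>: "P u - P v \<ge> 0" using P_anti[of u v] uv s by auto
      moreover have "measure m1 {u<..v} \<le> (1 + 2 * (P u - P v)) * (v - u)"
        using m1_arc(1)[of u v] uv s \<omega> by (simp add: m1.emeasure_eq_measure ennreal_le_iff)
      moreover have "(1 - 2 * (P u - P v)) * (v - u) \<le> measure m1 {u<..v}"
        using m1_arc(2)[of u v] uv s by (simp add: m1.emeasure_eq_measure ennreal_le_iff2) (smt (verit) measure_nonneg)
      ultimately show "\<bar>D v - D u\<bar> \<le> 2 * (P u - P v) * (v - u)" by (simp add: algebra_simps abs_le_iff)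
    qed (use s P_anti in auto)
    then have "measure m1 {s<..\<beta>} = \<beta> - s" by (simp add: D_def)
    then show ?thesis by (simp add: m1.emeasure_eq_measure)
  qed
  show ?thesis
  proof (rule measure_eqI_lessThan)
    fix x :: real
    show "emeasure m1 {x<..} < \<infinity>" by (simp add: m1.emeasure_eq_measure)
    have 2: "emeasure (density lborel (indicator {\<alpha>..\<beta>})) {x<..} = emeasure lborel ({\<alpha>..\<beta>} \<inter> {x<..})"
    proof -
      have "emeasure (density lborel (indicator {\<alpha>..\<beta>})) {x<..} = (\<integral>\<^sup>+y. indicator {\<alpha>..\<beta>} y * indicator {x<..} y \<partial>lborel)"
        by (rule emeasure_density) auto
      also have "\<dots> = (\<integral>\<^sup>+y. indicator ({\<alpha>..\<beta>} \<inter> {x<..}) y \<partial>lborel)" by (intro nn_integral_cong) (auto simp: indicator_def)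
      finally show ?thesis by simp
    qed
    consider "x < \<alpha>" | "\<alpha> \<le> x" "x \<le> \<beta>" | "\<beta> < x" by linarith
    then show "emeasure m1 {x<..} = emeasure (density lborel (indicator {\<alpha>..\<beta>})) {x<..}"
    proof cases
      case 1
      then have "{x<..} \<inter> {\<alpha><..\<beta>} = {\<alpha><..\<beta>}" "{\<alpha>..\<beta>} \<inter> {x<..} = {\<alpha>..\<beta>}" by auto
      then show ?thesis using conc[of "{x<..}"] Ioc[of \<alpha>] \<alpha>\<beta> 2 by simp
    next
      case c: 2
      then have "{x<..} \<inter> {\<alpha><..\<beta>} = {x<..\<beta>}" "{\<alpha>..\<beta>} \<inter> {x<..} = {x<..\<beta>}" by auto
      then show ?thesis using conc[of "{x<..}"] Ioc[of x] c 2 by simp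
    next
      case 3
      then have "{x<..} \<inter> {\<alpha><..\<beta>} = {}" "{\<alpha>..\<beta>} \<inter> {x<..} = {}" by auto
      then show ?thesis using conc[of "{x<..}"] 2 by simp
    qed
  qed (simp_all add: m1_def)
qed

lemma integral_\<nu>:
  fixes f :: "real \<Rightarrow> real"
  assumes [measurable]: "f \<in> borel_measurable borel"
  shows "(LINT x|hausdorff1. \<nu> x * f (x \<bullet> rot_minus_half_pi e)) = (LINT s:{\<alpha>..\<beta>}|lborel. f s)"
    "set_integrable lborel {\<alpha>..\<beta>} f \<Longrightarrow> integrable hausdorff1 (\<lambda>x. \<nu> x * f (x \<bullet> rot_minus_half_pi e))"
proof -
  have [measurable]: "\<nu> \<in> borel_measurable hausdorff1" using \<nu>_measurable by (simp cong: measurable_cong_sets)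
  have d: "density lborel (indicator {\<alpha>..\<beta>}) = density lborel (\<lambda>s. ennreal (indicator {\<alpha>..\<beta>} s))"
    by (rule density_cong) (auto simp: indicator_def)
  have "(LINT x|hausdorff1. \<nu> x * f (x \<bullet> rot_minus_half_pi e)) = (LINT x|density hausdorff1 (\<lambda>x. ennreal (\<nu> x)). f (x \<bullet> rot_minus_half_pi e))"
    by (subst integral_density) (auto simp: \<nu>_bounds)
  also have "\<dots> = (LINT s|m1. f s)" unfolding m1_def by (subst integral_distr) auto
  also have "\<dots> = (LINT s|lborel. indicator {\<alpha>..\<beta>} s *\<^sub>R f s)"
    unfolding m1_eq_lborel d by (subst integral_density) auto
  finally show "(LINT x|hausdorff1. \<nu> x * f (x \<bullet> rot_minus_half_pi e)) = (LINT s:{\<alpha>..\<beta>}|lborel. f s)"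
    by (simp add: set_lebesgue_integral_def)
  assume "set_integrable lborel {\<alpha>..\<beta>} f"
  then have "integrable m1 f"
    unfolding m1_eq_lborel d set_integrable_def by (subst integrable_density) auto
  then have "integrable (density hausdorff1 (\<lambda>x. ennreal (\<nu> x))) (\<lambda>x. f (x \<bullet> rot_minus_half_pi e))"
    unfolding m1_def by (subst (asm) integrable_distr_eq) auto
  then show "integrable hausdorff1 (\<lambda>x. \<nu> x * f (x \<bullet> rot_minus_half_pi e))"
    by (subst (asm) integrable_density) (auto simp: \<nu>_bounds)
qed

end

end

lemma annulus_frontier:
  assumes "annulus_data Op Om"
  shows "frontier (annulus Op Om) = frontier Op \<union> frontier Om" "frontier Op \<inter> frontier Om = {}"
proof -
  have o: "open Op" "open Om" and cl: "closure Om \<subseteq> Op" and cv: "convex Om"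
    using assms by (auto simp: annulus_data_def strictly_convex_def)
  have fp: "frontier Op = closure Op - Op" and fm: "frontier Om = closure Om - Om"
    using o by (auto simp: frontier_def interior_open)
  show "frontier Op \<inter> frontier Om = {}" unfolding fp fm using cl by auto
  have oA: "open (annulus Op Om)" unfolding annulus_def using o by auto
  have fA: "frontier (annulus Op Om) = closure (annulus Op Om) - annulus Op Om"
    using oA by (simp add: frontier_def interior_open)
  \<comment> \<open>Convexity excludes slits: a neighbourhood of a point of the inner frontier is
    never contained in \<open>closure Om\<close>.\<close>
  have intcl: "interior (closure Om) = Om" using cv o by (simp add: convex_interior_closure interior_open)
  show "frontier (annulus Op Om) = frontier Op \<union> frontier Om"
  proof (intro equalityI subsetI)
    fix x assume x: "x \<in> frontier (annulus Op Om)"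
    have "x \<in> closure Op" using x 
    proof -
      have "closure (annulus Op Om) \<subseteq> closure Op" unfolding annulus_def by (intro closure_mono) auto
      then show ?thesis using x fA by blast
    qed
    moreover have "x \<notin> Om"
    proof
      assume "x \<in> Om"
      moreover have "Om \<inter> annulus Op Om = {}" unfolding annulus_def using closure_subset by auto
      ultimately show False using x o(2) unfolding fA by (metis DiffD1 IntI closure_iff_nhds_not_empty empty_iff inf_commute open_Int_closure_eq_empty)
    qed
    moreover have "x \<notin> Op \<or> x \<in> closure Om" 
    proof -
      have "x \<notin> annulus Op Om" using x fA by blast
      then show ?thesis unfolding annulus_def by blast
    qed
    ultimately show "x \<in> frontier Op \<union> frontier Om" unfolding fp fm by auto
  next
    fix x assume "x \<in> frontier Op \<union> frontier Om"
    then consider "x \<in> frontier Op" | "x \<in> frontier Om" by auto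
    then show "x \<in> frontier (annulus Op Om)"
    proof cases
      case 1
      then have x: "x \<in> closure Op" "x \<notin> Op" unfolding fp by auto
      have "x \<in> closure (annulus Op Om)"
        unfolding closure_iff_nhds_not_empty
      proof (intro allI impI)
        fix A V assume V: "V \<subseteq> A" "open V" "x \<in> V"
        have "x \<in> V - closure Om" "open (V - closure Om)" using V x cl by auto
        then have "Op \<inter> (V - closure Om) \<noteq> {}" using x(1) by (metis closure_iff_nhds_not_empty order_refl)
        then show "annulus Op Om \<inter> A \<noteq> {}" using V unfolding annulus_def by auto
      qed
      moreover have "x \<notin> annulus Op Om" using x unfolding annulus_def by blast
      ultimately show ?thesis using fA by blast
    next
      case 2
      then have x: "x \<in> closure Om" "x \<notin> Om" unfolding fm by auto
      have "x \<in> closure (annulus Op Om)"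
        unfolding closure_iff_nhds_not_empty
      proof (intro allI impI)
        fix A V assume V: "V \<subseteq> A" "open V" "x \<in> V"
        have "open (V \<inter> Op)" "x \<in> V \<inter> Op" using V x cl o by auto
        then have "\<not> V \<inter> Op \<subseteq> closure Om" using x(2) intcl interior_maximal by blast
        then show "annulus Op Om \<inter> A \<noteq> {}" using V unfolding annulus_def by auto
      qed
      moreover have "x \<notin> annulus Op Om" using x unfolding annulus_def by blast
      ultimately show ?thesis using fA by blast
    qed
  qed
qed

section \<open>Testing the tangential derivative with bumps\<close>

context frontier_graph
begin

abbreviation q where "q x \<equiv> x \<bullet> rot_minus_half_pi e"

text \<open>Up to a multiple of \<open>n \<bullet> e\<close>, the tangential derivative of the bump is \<^const>\<open>bump'\<close>, which changes sign at the
  midpoint of \<open>u\<close> and \<open>v\<close>, just as \<open>g\<close> minus its value there does.\<close>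

lemma test_inequality:
  assumes H: "\<And>A. A \<in> sets borel \<Longrightarrow> emeasure hausdorff1 A = hausdorff1_outer A"
    and data: "annulus_data Op Om" and td: "tangential_derivative Op Om g fp fm"
    and g_int: "integrable (boundary_measure (annulus Op Om)) g"
    and sg: "S = Op \<and> sg = 1 \<or> S = Om \<and> sg = -1"
    and R: "0 < R1" "R1 < R0" and KR: "\<And>s. s \<in> {\<alpha>..\<beta>} \<Longrightarrow> dist (k s) x0 \<le> R1"
    and other: "\<And>x. x \<in> frontier Op \<union> frontier Om \<Longrightarrow> dist x x0 < R0 \<Longrightarrow> x \<in> frontier S"
    and near: "\<And>x n. x \<in> frontier S \<Longrightarrow> dist x x0 < R0 \<Longrightarrow> outward_unit_normal S x n \<Longrightarrow> n \<bullet> e \<ge> a"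
    and mono: "\<And>s t. \<alpha> \<le> s \<Longrightarrow> s \<le> t \<Longrightarrow> t \<le> \<beta> \<Longrightarrow> \<delta> * g (k s) \<le> \<delta> * g (k t)"
    and uv: "\<alpha> \<le> u" "u < v" "v \<le> \<beta>" and n: "n > 0" "2 \<le> n * (v - u)"
  shows "0 \<le> \<delta> * sg * ((LINT x|fp. indicator K x * bump n u v (q x)) - (LINT x|fm. indicator K x * bump n u v (q x)))"
proof -
  define c where "c = R0\<^sup>2 - R1\<^sup>2"
  have c: "c > 0" using R by (simp add: c_def power_strict_mono)
  define f where "f = rot_minus_half_pi e"
  \<comment> \<open>A radial cutoff: \<open>arg\<close> is at most 0 from distance \<open>R0\<close>
    on and at least 1 up to distance \<open>R1\<close>, so composing it with \<open>sigmoid\<close>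
    localizes the bump near \<open>x0\<close> without changing it on the graph.\<close>
  define arg where "arg z = (R0\<^sup>2 - (z - x0) \<bullet> (z - x0)) / c" for z
  define ph where "ph z = bump n u v (z \<bullet> f) * sigmoid (arg z)" for z
  define G where "G z = (bump' n u v (z \<bullet> f) * sigmoid (arg z)) *\<^sub>R f
     + (bump n u v (z \<bullet> f) * sigmoid' (arg z) * (- 2 / c)) *\<^sub>R (z - x0)" for z
  have far: "sigmoid (arg z) = 0" "sigmoid' (arg z) = 0" if "R0 \<le> dist z x0" for z
  proof -
    have "R0\<^sup>2 \<le> (dist z x0)\<^sup>2" using that R by (intro power_mono) auto
    then have "arg z \<le> 0" using c by (simp add: arg_def dist_norm power2_norm_eq_inner divide_le_0_iff)
    then show "sigmoid (arg z) = 0" "sigmoid' (arg z) = 0" by (auto simp: sigmoid_simps)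
  qed
  have inn: "sigmoid (arg z) = 1" "sigmoid' (arg z) = 0" if "dist z x0 \<le> R1" for z
  proof -
    have "(dist z x0)\<^sup>2 \<le> R1\<^sup>2" using that by (intro power_mono) auto
    then have "arg z \<ge> 1" using c by (simp add: arg_def dist_norm power2_norm_eq_inner le_divide_eq c_def)
    then show "sigmoid (arg z) = 1" "sigmoid' (arg z) = 0" by (auto simp: sigmoid_simps)
  qed
  have contarg: "continuous_on A arg" for A unfolding arg_def using c by (intro continuous_intros) auto
  have C1: "C1_closure (annulus Op Om) ph G"
    unfolding C1_closure_def
  proof (intro conjI ballI)
    show "continuous_on (closure (annulus Op Om)) ph"
      unfolding ph_def
      by (intro continuous_intros continuous_on_compose2[OF continuous_on_bump(1)[of UNIV]]
          continuous_on_compose2[OF continuous_on_sigmoid[of UNIV]] contarg) auto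
    show "continuous_on (closure (annulus Op Om)) G"
      unfolding G_def
      by (intro continuous_intros continuous_on_compose2[OF continuous_on_bump(1)[of UNIV]]
          continuous_on_compose2[OF continuous_on_bump(2)[of UNIV]]
          continuous_on_compose2[OF continuous_on_sigmoid[of UNIV]] continuous_on_compose2[OF continuous_on_sigmoid'[of UNIV]] contarg) auto
    fix z
    have 1: "((\<lambda>z. bump n u v (z \<bullet> f)) has_derivative (\<lambda>h. (h \<bullet> f) * bump' n u v (z \<bullet> f))) (at z)"
      by (rule DERIV_compose_FDERIV[OF DERIV_bump]) (auto intro!: derivative_eq_intros)
    have "(arg has_derivative (\<lambda>h. - 2 / c * (h \<bullet> (z - x0)))) (at z)"
      unfolding arg_def using c by (auto intro!: derivative_eq_intros simp: inner_commute field_simps)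
    then have 2: "((\<lambda>z. sigmoid (arg z)) has_derivative (\<lambda>h. (- 2 / c * (h \<bullet> (z - x0))) * sigmoid' (arg z))) (at z)"
      by (rule DERIV_compose_FDERIV[OF DERIV_sigmoid])
    have "(ph has_derivative (\<lambda>h. bump n u v (z \<bullet> f) * ((- 2 / c * (h \<bullet> (z - x0))) * sigmoid' (arg z))
       + (h \<bullet> f) * bump' n u v (z \<bullet> f) * sigmoid (arg z))) (at z)"
      unfolding ph_def by (rule has_derivative_mult[OF 1 2])
    then show "GDERIV ph z :> G z"
      unfolding gderiv_def G_def by (simp add: inner_add_right inner_diff_right algebra_simps)
  qed
  define \<Omega> where "\<Omega> = annulus Op Om"
  have fr: "frontier \<Omega> = frontier Op \<union> frontier Om" unfolding \<Omega>_def by (rule annulus_frontier[OF data])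
  have SS: "frontier S \<subseteq> frontier \<Omega>" using sg fr by auto
  have KS: "K \<subseteq> frontier S" using k_frontier unfolding K_def by (auto simp: image_subset_iff)
  have onK: "ph x = bump n u v (q x)" "G x = bump' n u v (q x) *\<^sub>R f" if xK: "x \<in> K" for x
  proof -
    obtain s where "s \<in> {\<alpha>..\<beta>}" "x = k s" using K_ex[OF xK] by blast
    then have "dist x x0 \<le> R1" using KR by simp
    then show "ph x = bump n u v (q x)" "G x = bump' n u v (q x) *\<^sub>R f"
      using inn[of x] by (auto simp: ph_def G_def f_def)
  qed
  \<comment> \<open>Near \<open>x0\<close> the frontier is a graph: two frontier points with the
    same tangential coordinate bound each other's height through their normals and coincide. So a
    nearby frontier point off \<open>K\<close> has its coordinate outside \<open>{u<..<v}\<close>,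
    where the bump vanishes.\<close>
  have offK: "ph x = 0 \<and> G x = 0" if x: "x \<in> frontier \<Omega>" "x \<notin> K" for x
  proof (cases "R0 \<le> dist x x0")
    case True
    then show ?thesis using far[of x] by (simp add: ph_def G_def)
  next
    case False
    then have xS: "x \<in> frontier S" using other[of x] x fr by auto
    have "\<not> (u < x \<bullet> f \<and> x \<bullet> f < v)"
    proof
      assume xf: "u < x \<bullet> f \<and> x \<bullet> f < v"
      define s where "s = x \<bullet> f"
      have s: "s \<in> {\<alpha><..\<beta>}" using xf uv by (auto simp: s_def)
      have ks: "k s \<bullet> f = x \<bullet> f" using k_inv[of s] s by (auto simp: f_def s_def)
      obtain m where m: "outward_unit_normal S (k s) m" using normal_ex[of s] s by auto
      obtain m' where m': "outward_unit_normal S x m'"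
        using outward_unit_normal_exists[OF S(2,1,3) xS] by blast
      have "m \<bullet> e \<ge> a" using k_normal[OF _ m] s by auto
      moreover have "m' \<bullet> e \<ge> a" using near[OF xS _ m'] False by auto
      ultimately have pos: "m \<bullet> e > 0" "m' \<bullet> e > 0" using a by auto
      have "x \<in> closure S" using xS by (simp add: frontier_def)
      then have "(x - k s) \<bullet> m \<le> 0" by (rule normal_le_closure[OF m])
      then have 1: "((x - k s) \<bullet> e) * (m \<bullet> e) \<le> 0"
        unfolding rot_frame_inner[OF e, of "x - k s" m] using ks by (simp add: f_def inner_diff_left)
      have "k s \<in> closure S" using s by (intro k_closure) auto
      then have "(k s - x) \<bullet> m' \<le> 0" by (rule normal_le_closure[OF m'])
      then have 2: "((k s - x) \<bullet> e) * (m' \<bullet> e) \<le> 0"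
        unfolding rot_frame_inner[OF e, of "k s - x" m'] using ks by (simp add: f_def inner_diff_left)
      have "(x - k s) \<bullet> e \<le> 0" using 1 pos by (simp add: mult_le_0_iff)
      moreover have "(k s - x) \<bullet> e \<le> 0" using 2 pos by (simp add: mult_le_0_iff)
      ultimately have "x \<bullet> e = k s \<bullet> e" by (simp add: inner_diff_left)
      then have "x = k s" using ks by (intro rot_frame_eqI[OF e]) (auto simp: f_def)
      then show False using x(2) s by (auto simp: K_def)
    qed
    then have "bump n u v (x \<bullet> f) = 0" "bump' n u v (x \<bullet> f) = 0"
      using bump_zero[OF n(1), of "x \<bullet> f" u v] by auto
    then show ?thesis by (simp add: ph_def G_def)
  qed
  have lhs: "(LINT x:frontier \<Omega>|M. ph x) = (LINT x|M. indicator K x * bump n u v (q x))" for M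
    unfolding set_lebesgue_integral_def
  proof (rule Bochner_Integration.integral_cong[OF refl])
    fix x
    show "indicator (frontier \<Omega>) x *\<^sub>R ph x = indicator K x * bump n u v (q x)"
      using onK[of x] offK[of x] KS SS by (cases "x \<in> K"; cases "x \<in> frontier \<Omega>") (auto simp: indicator_def)
  qed
  have frb: "frontier \<Omega> \<inter> space hausdorff1 \<in> sets hausdorff1" by simp
  define J where "J = (LINT x|hausdorff1. g x * (\<nu> x * bump' n u v (q x)))"
  \<comment> \<open>The corners are dropped as a countable set of length 0. On the inner boundary
    the outward normal of the annulus is opposite to that of \<open>Om\<close>, which gives the sign
    \<open>sg\<close>.\<close>
  have rhs: "(LINT x|boundary_measure \<Omega>. g x * (G x \<bullet> tangent Op Om x)) = sg * J"
  proof -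
    have "(LINT x|boundary_measure \<Omega>. g x * (G x \<bullet> tangent Op Om x)) =
      (LINT x|hausdorff1. indicator (frontier \<Omega>) x *\<^sub>R (g x * (G x \<bullet> tangent Op Om x)))"
      unfolding boundary_measure_def by (rule integral_restrict_space[OF frb])
    also have "\<dots> = (LINT x|hausdorff1. sg * (g x * (\<nu> x * bump' n u v (q x))))"
    proof (rule integral_discrete_difference[where X=corners])
      show "countable corners" by (rule countable_corners')
      fix x
      show "emeasure hausdorff1 {x} = 0" using H[of "{x}"] hausdorff1_outer_countable[of "{x}"] by simp
      show "{x} \<in> sets hausdorff1" by simp
      assume nc: "x \<notin> corners"
      show "indicator (frontier \<Omega>) x *\<^sub>R (g x * (G x \<bullet> tangent Op Om x)) = sg * (g x * (\<nu> x * bump' n u v (q x)))"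
      proof (cases "x \<in> K")
        case True
        then have xS: "x \<in> frontier S" using KS by auto
        have tn: "tangent Op Om x = sg *\<^sub>R rot_minus_half_pi (unit_normal S x)"
          using sg
        proof
          assume "S = Op \<and> sg = 1"
          then show ?thesis using xS by (simp add: tangent_def annulus_normal_def)
        next
          assume s: "S = Om \<and> sg = -1"
          then have "x \<notin> frontier Op" using xS annulus_frontier(2)[OF data] by auto
          then show ?thesis using s by (simp add: tangent_def annulus_normal_def rot_uminus)
        qed
        have "G x \<bullet> tangent Op Om x = sg * (bump' n u v (q x) * (e \<bullet> unit_normal S x))"
          unfolding tn onK(2)[OF True] f_def by simp
        moreover have "\<nu> x = e \<bullet> unit_normal S x" using True nc by (simp add: \<nu>_def inner_commute)
        ultimately show ?thesis using True KS SS by (auto simp: indicator_def)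
      next
        case False
        then show ?thesis using offK[of x] by (auto simp: indicator_def \<nu>_def)
      qed
    qed
    finally show ?thesis by (simp add: J_def)
  qed
  have "(LINT x:frontier \<Omega>|fp. ph x) - (LINT x:frontier \<Omega>|fm. ph x) = - (LINT x|boundary_measure \<Omega>. g x * (G x \<bullet> tangent Op Om x))"
    using td C1 unfolding tangential_derivative_def Let_def \<Omega>_def by blast
  then have main: "(LINT x|fp. indicator K x * bump n u v (q x)) - (LINT x|fm. indicator K x * bump n u v (q x)) = - (sg * J)"
    unfolding lhs rhs .
  have bm [measurable]: "bump' n u v \<in> borel_measurable borel"
    by (intro borel_measurable_continuous_onI continuous_on_bump)
  have [measurable]: "\<nu> \<in> borel_measurable hausdorff1" "(\<lambda>x. q x) \<in> borel_measurable hausdorff1"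
    using \<nu>_measurable q_measurable by (simp_all cong: measurable_cong_sets)
  have si: "set_integrable lborel {\<alpha>..\<beta>} (bump' n u v)"
    by (intro borel_integrable_atLeastAtMost' continuous_on_bump)
  define T where "T x = \<nu> x * bump' n u v (q x)" for x
  have Ti: "integrable hausdorff1 T" unfolding T_def by (rule integral_\<nu>(2)[OF H bm si])
  \<comment> \<open>The bump vanishes at both ends, so its derivative integrates to 0 and a constant
    may be subtracted from \<open>g\<close>; the value \<open>g0\<close> at the midpoint will be
    used.\<close>
  have T0: "(LINT x|hausdorff1. T x) = 0"
  proof -
    have "(LINT x|hausdorff1. T x) = (LINT s:{\<alpha>..\<beta>}|lborel. bump' n u v s)"
      unfolding T_def by (rule integral_\<nu>(1)[OF H bm])
    also have "\<dots> = (\<integral>s. bump' n u v s * indicator {\<alpha>..\<beta>} s \<partial>lborel)"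
      by (simp add: set_lebesgue_integral_def mult.commute)
    also have "\<dots> = bump n u v \<beta> - bump n u v \<alpha>"
    proof (rule integral_FTC_Icc_real)
      show "isCont (bump' n u v) s" for s
        using continuous_on_bump(2)[of UNIV n u v] by (simp add: continuous_on_eq_continuous_at)
    qed (use \<alpha>\<beta> DERIV_bump in auto)
    also have "\<dots> = 0" using bump_zero(1)[OF n(1), of _ u v] uv by simp
    finally show ?thesis .
  qed
  obtain C where C: "\<And>s. \<bar>bump' n u v s\<bar> \<le> C"
  proof -
    have "compact (bump' n u v ` {u..v})" by (intro compact_continuous_image continuous_on_bump) simp
    then obtain C where C: "\<And>y. y \<in> bump' n u v ` {u..v} \<Longrightarrow> norm y \<le> C" using compact_imp_bounded bounded_iff by metis
    have "\<bar>bump' n u v s\<bar> \<le> max C 0" for s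
      using C[of "bump' n u v s"] bump_zero(2)[OF n(1), of s u v] by (cases "s \<in> {u..v}") (auto simp: max_def)
    then show ?thesis using that by blast
  qed
  have gi: "integrable hausdorff1 (\<lambda>x. indicator (frontier \<Omega>) x *\<^sub>R g x)"
    using g_int unfolding boundary_measure_def \<Omega>_def[symmetric] by (subst (asm) integrable_restrict_space[OF frb])
  have gT: "g x * T x = (indicator (frontier \<Omega>) x *\<^sub>R g x) * T x" for x
    using KS SS by (auto simp: T_def \<nu>_def indicator_def)
  have gTi: "integrable hausdorff1 (\<lambda>x. g x * T x)"
    unfolding gT
  proof (rule Bochner_Integration.integrable_bound[where f="\<lambda>x. C * (indicator (frontier \<Omega>) x *\<^sub>R g x)"])
    show "integrable hausdorff1 (\<lambda>x. C * (indicator (frontier \<Omega>) x *\<^sub>R g x))" using gi by (rule integrable_mult_right)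
    show "(\<lambda>x. indicator (frontier \<Omega>) x *\<^sub>R g x * T x) \<in> borel_measurable hausdorff1"
      using gi Ti by (intro borel_measurable_times) auto
    have "\<bar>T x\<bar> \<le> C" for x
    proof -
      have "\<bar>T x\<bar> \<le> 1 * C" unfolding T_def abs_mult using \<nu>_bounds[of x] C by (intro mult_mono) auto
      then show ?thesis by simp
    qed
    then have "\<bar>T x\<bar> \<le> \<bar>C\<bar>" for x using abs_ge_self[of C] by (rule order_trans)
    then have "\<bar>y\<bar> * \<bar>T x\<bar> \<le> \<bar>y\<bar> * \<bar>C\<bar>" for y x by (intro mult_left_mono) auto
    then have "\<bar>y * T x\<bar> \<le> \<bar>C * y\<bar>" for y x by (simp only: abs_mult mult.commute[of "\<bar>C\<bar>"])
    then show "AE x in hausdorff1. norm (indicator (frontier \<Omega>) x *\<^sub>R g x * T x) \<le> norm (C * (indicator (frontier \<Omega>) x *\<^sub>R g x))"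
      by simp
  qed
  define g0 where "g0 = g (k ((u + v) / 2))"
  have mid: "\<alpha> \<le> (u + v) / 2" "(u + v) / 2 \<le> \<beta>" using uv by auto
  have "\<delta> * J = (LINT x|hausdorff1. \<delta> * (g x * T x))" by (simp add: J_def T_def)
  also have "\<dots> = (LINT x|hausdorff1. \<delta> * ((g x - g0) * T x) + \<delta> * (g0 * T x))"
    by (intro Bochner_Integration.integral_cong) (auto simp: algebra_simps)
  also have "\<dots> = (LINT x|hausdorff1. \<delta> * ((g x - g0) * T x)) + (LINT x|hausdorff1. \<delta> * (g0 * T x))"
  proof (rule Bochner_Integration.integral_add)
    have "integrable hausdorff1 (\<lambda>x. \<delta> * (g x * T x - g0 * T x))" using gTi Ti by simp
    then show "integrable hausdorff1 (\<lambda>x. \<delta> * ((g x - g0) * T x))" by (simp add: left_diff_distrib)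
    show "integrable hausdorff1 (\<lambda>x. \<delta> * (g0 * T x))" using Ti by simp
  qed
  also have "(LINT x|hausdorff1. \<delta> * (g0 * T x)) = 0" using T0 by simp
  also have "(LINT x|hausdorff1. \<delta> * ((g x - g0) * T x)) \<le> 0"
  proof -
    \<comment> \<open>On each side of the midpoint \<open>\<delta> * (g x - g0)\<close> and the
      derivative of the bump have opposite signs.\<close>
    have "0 \<le> - (\<delta> * ((g x - g0) * T x))" for x
    proof (cases "x \<in> K")
      case True
      then obtain s where s: "s \<in> {\<alpha>..\<beta>}" "x = k s" using K_ex by blast
      have qs: "q x = s" using s k_inv by simp
      have "(\<delta> * (g x - g0)) * bump' n u v s \<le> 0"
      proof (cases "s \<le> (u + v) / 2")
        case True
        have "\<delta> * g x \<le> \<delta> * g0" unfolding g0_def s(2) using mono[of s "(u + v) / 2"] s mid True by auto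
        then have "\<delta> * (g x - g0) \<le> 0" by (simp add: right_diff_distrib)
        then show ?thesis using bump'_sign(1)[OF n True] by (rule mult_nonpos_nonneg)
      next
        case False
        have "\<delta> * g0 \<le> \<delta> * g x" unfolding g0_def s(2) using mono[of "(u + v) / 2" s] s mid False by auto
        then have "0 \<le> \<delta> * (g x - g0)" by (simp add: right_diff_distrib)
        moreover have "bump' n u v s \<le> 0" using bump'_sign(2)[OF n, of s] False by simp
        ultimately show ?thesis by (rule mult_nonneg_nonpos)
      qed
      then have "\<nu> x * ((\<delta> * (g x - g0)) * bump' n u v s) \<le> 0" using \<nu>_bounds(1)[of x] by (simp add: mult_nonneg_nonpos)
      moreover have "\<delta> * ((g x - g0) * T x) = \<nu> x * ((\<delta> * (g x - g0)) * bump' n u v s)" unfolding T_def qs by (simp only: mult_ac)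
      ultimately show ?thesis by linarith
    qed (simp add: T_def \<nu>_def)
    then have "0 \<le> (LINT x|hausdorff1. - (\<delta> * ((g x - g0) * T x)))" by (intro integral_nonneg_AE always_eventually allI)
    then show ?thesis by simp
  qed
  finally have dJ: "\<delta> * J \<le> 0" by simp
  have "sg * sg = 1" using sg by auto
  then have eq: "\<delta> * sg * - (sg * J) = - (\<delta> * J)" by (metis mult.assoc mult.commute mult_minus_right mult.left_neutral)
  show ?thesis unfolding main eq using dJ by simp
qed

text \<open>As the bumps tend to indicators, the hypothesis says that \<open>B\<close> is at most
  \<open>A\<close> on open subarcs, hence on all Borel subsets of the open arc. \<open>B\<close>
  lives on the complement of \<open>Zc\<close>, where \<open>A\<close> is null, so \<open>B\<close>
  vanishes there too.\<close>

lemma null_of_test_inequality: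
  fixes A B :: "plane measure"
  assumes fin: "finite_measure A" "finite_measure B" and sets [measurable_cong]: "sets A = sets borel" "sets B = sets borel"
    and Zc [measurable]: "Zc \<in> sets borel" and sing: "emeasure A (- Zc) = 0" "emeasure B Zc = 0"
    and atoms: "\<And>x. emeasure A {x} = 0" "\<And>x. emeasure B {x} = 0"
    and test: "\<And>u v n. \<alpha> \<le> u \<Longrightarrow> u < v \<Longrightarrow> v \<le> \<beta> \<Longrightarrow> n > 0 \<Longrightarrow> 2 \<le> n * (v - u) \<Longrightarrow>
      (LINT x|B. indicator K x * bump n u v (q x)) \<le> (LINT x|A. indicator K x * bump n u v (q x))"
  shows "emeasure B (k ` {\<alpha><..<\<beta>}) = 0"
proof -
  interpret A: finite_measure A by fact
  interpret B: finite_measure B by fact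
  have sp: "space A = UNIV" "space B = UNIV" using sets_eq_imp_space_eq[OF sets(1)] sets_eq_imp_space_eq[OF sets(2)] by auto
  have conv: "(\<lambda>i. LINT x|M. indicator K x * bump (real i) u v (q x)) \<longlonglongrightarrow> measure M (k ` {u<..<v})"
    if M: "finite_measure M" "sets M = sets borel" and uv: "\<alpha> \<le> u" "u < v" "v \<le> \<beta>" for M u v
  proof -
    interpret M: finite_measure M by fact
    note M(2) [measurable_cong]
    have kb: "k ` {u<..<v} \<in> sets borel" using uv by (intro k_image_borel) auto
    have lim: "(\<lambda>i. LINT x|M. indicator K x * bump (real i) u v (q x)) \<longlonglongrightarrow> (LINT x|M. indicator K x * indicator {u<..<v} (q x))"
    proof (rule integral_dominated_convergence[where w="\<lambda>_. 1"])
      have [measurable]: "bump (real i) u v \<in> borel_measurable borel" for i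
        by (intro borel_measurable_continuous_onI continuous_on_bump)
      show "(\<lambda>x. indicator K x * bump (real i) u v (q x)) \<in> borel_measurable M" for i by measurable
      show "AE x in M. (\<lambda>i. indicator K x * bump (real i) u v (q x)) \<longlonglongrightarrow> indicator K x * indicator {u<..<v} (q x)"
        by (intro AE_I2 tendsto_intros bump_tendsto)
      show "AE x in M. norm (indicator K x * bump (real i) u v (q x)) \<le> 1" for i
        using bump_bounds by (intro AE_I2) (auto simp: indicator_def)
    qed auto
    have "indicator K x * indicator {u<..<v} (q x) = (indicator (k ` {u<..<v}) x :: real)" for x
    proof -
      have "x \<in> k ` {u<..<v} \<longleftrightarrow> x \<in> K \<and> q x \<in> {u<..<v}"
        unfolding K_def using uv k_inv by (auto simp: image_iff)
      then show ?thesis by (simp add: indicator_def)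
    qed
    then show ?thesis using lim kb M(2) by simp
  qed
  have le: "measure B (k ` {u<..<v}) \<le> measure A (k ` {u<..<v})" if uv: "\<alpha> \<le> u" "u < v" "v \<le> \<beta>" for u v
  proof (rule LIMSEQ_le[OF conv[OF fin(2) sets(2) uv] conv[OF fin(1) sets(1) uv]])
    obtain N :: nat where N: "2 / (v - u) < real N" using reals_Archimedean2 by blast
    have "(LINT x|B. indicator K x * bump (real i) u v (q x)) \<le> (LINT x|A. indicator K x * bump (real i) u v (q x))" if "i \<ge> N" for i
    proof (rule test[OF uv])
      have "2 / (v - u) < real i" using N that by linarith
      then show "2 \<le> real i * (v - u)" using uv by (simp add: pos_divide_less_eq less_imp_le)
      then show "real i > 0" using uv by (cases i) auto
    qed
    then show "\<exists>N. \<forall>i\<ge>N. (LINT x|B. indicator K x * bump (real i) u v (q x)) \<le> (LINT x|A. indicator K x * bump (real i) u v (q x))"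
      by blast
  qed
  define Ko where "Ko = k ` {\<alpha><..<\<beta>}"
  have Ko [measurable]: "Ko \<in> sets borel" unfolding Ko_def by (intro k_image_borel) auto
  have Koq: "x \<in> Ko \<and> q x \<in> I \<longleftrightarrow> x \<in> k ` ({\<alpha><..<\<beta>} \<inter> I)" for x I
    unfolding Ko_def using k_inv by (auto simp: image_iff)
  define \<kappa> where "\<kappa> M = distr (density M (indicator Ko)) borel (\<lambda>x. q x)" for M :: "plane measure"
  have \<kappa>: "emeasure (\<kappa> M) I = emeasure M (k ` ({\<alpha><..<\<beta>} \<inter> I))" if [measurable_cong]: "sets M = sets borel" and [measurable]: "I \<in> sets borel" for M I
  proof -
    have "emeasure (\<kappa> M) I = (\<integral>\<^sup>+x. indicator I x \<partial>\<kappa> M)" by (simp add: \<kappa>_def)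
    also have "\<dots> = (\<integral>\<^sup>+x. indicator I (q x) \<partial>density M (indicator Ko))"
      unfolding \<kappa>_def by (rule nn_integral_distr) auto
    also have "\<dots> = (\<integral>\<^sup>+x. indicator Ko x * indicator I (q x) \<partial>M)" by (rule nn_integral_density) auto
    also have "\<dots> = (\<integral>\<^sup>+x. indicator (k ` ({\<alpha><..<\<beta>} \<inter> I)) x \<partial>M)"
    proof (intro nn_integral_cong)
      fix x
      show "indicator Ko x * indicator I (q x) = (indicator (k ` ({\<alpha><..<\<beta>} \<inter> I)) x :: ennreal)"
        using Koq[of x I] by (cases "x \<in> Ko"; cases "q x \<in> I") (simp_all add: indicator_def)
    qed
    also have "\<dots> = emeasure M (k ` ({\<alpha><..<\<beta>} \<inter> I))"
    proof (rule nn_integral_indicator)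
      have "k ` ({\<alpha><..<\<beta>} \<inter> I) \<in> sets borel" by (intro k_image_borel) auto
      then show "k ` ({\<alpha><..<\<beta>} \<inter> I) \<in> sets M" by (simp add: that)
    qed
    finally show ?thesis .
  qed
  have \<kappa>fin: "finite_measure (\<kappa> A)" "finite_measure (\<kappa> B)"
    by (auto intro!: finite_measureI simp: \<kappa>[OF sets(1)] \<kappa>[OF sets(2)] A.emeasure_eq_measure B.emeasure_eq_measure sets_eq_imp_space_eq[of "\<kappa> _" borel] \<kappa>_def[THEN arg_cong[where f=space]])
  \<comment> \<open>Without atoms the right end of a half-open arc does not count; the bumps
    converge to indicators of open arcs.\<close>
  have drop: "emeasure M (k ` ({\<alpha><..<\<beta>} \<inter> {b<..c})) = emeasure M (k ` {max b \<alpha><..<min c \<beta>})"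
    if M: "sets M = sets borel" "\<And>x. emeasure M {x} = 0" for M and b c
  proof (rule antisym)
    have kb: "k ` {max b \<alpha><..<min c \<beta>} \<in> sets M" unfolding M(1) by (intro k_image_borel) auto
    have kc: "{k c} \<in> sets M" unfolding M(1) by simp
    have "k ` ({\<alpha><..<\<beta>} \<inter> {b<..c}) \<subseteq> k ` {max b \<alpha><..<min c \<beta>} \<union> {k c}"
    proof
      fix x assume "x \<in> k ` ({\<alpha><..<\<beta>} \<inter> {b<..c})"
      then obtain s where s: "x = k s" "s \<in> {\<alpha><..<\<beta>} \<inter> {b<..c}" by blast
      then show "x \<in> k ` {max b \<alpha><..<min c \<beta>} \<union> {k c}" by (cases "s = c") auto
    qed
    then have "emeasure M (k ` ({\<alpha><..<\<beta>} \<inter> {b<..c})) \<le> emeasure M (k ` {max b \<alpha><..<min c \<beta>} \<union> {k c})"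
      by (rule emeasure_mono[OF _ sets.Un[OF kb kc]])
    also have "\<dots> \<le> emeasure M (k ` {max b \<alpha><..<min c \<beta>}) + emeasure M {k c}"
      by (rule emeasure_subadditive[OF kb kc])
    finally show "emeasure M (k ` ({\<alpha><..<\<beta>} \<inter> {b<..c})) \<le> emeasure M (k ` {max b \<alpha><..<min c \<beta>})" by (simp add: M)
    have "k ` ({\<alpha><..<\<beta>} \<inter> {b<..c}) \<in> sets M" unfolding M(1) by (intro k_image_borel) auto
    then show "emeasure M (k ` {max b \<alpha><..<min c \<beta>}) \<le> emeasure M (k ` ({\<alpha><..<\<beta>} \<inter> {b<..c}))"
      by (intro emeasure_mono image_mono) auto
  qed
  have Ioc: "emeasure (\<kappa> B) {b<..c} \<le> emeasure (\<kappa> A) {b<..c}" if "b < c" for b c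
  proof -
    have "emeasure B (k ` {max b \<alpha><..<min c \<beta>}) \<le> emeasure A (k ` {max b \<alpha><..<min c \<beta>})"
    proof (cases "max b \<alpha> < min c \<beta>")
      case True
      then show ?thesis using le[of "max b \<alpha>" "min c \<beta>"] by (simp add: A.emeasure_eq_measure B.emeasure_eq_measure)
    qed auto
    then show ?thesis using drop[OF sets(1) atoms(1), of b c] drop[OF sets(2) atoms(2), of b c]
      by (simp add: \<kappa>[OF sets(1)] \<kappa>[OF sets(2)])
  qed
  define E where "E = Ko - Zc"
  define I where "I = {s \<in> {\<alpha><..<\<beta>}. k s \<in> - Zc}"
  have I [measurable]: "I \<in> sets borel"
  proof -
    have "continuous_on {\<alpha><..<\<beta>} k" by (rule continuous_on_subset[OF k_cont]) auto
    then have m: "k \<in> borel_measurable (restrict_space borel {\<alpha><..<\<beta>})" by (rule borel_measurable_continuous_on_restrict)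
    have "k -` (- Zc) \<inter> space (restrict_space borel {\<alpha><..<\<beta>}) \<in> sets (restrict_space borel {\<alpha><..<\<beta>})"
      by (rule measurable_sets[OF m]) simp
    moreover have "k -` (- Zc) \<inter> space (restrict_space borel {\<alpha><..<\<beta>}) = I" by (auto simp: I_def space_restrict_space)
    ultimately show ?thesis by (subst (asm) sets_restrict_space_iff) auto
  qed
  have EI: "E = k ` ({\<alpha><..<\<beta>} \<inter> I)" by (auto simp: E_def I_def Ko_def)
  have "emeasure B E = emeasure (\<kappa> B) I" unfolding EI by (rule \<kappa>[OF sets(2) I, symmetric])
  also have "\<dots> \<le> emeasure (\<kappa> A) I"
    by (rule emeasure_le_if_Ioc_le[OF \<kappa>fin(2,1) _ _ Ioc I]) (auto simp: \<kappa>_def)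
  also have "\<dots> = emeasure A E" unfolding EI by (rule \<kappa>[OF sets(1) I])
  also have "\<dots> \<le> emeasure A (- Zc)" by (intro emeasure_mono) (auto simp: E_def sets)
  finally have "emeasure B E = 0" using sing by simp
  moreover have "emeasure B Ko \<le> emeasure B E + emeasure B Zc"
  proof -
    have "emeasure B Ko \<le> emeasure B (E \<union> Zc)" by (intro emeasure_mono) (auto simp: E_def sets)
    also have "\<dots> \<le> emeasure B E + emeasure B Zc" by (intro emeasure_subadditive) (auto simp: E_def sets)
    finally show ?thesis .
  qed
  ultimately show ?thesis using sing unfolding Ko_def by simp
qed

end

section \<open>Charts along boundary paths and the sign on an arc\<close>

text \<open>\<open>e\<close> points from the centre \<open>p\<close> of a ball inside
  \<open>S\<close> to \<open>c t0\<close>. Normals at nearby frontier points have scalar product at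
  least \<open>r / 2\<close> with \<open>c t0 - p\<close>; therefore two such points with equal
  tangential coordinate coincide, and this coordinate is injective along the path.\<close>

lemma simple_path_chart:
  fixes c :: "real \<Rightarrow> plane"
  assumes S: "open S" "convex S" "S \<noteq> {}"
    and c: "continuous_on {0..1} c" "inj_on c {0<..<1}" "c ` {0..1} \<subseteq> frontier S"
    and F: "closed F" "F \<inter> frontier S = {}" and t0: "t0 \<in> {0<..<1}"
  obtains t1 t2 e a R0 R1 where "0 < t1" "t1 < t0" "t0 < t2" "t2 < 1" "norm e = 1" "a > 0" "0 < R1" "R1 < R0"
    "\<And>t. t \<in> {t1..t2} \<Longrightarrow> dist (c t) (c t0) \<le> R1"
    "\<And>x. x \<in> F \<Longrightarrow> R0 \<le> dist x (c t0)"
    "\<And>x n. x \<in> frontier S \<Longrightarrow> dist x (c t0) < R0 \<Longrightarrow> outward_unit_normal S x n \<Longrightarrow> n \<bullet> e \<ge> a"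
    "inj_on (\<lambda>t. c t \<bullet> rot_minus_half_pi e) {t1..t2}"
proof -
  define x0 where "x0 = c t0"
  have x0: "x0 \<in> frontier S" using c(3) t0 by (auto simp: x0_def image_subset_iff)
  obtain p where p: "p \<in> S" using S by auto
  obtain r where r: "r > 0" "cball p r \<subseteq> S" using S p open_contains_cball by blast
  have x0S: "x0 \<notin> S" using x0 S by (simp add: frontier_def interior_open)
  then have ne: "x0 \<noteq> p" using p by auto
  define e where "e = sgn (x0 - p)"
  have e: "norm e = 1" using ne by (simp add: e_def norm_sgn)
  obtain d where d: "d > 0" "\<And>x. x \<in> F \<Longrightarrow> d \<le> dist x0 x"
    using separate_point_closed[OF F(1), of x0] F(2) x0 by blast
  \<comment> \<open>Up to distance \<open>r / 2\<close> half of the ball bound \<open>r\<close>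
    survives, and up to distance \<open>d\<close> the set \<open>F\<close>, in the application the
    other boundary curve, is not met.\<close>
  define R0 where "R0 = min d (r / 2)"
  define R1 where "R1 = R0 / 2"
  have R: "0 < R1" "R1 < R0" "R0 \<le> r / 2" "R0 \<le> d" using d r by (auto simp: R0_def R1_def)
  define a where "a = r / 2 / norm (x0 - p)"
  have a: "a > 0" using r ne by (simp add: a_def)
  have near: "n \<bullet> e \<ge> a" if x: "x \<in> frontier S" "dist x x0 < R0" "outward_unit_normal S x n" for x n
  proof -
    have "(x - p) \<bullet> n \<ge> r" using normal_ball_bound[OF x(3) r(2)] r by simp
    moreover have "(x - x0) \<bullet> n \<le> r / 2"
      using Cauchy_Schwarz_ineq2[of "x - x0" n] x R by (simp add: outward_unit_normal_def dist_norm)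
    moreover have "(x - p) \<bullet> n = (x - x0) \<bullet> n + (x0 - p) \<bullet> n" by (simp add: inner_diff_left)
    ultimately have "(x0 - p) \<bullet> n \<ge> r / 2" by linarith
    then have "r / 2 / norm (x0 - p) \<le> (x0 - p) \<bullet> n / norm (x0 - p)" by (intro divide_right_mono) auto
    moreover have "n \<bullet> e = (x0 - p) \<bullet> n / norm (x0 - p)"
      by (simp add: e_def sgn_div_norm inner_commute divide_inverse mult.commute)
    ultimately show ?thesis by (simp add: a_def)
  qed
  have "isCont c t0" using c(1) t0 by (intro continuous_on_interior) (auto simp: interior_atLeastAtMost_real)
  then obtain \<delta> where \<delta>: "\<delta> > 0" "\<And>t. dist t t0 < \<delta> \<Longrightarrow> dist (c t) x0 < R1"
    using R(1) unfolding continuous_at_eps_delta x0_def by blast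
  define h where "h = min (\<delta> / 2) (min (t0 / 2) ((1 - t0) / 2))"
  have h: "h > 0" "h < \<delta>" "h < t0" "h < 1 - t0" 
  proof -
    have t: "0 < t0" "t0 < 1" using t0 by auto
    have le: "h \<le> \<delta> / 2" "h \<le> t0 / 2" "h \<le> (1 - t0) / 2"
      unfolding h_def by (simp, intro min.coboundedI2 min.cobounded1, intro min.coboundedI2 min.cobounded2)
    show "h < \<delta>" using le(1) \<delta>(1) by linarith
    show "h < t0" using le(2) t by linarith
    show "h < 1 - t0" using le(3) t by simp
    show "h > 0" using t \<delta>(1) by (auto simp: h_def)
  qed
  have close: "dist (c t) x0 < R1" if "t \<in> {t0 - h..t0 + h}" for t
    using that h by (intro \<delta>) (auto simp: dist_real_def)
  have inj: "inj_on (\<lambda>t. c t \<bullet> rot_minus_half_pi e) {t0 - h..t0 + h}"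
  proof (rule inj_onI)
    fix s t assume st: "s \<in> {t0 - h..t0 + h}" "t \<in> {t0 - h..t0 + h}"
      and eq: "c s \<bullet> rot_minus_half_pi e = c t \<bullet> rot_minus_half_pi e"
    have fr: "c s \<in> frontier S" "c t \<in> frontier S" using st h c(3) by (auto simp: image_subset_iff)
    have le: "(c u - c v) \<bullet> e \<le> 0"
      if uv: "u \<in> {t0 - h..t0 + h}" "v \<in> {t0 - h..t0 + h}" "c u \<in> frontier S" "c v \<in> frontier S"
        "c u \<bullet> rot_minus_half_pi e = c v \<bullet> rot_minus_half_pi e" for u v
    proof -
      obtain n where n: "outward_unit_normal S (c v) n"
        using outward_unit_normal_exists[OF S(2,1,3) uv(4)] by blast
      have "n \<bullet> e \<ge> a" using near[OF uv(4) _ n] close[OF uv(2)] R by simp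
      then have pos: "n \<bullet> e > 0" using a by simp
      have "c u \<in> closure S" using uv(3) by (simp add: frontier_def)
      then have "(c u - c v) \<bullet> n \<le> 0" by (rule normal_le_closure[OF n])
      then have "((c u - c v) \<bullet> e) * (n \<bullet> e) \<le> 0"
        unfolding rot_frame_inner[OF e, of "c u - c v" n] using uv(5) by (simp add: inner_diff_left)
      then show ?thesis using pos by (simp add: mult_le_0_iff)
    qed
    have "c s \<bullet> e = c t \<bullet> e" using le[OF st fr eq] le[OF st(2,1) fr(2,1) eq[symmetric]] by (simp add: inner_diff_left)
    then have "c s = c t" using eq by (intro rot_frame_eqI[OF e])
    then show "s = t" using c(2) st h by (auto dest: inj_onD)
  qed
  show ?thesis
  proof (rule that[of "t0 - h" "t0 + h" e a R1 R0])
    show "dist (c t) (c t0) \<le> R1" if "t \<in> {t0 - h..t0 + h}" for t using close[OF that] by (simp add: x0_def)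
    show "R0 \<le> dist x (c t0)" if "x \<in> F" for x using d(2)[OF that] R by (simp add: x0_def dist_commute)
    show "n \<bullet> e \<ge> a" if "x \<in> frontier S" "dist x (c t0) < R0" "outward_unit_normal S x n" for x n
      using near that by (simp add: x0_def)
  qed (use h e a R inj in auto)
qed

text \<open>Along a clockwise path the tangential coordinate cannot decrease: the normal at a middle point
  bounds both chords and would force a counterclockwise triangle.\<close>

lemma clockwise_increasing:
  assumes e: "norm e = 1" and n: "outward_unit_normal S (c t) n" "n \<bullet> e > 0"
    and cl: "c s \<in> closure S" "c u \<in> closure S"
    and neg: "cross2 (c t - c s) (c u - c s) < 0"
    and mono: "c t \<bullet> rot_minus_half_pi e < c s \<bullet> rot_minus_half_pi e" "c u \<bullet> rot_minus_half_pi e < c t \<bullet> rot_minus_half_pi e"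
  shows False
proof -
  define f where "f = rot_minus_half_pi e"
  define A where "A = c t - c s"
  define B where "B = c u - c t"
  have ee: "e $ 1 * e $ 1 + e $ 2 * e $ 2 = 1" using e by (simp add: norm_eq_1 inner_plane)
  have cross: "cross2 A (A + B) = (A \<bullet> f) * (B \<bullet> e) - (A \<bullet> e) * (B \<bullet> f)"
  proof -
    have "(A \<bullet> f) * (B \<bullet> e) - (A \<bullet> e) * (B \<bullet> f) = cross2 A B * (e $ 1 * e $ 1 + e $ 2 * e $ 2)"
      by (simp add: f_def inner_plane cross2_def algebra_simps)
    then show ?thesis unfolding ee by (simp add: cross2_def algebra_simps)
  qed
  have Af: "A \<bullet> f < 0" "B \<bullet> f < 0" using mono by (auto simp: A_def B_def f_def inner_diff_left)
  have "(- A) \<bullet> n \<le> 0" "B \<bullet> n \<le> 0"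
    using normal_le_closure[OF n(1) cl(1)] normal_le_closure[OF n(1) cl(2)] by (auto simp: A_def B_def)
  then have 1: "(A \<bullet> e) * (n \<bullet> e) + (A \<bullet> f) * (n \<bullet> f) \<ge> 0" and 2: "(B \<bullet> e) * (n \<bullet> e) + (B \<bullet> f) * (n \<bullet> f) \<le> 0"
    using rot_frame_inner[OF e, of A n] rot_frame_inner[OF e, of B n] by (auto simp: f_def)
  have "((B \<bullet> e) * (n \<bullet> e) + (B \<bullet> f) * (n \<bullet> f)) * (A \<bullet> f) \<ge> 0" using 2 Af by (intro mult_nonpos_nonpos) auto
  moreover have "((A \<bullet> e) * (n \<bullet> e) + (A \<bullet> f) * (n \<bullet> f)) * (B \<bullet> f) \<le> 0" using 1 Af by (intro mult_nonneg_nonpos) auto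
  ultimately have "(n \<bullet> e) * ((A \<bullet> f) * (B \<bullet> e) - (A \<bullet> e) * (B \<bullet> f)) \<ge> 0" by (simp add: algebra_simps)
  then have "(A \<bullet> f) * (B \<bullet> e) - (A \<bullet> e) * (B \<bullet> f) \<ge> 0" using n(2) by (simp add: zero_le_mult_iff)
  moreover have AB: "A + B = c u - c s" by (simp add: A_def B_def)
  have "cross2 A (A + B) < 0" unfolding AB using neg by (simp add: A_def)
  ultimately show False unfolding cross by linarith
qed

text \<open>\<open>\<epsilon>\<close> tells whether \<open>g\<close> increases or decreases along
  the clockwise path, and \<open>sg\<close> whether \<open>\<tau>\<close> runs clockwise (outer
  boundary) or counterclockwise (inner boundary); the product is the sign of the derivative. Every
  inner parameter has a chart where the test inequality applies, countably many charts suffice, and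
  the two ends have mass 0. The alternative of a constant \<open>g\<close> is compatible with both
  signs.\<close>

lemma path_sign:
  fixes c :: "real \<Rightarrow> plane" and sg \<epsilon> :: real
  assumes H: "\<And>A. A \<in> sets borel \<Longrightarrow> emeasure hausdorff1 A = hausdorff1_outer A"
    and data: "annulus_data Op Om" and td: "tangential_derivative Op Om g fp fm"
    and g_int: "integrable (boundary_measure (annulus Op Om)) g"
    and sg: "S = Op \<and> sg = 1 \<or> S = Om \<and> sg = -1"
    and ne: "S \<noteq> {}"
    and atoms: "\<And>x. emeasure fp {x} = 0" "\<And>x. emeasure fm {x} = 0"
    and c: "continuous_on {0..1} c" "inj_on c {0<..<1}" "c ` {0..1} \<subseteq> frontier S"
    and mono: "(clockwise_arc S c \<and> (\<forall>s t. 0 \<le> s \<longrightarrow> s \<le> t \<longrightarrow> t \<le> 1 \<longrightarrow> \<epsilon> * g (c s) \<le> \<epsilon> * g (c t)))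
       \<or> (\<forall>s\<in>{0..1}. \<forall>t\<in>{0..1}. g (c s) = g (c t))"
    and \<epsilon>: "\<epsilon> = 1 \<or> \<epsilon> = -1"
  shows "\<epsilon> * sg = 1 \<Longrightarrow> emeasure fm (c ` {0..1}) = 0" "\<epsilon> * sg = -1 \<Longrightarrow> emeasure fp (c ` {0..1}) = 0"
proof -
  have jp: "jordan_parts fp fm" using td by (simp add: tangential_derivative_def Let_def)
  then have fin: "finite_measure fp" "finite_measure fm" and sets: "sets fp = sets borel" "sets fm = sets borel"
    by (auto simp: jordan_parts_def)
  obtain Z where Z: "Z \<in> sets borel" "emeasure fp (- Z) = 0" "emeasure fm Z = 0"
    using jp by (auto simp: jordan_parts_def)
  have Sprops: "open S" "convex S" using sg data by (auto simp: annulus_data_def strictly_convex_def)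
  define F where "F = (if S = Op then frontier Om else frontier Op)"
  have OpOm: "Op \<noteq> Om"
  proof
    assume eq: "Op = Om"
    have "closed Om" using data closure_subset[of Om] unfolding annulus_data_def eq by (metis closure_closed closed_closure order_antisym)
    moreover have "open Om" "Om \<noteq> {}" "bounded Om" using data by (auto simp: annulus_data_def)
    ultimately show False using clopen[of Om] not_bounded_UNIV by blast
  qed
  have F: "closed F" "F \<inter> frontier S = {}" "frontier Op \<union> frontier Om = frontier S \<union> F"
    using sg annulus_frontier(2)[OF data] OpOm by (auto simp: F_def)
  define N where "N M = (\<forall>t0\<in>{0<..<1}. \<exists>t1 t2. 0 < t1 \<and> t1 < t0 \<and> t0 < t2 \<and> t2 < 1 \<and> emeasure M (c ` {t1<..<t2}) = 0)" for M :: "plane measure"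
  have loc: "(\<epsilon> * sg = 1 \<longrightarrow> N fm) \<and> (\<epsilon> * sg = -1 \<longrightarrow> N fp)"
  proof -
    have "\<exists>t1 t2. 0 < t1 \<and> t1 < t0 \<and> t0 < t2 \<and> t2 < 1 \<and>
        (\<epsilon> * sg = 1 \<longrightarrow> emeasure fm (c ` {t1<..<t2}) = 0) \<and> (\<epsilon> * sg = -1 \<longrightarrow> emeasure fp (c ` {t1<..<t2}) = 0)"
      if t0: "t0 \<in> {0<..<1}" for t0
    proof -
      obtain t1 t2 e a R0 R1 where ch: "0 < t1" "t1 < t0" "t0 < t2" "t2 < 1" "norm e = 1" "a > 0" "0 < R1" "R1 < R0"
        "\<And>t. t \<in> {t1..t2} \<Longrightarrow> dist (c t) (c t0) \<le> R1"
        "\<And>x. x \<in> F \<Longrightarrow> R0 \<le> dist x (c t0)"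
        "\<And>x n. x \<in> frontier S \<Longrightarrow> dist x (c t0) < R0 \<Longrightarrow> outward_unit_normal S x n \<Longrightarrow> n \<bullet> e \<ge> a"
        "inj_on (\<lambda>t. c t \<bullet> rot_minus_half_pi e) {t1..t2}"
        using simple_path_chart[OF Sprops ne c F(1,2) t0] by metis
      define Q where "Q t = c t \<bullet> rot_minus_half_pi e" for t
      have Qc: "continuous_on {t1..t2} Q" unfolding Q_def
        using ch by (intro continuous_intros continuous_on_subset[OF c(1)]) auto
      have Qi: "inj_on Q {t1..t2}" using ch(12) unfolding Q_def .
      have t12: "t1 < t2" using ch by auto
      \<comment> \<open>The sense in which the tangential coordinate runs along the path is still
        open here. For a clockwise path it is determined below; for constant \<open>g\<close> it has
        no influence.\<close>
      have mm: "strict_mono_on {t1..t2} Q \<or> strict_antimono_on {t1..t2} Q"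
        using injective_eq_monotone_map[of "{t1..t2}" Q] Qc Qi is_interval_cc by blast
      define \<alpha> where "\<alpha> = min (Q t1) (Q t2)"
      define \<beta> where "\<beta> = max (Q t1) (Q t2)"
      have Qab: "{Q t1, Q t2} = {\<alpha>, \<beta>}" by (auto simp: \<alpha>_def \<beta>_def min_def max_def)
      have rng: "\<alpha> \<le> Q t \<and> Q t \<le> \<beta>" if t: "t \<in> {t1..t2}" for t
      proof (cases "t = t1 \<or> t = t2")
        case False
        then have "t1 < t" "t < t2" using t by auto
        then show ?thesis using continuous_inj_imp_mono[OF _ _ Qc Qi, of t] by (auto simp: \<alpha>_def \<beta>_def)
      qed (auto simp: \<alpha>_def \<beta>_def)
      have conn: "connected (Q ` {t1..t2})" by (intro connected_continuous_image Qc connected_Icc)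
      have ends: "\<alpha> \<in> Q ` {t1..t2}" "\<beta> \<in> Q ` {t1..t2}" using t12 by (auto simp: \<alpha>_def \<beta>_def min_def max_def)
      have im1: "Q ` {t1..t2} = {\<alpha>..\<beta>}"
        using connected_contains_Icc[OF conn ends] rng by auto
      have "Q ` {t1<..<t2} = Q ` ({t1..t2} - {t1, t2})" by (rule arg_cong[where f="(`) Q"]) auto
      also have "\<dots> = Q ` {t1..t2} - Q ` {t1, t2}" using t12 by (intro inj_on_image_set_diff[OF Qi]) auto
      also have "\<dots> = {\<alpha>..\<beta>} - {\<alpha>, \<beta>}" unfolding im1 Qab[symmetric] by simp
      also have "\<dots> = {\<alpha><..<\<beta>}" by auto
      finally have im2: "Q ` {t1<..<t2} = {\<alpha><..<\<beta>}" .
      note im = im1 im2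
      have \<alpha>\<beta>: "\<alpha> < \<beta>"
      proof -
        have "Q t1 \<noteq> Q t2" using inj_onD[OF Qi, of t1 t2] t12 by auto
        then show ?thesis by (auto simp: \<alpha>_def \<beta>_def)
      qed
      define k where "k s = c (the_inv_into {t1..t2} Q s)" for s
      have kQ: "k (Q t) = c t" if "t \<in> {t1..t2}" for t
        unfolding k_def using the_inv_into_f_f[OF Qi that] by simp
      have kc: "continuous_on {\<alpha>..\<beta>} k"
      proof -
        have "continuous_on {\<alpha>..\<beta>} (the_inv_into {t1..t2} Q)"
          using continuous_on_inv_into[OF Qc compact_Icc Qi] unfolding im1 .
        moreover have "the_inv_into {t1..t2} Q ` {\<alpha>..\<beta>} \<subseteq> {0..1}"
        proof -
          have "the_inv_into {t1..t2} Q ` {\<alpha>..\<beta>} = {t1..t2}"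
            unfolding im1[symmetric] by (rule the_inv_into_onto[OF Qi])
          then show ?thesis using ch by auto
        qed
        ultimately show ?thesis unfolding k_def by (rule continuous_on_compose2[OF c(1)])
      qed
      interpret frontier_graph S e a \<alpha> \<beta> k
      proof
        show "k s \<bullet> rot_minus_half_pi e = s" if "s \<in> {\<alpha>..\<beta>}" for s
          using that kQ unfolding im(1)[symmetric] by (auto simp: Q_def)
        show "k ` {\<alpha>..\<beta>} \<subseteq> frontier S"
          unfolding im(1)[symmetric] using kQ c(3) ch by (auto simp: image_subset_iff)
        show "n \<bullet> e \<ge> a" if sn: "s \<in> {\<alpha>..\<beta>}" "outward_unit_normal S (k s) n" for s n
        proof -
          obtain t where t: "t \<in> {t1..t2}" "s = Q t" using sn(1) im(1) by blast
          have "c t \<in> frontier S" using t ch c(3) by (auto simp: image_subset_iff)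
          then show ?thesis using ch(11)[of "c t" n] ch(9)[OF t(1)] ch(8) sn(2) kQ[OF t(1)] t(2) by auto
        qed
      qed (use Sprops ne ch \<alpha>\<beta> kc in auto)
      have kim: "k ` {\<alpha><..<\<beta>} = c ` {t1<..<t2}"
        unfolding im(2)[symmetric] image_image using kQ by (intro image_cong) auto
      have mono_k: "\<epsilon> * g (k s) \<le> \<epsilon> * g (k t)" if st: "\<alpha> \<le> s" "s \<le> t" "t \<le> \<beta>" for s t
      proof -
        obtain s' where s': "s' \<in> {t1..t2}" "s = Q s'" using st im(1) by (metis atLeastAtMost_iff imageE order_trans)
        obtain t' where t': "t' \<in> {t1..t2}" "t = Q t'" using st im(1) by (metis atLeastAtMost_iff imageE order_trans)
        have ks: "k s = c s'" "k t = c t'" using kQ s' t' by auto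
        show ?thesis using mono
        proof
          assume "\<forall>s\<in>{0..1}. \<forall>t\<in>{0..1}. g (c s) = g (c t)"
          then have "g (c s') = g (c t')" using s' t' ch by auto
          then show ?thesis by (simp add: ks)
        next
          assume cw: "clockwise_arc S c \<and> (\<forall>s t. 0 \<le> s \<longrightarrow> s \<le> t \<longrightarrow> t \<le> 1 \<longrightarrow> \<epsilon> * g (c s) \<le> \<epsilon> * g (c t))"
          \<comment> \<open>Three parameters exclude the wrong sense, because the normal at the
            middle point has positive \<open>e\<close>-component.\<close>
          have "\<not> strict_antimono_on {t1..t2} Q"
          proof
            assume an: "strict_antimono_on {t1..t2} Q"
            have "c t0 \<in> frontier S" using c(3) t0 by (auto simp: image_subset_iff)
            then obtain n where n: "outward_unit_normal S (c t0) n"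
              using outward_unit_normal_exists[OF Sprops(2,1) ne] by blast
            have fr: "c t \<in> closure S" if "t \<in> {t1..t2}" for t
              using c(3) that ch by (auto simp: image_subset_iff frontier_def)
            show False
            proof (rule clockwise_increasing[of e S c t0 n t1 t2])
              show "n \<bullet> e > 0" using ch(11)[OF \<open>c t0 \<in> frontier S\<close> _ n] ch(6,7,8) by simp
              show "cross2 (c t0 - c t1) (c t2 - c t1) < 0" using cw ch by (auto simp: clockwise_arc_def)
              show "c t0 \<bullet> rot_minus_half_pi e < c t1 \<bullet> rot_minus_half_pi e" "c t2 \<bullet> rot_minus_half_pi e < c t0 \<bullet> rot_minus_half_pi e"
                using monotone_onD[OF an, of t1 t0] monotone_onD[OF an, of t0 t2] ch by (auto simp: Q_def)
            qed (use ch n fr t12 in auto)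
          qed
          then have sm: "strict_mono_on {t1..t2} Q" using mm by blast
          have "s' \<le> t'"
          proof (rule ccontr)
            assume "\<not> s' \<le> t'"
            then have "Q t' < Q s'" using strict_mono_onD[OF sm t'(1) s'(1)] by simp
            then show False using st s' t' by simp
          qed
          then show ?thesis unfolding ks using cw s' t' ch by auto
        qed
      qed
      have test: "0 \<le> \<epsilon> * sg * ((LINT x|fp. indicator K x * bump n u v (q x)) - (LINT x|fm. indicator K x * bump n u v (q x)))"
        if "\<alpha> \<le> u" "u < v" "v \<le> \<beta>" "n > 0" "2 \<le> n * (v - u)" for u v n
      proof (rule test_inequality[OF H data td g_int sg ch(7,8), where ?x0.0="c t0"])
        show "dist (k s) (c t0) \<le> R1" if "s \<in> {\<alpha>..\<beta>}" for s
        proof -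
          obtain t where t: "t \<in> {t1..t2}" "s = Q t" using \<open>s \<in> {\<alpha>..\<beta>}\<close> im(1) by blast
          then show ?thesis using ch(9)[OF t(1)] kQ[OF t(1)] by simp
        qed
        show "x \<in> frontier S" if "x \<in> frontier Op \<union> frontier Om" "dist x (c t0) < R0" for x
          using that F(3) ch(10)[of x] by auto
      qed (use ch(11) mono_k that in auto)
      have "\<epsilon> * sg = 1 \<longrightarrow> emeasure fm (k ` {\<alpha><..<\<beta>}) = 0"
      proof
        assume "\<epsilon> * sg = 1"
        with test show "emeasure fm (k ` {\<alpha><..<\<beta>}) = 0"
          by (intro null_of_test_inequality[OF fin(1,2) sets(1,2) Z(1,2,3) atoms(1,2)]) auto
      qed
      moreover have "\<epsilon> * sg = -1 \<longrightarrow> emeasure fp (k ` {\<alpha><..<\<beta>}) = 0"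
      proof
        assume "\<epsilon> * sg = -1"
        with test show "emeasure fp (k ` {\<alpha><..<\<beta>}) = 0"
          by (intro null_of_test_inequality[OF fin(2,1) sets(2,1) borel_comp[OF Z(1)] _ Z(2) atoms(2,1)]) (auto simp: Z)
      qed
      ultimately show ?thesis using ch(1-4) unfolding kim by blast
    qed
    then show ?thesis unfolding N_def by blast
  qed
  have glob: "emeasure M (c ` {0..1}) = 0" if M: "N M" "sets M = sets borel" "\<And>x. emeasure M {x} = 0" for M
  proof -
    \<comment> \<open>The null intervals supplied by the charts cover the open parameter interval,
      and by the Lindelof property countably many of them do.\<close>
    define \<F> where "\<F> = {{t1<..<t2} | t1 t2. 0 < t1 \<and> t2 < 1 \<and> emeasure M (c ` {t1<..<t2}) = 0}"
    obtain \<G> where \<G>: "\<G> \<subseteq> \<F>" "countable \<G>" "\<Union>\<G> = \<Union>\<F>"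
    proof -
      have op: "open T" if "T \<in> \<F>" for T using that unfolding \<F>_def by auto
      show ?thesis using Lindelof[of \<F>, OF op] that by blast
    qed
    have cover: "{0<..<1} \<subseteq> \<Union>\<G>"
    proof
      fix t0 :: real assume t0: "t0 \<in> {0<..<1}"
      then obtain t1 t2 where "0 < t1" "t1 < t0" "t0 < t2" "t2 < 1" "emeasure M (c ` {t1<..<t2}) = 0"
        using M(1) unfolding N_def by blast
      then have "{t1<..<t2} \<in> \<F>" "t0 \<in> {t1<..<t2}" unfolding \<F>_def by auto
      then show "t0 \<in> \<Union>\<G>" unfolding \<G>(3) by blast
    qed
    have meas: "c ` {s<..<t} \<in> sets M" if "0 < s" "t < 1" for s t
    proof -
      have "{s<..<t} = (\<Union>n. {s + 1 / Suc n..t - 1 / Suc n})"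
      proof (intro equalityI subsetI)
        fix x assume x: "x \<in> {s<..<t}"
        obtain n where n: "1 / Suc n < min (x - s) (t - x)" using nat_approx_posE[of "min (x - s) (t - x)"] x by auto
        then show "x \<in> (\<Union>n. {s + 1 / Suc n..t - 1 / Suc n})" by (intro UN_I[of n]) auto
      next
        fix x assume "x \<in> (\<Union>n. {s + 1 / Suc n..t - 1 / Suc n})"
        then obtain n where n: "s + 1 / Suc n \<le> x" "x \<le> t - 1 / Suc n" by auto
        have "(0::real) < 1 / Suc n" by simp
        with n show "x \<in> {s<..<t}" unfolding greaterThanLessThan_iff by linarith
      qed
      then have "c ` {s<..<t} = (\<Union>n. c ` {s + 1 / Suc n..t - 1 / Suc n})" by (simp only: image_UN)
      also have "\<dots> \<in> sets borel"
      proof (intro sets.countable_UN'' borel_compact compact_continuous_image)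
        fix n :: nat
        have "(0::real) < 1 / Suc n" by simp
        then show "continuous_on {s + 1 / Suc n..t - 1 / Suc n} c"
          using that by (intro continuous_on_subset[OF c(1)] subsetI) (simp only: atLeastAtMost_iff, linarith)
      qed auto
      finally show ?thesis by (simp add: M)
    qed
    have "(\<Union>T\<in>\<G>. c ` T) \<in> null_sets M"
    proof (rule null_sets_UN'[OF \<G>(2)])
      fix T assume "T \<in> \<G>"
      then obtain t1 t2 where "T = {t1<..<t2}" "0 < t1" "t2 < 1" "emeasure M (c ` T) = 0"
        using \<G>(1) unfolding \<F>_def by blast
      then show "c ` T \<in> null_sets M" using meas by (simp add: null_sets_def)
    qed
    moreover have "{c 0} \<in> null_sets M" "{c 1} \<in> null_sets M" using M by (auto simp: null_sets_def)
    ultimately have nul: "(\<Union>T\<in>\<G>. c ` T) \<union> {c 0} \<union> {c 1} \<in> null_sets M" by (intro null_sets.Un)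
    have "c ` {0..1} \<subseteq> (\<Union>T\<in>\<G>. c ` T) \<union> {c 0} \<union> {c 1}"
    proof
      fix x assume "x \<in> c ` {0..1}"
      then obtain t where t: "t \<in> {0..1}" "x = c t" by blast
      show "x \<in> (\<Union>T\<in>\<G>. c ` T) \<union> {c 0} \<union> {c 1}"
      proof (cases "t = 0 \<or> t = 1")
        case False
        then have "t \<in> {0<..<1}" using t by auto
        then obtain T where "T \<in> \<G>" "t \<in> T" using cover by blast
        then show ?thesis using t by blast
      qed (use t in auto)
    qed
    then show ?thesis using nul by (metis emeasure_eq_0 null_setsD1 null_setsD2)
  qed
  show "\<epsilon> * sg = 1 \<Longrightarrow> emeasure fm (c ` {0..1}) = 0" using loc glob[of fm] sets atoms by blast
  show "\<epsilon> * sg = -1 \<Longrightarrow> emeasure fp (c ` {0..1}) = 0" using loc glob[of fp] sets atoms by blast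
qed

section \<open>Estimates for the transport density\<close>

text \<open>On \<open>Z\<close> the signed measure \<open>h M\<close> equals \<open>fp\<close>, and
  off \<open>Z\<close> the measure \<open>fp\<close> vanishes, so the density is \<open>h\<close>
  cut off to \<open>Z\<close>. It is nonnegative almost everywhere, since otherwise the set of its
  negative values would have negative \<open>fp\<close>-mass.\<close>

lemma jordan_density:
  fixes h :: "plane \<Rightarrow> real"
  assumes M: "sets M = sets borel" and h: "integrable M h"
    and fin: "finite_measure fp" "finite_measure fm" and sets: "sets fp = sets borel" "sets fm = sets borel"
    and Z: "Z \<in> sets borel" "emeasure fp (- Z) = 0" "emeasure fm Z = 0"
    and eq: "\<And>A. A \<in> sets borel \<Longrightarrow> measure fp A - measure fm A = (LINT x|M. indicator A x * h x)"
  shows "fp = density M (\<lambda>x. ennreal (indicator Z x * h x))"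
proof (rule measure_eqI)
  interpret fp: finite_measure fp by fact
  interpret fm: finite_measure fm by fact
  note M [measurable_cong]
  show "sets fp = sets (density M (\<lambda>x. ennreal (indicator Z x * h x)))" using M sets by simp
  have [measurable]: "h \<in> borel_measurable M" using h by (rule borel_measurable_integrable)
  have Zm [measurable]: "Z \<in> sets M" using Z M by simp
  have iZ: "integrable M (\<lambda>x. indicator A x * (indicator Z x * h x))" if [measurable]: "A \<in> sets M" for A
    by (rule Bochner_Integration.integrable_bound[OF h]) (auto simp: indicator_def)
  have m: "measure fp A = (LINT x|M. indicator A x * (indicator Z x * h x))" if A: "A \<in> sets borel" for A
  proof -
    have "measure fp A = measure fp (A \<inter> Z)"
    proof -
      have "emeasure fp A \<le> emeasure fp (A \<inter> Z) + emeasure fp (- Z)"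
      proof -
        have "emeasure fp A \<le> emeasure fp ((A \<inter> Z) \<union> - Z)" using A Z sets by (intro emeasure_mono) auto
        also have "\<dots> \<le> emeasure fp (A \<inter> Z) + emeasure fp (- Z)" using A Z sets by (intro emeasure_subadditive) auto
        finally show ?thesis .
      qed
      moreover have "emeasure fp (A \<inter> Z) \<le> emeasure fp A" using A sets by (intro emeasure_mono) auto
      ultimately show ?thesis using Z by (simp add: fp.emeasure_eq_measure)
    qed
    also have "\<dots> = measure fp (A \<inter> Z) - measure fm (A \<inter> Z)"
    proof -
      have "emeasure fm (A \<inter> Z) \<le> emeasure fm Z" using Z sets by (intro emeasure_mono) auto
      then have "measure fm (A \<inter> Z) = 0" using Z by (simp add: fm.emeasure_eq_measure measure_le_0_iff)
      then show ?thesis by simp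
    qed
    also have "\<dots> = (LINT x|M. indicator (A \<inter> Z) x * h x)" using A Z by (intro eq) auto
    also have "\<dots> = (LINT x|M. indicator A x * (indicator Z x * h x))"
      by (intro Bochner_Integration.integral_cong) (auto simp: indicator_def)
    finally show ?thesis .
  qed
  define N where "N = {x \<in> space M. indicator Z x * h x < 0}"
  have NM [measurable]: "N \<in> sets M" unfolding N_def by measurable
  have "AE x in M. 0 \<le> indicator Z x * h x"
  proof -
    have "0 \<le> (LINT x|M. indicator N x * (indicator Z x * h x))"
      using m[of N] NM M by (metis measure_nonneg)
    moreover have i: "integrable M (\<lambda>x. - (indicator N x * (indicator Z x * h x)))" using iZ[OF NM] by simp
    moreover have nn: "AE x in M. 0 \<le> - (indicator N x * (indicator Z x * h x))"
      by (auto simp: N_def indicator_def)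
    moreover have "0 \<le> (LINT x|M. - (indicator N x * (indicator Z x * h x)))"
      by (rule integral_nonneg_AE[OF nn])
    ultimately have "(LINT x|M. - (indicator N x * (indicator Z x * h x))) = 0" by simp
    then have "AE x in M. - (indicator N x * (indicator Z x * h x)) = 0"
      using integral_nonneg_eq_0_iff_AE[OF i nn] by simp
    then show ?thesis
    proof (rule AE_mp, intro AE_I2 impI)
      fix x assume "x \<in> space M" "- (indicator N x * (indicator Z x * h x)) = 0"
      then show "0 \<le> indicator Z x * h x" by (cases "x \<in> N") (auto simp: N_def)
    qed
  qed
  then have nn: "AE x in M. 0 \<le> indicator A x * (indicator Z x * h x)" for A
    by (rule AE_mp) (auto simp: indicator_def)
  fix A assume "A \<in> sets fp"
  then have A: "A \<in> sets borel" "A \<in> sets M" using sets M by auto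
  have "emeasure fp A = ennreal (LINT x|M. indicator A x * (indicator Z x * h x))"
    using m[OF A(1)] by (simp add: fp.emeasure_eq_measure)
  also have "\<dots> = (\<integral>\<^sup>+x. ennreal (indicator A x * (indicator Z x * h x)) \<partial>M)"
    by (rule nn_integral_eq_integral[symmetric, OF iZ[OF A(2)] nn])
  also have "\<dots> = (\<integral>\<^sup>+x. ennreal (indicator Z x * h x) * indicator A x \<partial>M)"
    by (intro nn_integral_cong) (auto simp: indicator_def)
  also have "\<dots> = emeasure (density M (\<lambda>x. ennreal (indicator Z x * h x))) A"
    using A by (intro emeasure_density[symmetric]) auto
  finally show "emeasure fp A = emeasure (density M (\<lambda>x. ennreal (indicator Z x * h x))) A" .
qed

section \<open>Pairing of sets by a monotone plan\<close>

lemma dist_le_max_dist: "x \<in> A \<Longrightarrow> y \<in> B \<Longrightarrow> ennreal (dist x y) \<le> max_dist A B"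
  unfolding max_dist_def by (intro SUP_upper2[of x A] SUP_upper2[of y B]) auto

lemma min_dist_le_dist: "x \<in> A \<Longrightarrow> y \<in> B \<Longrightarrow> min_dist A B \<le> ennreal (dist x y)"
  unfolding min_dist_def by (intro INF_lower2[of x A] INF_lower2[of y B]) auto

text \<open>Distances on the left are at most maximal distances, those on the right at least minimal
  distances. The extended values in (H4) thus become an inequality between four real
  distances.\<close>

lemma dist_less_of_max_dist_less:
  assumes less: "max_dist A B + max_dist A' B' < min_dist C E + min_dist C' E'"
    and "x1 \<in> A" "y1 \<in> B" "x2 \<in> A'" "y2 \<in> B'" "x3 \<in> C" "y3 \<in> E" "x4 \<in> C'" "y4 \<in> E'"
  shows "dist x1 y1 + dist x2 y2 < dist x3 y3 + dist x4 y4"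
proof -
  have "ennreal (dist x1 y1) + ennreal (dist x2 y2) \<le> max_dist A B + max_dist A' B'"
    using assms by (intro add_mono dist_le_max_dist)
  also note less
  also have "min_dist C E + min_dist C' E' \<le> ennreal (dist x3 y3) + ennreal (dist x4 y4)"
    using assms by (intro add_mono min_dist_le_dist)
  finally have "ennreal (dist x1 y1 + dist x2 y2) < ennreal (dist x3 y3 + dist x4 y4)" by simp
  then show ?thesis by (subst (asm) ennreal_less_iff) auto
qed

text \<open>As \<open>A\<close> and \<open>B\<close> have the same mass, what leaves
  \<open>A\<close> without reaching \<open>B\<close> is balanced by what enters \<open>B\<close>
  from outside \<open>A\<close>. If this mass were positive, \<open>\<Gamma>\<close> would contain a
  ray of each kind, and exchanging their targets would be strictly shorter by \<open>less\<close>,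
  against monotonicity.\<close>

lemma monotone_plan_pairing:
  fixes \<gamma> :: "(plane \<times> plane) measure"
  assumes fin: "finite_measure \<gamma>" and sets [measurable_cong]: "sets \<gamma> = sets (borel \<Otimes>\<^sub>M borel)"
    and A [measurable]: "A \<in> sets borel" and B [measurable]: "B \<in> sets borel"
    and eq: "emeasure (distr \<gamma> borel fst) A = emeasure (distr \<gamma> borel snd) B"
    and supp: "AE z in \<gamma>. z \<in> \<Gamma> \<and> fst z \<in> Lp \<and> snd z \<in> Lm"
    and mono: "\<And>p q. p \<in> \<Gamma> \<Longrightarrow> q \<in> \<Gamma> \<Longrightarrow> dist (fst p) (snd p) + dist (fst q) (snd q) \<le> dist (fst p) (snd q) + dist (fst q) (snd p)"
    and less: "\<And>x y x' y'. x \<in> A \<Longrightarrow> y \<in> B \<Longrightarrow> x' \<in> Lp - A \<Longrightarrow> y' \<in> Lm - B \<Longrightarrow> dist x y + dist x' y' < dist x y' + dist x' y"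
  shows "AE z in \<gamma>. fst z \<in> A \<longrightarrow> snd z \<in> B"
proof (rule ccontr)
  interpret finite_measure \<gamma> by fact
  have sp: "space \<gamma> = UNIV" using sets_eq_imp_space_eq[OF sets] by (simp add: space_pair_measure)
  have rect: "X \<times> Y \<in> sets \<gamma>" if "X \<in> sets borel" "Y \<in> sets borel" for X Y unfolding sets using that by (rule pair_measureI)
  have [simp]: "- A \<in> sets borel" "- B \<in> sets borel" using A B by auto
  have vf: "emeasure (distr \<gamma> borel fst) A = emeasure \<gamma> (A \<times> UNIV)"
    by (subst emeasure_distr) (auto simp: sp intro!: arg_cong[where f="emeasure \<gamma>"])
  have vs: "emeasure (distr \<gamma> borel snd) B = emeasure \<gamma> (UNIV \<times> B)"
    by (subst emeasure_distr) (auto simp: sp intro!: arg_cong[where f="emeasure \<gamma>"])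
  have a: "measure \<gamma> (A \<times> UNIV) = measure \<gamma> (A \<times> B) + measure \<gamma> (A \<times> (- B))"
    by (subst finite_measure_Union[symmetric]) (auto simp: rect intro!: arg_cong[where f="measure \<gamma>"])
  have b: "measure \<gamma> (UNIV \<times> B) = measure \<gamma> (A \<times> B) + measure \<gamma> ((- A) \<times> B)"
    by (subst finite_measure_Union[symmetric]) (auto simp: rect intro!: arg_cong[where f="measure \<gamma>"])
  have ab: "measure \<gamma> (A \<times> (- B)) = measure \<gamma> ((- A) \<times> B)"
    using eq a b unfolding vf vs by (simp add: emeasure_eq_measure)
  have find: "\<exists>z\<in>W. z \<in> \<Gamma> \<and> fst z \<in> Lp \<and> snd z \<in> Lm" if W: "W \<in> sets \<gamma>" "measure \<gamma> W \<noteq> 0" for W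
  proof (rule ccontr)
    assume no: "\<not> (\<exists>z\<in>W. z \<in> \<Gamma> \<and> fst z \<in> Lp \<and> snd z \<in> Lm)"
    have "AE z in \<gamma>. z \<notin> W" using supp by eventually_elim (use no in auto)
    then have "emeasure \<gamma> W = 0" using W(1) AE_iff_null_sets by blast
    then show False using W(2) by (simp add: measure_def)
  qed
  assume "\<not> (AE z in \<gamma>. fst z \<in> A \<longrightarrow> snd z \<in> B)"
  then have "measure \<gamma> (A \<times> (- B)) \<noteq> 0"
  proof (rule contrapos_nn)
    assume "measure \<gamma> (A \<times> (- B)) = 0"
    then have "A \<times> (- B) \<in> null_sets \<gamma>" using rect[of A "- B"] by (simp add: null_sets_def emeasure_eq_measure)
    then have "AE z in \<gamma>. z \<notin> A \<times> (- B)" by (rule AE_not_in)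
    then show "AE z in \<gamma>. fst z \<in> A \<longrightarrow> snd z \<in> B" by eventually_elim auto
  qed
  then obtain p where p: "p \<in> A \<times> (- B)" "p \<in> \<Gamma>" "fst p \<in> Lp" "snd p \<in> Lm" using find[of "A \<times> (- B)"] rect by auto
  have "measure \<gamma> ((- A) \<times> B) \<noteq> 0" using \<open>measure \<gamma> (A \<times> (- B)) \<noteq> 0\<close> ab by simp
  then obtain r where r: "r \<in> (- A) \<times> B" "r \<in> \<Gamma>" "fst r \<in> Lp" "snd r \<in> Lm" using find[of "(- A) \<times> B"] rect by auto
  have "dist (fst p) (snd r) + dist (fst r) (snd p) < dist (fst p) (snd p) + dist (fst r) (snd r)"
    using p r by (intro less) auto
  then show False using mono[OF p(2) r(2)] by simp
qed

text \<open>The weight \<open>1 / \<rho>\<close> cancels the density of the first marginal, which is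
  then bounded by \<open>H^1\<close>, as \<open>transport_mass_le\<close> requires.\<close>

lemma half_transport_mass_le:
  fixes \<gamma> :: "(plane \<times> plane) measure" and w :: "plane \<times> plane \<Rightarrow> real" and \<rho> :: "plane \<Rightarrow> real"
  assumes H: "\<And>A. A \<in> sets borel \<Longrightarrow> emeasure hausdorff1 A \<le> hausdorff1_outer A"
    and fin: "finite_measure \<gamma>" and sets [measurable_cong]: "sets \<gamma> = sets borel"
    and \<rho> [measurable]: "\<rho> \<in> borel_measurable borel"
    and marg: "distr \<gamma> borel fst = density hausdorff1 (\<lambda>x. ennreal (\<rho> x))"
    and S: "strictly_convex S" "strictly_convex S'"
    and \<Gamma>: "compact \<Gamma>" "\<Gamma> \<subseteq> (frontier S \<union> frontier S') \<times> (frontier S \<union> frontier S')"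
    and mono: "\<And>p q. p \<in> \<Gamma> \<Longrightarrow> q \<in> \<Gamma> \<Longrightarrow> dist (fst p) (snd p) + dist (fst q) (snd q) \<le> dist (fst p) (snd q) + dist (fst q) (snd p)"
    and w: "continuous_on UNIV w" "\<And>z. w z \<ge> 0"
    and good: "AE z in \<gamma>. z \<in> \<Gamma> \<and> (w z > 0 \<longrightarrow> (\<exists>R\<in>{S, S'}. \<exists>n. fst z \<in> closure R \<and> outward_unit_normal R (fst z) n \<and>
        w z \<le> \<bar>n \<bullet> (snd z - fst z)\<bar>))"
    and B [measurable]: "B \<in> sets borel"
  shows "(\<integral>\<^sup>+z. ennreal (1 / \<rho> (fst z)) * (ennreal (w z) * half_mass B z) \<partial>\<gamma>) \<le> 512 * emeasure lborel B"
proof -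
  interpret finite_measure \<gamma> by fact
  have fstm [measurable]: "fst \<in> \<gamma> \<rightarrow>\<^sub>M (borel :: plane measure)" "(fst :: plane \<times> plane \<Rightarrow> plane) \<in> borel \<rightarrow>\<^sub>M borel"
  proof -
    show "(fst :: plane \<times> plane \<Rightarrow> plane) \<in> borel \<rightarrow>\<^sub>M borel" by (intro borel_measurable_continuous_onI continuous_intros)
    then show "fst \<in> \<gamma> \<rightarrow>\<^sub>M (borel :: plane measure)" using sets by (simp cong: measurable_cong_sets)
  qed
  have [measurable]: "w \<in> borel_measurable borel" using w(1) by (rule borel_measurable_continuous_onI)
  define \<gamma>' where "\<gamma>' = density \<gamma> (\<lambda>z. ennreal (1 / \<rho> (fst z)))"
  have s': "sets \<gamma>' = sets borel" by (simp add: \<gamma>'_def sets)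
  have [measurable]: "\<rho> \<in> borel_measurable hausdorff1" using \<rho> by (simp cong: measurable_cong_sets)
  have "(\<integral>\<^sup>+z. ennreal (w z) * half_mass B z \<partial>\<gamma>') \<le> 512 * emeasure lborel B"
  proof (rule transport_mass_le[OF _ s' _ S \<Gamma> mono w _ B])
    show "sigma_finite_measure \<gamma>'"
      unfolding \<gamma>'_def by (subst sigma_finite_iff_density_finite) auto
    show "AE z in \<gamma>'. z \<in> \<Gamma> \<and> (w z > 0 \<longrightarrow> (\<exists>R\<in>{S, S'}. \<exists>n. fst z \<in> closure R \<and> outward_unit_normal R (fst z) n \<and>
        w z \<le> \<bar>n \<bullet> (snd z - fst z)\<bar>))"
      unfolding \<gamma>'_def
    proof (subst AE_density)
      show "AE z in \<gamma>. 0 < ennreal (1 / \<rho> (fst z)) \<longrightarrow> z \<in> \<Gamma> \<and> (w z > 0 \<longrightarrow> (\<exists>R\<in>{S, S'}. \<exists>n. fst z \<in> closure R \<and> outward_unit_normal R (fst z) n \<and>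
        w z \<le> \<bar>n \<bullet> (snd z - fst z)\<bar>))"
        using good by eventually_elim blast
    qed measurable
    fix F :: "plane set" assume F [measurable]: "F \<in> sets borel"
    have FU: "F \<times> UNIV \<in> sets \<gamma>" unfolding sets borel_prod[symmetric] using F by (intro pair_measureI) auto
    have "emeasure \<gamma>' (F \<times> UNIV) = (\<integral>\<^sup>+z. ennreal (1 / \<rho> (fst z)) * indicator (F \<times> UNIV) z \<partial>\<gamma>)"
      unfolding \<gamma>'_def using FU by (intro emeasure_density) auto
    also have "\<dots> = (\<integral>\<^sup>+z. ennreal (1 / \<rho> (fst z)) * indicator F (fst z) \<partial>\<gamma>)"
      by (intro nn_integral_cong) (auto simp: indicator_def)
    also have "\<dots> = (\<integral>\<^sup>+x. ennreal (1 / \<rho> x) * indicator F x \<partial>distr \<gamma> borel fst)"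
      by (subst nn_integral_distr) auto
    also have "\<dots> = (\<integral>\<^sup>+x. ennreal (\<rho> x) * (ennreal (1 / \<rho> x) * indicator F x) \<partial>hausdorff1)"
      unfolding marg by (subst nn_integral_density) auto
    also have "\<dots> \<le> (\<integral>\<^sup>+x. indicator F x \<partial>hausdorff1)"
    proof (rule nn_integral_mono)
      fix x
      \<comment> \<open>Where \<open>\<rho> x \<le> 0\<close> the factor
        \<open>ennreal (\<rho> x)\<close> is 0, so the value of \<open>1 / \<rho> x\<close> does not
        matter.\<close>
      have "ennreal (\<rho> x) * ennreal (1 / \<rho> x) \<le> 1"
      proof (cases "\<rho> x > 0")
        case True
        then have "ennreal (\<rho> x) * ennreal (1 / \<rho> x) = ennreal (\<rho> x * (1 / \<rho> x))" by (intro ennreal_mult'[symmetric]) simp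
        then show ?thesis using True by simp
      qed (simp add: ennreal_neg)
      then show "ennreal (\<rho> x) * (ennreal (1 / \<rho> x) * indicator F x) \<le> indicator F x" by (simp add: indicator_def)
    qed
    also have "\<dots> = emeasure hausdorff1 F" by simp
    also have "\<dots> \<le> hausdorff1_outer F" by (rule H[OF F])
    finally show "emeasure \<gamma>' (F \<times> UNIV) \<le> hausdorff1_outer F" .
  qed
  also have "(\<integral>\<^sup>+z. ennreal (w z) * half_mass B z \<partial>\<gamma>') = (\<integral>\<^sup>+z. ennreal (1 / \<rho> (fst z)) * (ennreal (w z) * half_mass B z) \<partial>\<gamma>)"
    unfolding \<gamma>'_def by (rule nn_integral_density) auto
  finally show ?thesis .
qed

text \<open>The indicator of a nonempty closed set is the limit of the continuous functions
  \<open>max 0 (1 - real n * infdist x C)\<close>, and closed sets form a generator that is stable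
  under intersection.\<close>

lemma finite_borel_measure_eqI_continuous:
  fixes M N :: "'a::euclidean_space measure"
  assumes fin: "finite_measure M" "finite_measure N" and sets: "sets M = sets borel" "sets N = sets borel"
    and eq: "\<And>f :: 'a \<Rightarrow> real. continuous_on UNIV f \<Longrightarrow> (\<And>x. 0 \<le> f x \<and> f x \<le> 1) \<Longrightarrow> (LINT x|M. f x) = (LINT x|N. f x)"
  shows "M = N"
proof (rule measure_eqI_generator_eq[where \<Omega>=UNIV and E="{C. closed C}" and A="\<lambda>_. UNIV"])
  interpret M: finite_measure M by fact
  interpret N: finite_measure N by fact
  show "Int_stable {C :: 'a set. closed C}" by (auto simp: Int_stable_def)
  show "sets M = sigma_sets UNIV {C. closed C}" "sets N = sigma_sets UNIV {C. closed C}"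
    using sets by (simp_all add: borel_eq_closed)
  show "emeasure M UNIV \<noteq> \<infinity>" by (simp add: M.emeasure_eq_measure)
  fix C :: "'a set" assume "C \<in> {C. closed C}"
  then have C: "closed C" by simp
  show "emeasure M C = emeasure N C"
  \<comment> \<open>\<open>infdist x {}\<close> is 0 by convention, so for the empty set the
    approximating functions would tend to 1.\<close>
  proof (cases "C = {}")
    case False
    define f where "f n x = max 0 (1 - real n * infdist x C)" for n x
    have fc: "continuous_on UNIV (f n)" for n unfolding f_def by (intro continuous_intros)
    have fb: "0 \<le> f n x \<and> f n x \<le> 1" for n x by (auto simp: f_def infdist_nonneg)
    have lim: "(\<lambda>n. f n x) \<longlonglongrightarrow> indicator C x" for x
    proof (cases "x \<in> C")
      case True
      then show ?thesis by (simp add: f_def)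
    next
      case xC: False
      then have pos: "infdist x C > 0" using C False by (metis in_closed_iff_infdist_zero infdist_nonneg order_le_less)
      obtain n0 where n0: "1 / infdist x C < real n0" using reals_Archimedean2 by blast
      have "f n x = 0" if "n \<ge> n0" for n
      proof -
        have "1 / infdist x C \<le> real n" using n0 that by linarith
        then have "1 \<le> real n * infdist x C" using pos by (simp add: field_simps)
        then show ?thesis by (simp add: f_def)
      qed
      then show ?thesis using xC by (intro tendsto_eventually) (auto simp: eventually_sequentially)
    qed
    have conv: "(\<lambda>n. LINT x|K. f n x) \<longlonglongrightarrow> measure K C" if K: "finite_measure K" "sets K = sets borel" for K
    proof -
      interpret K: finite_measure K by fact
      have "(\<lambda>n. LINT x|K. f n x) \<longlonglongrightarrow> (LINT x|K. indicator C x)"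
      proof (rule integral_dominated_convergence[where w="\<lambda>_. 1"])
        show "(f n) \<in> borel_measurable K" for n
          using borel_measurable_continuous_onI[OF fc[of n]] K(2) by (simp cong: measurable_cong_sets)
        show "(indicator C :: 'a \<Rightarrow> real) \<in> borel_measurable K" using C K(2) by (intro borel_measurable_indicator) auto
      qed (use lim fb in auto)
      then show ?thesis using C K(2) by simp
    qed
    have "(LINT x|M. f n x) = (LINT x|N. f n x)" for n by (rule eq[OF fc fb])
    then have "measure M C = measure N C"
      using conv[OF fin(1) sets(1)] conv[OF fin(2) sets(2)] LIMSEQ_unique by (metis (no_types, lifting) ext)
    then show ?thesis by (simp add: M.emeasure_eq_measure N.emeasure_eq_measure)
  qed simp
qed auto

text \<open>True in both cases of \<open>emeasure_hausdorff1_cases\<close>, so upper bounds through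
  \<open>H^1\<close> need no case distinction.\<close>

lemma emeasure_hausdorff1_le: "A \<in> sets borel \<Longrightarrow> emeasure hausdorff1 A \<le> hausdorff1_outer A"
  by (cases rule: emeasure_hausdorff1_cases) auto

lemma emeasure_hausdorff1_countable:
  assumes "countable A" shows "emeasure hausdorff1 A = 0"
proof (cases rule: emeasure_hausdorff1_cases)
  case measure
  have "(\<Union>x\<in>A. {x}) \<in> sets borel" using assms by (intro sets.countable_UN') auto
  then show ?thesis using measure[of A] hausdorff1_outer_countable[OF assms] by simp
qed simp

section \<open>Pairing of the arcs and transversality\<close>

text \<open>\<open>ac\<close> will follow from the densities of \<open>fp\<close> and
  \<open>fm\<close> with respect to \<open>hausdorff1\<close>. It makes points and the countable set
  of corners negligible, and it settles the case of a vanishing \<open>hausdorff1\<close>.\<close>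

locale transport_setup =
  fixes Op Om :: "plane set" and g :: "plane \<Rightarrow> real" and fp fm :: "plane measure"
    and \<gamma> :: "(plane \<times> plane) measure" and D :: decomposition
  assumes data: "annulus_data Op Om" and td: "tangential_derivative Op Om g fp fm"
    and h1: "H1 Op Om g" and h2: "H2 Op Om g fp fm D" and h4: "H4 g D" and h5: "H5 Om D"
    and opt: "optimal_plan (annulus Op Om) fp fm \<gamma>"
    and ac: "\<And>A. A \<in> sets borel \<Longrightarrow> emeasure hausdorff1 A = 0 \<Longrightarrow> emeasure fp A = 0 \<and> emeasure fm A = 0"
begin

lemma Op_Om: "open Op" "bounded Op" "convex Op" "strictly_convex Op" "Op \<noteq> {}"
  "open Om" "bounded Om" "convex Om" "strictly_convex Om" "Om \<noteq> {}" "closure Om \<subseteq> Op"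
  using data closure_subset[of Om] by (auto simp: annulus_data_def strictly_convex_def)

lemma jordan: "jordan_parts fp fm"
  using td by (simp add: tangential_derivative_def Let_def)

lemma fin: "finite_measure fp" "finite_measure fm"
  and sets_f [measurable_cong, simp]: "sets fp = sets borel" "sets fm = sets borel"
  using jordan by (auto simp: jordan_parts_def)

definition T where "T = frontier Op \<union> frontier Om"

lemma frontier_annulus: "frontier (annulus Op Om) = T"
  unfolding T_def by (rule annulus_frontier(1)[OF data])

lemma compact_T: "compact T"
  unfolding T_def using Op_Om by (intro compact_Un compact_frontier_bounded)

lemma supported_T: "AE x in fp. x \<in> T" "AE x in fm. x \<in> T"
proof -
  have "emeasure fp (- T) = 0" "emeasure fm (- T) = 0"
    using td by (auto simp: tangential_derivative_def Let_def frontier_annulus)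
  moreover have "- T \<in> sets borel" using compact_T by (intro borel_open open_Compl compact_imp_closed)
  ultimately have n: "- T \<in> null_sets fp" "- T \<in> null_sets fm" by (auto simp: null_sets_def)
  show "AE x in fp. x \<in> T" "AE x in fm. x \<in> T" using AE_not_in[OF n(1)] AE_not_in[OF n(2)] by simp_all
qed

lemma g_integrable: "integrable (boundary_measure (annulus Op Om)) g"
  using h1 by (simp add: H1_def)

lemma atoms: "emeasure fp {x} = 0" "emeasure fm {x} = 0"
  using ac[of "{x}"] emeasure_hausdorff1_countable[of "{x}"] by auto

lemma plan: "sets \<gamma> = sets borel" "emeasure \<gamma> (- (closure (annulus Op Om) \<times> closure (annulus Op Om))) = 0"
  "distr \<gamma> borel fst = fp" "distr \<gamma> borel snd = fm"
  using opt unfolding optimal_plan_def transport_plan_def by blast+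

lemma sets_\<gamma> [measurable_cong]: "sets \<gamma> = sets (borel \<Otimes>\<^sub>M borel)"
  unfolding borel_prod by (rule plan(1))

lemma space_\<gamma> [simp]: "space \<gamma> = UNIV"
  using sets_eq_imp_space_eq[OF plan(1)] by simp

lemma proj_measurable [measurable]:
  "fst \<in> \<gamma> \<rightarrow>\<^sub>M (borel :: plane measure)" "snd \<in> \<gamma> \<rightarrow>\<^sub>M (borel :: plane measure)"
  by measurable

lemma finite_\<gamma>: "finite_measure \<gamma>"
proof (rule finite_measureI)
  have "emeasure \<gamma> (space \<gamma>) = emeasure (distr \<gamma> borel fst) UNIV" by (simp add: emeasure_distr)
  then show "emeasure \<gamma> (space \<gamma>) \<noteq> \<infinity>" unfolding plan(3)
    using finite_measure.emeasure_finite[OF fin(1)] by simp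
qed

lemma AE_fst: "AE x in fp. Q x \<Longrightarrow> AE z in \<gamma>. Q (fst z)"
  unfolding plan(3)[symmetric] by (rule AE_distrD[rotated]) measurable

lemma AE_snd: "AE x in fm. Q x \<Longrightarrow> AE z in \<gamma>. Q (snd z)"
  unfolding plan(4)[symmetric] by (rule AE_distrD[rotated]) measurable

text \<open>Monotonicity holds for every pair of points of the support, not only almost everywhere;
  the intersection with \<open>T \<times> T\<close> makes the set compact and puts both ends on the
  boundary curves.\<close>

definition \<Gamma> where "\<Gamma> = msupport \<gamma> \<inter> T \<times> T"

lemma compact_\<Gamma>: "compact \<Gamma>"
  unfolding \<Gamma>_def by (intro closed_Int_compact closed_msupport compact_Times compact_T)

lemma AE_\<Gamma>: "AE z in \<gamma>. z \<in> \<Gamma>"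
  using AE_msupport[OF plan(1)] AE_fst[OF supported_T(1)] AE_snd[OF supported_T(2)]
  by eventually_elim (auto simp: \<Gamma>_def mem_Times_iff)

lemma bounded_annulus: "bounded (annulus Op Om)"
  unfolding annulus_def using Op_Om(2) by (rule bounded_subset) auto

lemma mono_\<Gamma>: "p \<in> \<Gamma> \<Longrightarrow> q \<in> \<Gamma> \<Longrightarrow> dist (fst p) (snd p) + dist (fst q) (snd q) \<le> dist (fst p) (snd q) + dist (fst q) (snd p)"
  using optimal_plan_monotone[OF opt fin(1) bounded_annulus, of "fst p" "snd p" "fst q" "snd q"]
  by (auto simp: \<Gamma>_def)

text \<open>Disposes of the case where \<open>hausdorff1\<close> is the zero measure:
  \<open>fp\<close> vanishes by \<open>ac\<close>, and with it \<open>\<gamma>\<close>.\<close>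

lemma null_of_zero: assumes "\<And>A. emeasure hausdorff1 A = 0" shows "AE z in \<gamma>. Q z"
proof -
  have "emeasure \<gamma> (space \<gamma>) = emeasure (distr \<gamma> borel fst) UNIV" by (simp add: emeasure_distr)
  also have "\<dots> = 0" unfolding plan(3) using ac[of UNIV] assms by simp
  finally have "space \<gamma> \<in> null_sets \<gamma>" using sets.top[of \<gamma>] by (simp add: null_sets_def)
  then have "AE z in \<gamma>. z \<notin> space \<gamma>" by (rule AE_not_in)
  then show ?thesis by eventually_elim auto
qed

context
  assumes H: "\<And>A. A \<in> sets borel \<Longrightarrow> emeasure hausdorff1 A = hausdorff1_outer A"
begin

lemma clockwise_arcD:
  assumes "clockwise_arc S c"
  shows "continuous_on {0..1} c" "inj_on c {0<..<1}" "c ` {0..1} \<subseteq> frontier S" "path_image c = c ` {0..1}"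
  using assms by (auto simp: clockwise_arc_def arc_def path_def path_image_def intro: inj_on_subset)

lemma increasing_arc_sign:
  assumes "increasing_arc g S A"
  shows "S = Op \<Longrightarrow> emeasure fm A = 0" "S = Om \<Longrightarrow> emeasure fp A = 0"
proof -
  obtain c where c: "clockwise_arc S c" "path_image c = A" "mono_on {0..1} (g \<circ> c)"
    using assms by (auto simp: increasing_arc_def)
  have m: "clockwise_arc S c \<and> (\<forall>s t. 0 \<le> s \<longrightarrow> s \<le> t \<longrightarrow> t \<le> 1 \<longrightarrow> 1 * g (c s) \<le> 1 * g (c t))
       \<or> (\<forall>s\<in>{0..1}. \<forall>t\<in>{0..1}. g (c s) = g (c t))"
    using c mono_onD[OF c(3)] by auto
  show "S = Op \<Longrightarrow> emeasure fm A = 0"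
    using path_sign(1)[OF H data td g_integrable _ _ atoms clockwise_arcD(1-3)[OF c(1)] m, of 1] Op_Om(5) c(2)
    by (auto simp: path_image_def)
  show "S = Om \<Longrightarrow> emeasure fp A = 0"
    using path_sign(2)[OF H data td g_integrable _ _ atoms clockwise_arcD(1-3)[OF c(1)] m, of "-1"] Op_Om(10) c(2)
    by (auto simp: path_image_def)
qed

lemma decreasing_arc_sign:
  assumes "decreasing_arc g S A"
  shows "S = Op \<Longrightarrow> emeasure fp A = 0" "S = Om \<Longrightarrow> emeasure fm A = 0"
proof -
  obtain c where c: "clockwise_arc S c" "path_image c = A" "antimono_on {0..1} (g \<circ> c)"
    using assms by (auto simp: decreasing_arc_def)
  have m: "clockwise_arc S c \<and> (\<forall>s t. 0 \<le> s \<longrightarrow> s \<le> t \<longrightarrow> t \<le> 1 \<longrightarrow> (-1) * g (c s) \<le> (-1) * g (c t))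
       \<or> (\<forall>s\<in>{0..1}. \<forall>t\<in>{0..1}. g (c s) = g (c t))"
    using c(1) monotone_onD[OF c(3)] by auto
  show "S = Op \<Longrightarrow> emeasure fp A = 0"
    using path_sign(2)[OF H data td g_integrable _ _ atoms clockwise_arcD(1-3)[OF c(1)] m, of 1] Op_Om(5) c(2)
    by (auto simp: path_image_def)
  show "S = Om \<Longrightarrow> emeasure fm A = 0"
    using path_sign(1)[OF H data td g_integrable _ _ atoms clockwise_arcD(1-3)[OF c(1)] m, of "-1"] Op_Om(10) c(2)
    by (auto simp: path_image_def)
qed

text \<open>A constant function is increasing and decreasing at once, so \<open>path_sign\<close>
  applies with \<open>\<epsilon>\<close> equal to \<open>sg\<close> and to \<open>- sg\<close>. The
  arc may be a closed curve, which is injective only on the open parameter interval.\<close>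

lemma constant_arc_null:
  assumes "boundary_arc S A" "g constant_on A" "S = Op \<or> S = Om"
  shows "emeasure fp A = 0" "emeasure fm A = 0"
proof -
  obtain c where c: "simple_path c" "path_image c = A" "A \<subseteq> frontier S"
    using assms(1) by (auto simp: boundary_arc_def)
  have cc: "continuous_on {0..1} c" "c ` {0..1} \<subseteq> frontier S" "c ` {0..1} = A"
    using c by (auto simp: simple_path_def path_def path_image_def)
  have ci: "inj_on c {0<..<1}"
  proof (rule inj_onI)
    fix x y :: real assume xy: "x \<in> {0<..<1}" "y \<in> {0<..<1}" "c x = c y"
    have "loop_free c" using c(1) by (simp add: simple_path_def)
    moreover have "x \<in> {0..1}" "y \<in> {0..1}" using xy by auto
    ultimately have "x = y \<or> x = 0 \<and> y = 1 \<or> x = 1 \<and> y = 0" unfolding loop_free_def using xy(3) by blast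
    then show "x = y" using xy by auto
  qed
  obtain y where "\<And>x. x \<in> A \<Longrightarrow> g x = y" using assms(2) by (auto simp: constant_on_def)
  then have m: "clockwise_arc S c \<and> (\<forall>s t. 0 \<le> s \<longrightarrow> s \<le> t \<longrightarrow> t \<le> 1 \<longrightarrow> \<epsilon> * g (c s) \<le> \<epsilon> * g (c t))
       \<or> (\<forall>s\<in>{0..1}. \<forall>t\<in>{0..1}. g (c s) = g (c t))" for \<epsilon>
    using cc(3) by auto
  obtain sg :: real where sg: "S = Op \<and> sg = 1 \<or> S = Om \<and> sg = -1" using assms(3) by auto
  have ne: "S \<noteq> {}" using sg Op_Om by auto
  have "sg = 1 \<or> sg = -1" using sg by auto
  then show "emeasure fm A = 0" "emeasure fp A = 0"
    using path_sign(1)[OF H data td g_integrable sg ne atoms cc(1) ci cc(2) m, of sg]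
      path_sign(2)[OF H data td g_integrable sg ne atoms cc(1) ci cc(2) m, of "- sg"] cc(3) by auto
qed

end

lemma arcs_compact:
  "increasing_arc g S A \<Longrightarrow> compact A" "decreasing_arc g S A \<Longrightarrow> compact A" "boundary_arc S A \<Longrightarrow> compact A"
  by (auto simp: increasing_arc_def decreasing_arc_def boundary_arc_def clockwise_arc_def compact_arc_image compact_simple_path_image)

abbreviation nonflat where "nonflat i \<equiv> i \<in> IFp D \<and> \<not> g constant_on Fp D i"

lemma H2D:
  "frontier Op = (\<Union>i\<in>IX D. Xp D i) \<union> (\<Union>i\<in>IG D. Gp D i) \<union> (\<Union>i\<in>IFp D. Fp D i)"
  "frontier Om = (\<Union>i\<in>IX D. Xm D i) \<union> (\<Union>i\<in>IG D. Gm D i) \<union> (\<Union>i\<in>IFm D. Fm D i)"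
  "i \<in> IX D \<Longrightarrow> increasing_arc g Op (Xp D i)" "i \<in> IX D \<Longrightarrow> increasing_arc g Om (Xm D i)"
  "i \<in> IX D \<Longrightarrow> TV fp fm (Xp D i) = TV fp fm (Xm D i)"
  "i \<in> IG D \<Longrightarrow> decreasing_arc g Op (Gp D i)" "i \<in> IG D \<Longrightarrow> decreasing_arc g Om (Gm D i)"
  "i \<in> IG D \<Longrightarrow> TV fp fm (Gp D i) = TV fp fm (Gm D i)"
  "i \<in> IFp D \<Longrightarrow> boundary_arc Op (Fp D i)"
  "i \<in> IFp D \<Longrightarrow> g constant_on Fp D i \<Longrightarrow> Fpp D i = {} \<and> Fpm D i = {}"
  "nonflat i \<Longrightarrow> Fp D i = Fpp D i \<union> Fpm D i" "nonflat i \<Longrightarrow> increasing_arc g Op (Fpp D i)"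
  "nonflat i \<Longrightarrow> decreasing_arc g Op (Fpm D i)" "nonflat i \<Longrightarrow> TV fp fm (Fpp D i) = TV fp fm (Fpm D i)"
  "i \<in> IFm D \<Longrightarrow> boundary_arc Om (Fm D i) \<and> g constant_on Fm D i"
  using h2 unfolding H2_def decomposes_def by (auto split: if_splits)

abbreviation Lp where "Lp \<equiv> Lambda_pos D"
abbreviation Lm where "Lm \<equiv> Lambda_neg D"

definition paired :: "plane \<times> plane \<Rightarrow> bool" where
  "paired z \<longleftrightarrow> (\<exists>i\<in>IX D. fst z \<in> Xp D i \<and> snd z \<in> Xm D i) \<or> (\<exists>i\<in>IG D. fst z \<in> Gm D i \<and> snd z \<in> Gp D i) \<or>
     (\<exists>i. nonflat i \<and> fst z \<in> Fpp D i \<and> snd z \<in> Fpm D i)"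

lemma AE_avoid:
  fixes M :: "plane measure"
  assumes "sets M = sets borel" "\<And>i::nat. i \<in> I \<Longrightarrow> compact (A i)" "\<And>i. i \<in> I \<Longrightarrow> emeasure M (A i) = 0"
  shows "AE x in M. \<forall>i\<in>I. x \<notin> A i"
proof (subst AE_ball_countable)
  show "countable I" by simp
  show "\<forall>i\<in>I. AE x in M. x \<notin> A i"
    using assms by (auto intro!: AE_not_in simp: null_sets_def borel_compact)
qed

text \<open>The signs on the arcs put \<open>fp\<close> on \<open>Lp\<close> and \<open>fm\<close>
  on \<open>Lm\<close>. They also reduce equality of the total variations to equality of the
  \<open>fp\<close>-mass of one arc and the \<open>fm\<close>-mass of its partner, the other parts
  being null there. (H4) supplies the strict inequality that \<open>monotone_plan_pairing\<close>
  asks for.\<close>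

lemma AE_paired: "AE z in \<gamma>. paired z"
proof (cases rule: emeasure_hausdorff1_cases)
  case zero
  then show ?thesis by (rule null_of_zero)
next
  case H: measure
  have fp0: "AE x in fp. (\<forall>i\<in>IG D. x \<notin> Gp D i) \<and> (\<forall>i\<in>{i. nonflat i}. x \<notin> Fpm D i) \<and> (\<forall>i\<in>{i\<in>IFp D. g constant_on Fp D i}. x \<notin> Fp D i)
      \<and> (\<forall>i\<in>IX D. x \<notin> Xm D i) \<and> (\<forall>i\<in>IFm D. x \<notin> Fm D i)"
  proof (intro AE_conjI AE_avoid)
    show "emeasure fp (Gp D i) = 0" "compact (Gp D i)" if "i \<in> IG D" for i
      using decreasing_arc_sign(1)[OF H H2D(6)[OF that]] arcs_compact(2)[OF H2D(6)[OF that]] by auto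
    show "emeasure fp (Fpm D i) = 0" "compact (Fpm D i)" if "i \<in> {i. nonflat i}" for i
      using decreasing_arc_sign(1)[OF H H2D(13)] arcs_compact(2)[OF H2D(13)] that by auto
    show "emeasure fp (Fp D i) = 0" "compact (Fp D i)" if "i \<in> {i\<in>IFp D. g constant_on Fp D i}" for i
      using constant_arc_null(1)[OF H H2D(9), of i] arcs_compact(3)[OF H2D(9), of i] that by auto
    show "emeasure fp (Xm D i) = 0" "compact (Xm D i)" if "i \<in> IX D" for i
      using increasing_arc_sign(2)[OF H H2D(4)[OF that]] arcs_compact(1)[OF H2D(4)[OF that]] by auto
    show "emeasure fp (Fm D i) = 0" "compact (Fm D i)" if "i \<in> IFm D" for i
      using constant_arc_null(1)[OF H, of Om "Fm D i"] H2D(15)[OF that] arcs_compact(3)[of Om "Fm D i"] by auto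
  qed simp_all
  have fm0: "AE x in fm. (\<forall>i\<in>IX D. x \<notin> Xp D i) \<and> (\<forall>i\<in>{i. nonflat i}. x \<notin> Fpp D i) \<and> (\<forall>i\<in>{i\<in>IFp D. g constant_on Fp D i}. x \<notin> Fp D i)
      \<and> (\<forall>i\<in>IG D. x \<notin> Gm D i) \<and> (\<forall>i\<in>IFm D. x \<notin> Fm D i)"
  proof (intro AE_conjI AE_avoid)
    show "emeasure fm (Xp D i) = 0" "compact (Xp D i)" if "i \<in> IX D" for i
      using increasing_arc_sign(1)[OF H H2D(3)[OF that]] arcs_compact(1)[OF H2D(3)[OF that]] by auto
    show "emeasure fm (Fpp D i) = 0" "compact (Fpp D i)" if "i \<in> {i. nonflat i}" for i
      using increasing_arc_sign(1)[OF H H2D(12)] arcs_compact(1)[OF H2D(12)] that by auto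
    show "emeasure fm (Fp D i) = 0" "compact (Fp D i)" if "i \<in> {i\<in>IFp D. g constant_on Fp D i}" for i
      using constant_arc_null(2)[OF H H2D(9), of i] arcs_compact(3)[OF H2D(9), of i] that by auto
    show "emeasure fm (Gm D i) = 0" "compact (Gm D i)" if "i \<in> IG D" for i
      using decreasing_arc_sign(2)[OF H H2D(7)[OF that]] arcs_compact(2)[OF H2D(7)[OF that]] by auto
    show "emeasure fm (Fm D i) = 0" "compact (Fm D i)" if "i \<in> IFm D" for i
      using constant_arc_null(2)[OF H, of Om "Fm D i"] H2D(15)[OF that] arcs_compact(3)[of Om "Fm D i"] by auto
  qed simp_all
  have fpL: "AE x in fp. x \<in> Lp"
    using fp0 supported_T(1)
  proof eventually_elim
    fix x assume x: "(\<forall>i\<in>IG D. x \<notin> Gp D i) \<and> (\<forall>i\<in>{i. nonflat i}. x \<notin> Fpm D i) \<and> (\<forall>i\<in>{i\<in>IFp D. g constant_on Fp D i}. x \<notin> Fp D i)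
      \<and> (\<forall>i\<in>IX D. x \<notin> Xm D i) \<and> (\<forall>i\<in>IFm D. x \<notin> Fm D i)" "x \<in> T"
    then show "x \<in> Lp" using H2D(11) unfolding T_def H2D(1,2) Lambda_pos_def by blast
  qed
  have fmL: "AE x in fm. x \<in> Lm"
    using fm0 supported_T(2)
  proof eventually_elim
    fix x assume x: "(\<forall>i\<in>IX D. x \<notin> Xp D i) \<and> (\<forall>i\<in>{i. nonflat i}. x \<notin> Fpp D i) \<and> (\<forall>i\<in>{i\<in>IFp D. g constant_on Fp D i}. x \<notin> Fp D i)
      \<and> (\<forall>i\<in>IG D. x \<notin> Gm D i) \<and> (\<forall>i\<in>IFm D. x \<notin> Fm D i)" "x \<in> T"
    then show "x \<in> Lm" using H2D(11) unfolding T_def H2D(1,2) Lambda_neg_def by blast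
  qed
  have supp: "AE z in \<gamma>. z \<in> \<Gamma> \<and> fst z \<in> Lp \<and> snd z \<in> Lm"
    using AE_\<Gamma> AE_fst[OF fpL] AE_snd[OF fmL] by eventually_elim auto
  have pair: "AE z in \<gamma>. fst z \<in> A \<longrightarrow> snd z \<in> B"
    if A: "compact A" and B: "compact B" and eq: "emeasure fp A = emeasure fm B"
      and less: "\<And>x y x' y'. x \<in> A \<Longrightarrow> y \<in> B \<Longrightarrow> x' \<in> Lp - A \<Longrightarrow> y' \<in> Lm - B \<Longrightarrow> dist x y + dist x' y' < dist x y' + dist x' y"
    for A B
    by (rule monotone_plan_pairing[OF finite_\<gamma> sets_\<gamma> borel_compact[OF A] borel_compact[OF B] _ supp mono_\<Gamma> less])
       (use eq in \<open>simp_all add: plan\<close>)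
  have pX: "AE z in \<gamma>. \<forall>i\<in>IX D. fst z \<in> Xp D i \<longrightarrow> snd z \<in> Xm D i"
  proof (subst AE_ball_countable, simp, intro ballI pair)
    fix i assume i: "i \<in> IX D"
    show "compact (Xp D i)" "compact (Xm D i)" using arcs_compact(1) H2D(3,4) i by blast+
    show "emeasure fp (Xp D i) = emeasure fm (Xm D i)"
      using H2D(5)[OF i] increasing_arc_sign[OF H H2D(3)[OF i]] increasing_arc_sign[OF H H2D(4)[OF i]] by (simp add: TV_def)
    fix x y x' y' assume "x \<in> Xp D i" "y \<in> Xm D i" "x' \<in> Lp - Xp D i" "y' \<in> Lm - Xm D i"
    moreover have "max_dist (Xp D i) (Xm D i) + max_dist (Lp - Xp D i) (Lm - Xm D i)
           < min_dist (Xp D i) (Lm - Xm D i) + min_dist (Xm D i) (Lp - Xp D i)"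
      using h4 i unfolding H4_def Let_def by blast
    ultimately have "dist x y + dist x' y' < dist x y' + dist y x'" by (intro dist_less_of_max_dist_less)
    then show "dist x y + dist x' y' < dist x y' + dist x' y" by (simp add: dist_commute)
  qed
  have pG: "AE z in \<gamma>. \<forall>i\<in>IG D. fst z \<in> Gm D i \<longrightarrow> snd z \<in> Gp D i"
  proof (subst AE_ball_countable, simp, intro ballI pair)
    fix i assume i: "i \<in> IG D"
    show "compact (Gp D i)" "compact (Gm D i)" using arcs_compact(2) H2D(6,7) i by blast+
    show "emeasure fp (Gm D i) = emeasure fm (Gp D i)"
      using H2D(8)[OF i] decreasing_arc_sign[OF H H2D(6)[OF i]] decreasing_arc_sign[OF H H2D(7)[OF i]] by (simp add: TV_def)
    fix x y x' y' assume "x \<in> Gm D i" "y \<in> Gp D i" "x' \<in> Lp - Gm D i" "y' \<in> Lm - Gp D i"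
    moreover have "max_dist (Gp D i) (Gm D i) + max_dist (Lp - Gm D i) (Lm - Gp D i)
           < min_dist (Gp D i) (Lp - Gm D i) + min_dist (Gm D i) (Lm - Gp D i)"
      using h4 i unfolding H4_def Let_def by blast
    ultimately have "dist y x + dist x' y' < dist y x' + dist x y'" by (intro dist_less_of_max_dist_less)
    then show "dist x y + dist x' y' < dist x y' + dist x' y" by (simp add: dist_commute)
  qed
  have pF: "AE z in \<gamma>. \<forall>i\<in>{i. nonflat i}. fst z \<in> Fpp D i \<longrightarrow> snd z \<in> Fpm D i"
  proof (subst AE_ball_countable, simp, intro ballI pair)
    fix i assume "i \<in> {i. nonflat i}"
    then have i: "nonflat i" by simp
    show "compact (Fpp D i)" "compact (Fpm D i)" using arcs_compact(1,2) H2D(12,13) i by blast+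
    show "emeasure fp (Fpp D i) = emeasure fm (Fpm D i)"
      using H2D(14)[OF i] increasing_arc_sign[OF H H2D(12)[OF i]] decreasing_arc_sign[OF H H2D(13)[OF i]] by (simp add: TV_def)
    fix x y x' y' assume "x \<in> Fpp D i" "y \<in> Fpm D i" "x' \<in> Lp - Fpp D i" "y' \<in> Lm - Fpm D i"
    moreover have "max_dist (Fpp D i) (Fpm D i) + max_dist (Lp - Fpp D i) (Lm - Fpm D i)
           < min_dist (Fpp D i) (Lm - Fpm D i) + min_dist (Fpm D i) (Lp - Fpp D i)"
      using h4 i unfolding H4_def Let_def by blast
    ultimately have "dist x y + dist x' y' < dist x y' + dist y x'" by (intro dist_less_of_max_dist_less)
    then show "dist x y + dist x' y' < dist x y' + dist x' y" by (simp add: dist_commute)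
  qed
  show ?thesis
    using supp pX pG pF
  proof eventually_elim
    fix z assume z: "z \<in> \<Gamma> \<and> fst z \<in> Lp \<and> snd z \<in> Lm" "\<forall>i\<in>IX D. fst z \<in> Xp D i \<longrightarrow> snd z \<in> Xm D i"
      "\<forall>i\<in>IG D. fst z \<in> Gm D i \<longrightarrow> snd z \<in> Gp D i" "\<forall>i\<in>{i. nonflat i}. fst z \<in> Fpp D i \<longrightarrow> snd z \<in> Fpm D i"
    consider i where "i \<in> IX D" "fst z \<in> Xp D i" | i where "i \<in> IG D" "fst z \<in> Gm D i" | i where "i \<in> IFp D" "fst z \<in> Fpp D i"
      using z(1) unfolding Lambda_pos_def by blast
    then show "paired z"
    proof cases
      case 3
      \<comment> \<open>On a flat part both subarcs are empty, so a point of \<open>Fpp D i\<close>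
        shows that the part is not flat.\<close>
      then have "nonflat i" using H2D(10) by blast
      then show ?thesis unfolding paired_def using 3 z by blast
    qed (use z in \<open>auto simp: paired_def\<close>)
  qed
qed

definition transversal :: "real \<Rightarrow> plane \<Rightarrow> plane \<Rightarrow> bool" where
  "transversal w x y \<longleftrightarrow> (\<exists>R\<in>{Op, Om}. \<exists>n. x \<in> closure R \<and> outward_unit_normal R x n \<and> w \<le> \<bar>n \<bullet> (y - x)\<bar>)"

lemma transversal_mono: "transversal w x y \<Longrightarrow> v \<le> w \<Longrightarrow> transversal v x y"
  unfolding transversal_def by (meson order_trans)

text \<open>If \<open>d\<close> separates \<open>closure Om\<close> from the complement of
  \<open>Op\<close>, the ball of radius \<open>d / 2\<close> around \<open>y\<close> lies in
  \<open>Op\<close>, and \<open>normal_ball_bound\<close> bounds the normal component from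
  below.\<close>

lemma outer_transversal:
  obtains d where "d > 0" "\<And>x y. x \<in> frontier Op \<Longrightarrow> y \<in> closure Om \<Longrightarrow> transversal d x y"
proof -
  have "compact (closure Om)" using Op_Om(7) by (simp add: compact_closure)
  moreover have "closed (- Op)" using Op_Om(1) by (simp add: closed_Compl)
  moreover have "closure Om \<inter> - Op = {}" using Op_Om(11) by auto
  ultimately obtain d where d: "d > 0" "\<And>x y. x \<in> closure Om \<Longrightarrow> y \<in> - Op \<Longrightarrow> d \<le> dist x y"
    using separate_compact_closed by metis
  have "transversal (d / 2) x y" if xy: "x \<in> frontier Op" "y \<in> closure Om" for x y
  proof -
    obtain n where n: "outward_unit_normal Op x n"
      using outward_unit_normal_exists[OF Op_Om(3,1,5) xy(1)] by blast
    have "cball y (d / 2) \<subseteq> Op"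
    proof
      fix z assume "z \<in> cball y (d / 2)"
      then have "dist y z < d" using d(1) by auto
      then show "z \<in> Op" using d(2)[OF xy(2), of z] by auto
    qed
    then have "(x - y) \<bullet> n \<ge> d / 2" using normal_ball_bound[OF n \<open>cball y (d / 2) \<subseteq> Op\<close>] d(1) by simp
    moreover have "n \<bullet> (y - x) = - ((x - y) \<bullet> n)" by (simp add: inner_commute inner_diff_right)
    ultimately have "d / 2 \<le> \<bar>n \<bullet> (y - x)\<bar>" by simp
    moreover have "x \<in> closure Op" using xy by (simp add: frontier_def)
    ultimately show ?thesis unfolding transversal_def using n by blast
  qed
  then show ?thesis using that[of "d / 2"] d(1) by simp
qed

text \<open>(H5) is imposed only where the normal to \<open>Om\<close> is unique; the other points
  of the inner frontier are countably many and carry no mass by \<open>ac\<close>.\<close>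

lemma AE_unique_normal:
  "AE x in fp. x \<in> frontier Om \<longrightarrow> (\<exists>!n. outward_unit_normal Om x n)"
  "AE x in fm. x \<in> frontier Om \<longrightarrow> (\<exists>!n. outward_unit_normal Om x n)"
proof -
  define C where "C = {x \<in> closure Om. \<exists>n n'. n \<noteq> n' \<and> outward_unit_normal Om x n \<and> outward_unit_normal Om x n'}"
  have C: "countable C" unfolding C_def by (rule countable_corners[OF Op_Om(6,10)])
  have "(\<Union>x\<in>C. {x}) \<in> sets borel" using C by (intro sets.countable_UN') auto
  then have Cb: "C \<in> sets borel" by simp
  have "C \<in> null_sets fp" "C \<in> null_sets fm"
    using ac[OF Cb emeasure_hausdorff1_countable[OF C]] Cb by (auto simp: null_sets_def)
  then have ae: "AE x in fp. x \<notin> C" "AE x in fm. x \<notin> C" by (auto intro: AE_not_in)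
  have u: "\<exists>!n. outward_unit_normal Om x n" if xC: "x \<notin> C" and xf: "x \<in> frontier Om" for x
  proof -
    obtain n where n: "outward_unit_normal Om x n"
      using outward_unit_normal_exists[OF Op_Om(8,6,10) xf] by blast
    moreover have "x \<in> closure Om" using xf by (simp add: frontier_def)
    ultimately show ?thesis using xC unfolding C_def by blast
  qed
  show "AE x in fp. x \<in> frontier Om \<longrightarrow> (\<exists>!n. outward_unit_normal Om x n)"
    "AE x in fm. x \<in> frontier Om \<longrightarrow> (\<exists>!n. outward_unit_normal Om x n)"
    by (rule eventually_mono[OF ae(1)], use u in blast) (rule eventually_mono[OF ae(2)], use u in blast)
qed

lemma arcs_frontier:
  "i \<in> IX D \<Longrightarrow> Xp D i \<subseteq> frontier Op" "i \<in> IX D \<Longrightarrow> Xm D i \<subseteq> frontier Om"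
  "i \<in> IG D \<Longrightarrow> Gp D i \<subseteq> frontier Op" "i \<in> IG D \<Longrightarrow> Gm D i \<subseteq> frontier Om"
  "nonflat i \<Longrightarrow> Fpp D i \<subseteq> frontier Op" "nonflat i \<Longrightarrow> Fpm D i \<subseteq> frontier Op"
  using H2D(1,2) H2D(11)[of i] by blast+

text \<open>Rays between the two curves are transversal to the outer one by the distance between the
  curves and to the inner one by (H5). The remaining rays join the two subarcs of a part of the
  outer curve that is not flat.\<close>

lemma annular_transversal:
  obtains c where "c > 0" "AE z in \<gamma>. (transversal c (fst z) (snd z) \<and> transversal c (snd z) (fst z)) \<or>
    (\<exists>i. nonflat i \<and> fst z \<in> Fpp D i \<and> snd z \<in> Fpm D i)"
proof -
  obtain d where d: "d > 0" "\<And>x y. x \<in> frontier Op \<Longrightarrow> y \<in> closure Om \<Longrightarrow> transversal d x y"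
    using outer_transversal by blast
  from h5[unfolded H5_def] obtain c where c': "c > 0 \<and>
      (\<forall>i\<in>IX D. \<forall>x\<in>Xm D i. \<forall>y\<in>Xp D i. (\<exists>!n. outward_unit_normal Om x n) \<longrightarrow> (y - x) \<bullet> unit_normal Om x \<ge> c) \<and>
      (\<forall>i\<in>IG D. \<forall>x\<in>Gm D i. \<forall>y\<in>Gp D i. (\<exists>!n. outward_unit_normal Om x n) \<longrightarrow> (y - x) \<bullet> unit_normal Om x \<ge> c)"
    by (rule exE) (rule that)
  note c = conjunct1[OF c'] conjunct1[OF conjunct2[OF c'], rule_format] conjunct2[OF conjunct2[OF c'], rule_format]
  have inner: "transversal c x y"
    if "x \<in> frontier Om" "\<exists>!n. outward_unit_normal Om x n" "(y - x) \<bullet> unit_normal Om x \<ge> c" for x y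
  proof -
    have "outward_unit_normal Om x (unit_normal Om x)" unfolding unit_normal_def by (rule theI'[OF that(2)])
    moreover have "c \<le> \<bar>unit_normal Om x \<bullet> (y - x)\<bar>" using that(3) by (simp add: inner_commute)
    moreover have "x \<in> closure Om" using that(1) by (simp add: frontier_def)
    ultimately show ?thesis unfolding transversal_def by blast
  qed
  have cl: "frontier Om \<subseteq> closure Om" by (simp add: frontier_def)
  have "AE z in \<gamma>. (transversal (min c d) (fst z) (snd z) \<and> transversal (min c d) (snd z) (fst z)) \<or>
    (\<exists>i. nonflat i \<and> fst z \<in> Fpp D i \<and> snd z \<in> Fpm D i)"
    using AE_paired AE_fst[OF AE_unique_normal(1)] AE_snd[OF AE_unique_normal(2)]
  proof eventually_elim
    fix z assume z: "paired z" "fst z \<in> frontier Om \<longrightarrow> (\<exists>!n. outward_unit_normal Om (fst z) n)"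
      "snd z \<in> frontier Om \<longrightarrow> (\<exists>!n. outward_unit_normal Om (snd z) n)"
    consider i where "i \<in> IX D" "fst z \<in> Xp D i" "snd z \<in> Xm D i" | i where "i \<in> IG D" "fst z \<in> Gm D i" "snd z \<in> Gp D i"
      | "\<exists>i. nonflat i \<and> fst z \<in> Fpp D i \<and> snd z \<in> Fpm D i" using z(1) unfolding paired_def by blast
    then show "(transversal (min c d) (fst z) (snd z) \<and> transversal (min c d) (snd z) (fst z)) \<or>
      (\<exists>i. nonflat i \<and> fst z \<in> Fpp D i \<and> snd z \<in> Fpm D i)"
    proof cases
      case 1
      then have fr: "fst z \<in> frontier Op" "snd z \<in> frontier Om" using arcs_frontier(1,2) by blast+
      have "transversal d (fst z) (snd z)" using d(2) fr cl by blast
      moreover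
      have u: "\<exists>!n. outward_unit_normal Om (snd z) n" using z(3) fr(2) by (rule mp)
      have "transversal c (snd z) (fst z)" by (rule inner[OF fr(2) u c(2)[OF 1(1,3,2) u]])
      ultimately show ?thesis using transversal_mono by (meson min.cobounded1 min.cobounded2)
    next
      case 2
      then have fr: "fst z \<in> frontier Om" "snd z \<in> frontier Op" using arcs_frontier(3,4) by blast+
      have "transversal d (snd z) (fst z)" using d(2) fr cl by blast
      moreover
      have u: "\<exists>!n. outward_unit_normal Om (fst z) n" using z(2) fr(1) by (rule mp)
      have "transversal c (fst z) (snd z)" by (rule inner[OF fr(1) u c(3)[OF 2(1,2,3) u]])
      ultimately show ?thesis using transversal_mono by (meson min.cobounded1 min.cobounded2)
    qed blast
  qed
  then show ?thesis using that[of "min c d"] c(1) d(1) by simp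
qed

lemma flat_transversal:
  assumes "\<forall>i\<in>IFp D. g constant_on Fp D i"
  obtains c where "c > 0" "AE z in \<gamma>. transversal c (fst z) (snd z) \<and> transversal c (snd z) (fst z)"
proof -
  obtain c where c: "c > 0" "AE z in \<gamma>. (transversal c (fst z) (snd z) \<and> transversal c (snd z) (fst z)) \<or>
    (\<exists>i. nonflat i \<and> fst z \<in> Fpp D i \<and> snd z \<in> Fpm D i)" by (rule annular_transversal)
  have "AE z in \<gamma>. transversal c (fst z) (snd z) \<and> transversal c (snd z) (fst z)"
    using c(2) by eventually_elim (use assms in blast)
  then show ?thesis using that c(1) by blast
qed

lemma diameter_bound:
  obtains K where "K > 0" "AE z in \<gamma>. dist (fst z) (snd z) \<le> K"
proof -
  obtain K where K: "\<And>x y. x \<in> T \<Longrightarrow> y \<in> T \<Longrightarrow> dist x y \<le> K"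
    using compact_imp_bounded[OF compact_T] bounded_two_points by metis
  have "AE z in \<gamma>. dist (fst z) (snd z) \<le> max K 1"
    using AE_\<Gamma>
  proof eventually_elim
    fix z assume "z \<in> \<Gamma>"
    then have "dist (fst z) (snd z) \<le> K" by (intro K) (auto simp: \<Gamma>_def)
    then show "dist (fst z) (snd z) \<le> max K 1" by simp
  qed
  then show ?thesis using that[of "max K 1"] by simp
qed

lemma uniform_transversal:
  assumes "uniformly_convex Op"
  obtains c where "c > 0" "AE z in \<gamma>. transversal (c * (dist (fst z) (snd z))\<^sup>2) (fst z) (snd z) \<and>
    transversal (c * (dist (fst z) (snd z))\<^sup>2) (snd z) (fst z)"
proof -
  obtain c where c: "c > 0" "AE z in \<gamma>. (transversal c (fst z) (snd z) \<and> transversal c (snd z) (fst z)) \<or>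
    (\<exists>i. nonflat i \<and> fst z \<in> Fpp D i \<and> snd z \<in> Fpm D i)" by (rule annular_transversal)
  obtain K where K: "K > 0" "AE z in \<gamma>. dist (fst z) (snd z) \<le> K" by (rule diameter_bound)
  obtain R where R: "R > 0" "\<And>x n. x \<in> frontier Op \<Longrightarrow> outward_unit_normal Op x n \<Longrightarrow> Op \<subseteq> cball (x - R *\<^sub>R n) R"
    using assms unfolding uniformly_convex_def by blast
  \<comment> \<open>\<open>1 / (2 * R)\<close> serves the rays with both ends on the outer boundary,
    while \<open>c / K\<^sup>2\<close> turns the constant bound for the other rays into a quadratic
    one, as almost no ray is longer than \<open>K\<close>.\<close>
  define c' where "c' = min (c / K\<^sup>2) (1 / (2 * R))"
  have c': "c' > 0" using c(1) K(1) R(1) by (simp add: c'_def)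
  have outer: "transversal (c' * (dist x y)\<^sup>2) x y" if xy: "x \<in> frontier Op" "y \<in> frontier Op" for x y
  proof -
    obtain n where n: "outward_unit_normal Op x n"
      using outward_unit_normal_exists[OF Op_Om(3,1,5) xy(1)] by blast
    have cl: "x \<in> closure Op" "y \<in> closure Op" using xy by (auto simp: frontier_def)
    have "(norm (y - x))\<^sup>2 \<le> 2 * R * ((x - y) \<bullet> n)" by (rule uniformly_convex_bound[OF n R(2)[OF xy(1) n] cl(2)])
    then have "1 / (2 * R) * (dist x y)\<^sup>2 \<le> (x - y) \<bullet> n" using R(1) by (simp add: dist_norm norm_minus_commute field_simps)
    moreover have "c' * (dist x y)\<^sup>2 \<le> 1 / (2 * R) * (dist x y)\<^sup>2" unfolding c'_def by (intro mult_right_mono) auto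
    moreover have "n \<bullet> (y - x) = - ((x - y) \<bullet> n)" by (simp add: inner_commute inner_diff_right)
    ultimately have "c' * (dist x y)\<^sup>2 \<le> \<bar>n \<bullet> (y - x)\<bar>" by linarith
    then show ?thesis unfolding transversal_def using n cl by blast
  qed
  have "AE z in \<gamma>. transversal (c' * (dist (fst z) (snd z))\<^sup>2) (fst z) (snd z) \<and>
    transversal (c' * (dist (fst z) (snd z))\<^sup>2) (snd z) (fst z)"
    using c(2) K(2)
  proof eventually_elim
    fix z assume z: "(transversal c (fst z) (snd z) \<and> transversal c (snd z) (fst z)) \<or>
      (\<exists>i. nonflat i \<and> fst z \<in> Fpp D i \<and> snd z \<in> Fpm D i)" "dist (fst z) (snd z) \<le> K"
    have "c' * (dist (fst z) (snd z))\<^sup>2 \<le> (c / K\<^sup>2) * K\<^sup>2"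
      using z(2) c' c(1) K(1) by (intro mult_mono power_mono) (auto simp: c'_def)
    then have le: "c' * (dist (fst z) (snd z))\<^sup>2 \<le> c" using K(1) by simp
    from z(1) show "transversal (c' * (dist (fst z) (snd z))\<^sup>2) (fst z) (snd z) \<and>
      transversal (c' * (dist (fst z) (snd z))\<^sup>2) (snd z) (fst z)"
    proof
      assume "transversal c (fst z) (snd z) \<and> transversal c (snd z) (fst z)"
      then show ?thesis using transversal_mono[OF _ le] by blast
    next
      assume "\<exists>i. nonflat i \<and> fst z \<in> Fpp D i \<and> snd z \<in> Fpm D i"
      then have "fst z \<in> frontier Op" "snd z \<in> frontier Op" using arcs_frontier(5,6) by blast+
      then show ?thesis using outer[of "fst z" "snd z"] outer[of "snd z" "fst z"] by (simp add: dist_commute)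
    qed
  qed
  then show ?thesis using that c' by blast
qed

end

section \<open>Integrability of the transport density\<close>

text \<open>Replacing \<open>t\<close> by \<open>1 - t\<close> turns the second half of a ray into
  the first half of the reversed ray. The midpoint is counted with the first half only, hence an
  inequality.\<close>

lemma half_mass_swap:
  assumes B [measurable]: "B \<in> sets borel"
  shows "(\<integral>\<^sup>+t. indicator {1/2<..<1} t * indicator B (seg z t) \<partial>lborel) \<le> half_mass B (prod.swap z)"
proof -
  have [measurable]: "(\<lambda>t. seg z t) \<in> borel_measurable borel"
    unfolding seg_def by (intro borel_measurable_continuous_onI continuous_intros)
  have "(\<integral>\<^sup>+t. indicator {1/2<..<1} t * indicator B (seg z t) \<partial>lborel) =
    ennreal \<bar>-1\<bar> * (\<integral>\<^sup>+t. indicator {1/2<..<1} (1 + -1 * t) * indicator B (seg z (1 + -1 * t)) \<partial>lborel)"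
    by (rule nn_integral_real_affine) auto
  also have "\<dots> = (\<integral>\<^sup>+t. indicator {1/2<..<1} (1 - t) * indicator B (seg z (1 - t)) \<partial>lborel)" by simp
  also have "\<dots> \<le> half_mass B (prod.swap z)"
    unfolding half_mass_def
  proof (rule nn_integral_mono)
    fix t :: real
    have "seg z (1 - t) = seg (prod.swap z) t" by (simp add: seg_def)
    then show "indicator {1/2<..<1} (1 - t) * indicator B (seg z (1 - t)) \<le> (indicator {0<..1/2} t * indicator B (seg (prod.swap z) t) :: ennreal)"
      by (auto simp: indicator_def)
  qed
  finally show ?thesis .
qed

text \<open>The restriction to exponents at most 2 enters here.\<close>

lemma weight_power_le:
  fixes d K c p :: real
  assumes d: "0 < d" "d \<le> K" and c: "c > 0" and p: "1 \<le> p" "\<kappa> \<longrightarrow> p \<le> 2"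
  shows "d * (d / (c * (if \<kappa> then d\<^sup>2 else 1))) powr (p - 1) \<le> (if \<kappa> then K powr (2 - p) * c powr (1 - p) else K * (K / c) powr (p - 1))"
proof (cases \<kappa>)
  case False
  have "(d / c) powr (p - 1) \<le> (K / c) powr (p - 1)"
    using d c p by (intro powr_mono2 divide_right_mono) auto
  then show ?thesis using False d by (auto intro!: mult_mono)
next
  case True
  have e: "d / (c * d\<^sup>2) = inverse (c * d)" using d c by (simp add: power2_eq_square field_simps)
  have "d * (d / (c * d\<^sup>2)) powr (p - 1) = d * (c * d) powr (1 - p)"
  proof -
    have "(c * d) powr (1 - p) = (c * d) powr (- (p - 1))" by simp
    also have "\<dots> = inverse (c * d) powr (p - 1)" using d c by (simp only: powr_minus inverse_powr)
    finally show ?thesis unfolding e by simp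
  qed
  also have "\<dots> = c powr (1 - p) * (d * d powr (1 - p))" using d c by (simp add: powr_mult)
  also have "d * d powr (1 - p) = d powr (2 - p)" using d powr_mult_base[of d "1 - p"] by simp
  also have "c powr (1 - p) * d powr (2 - p) \<le> c powr (1 - p) * K powr (2 - p)"
    using d p True by (intro mult_left_mono powr_mono2) auto
  finally show ?thesis using True by (simp add: mult.commute)
qed

context transport_setup
begin

lemma swap_measurable [measurable]: "prod.swap \<in> \<gamma> \<rightarrow>\<^sub>M (borel :: (plane \<times> plane) measure)"
proof -
  have "continuous_on UNIV (prod.swap :: plane \<times> plane \<Rightarrow> plane \<times> plane)" by (intro continuous_intros)
  then have "(prod.swap :: plane \<times> plane \<Rightarrow> plane \<times> plane) \<in> borel_measurable borel" by (rule borel_measurable_continuous_onI)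
  then show ?thesis using plan(1) by (simp cong: measurable_cong_sets)
qed

text \<open>\<open>prod.swap\<close> is an involution, so a null set that contains the exceptions is
  carried over as it is. This works for arbitrary \<open>Q\<close>, such as statements about
  \<open>transversal\<close>.\<close>

lemma AE_distr_swap:
  assumes "AE z in \<gamma>. Q (prod.swap z)" shows "AE z in distr \<gamma> borel prod.swap. Q z"
proof -
  obtain N where N: "{z \<in> space \<gamma>. \<not> Q (prod.swap z)} \<subseteq> N" "emeasure \<gamma> N = 0" "N \<in> sets \<gamma>"
    using assms by (rule AE_E)
  have s: "prod.swap -` N \<in> sets borel"
  proof -
    have "continuous_on UNIV (prod.swap :: plane \<times> plane \<Rightarrow> plane \<times> plane)" by (intro continuous_intros)
    then have "(prod.swap :: plane \<times> plane \<Rightarrow> plane \<times> plane) \<in> borel_measurable borel" by (rule borel_measurable_continuous_onI)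
    moreover have "N \<in> sets borel" using N(3) plan(1) by simp
    ultimately show ?thesis using measurable_sets[of prod.swap borel borel N] by simp
  qed
  show ?thesis
  proof (rule AE_I)
    have "prod.swap -` prod.swap -` N = N" by auto
    then show "emeasure (distr \<gamma> borel prod.swap) (prod.swap -` N) = 0"
      using emeasure_distr[OF swap_measurable s] N(2) by simp
    show "{z \<in> space (distr \<gamma> borel prod.swap). \<not> Q z} \<subseteq> prod.swap -` N"
      using N(1) by fastforce
  qed (use s in simp)
qed

text \<open>Monotonicity, the frontiers and \<open>w\<close> are symmetric under exchange of the two
  ends, so the second bound is the first one for the reversed plan, whose first marginal is
  \<open>fm\<close>.\<close>

lemma halves_le:
  fixes \<rho>p \<rho>m :: "plane \<Rightarrow> real" and w :: "plane \<times> plane \<Rightarrow> real"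
  assumes \<rho> [measurable]: "\<rho>p \<in> borel_measurable borel" "\<rho>m \<in> borel_measurable borel"
    and dens: "fp = density hausdorff1 (\<lambda>x. ennreal (\<rho>p x))" "fm = density hausdorff1 (\<lambda>x. ennreal (\<rho>m x))"
    and w: "continuous_on UNIV w" "\<And>z. w z \<ge> 0" "\<And>z. w (prod.swap z) = w z"
    and good: "AE z in \<gamma>. transversal (w z) (fst z) (snd z) \<and> transversal (w z) (snd z) (fst z)"
    and B [measurable]: "B \<in> sets borel"
  shows "(\<integral>\<^sup>+z. ennreal (1 / \<rho>p (fst z)) * (ennreal (w z) * half_mass B z) \<partial>\<gamma>) \<le> 512 * emeasure lborel B"
    "(\<integral>\<^sup>+z. ennreal (1 / \<rho>m (snd z)) * (ennreal (w z) * half_mass B (prod.swap z)) \<partial>\<gamma>) \<le> 512 * emeasure lborel B"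
proof -
  have \<Gamma>T: "\<Gamma> \<subseteq> (frontier Op \<union> frontier Om) \<times> (frontier Op \<union> frontier Om)" by (auto simp: \<Gamma>_def T_def)
  show "(\<integral>\<^sup>+z. ennreal (1 / \<rho>p (fst z)) * (ennreal (w z) * half_mass B z) \<partial>\<gamma>) \<le> 512 * emeasure lborel B"
  proof (rule half_transport_mass_le[OF emeasure_hausdorff1_le finite_\<gamma> plan(1) \<rho>(1) _ Op_Om(4,9) compact_\<Gamma> \<Gamma>T mono_\<Gamma> w(1,2) _ B])
    show "distr \<gamma> borel fst = density hausdorff1 (\<lambda>x. ennreal (\<rho>p x))" using plan(3) dens(1) by simp
    show "AE z in \<gamma>. z \<in> \<Gamma> \<and> (0 < w z \<longrightarrow> (\<exists>R\<in>{Op, Om}. \<exists>n. fst z \<in> closure R \<and> outward_unit_normal R (fst z) n \<and> w z \<le> \<bar>n \<bullet> (snd z - fst z)\<bar>))"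
      using AE_\<Gamma> good by eventually_elim (auto simp: transversal_def)
  qed
  define \<gamma>s where "\<gamma>s = distr \<gamma> borel prod.swap"
  have sets_s [measurable_cong]: "sets \<gamma>s = sets borel" by (simp add: \<gamma>s_def)
  have fin_s: "finite_measure \<gamma>s" unfolding \<gamma>s_def by (rule finite_measure.finite_measure_distr[OF finite_\<gamma>]) measurable
  have "fst \<circ> prod.swap = (snd :: plane \<times> plane \<Rightarrow> plane)" by (auto simp: fun_eq_iff)
  then have marg: "distr \<gamma>s borel fst = density hausdorff1 (\<lambda>x. ennreal (\<rho>m x))"
    unfolding \<gamma>s_def dens(2)[symmetric] plan(4)[symmetric]
    by (subst distr_distr) (auto intro!: borel_measurable_continuous_onI continuous_intros)
  have [measurable]: "w \<in> borel_measurable borel" using w(1) by (rule borel_measurable_continuous_onI)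
  have [measurable]: "(fst :: plane \<times> plane \<Rightarrow> plane) \<in> borel \<rightarrow>\<^sub>M borel" by (intro borel_measurable_continuous_onI continuous_intros)
  have "(\<integral>\<^sup>+z. ennreal (1 / \<rho>m (fst z)) * (ennreal (w z) * half_mass B z) \<partial>\<gamma>s) \<le> 512 * emeasure lborel B"
  proof (rule half_transport_mass_le[OF emeasure_hausdorff1_le fin_s sets_s \<rho>(2) marg Op_Om(4,9) _ _ _ w(1,2) _ B])
    show "compact (prod.swap ` \<Gamma>)" by (intro compact_continuous_image compact_\<Gamma> continuous_intros)
    show "prod.swap ` \<Gamma> \<subseteq> (frontier Op \<union> frontier Om) \<times> (frontier Op \<union> frontier Om)" using \<Gamma>T by auto
    show "dist (fst p) (snd p) + dist (fst q) (snd q) \<le> dist (fst p) (snd q) + dist (fst q) (snd p)"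
      if pq: "p \<in> prod.swap ` \<Gamma>" "q \<in> prod.swap ` \<Gamma>" for p q
    proof -
      have "prod.swap p \<in> \<Gamma>" "prod.swap q \<in> \<Gamma>" using pq by auto
      from mono_\<Gamma>[OF this] show ?thesis by (simp add: dist_commute add.commute)
    qed
    show "AE z in \<gamma>s. z \<in> prod.swap ` \<Gamma> \<and> (0 < w z \<longrightarrow> (\<exists>R\<in>{Op, Om}. \<exists>n. fst z \<in> closure R \<and> outward_unit_normal R (fst z) n \<and> w z \<le> \<bar>n \<bullet> (snd z - fst z)\<bar>))"
      unfolding \<gamma>s_def
    proof (rule AE_distr_swap)
      show "AE z in \<gamma>. prod.swap z \<in> prod.swap ` \<Gamma> \<and> (0 < w (prod.swap z) \<longrightarrow> (\<exists>R\<in>{Op, Om}. \<exists>n. fst (prod.swap z) \<in> closure R \<and>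
          outward_unit_normal R (fst (prod.swap z)) n \<and> w (prod.swap z) \<le> \<bar>n \<bullet> (snd (prod.swap z) - fst (prod.swap z))\<bar>))"
        using AE_\<Gamma> good by eventually_elim (auto simp: transversal_def w(3))
    qed
  qed
  also have "(\<integral>\<^sup>+z. ennreal (1 / \<rho>m (fst z)) * (ennreal (w z) * half_mass B z) \<partial>\<gamma>s) =
     (\<integral>\<^sup>+z. ennreal (1 / \<rho>m (snd z)) * (ennreal (w z) * half_mass B (prod.swap z)) \<partial>\<gamma>)"
    unfolding \<gamma>s_def by (subst nn_integral_distr) (auto simp: w(3))
  finally show "(\<integral>\<^sup>+z. ennreal (1 / \<rho>m (snd z)) * (ennreal (w z) * half_mass B (prod.swap z)) \<partial>\<gamma>) \<le> 512 * emeasure lborel B" .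
qed

end

lemma AE_pair_fst:
  assumes "sigma_finite_measure L" "AE z in M. Q z"
  shows "AE p in M \<Otimes>\<^sub>M L. Q (fst p)"
proof -
  interpret L: sigma_finite_measure L by fact
  obtain N where N: "{z \<in> space M. \<not> Q z} \<subseteq> N" "emeasure M N = 0" "N \<in> sets M"
    using assms(2) by (rule AE_E)
  show ?thesis
  proof (rule AE_I)
    show "{p \<in> space (M \<Otimes>\<^sub>M L). \<not> Q (fst p)} \<subseteq> N \<times> space L"
      using N(1) by (auto simp: space_pair_measure)
    show "N \<times> space L \<in> sets (M \<Otimes>\<^sub>M L)" using N(3) by simp
    show "emeasure (M \<Otimes>\<^sub>M L) (N \<times> space L) = 0"
      using N(2,3) by (subst L.emeasure_pair_measure_Times) auto
  qed
qed

context transport_setup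
begin

text \<open>\<open>\<sigma>\<close> is the image of \<open>M\<close> under \<open>Z\<close>.
  \<open>V\<close> is chosen so that \<open>1 / V\<close> times the length \<open>d\<close> is
  \<open>w / \<rho>\<close>, the weight in \<open>halves_le\<close>, with the density taken at the
  end from which the half ray starts. \<open>\<kappa>\<close> selects the quadratic weight, for
  which exponents above 2 are excluded.\<close>

lemma transport_density_Lp:
  fixes \<rho>p \<rho>m :: "plane \<Rightarrow> real"
  assumes \<rho> [measurable]: "\<rho>p \<in> borel_measurable borel" "\<rho>m \<in> borel_measurable borel"
    and \<rho>0: "\<And>x. 0 \<le> \<rho>p x" "\<And>x. 0 \<le> \<rho>m x"
    and dens: "fp = density hausdorff1 (\<lambda>x. ennreal (\<rho>p x))" "fm = density hausdorff1 (\<lambda>x. ennreal (\<rho>m x))"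
    and \<sigma>: "transport_density (annulus Op Om) \<gamma> \<sigma>" and c: "c > 0"
    and good: "AE z in \<gamma>. transversal (c * (if \<kappa> then (dist (fst z) (snd z))\<^sup>2 else 1)) (fst z) (snd z) \<and>
      transversal (c * (if \<kappa> then (dist (fst z) (snd z))\<^sup>2 else 1)) (snd z) (fst z)"
  obtains h where "h \<in> borel_measurable borel" "\<And>x. 0 \<le> h x" "\<sigma> = density lborel (\<lambda>x. ennreal (h x))"
    "\<And>p. 1 \<le> p \<Longrightarrow> \<kappa> \<longrightarrow> p \<le> 2 \<Longrightarrow> (\<integral>\<^sup>+x. ennreal (\<rho>p x powr p) \<partial>hausdorff1) < \<infinity> \<Longrightarrow>
      (\<integral>\<^sup>+x. ennreal (\<rho>m x powr p) \<partial>hausdorff1) < \<infinity> \<Longrightarrow> (\<integral>\<^sup>+x. ennreal (h x powr p) \<partial>lborel) < \<infinity>"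
    "\<And>L. 0 \<le> L \<Longrightarrow> \<not> \<kappa> \<Longrightarrow> AE x in hausdorff1. \<rho>p x \<le> L \<and> \<rho>m x \<le> L \<Longrightarrow> \<exists>L'. AE x in lborel. h x \<le> L'"
proof -
  interpret \<gamma>: finite_measure \<gamma> by (rule finite_\<gamma>)
  interpret pair_sigma_finite \<gamma> "lborel :: real measure" ..
  define d where "d z = dist (fst z) (snd z)" for z :: "plane \<times> plane"
  define w where "w z = c * (if \<kappa> then (d z)\<^sup>2 else 1)" for z
  define N where "N = \<gamma> \<Otimes>\<^sub>M (lborel :: real measure)"
  define m where "m p = d (fst p) * indicator {0<..<1} (snd p)" for p :: "(plane \<times> plane) \<times> real"
  define M where "M = density N (\<lambda>p. ennreal (m p))"
  define Z where "Z p = seg (fst p) (snd p)" for p :: "(plane \<times> plane) \<times> real"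
  define V where "V p = (if snd p \<le> 1/2 then \<rho>p (fst (fst p)) else \<rho>m (snd (fst p))) * (d (fst p) / w (fst p))" for p :: "(plane \<times> plane) \<times> real"
  have "sets (\<gamma> \<Otimes>\<^sub>M (lborel :: real measure)) = sets ((borel :: (plane \<times> plane) measure) \<Otimes>\<^sub>M (borel :: real measure))"
    using plan(1) by (intro sets_pair_measure_cong) auto
  then have sN [measurable_cong]: "sets N = sets borel" unfolding N_def borel_prod .
  have sM [measurable_cong]: "sets M = sets borel" by (simp add: M_def sN)
  note plan(1) [measurable_cong]
  have cont: "continuous_on UNIV d" "continuous_on UNIV w" "continuous_on UNIV Z"
    unfolding d_def w_def Z_def seg_def by (cases \<kappa>; auto intro!: continuous_intros)+
  have [measurable]: "(fst :: plane \<times> plane \<Rightarrow> plane) \<in> borel \<rightarrow>\<^sub>M borel" "(snd :: plane \<times> plane \<Rightarrow> plane) \<in> borel \<rightarrow>\<^sub>M borel"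
    "(fst :: (plane \<times> plane) \<times> real \<Rightarrow> _) \<in> borel \<rightarrow>\<^sub>M borel" "(snd :: (plane \<times> plane) \<times> real \<Rightarrow> _) \<in> borel \<rightarrow>\<^sub>M borel"
    by (intro borel_measurable_continuous_onI continuous_intros)+
  have [measurable]: "d \<in> borel_measurable borel" "w \<in> borel_measurable borel" "Z \<in> borel_measurable borel"
    using cont by (auto intro: borel_measurable_continuous_onI)
  have [measurable]: "m \<in> borel_measurable borel" "V \<in> borel_measurable borel"
    unfolding m_def V_def by measurable
  have [measurable]: "\<rho>p \<in> borel_measurable hausdorff1" "\<rho>m \<in> borel_measurable hausdorff1"
    using \<rho> by (simp_all cong: measurable_cong_sets)
  have d0: "0 \<le> d z" for z by (simp add: d_def)
  have w0: "0 \<le> w z" for z using c by (simp add: w_def)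
  have wpos: "0 < w z" if "0 < d z" for z using c that by (simp add: w_def)
  have m0: "0 \<le> m p" for p by (simp add: m_def d0)
  have nnM: "(\<integral>\<^sup>+p. f p \<partial>M) = (\<integral>\<^sup>+z. (\<integral>\<^sup>+t. ennreal (m (z, t)) * f (z, t) \<partial>lborel) \<partial>\<gamma>)"
    if [measurable]: "f \<in> borel_measurable borel" for f
  proof -
    have "(\<integral>\<^sup>+p. f p \<partial>M) = (\<integral>\<^sup>+p. ennreal (m p) * f p \<partial>N)" unfolding M_def by (rule nn_integral_density) measurable
    also have "\<dots> = (\<integral>\<^sup>+z. (\<integral>\<^sup>+t. ennreal (m (z, t)) * f (z, t) \<partial>lborel) \<partial>\<gamma>)"
      unfolding N_def by (rule lborel.nn_integral_fst[symmetric]) (unfold N_def[symmetric], measurable)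
    finally show ?thesis .
  qed
  obtain K where K: "K > 0" "AE z in \<gamma>. d z \<le> K" unfolding d_def by (rule diameter_bound)
  \<comment> \<open>A measure does not charge the set where its density vanishes; this keeps
    \<open>V\<close> positive.\<close>
  have \<rho>pos: "AE z in \<gamma>. 0 < \<rho>p (fst z) \<and> 0 < \<rho>m (snd z)"
  proof (rule AE_conjI)
    have "AE x in fp. 0 < \<rho>p x" unfolding dens(1) by (subst AE_density) auto
    then show "AE z in \<gamma>. 0 < \<rho>p (fst z)" by (rule AE_fst)
    have "AE x in fm. 0 < \<rho>m x" unfolding dens(2) by (subst AE_density) auto
    then show "AE z in \<gamma>. 0 < \<rho>m (snd z)" by (rule AE_snd)
  qed
  have unit: "(\<integral>\<^sup>+t. indicator {0<..<1::real} t \<partial>lborel) = 1" by simp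
  have AE_M: "AE p in M. Q (fst p) \<and> 0 < d (fst p)" if "AE z in \<gamma>. Q z" for Q
  proof -
    have "AE p in N. Q (fst p)" unfolding N_def by (rule AE_pair_fst[OF lborel.sigma_finite_measure_axioms that])
    then have "AE p in N. 0 < ennreal (m p) \<longrightarrow> Q (fst p) \<and> 0 < d (fst p)"
      by eventually_elim (auto simp: m_def zero_less_mult_iff d0 indicator_def split: if_splits)
    then show ?thesis unfolding M_def by (subst AE_density) auto
  qed
  have finM: "finite_measure M"
  proof (rule finite_measureI)
    have "emeasure M (space M) = (\<integral>\<^sup>+p. 1 \<partial>M)" by simp
    also have "\<dots> = (\<integral>\<^sup>+z. (\<integral>\<^sup>+t. ennreal (m (z, t)) * 1 \<partial>lborel) \<partial>\<gamma>)" by (rule nnM) measurable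
    also have "\<dots> = (\<integral>\<^sup>+z. ennreal (d z) \<partial>\<gamma>)"
    proof (intro nn_integral_cong)
      fix z
      have "(\<integral>\<^sup>+t. ennreal (m (z, t)) * 1 \<partial>lborel) = (\<integral>\<^sup>+t. ennreal (d z) * indicator {0<..<1::real} t \<partial>lborel)"
        by (intro nn_integral_cong) (auto simp: m_def indicator_def)
      also have "\<dots> = ennreal (d z)" by (subst nn_integral_cmult) auto
      finally show "(\<integral>\<^sup>+t. ennreal (m (z, t)) * 1 \<partial>lborel) = ennreal (d z)" .
    qed
    also have "\<dots> \<le> (\<integral>\<^sup>+z. ennreal K \<partial>\<gamma>)" using K(2) by (intro nn_integral_mono_AE) (auto elim: eventually_mono intro: ennreal_leI)
    also have "\<dots> < \<infinity>" by (simp add: \<gamma>.emeasure_eq_measure ennreal_mult_less_top)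
    finally show "emeasure M (space M) \<noteq> \<infinity>" by simp
  qed
  interpret M: finite_measure M by (rule finM)
  \<comment> \<open>Both sides are finite measures with the same integrals of continuous functions.
    The ends of the parameter interval, left out in \<open>m\<close>, form a null set.\<close>
  have \<sigma>_eq: "\<sigma> = distr M borel Z"
  proof (rule finite_borel_measure_eqI_continuous)
    show "finite_measure \<sigma>" "sets \<sigma> = sets borel" using \<sigma> by (auto simp: transport_density_def)
    show "finite_measure (distr M borel Z)" by (rule M.finite_measure_distr) measurable
    show "sets (distr M borel Z) = sets borel" by simp
    fix f :: "plane \<Rightarrow> real" assume f: "continuous_on UNIV f" "\<And>x. 0 \<le> f x \<and> f x \<le> 1"
    have [measurable]: "f \<in> borel_measurable borel" using f(1) by (rule borel_measurable_continuous_onI)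
    have "integrable M (\<lambda>p. f (Z p))"
      using f(2) by (intro M.integrable_const_bound[where B=1]) auto
    then have int: "integrable (\<gamma> \<Otimes>\<^sub>M lborel) (\<lambda>p. m p * f (Z p))"
      unfolding M_def N_def[symmetric] by (subst (asm) integrable_density) (auto simp: m0)
    have "(LINT x|\<sigma>. f x) = (LINT z|\<gamma>. (LINT t:{0..1}|lborel. f ((1 - t) *\<^sub>R fst z + t *\<^sub>R snd z) * dist (fst z) (snd z)))"
      using \<sigma> f(1) by (auto simp: transport_density_def)
    also have "\<dots> = (LINT z|\<gamma>. (LINT t|lborel. m (z, t) * f (Z (z, t))))"
    proof (intro Bochner_Integration.integral_cong refl)
      fix z
      show "(LINT t:{0..1}|lborel. f ((1 - t) *\<^sub>R fst z + t *\<^sub>R snd z) * dist (fst z) (snd z)) = (LINT t|lborel. m (z, t) * f (Z (z, t)))"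
        unfolding set_lebesgue_integral_def
      proof (rule integral_discrete_difference[where X="{0, 1}"])
        fix t :: real assume "t \<notin> {0, 1}"
        then show "indicat_real {0..1} t *\<^sub>R (f ((1 - t) *\<^sub>R fst z + t *\<^sub>R snd z) * dist (fst z) (snd z)) = m (z, t) * f (Z (z, t))"
          by (auto simp: m_def d_def Z_def seg_def indicator_def)
      qed auto
    qed
    also have "\<dots> = (LINT p|(\<gamma> \<Otimes>\<^sub>M lborel). m p * f (Z p))" by (rule integral_fst'[OF int])
    also have "\<dots> = (LINT p|M. f (Z p))"
      unfolding M_def N_def[symmetric] by (subst integral_density) (auto simp: m0)
    also have "\<dots> = (LINT x|distr M borel Z. f x)" by (rule integral_distr[symmetric]) measurable
    finally show "(LINT x|\<sigma>. f x) = (LINT x|distr M borel Z. f x)" .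
  qed
  have bd: "(\<integral>\<^sup>+p. ennreal (1 / V p) * indicator B (Z p) \<partial>M) \<le> ennreal 1024 * emeasure lborel B"
    if B [measurable]: "B \<in> sets borel" for B
  proof -
    have [measurable]: "half_mass B \<in> borel_measurable borel" by measurable
    have [measurable]: "(prod.swap :: plane \<times> plane \<Rightarrow> plane \<times> plane) \<in> borel \<rightarrow>\<^sub>M borel"
      by (intro borel_measurable_continuous_onI continuous_intros)
    have [measurable]: "(\<lambda>t. seg z t) \<in> borel_measurable borel" for z
      unfolding seg_def by (intro borel_measurable_continuous_onI continuous_intros)
    have "(\<integral>\<^sup>+p. ennreal (1 / V p) * indicator B (Z p) \<partial>M) =
      (\<integral>\<^sup>+z. (\<integral>\<^sup>+t. ennreal (m (z, t)) * (ennreal (1 / V (z, t)) * indicator B (Z (z, t))) \<partial>lborel) \<partial>\<gamma>)" by (rule nnM) measurable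
    also have "\<dots> \<le> (\<integral>\<^sup>+z. ennreal (1 / \<rho>p (fst z)) * (ennreal (w z) * half_mass B z) +
        ennreal (1 / \<rho>m (snd z)) * (ennreal (w z) * half_mass B (prod.swap z)) \<partial>\<gamma>)"
    proof (intro nn_integral_mono_AE, use \<rho>pos in eventually_elim)
      fix z assume r: "0 < \<rho>p (fst z) \<and> 0 < \<rho>m (snd z)"
      \<comment> \<open>For rays of length 0 the left side is 0; otherwise the length cancels and
        \<open>w z / r\<close> remains.\<close>
      have e: "ennreal (d z) * ennreal (1 / (r * (d z / w z))) \<le> ennreal (1 / r) * ennreal (w z)" if "r > 0" for r
      proof (cases "d z = 0")
        case False
        then have "0 < d z" using d0[of z] by linarith
        then have "d z * (1 / (r * (d z / w z))) = (1 / r) * w z" using wpos[of z] that by (simp add: field_simps)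
        then show ?thesis using that d0[of z] w0[of z] by (simp add: ennreal_mult'[symmetric])
      qed simp
      have "(\<integral>\<^sup>+t. ennreal (m (z, t)) * (ennreal (1 / V (z, t)) * indicator B (Z (z, t))) \<partial>lborel) \<le>
        (\<integral>\<^sup>+t. (ennreal (1 / \<rho>p (fst z)) * ennreal (w z)) * (indicator {0<..1/2} t * indicator B (seg z t)) +
          (ennreal (1 / \<rho>m (snd z)) * ennreal (w z)) * (indicator {1/2<..<1} t * indicator B (seg z t)) \<partial>lborel)"
      proof (rule nn_integral_mono)
        fix t :: real
        consider "t \<in> {0<..1/2}" | "t \<in> {1/2<..<1}" | "t \<notin> {0<..<1}" by force
        then show "ennreal (m (z, t)) * (ennreal (1 / V (z, t)) * indicator B (Z (z, t))) \<le>
          (ennreal (1 / \<rho>p (fst z)) * ennreal (w z)) * (indicator {0<..1/2} t * indicator B (seg z t)) +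
          (ennreal (1 / \<rho>m (snd z)) * ennreal (w z)) * (indicator {1/2<..<1} t * indicator B (seg z t))"
        proof cases
          case 1
          then show ?thesis using e[of "\<rho>p (fst z)"] r by (simp add: m_def V_def Z_def indicator_def)
        next
          case 2
          then show ?thesis using e[of "\<rho>m (snd z)"] r by (simp add: m_def V_def Z_def indicator_def)
        qed (simp add: m_def)
      qed
      also have "\<dots> = (ennreal (1 / \<rho>p (fst z)) * ennreal (w z)) * half_mass B z +
          (ennreal (1 / \<rho>m (snd z)) * ennreal (w z)) * (\<integral>\<^sup>+t. indicator {1/2<..<1} t * indicator B (seg z t) \<partial>lborel)"
        unfolding half_mass_def by (subst nn_integral_add) (auto simp: nn_integral_cmult)
      also have "\<dots> \<le> (ennreal (1 / \<rho>p (fst z)) * ennreal (w z)) * half_mass B z +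
          (ennreal (1 / \<rho>m (snd z)) * ennreal (w z)) * half_mass B (prod.swap z)"
        by (intro add_left_mono mult_left_mono half_mass_swap B) simp
      finally show "(\<integral>\<^sup>+t. ennreal (m (z, t)) * (ennreal (1 / V (z, t)) * indicator B (Z (z, t))) \<partial>lborel) \<le>
        ennreal (1 / \<rho>p (fst z)) * (ennreal (w z) * half_mass B z) +
        ennreal (1 / \<rho>m (snd z)) * (ennreal (w z) * half_mass B (prod.swap z))" by (simp add: mult.assoc)
    qed
    also have "\<dots> = (\<integral>\<^sup>+z. ennreal (1 / \<rho>p (fst z)) * (ennreal (w z) * half_mass B z) \<partial>\<gamma>) +
        (\<integral>\<^sup>+z. ennreal (1 / \<rho>m (snd z)) * (ennreal (w z) * half_mass B (prod.swap z)) \<partial>\<gamma>)"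
      by (rule nn_integral_add) measurable
    \<comment> \<open>Each half of the rays contributes one share of 512.\<close>
    also have "\<dots> \<le> 512 * emeasure lborel B + 512 * emeasure lborel B"
    proof (intro add_mono halves_le[OF \<rho> dens cont(2) w0 _ _ B])
      show "w (prod.swap z) = w z" for z by (simp add: w_def d_def dist_commute)
      show "w (prod.swap z) = w z" for z by (simp add: w_def d_def dist_commute)
      show "AE z in \<gamma>. transversal (w z) (fst z) (snd z) \<and> transversal (w z) (snd z) (fst z)"
        "AE z in \<gamma>. transversal (w z) (fst z) (snd z) \<and> transversal (w z) (snd z) (fst z)"
        using good unfolding w_def d_def by auto
    qed
    also have "\<dots> = ennreal 1024 * emeasure lborel B" by (simp add: distrib_right[symmetric])
    finally show ?thesis .
  qed
  have Vpos: "AE p in M. V p > 0"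
    using AE_M[OF \<rho>pos] by eventually_elim (auto simp: V_def wpos)
  have ZV: "Z \<in> borel_measurable M" "V \<in> borel_measurable M" by measurable
  obtain h where h: "h \<in> borel_measurable borel" "\<And>z. h z \<ge> 0"
    "distr M borel Z = density lborel (\<lambda>z. ennreal (h z))"
    "\<And>p. p \<ge> 1 \<Longrightarrow> (\<integral>\<^sup>+p'. ennreal (V p' powr (p - 1)) \<partial>M) < \<infinity> \<Longrightarrow> (\<integral>\<^sup>+z. ennreal (h z powr p) \<partial>lborel) < \<infinity>"
    "\<And>K. K \<ge> 0 \<Longrightarrow> AE p in M. V p \<le> K \<Longrightarrow> AE z in lborel. h z \<le> 1024 * K"
  proof (rule pushforward_Lp_density[where C=1024, OF finM ZV Vpos _ bd])
    show "(0::real) < 1024" by simp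
  qed (assumption, rule that)
  have fin_p: "(\<integral>\<^sup>+x. ennreal (h x powr p) \<partial>lborel) < \<infinity>"
    if p: "1 \<le> p" "\<kappa> \<longrightarrow> p \<le> 2" and f: "(\<integral>\<^sup>+x. ennreal (\<rho>p x powr p) \<partial>hausdorff1) < \<infinity>" "(\<integral>\<^sup>+x. ennreal (\<rho>m x powr p) \<partial>hausdorff1) < \<infinity>" for p
  proof (rule h(4)[OF p(1)])
    \<comment> \<open>The bound of \<open>weight_power_le\<close> for the factor that depends on the
      length of the ray alone; only powers of the densities remain to be integrated.\<close>
    define L where "L = (if \<kappa> then K powr (2 - p) * c powr (1 - p) else K * (K / c) powr (p - 1))"
    have L0: "L \<ge> 0" using K(1) by (simp add: L_def)
    have pw: "\<rho> * \<rho> powr (p - 1) = \<rho> powr p" if "0 \<le> \<rho>" for \<rho> :: real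
      using powr_mult_base[OF that, of "p - 1"] by simp
    \<comment> \<open>The missing factor comes from the marginal itself: the power
      \<open>p - 1\<close> of \<open>\<rho>p\<close> integrated against \<open>fp\<close> is the
      power \<open>p\<close> integrated against \<open>hausdorff1\<close>.\<close>
    have i1: "(\<integral>\<^sup>+z. ennreal (\<rho>p (fst z) powr (p - 1)) \<partial>\<gamma>) = (\<integral>\<^sup>+x. ennreal (\<rho>p x powr p) \<partial>hausdorff1)"
    proof -
      have "(\<integral>\<^sup>+z. ennreal (\<rho>p (fst z) powr (p - 1)) \<partial>\<gamma>) = (\<integral>\<^sup>+x. ennreal (\<rho>p x powr (p - 1)) \<partial>fp)"
        unfolding plan(3)[symmetric] by (subst nn_integral_distr) auto
      also have "\<dots> = (\<integral>\<^sup>+x. ennreal (\<rho>p x) * ennreal (\<rho>p x powr (p - 1)) \<partial>hausdorff1)"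
        unfolding dens(1) by (rule nn_integral_density) measurable
      also have "\<dots> = (\<integral>\<^sup>+x. ennreal (\<rho>p x powr p) \<partial>hausdorff1)" using \<rho>0 pw by (simp add: ennreal_mult'[symmetric])
      finally show ?thesis .
    qed
    have i2: "(\<integral>\<^sup>+z. ennreal (\<rho>m (snd z) powr (p - 1)) \<partial>\<gamma>) = (\<integral>\<^sup>+x. ennreal (\<rho>m x powr p) \<partial>hausdorff1)"
    proof -
      have "(\<integral>\<^sup>+z. ennreal (\<rho>m (snd z) powr (p - 1)) \<partial>\<gamma>) = (\<integral>\<^sup>+x. ennreal (\<rho>m x powr (p - 1)) \<partial>fm)"
        unfolding plan(4)[symmetric] by (subst nn_integral_distr) auto
      also have "\<dots> = (\<integral>\<^sup>+x. ennreal (\<rho>m x) * ennreal (\<rho>m x powr (p - 1)) \<partial>hausdorff1)"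
        unfolding dens(2) by (rule nn_integral_density) measurable
      also have "\<dots> = (\<integral>\<^sup>+x. ennreal (\<rho>m x powr p) \<partial>hausdorff1)" using \<rho>0 pw by (simp add: ennreal_mult'[symmetric])
      finally show ?thesis .
    qed
    have "(\<integral>\<^sup>+p'. ennreal (V p' powr (p - 1)) \<partial>M) = (\<integral>\<^sup>+z. (\<integral>\<^sup>+t. ennreal (m (z, t)) * ennreal (V (z, t) powr (p - 1)) \<partial>lborel) \<partial>\<gamma>)"
      by (rule nnM) measurable
    also have "\<dots> \<le> (\<integral>\<^sup>+z. ennreal L * (ennreal (\<rho>p (fst z) powr (p - 1)) + ennreal (\<rho>m (snd z) powr (p - 1))) \<partial>\<gamma>)"
    proof (intro nn_integral_mono_AE, use K(2) in eventually_elim)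
      fix z assume dK: "d z \<le> K"
      define S where "S = \<rho>p (fst z) powr (p - 1) + \<rho>m (snd z) powr (p - 1)"
      have e: "d z * (r * (d z / w z)) powr (p - 1) \<le> L * r powr (p - 1)" if r: "0 \<le> r" for r
      proof (cases "d z = 0")
        case False
        then have dz: "0 < d z" using d0[of z] by linarith
        have "d z * (r * (d z / w z)) powr (p - 1) = (d z * (d z / w z) powr (p - 1)) * r powr (p - 1)"
        proof -
          have "(r * (d z / w z)) powr (p - 1) = r powr (p - 1) * (d z / w z) powr (p - 1)"
            by (rule powr_mult)
          then show ?thesis by (simp only: mult_ac)
        qed
        also have "\<dots> \<le> L * r powr (p - 1)"
          using weight_power_le[OF dz dK c p] unfolding w_def L_def by (intro mult_right_mono) auto
        finally show ?thesis .
      qed (simp add: L0)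
      have "(\<integral>\<^sup>+t. ennreal (m (z, t)) * ennreal (V (z, t) powr (p - 1)) \<partial>lborel) \<le> (\<integral>\<^sup>+t. ennreal (L * S) * indicator {0<..<1::real} t \<partial>lborel)"
      proof (rule nn_integral_mono)
        fix t :: real
        have "m (z, t) * V (z, t) powr (p - 1) \<le> L * S * indicator {0<..<1} t"
        proof (cases "t \<in> {0<..<1}")
          case True
          have "m (z, t) * V (z, t) powr (p - 1) \<le> L * (if t \<le> 1/2 then \<rho>p (fst z) powr (p - 1) else \<rho>m (snd z) powr (p - 1))"
            using e[OF \<rho>0(1)[of "fst z"]] e[OF \<rho>0(2)[of "snd z"]] True by (simp add: m_def V_def)
          also have "\<dots> \<le> L * S" unfolding S_def by (intro mult_left_mono L0) auto
          finally show ?thesis using True by simp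
        qed (simp add: m_def)
        then have "ennreal (m (z, t) * V (z, t) powr (p - 1)) \<le> ennreal (L * S * indicator {0<..<1} t)" by (rule ennreal_leI)
        then show "ennreal (m (z, t)) * ennreal (V (z, t) powr (p - 1)) \<le> ennreal (L * S) * indicator {0<..<1} t"
          unfolding ennreal_mult'[OF m0] by (cases "t \<in> {0<..<1}") auto
      qed
      also have "\<dots> = ennreal (L * S)" by (subst nn_integral_cmult) auto
      also have "\<dots> = ennreal L * (ennreal (\<rho>p (fst z) powr (p - 1)) + ennreal (\<rho>m (snd z) powr (p - 1)))"
        unfolding S_def using L0 by (simp add: ennreal_mult')
      finally show "(\<integral>\<^sup>+t. ennreal (m (z, t)) * ennreal (V (z, t) powr (p - 1)) \<partial>lborel) \<le>
        ennreal L * (ennreal (\<rho>p (fst z) powr (p - 1)) + ennreal (\<rho>m (snd z) powr (p - 1)))" .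
    qed
    also have "\<dots> = ennreal L * ((\<integral>\<^sup>+z. ennreal (\<rho>p (fst z) powr (p - 1)) \<partial>\<gamma>) + (\<integral>\<^sup>+z. ennreal (\<rho>m (snd z) powr (p - 1)) \<partial>\<gamma>))"
      by (subst nn_integral_cmult, measurable, subst nn_integral_add) auto
    also have "\<dots> < \<infinity>" unfolding i1 i2 using f by (simp add: ennreal_mult_less_top)
    finally show "(\<integral>\<^sup>+p'. ennreal (V p' powr (p - 1)) \<partial>M) < \<infinity>" .
  qed
  have fin_inf: "\<exists>L'. AE x in lborel. h x \<le> L'"
    if L: "0 \<le> L" and k: "\<not> \<kappa>" and b: "AE x in hausdorff1. \<rho>p x \<le> L \<and> \<rho>m x \<le> L" for L
  proof -
    have "AE x in fp. \<rho>p x \<le> L" unfolding dens(1) using b by (subst AE_density) auto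
    moreover have "AE x in fm. \<rho>m x \<le> L" unfolding dens(2) using b by (subst AE_density) auto
    ultimately have "AE z in \<gamma>. \<rho>p (fst z) \<le> L \<and> \<rho>m (snd z) \<le> L \<and> d z \<le> K"
      using K(2) by (intro AE_conjI AE_fst AE_snd)
    from AE_M[OF this] have "AE p in M. V p \<le> L * (K / c)"
    proof eventually_elim
      fix p :: "(plane \<times> plane) \<times> real"
      assume *: "(\<rho>p (fst (fst p)) \<le> L \<and> \<rho>m (snd (fst p)) \<le> L \<and> d (fst p) \<le> K) \<and> 0 < d (fst p)"
      show "V p \<le> L * (K / c)"
        unfolding V_def using * L k c d0[of "fst p"] by (intro mult_mono) (auto simp: w_def divide_right_mono)
    qed
    then have "AE z in lborel. h z \<le> 1024 * (L * (K / c))" using L K(1) c by (intro h(5)) auto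
    then show ?thesis by blast
  qed
  show ?thesis by (rule that[OF h(1,2) _ fin_p fin_inf]) (use h(3) \<sigma>_eq in auto)
qed

end

section \<open>Densities on the boundary and in the annulus\<close>

text \<open>The density of \<open>f\<close> is extended by 0 off the boundary and split by the set
  \<open>P\<close> of the Jordan decomposition. Its two parts are nonnegative almost everywhere;
  \<open>max 0\<close> makes them so at every point and leaves the measures unchanged.\<close>

lemma boundary_Lp_densities:
  assumes Lp: "boundary_Lp \<Omega> p fp fm" and J: "jordan_parts fp fm"
  obtains \<rho>p \<rho>m where "\<rho>p \<in> borel_measurable borel" "\<rho>m \<in> borel_measurable borel" "\<And>x. 0 \<le> \<rho>p x" "\<And>x. 0 \<le> \<rho>m x"
    "fp = density hausdorff1 (\<lambda>x. ennreal (\<rho>p x))" "fm = density hausdorff1 (\<lambda>x. ennreal (\<rho>m x))"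
    "p \<noteq> \<infinity> \<Longrightarrow> (\<integral>\<^sup>+x. ennreal (\<rho>p x powr enn2real p) \<partial>hausdorff1) < \<infinity>"
    "p \<noteq> \<infinity> \<Longrightarrow> (\<integral>\<^sup>+x. ennreal (\<rho>m x powr enn2real p) \<partial>hausdorff1) < \<infinity>"
    "p = \<infinity> \<Longrightarrow> \<exists>L\<ge>0. AE x in hausdorff1. \<rho>p x \<le> L \<and> \<rho>m x \<le> L"
proof -
  define F where "F = frontier \<Omega>"
  have F [measurable]: "F \<in> sets borel" by (simp add: F_def borel_closed)
  then have FH: "F \<inter> space hausdorff1 \<in> sets hausdorff1" by simp
  have "has_Lp_density (restrict_space hausdorff1 F) p (\<lambda>A. measure fp A - measure fm A)"
    using Lp by (simp add: boundary_Lp_def boundary_measure_def F_def)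
  then obtain h where h: "in_Lp (restrict_space hausdorff1 F) p h" "integrable (restrict_space hausdorff1 F) h"
    "\<forall>A\<in>sets borel. measure fp A - measure fm A = (LINT x|restrict_space hausdorff1 F. indicator A x * h x)"
    unfolding has_Lp_density_def by blast
  define k where "k x = indicator F x * h x" for x
  have ik: "integrable hausdorff1 k"
    using h(2) by (simp add: integrable_restrict_space[OF FH] k_def[abs_def])
  have eq: "measure fp A - measure fm A = (LINT x|hausdorff1. indicator A x * k x)" if "A \<in> sets borel" for A
    using h(3) that by (simp add: integral_restrict_space[OF FH] k_def mult.left_commute)
  have eq': "measure fm A - measure fp A = (LINT x|hausdorff1. indicator A x * - k x)" if "A \<in> sets borel" for A
    using eq[OF that] by simp
  have km [measurable]: "k \<in> borel_measurable borel"
    using borel_measurable_integrable[OF ik] by (simp cong: measurable_cong_sets)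
  obtain P where P [measurable]: "P \<in> sets borel" and P0: "emeasure fp (- P) = 0" "emeasure fm P = 0"
    and fin: "finite_measure fp" "finite_measure fm" and sets: "sets fp = sets borel" "sets fm = sets borel"
    using J unfolding jordan_parts_def by blast
  define \<rho>p where "\<rho>p x = max 0 (indicator P x * k x)" for x
  define \<rho>m where "\<rho>m x = max 0 (indicator (- P) x * - k x)" for x
  have le: "0 \<le> \<rho>p x" "0 \<le> \<rho>m x" "\<rho>p x \<le> \<bar>k x\<bar>" "\<rho>m x \<le> \<bar>k x\<bar>" for x
    by (auto simp: \<rho>p_def \<rho>m_def indicator_def)
  have [measurable]: "\<rho>p \<in> borel_measurable borel" "\<rho>m \<in> borel_measurable borel"
    unfolding \<rho>p_def \<rho>m_def by measurable
  have dp: "fp = density hausdorff1 (\<lambda>x. ennreal (\<rho>p x))"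
    unfolding \<rho>p_def ennreal_max_0
    by (rule jordan_density[OF _ ik fin sets P P0 eq]) simp
  have "- P \<in> sets borel" using P by simp
  then have dm: "fm = density hausdorff1 (\<lambda>x. ennreal (\<rho>m x))"
    unfolding \<rho>m_def ennreal_max_0
    using ik P0 by (intro jordan_density[OF _ _ fin(2,1) sets(2,1) _ _ _ eq']) auto
  have fin_p: "(\<integral>\<^sup>+x. ennreal (r x powr enn2real p) \<partial>hausdorff1) < \<infinity>"
    if "p \<noteq> \<infinity>" and r: "\<And>x. 0 \<le> r x \<and> r x \<le> \<bar>k x\<bar>" for r
  proof -
    have "integrable (restrict_space hausdorff1 F) (\<lambda>x. \<bar>h x\<bar> powr enn2real p)"
      using h(1) that(1) by (simp add: in_Lp_def)
    then have "integrable hausdorff1 (\<lambda>x. indicator F x * \<bar>h x\<bar> powr enn2real p)"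
      by (simp add: integrable_restrict_space[OF FH])
    then have "(\<integral>\<^sup>+x. ennreal (norm (indicator F x * \<bar>h x\<bar> powr enn2real p)) \<partial>hausdorff1) < \<infinity>"
      unfolding integrable_iff_bounded by simp
    moreover have "(\<integral>\<^sup>+x. ennreal (r x powr enn2real p) \<partial>hausdorff1) \<le> (\<integral>\<^sup>+x. ennreal (norm (indicator F x * \<bar>h x\<bar> powr enn2real p)) \<partial>hausdorff1)"
    proof (intro nn_integral_mono ennreal_leI)
      fix x
      have "r x powr enn2real p \<le> \<bar>k x\<bar> powr enn2real p" using r[of x] by (intro powr_mono2) auto
      also have "\<dots> = norm (indicator F x * \<bar>h x\<bar> powr enn2real p)" by (auto simp: k_def indicator_def)
      finally show "r x powr enn2real p \<le> norm (indicator F x * \<bar>h x\<bar> powr enn2real p)" .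
    qed
    ultimately show ?thesis by (rule le_less_trans[rotated])
  qed
  have fin_inf: "\<exists>L\<ge>0. AE x in hausdorff1. \<rho>p x \<le> L \<and> \<rho>m x \<le> L" if top: "p = \<infinity>"
  proof -
    obtain C where "AE x in restrict_space hausdorff1 F. \<bar>h x\<bar> \<le> C"
      using h(1) top by (auto simp: in_Lp_def)
    then have "AE x in hausdorff1. x \<in> F \<longrightarrow> \<bar>h x\<bar> \<le> C" by (simp add: AE_restrict_space_iff[OF FH])
    then have "AE x in hausdorff1. \<rho>p x \<le> max 0 C \<and> \<rho>m x \<le> max 0 C"
    proof eventually_elim
      fix x assume "x \<in> F \<longrightarrow> \<bar>h x\<bar> \<le> C"
      then have "\<bar>k x\<bar> \<le> max 0 C" by (auto simp: k_def indicator_def)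
      then show "\<rho>p x \<le> max 0 C \<and> \<rho>m x \<le> max 0 C" using le(3,4)[of x] by linarith
    qed
    then show ?thesis by (intro exI[of _ "max 0 C"]) simp
  qed
  show ?thesis
  proof (rule that[OF _ _ le(1,2) dp dm _ _ fin_inf])
    show "(\<integral>\<^sup>+x. ennreal (\<rho>p x powr enn2real p) \<partial>hausdorff1) < \<infinity>" if "p \<noteq> \<infinity>" using fin_p[OF that] le by blast
    show "(\<integral>\<^sup>+x. ennreal (\<rho>m x powr enn2real p) \<partial>hausdorff1) < \<infinity>" if "p \<noteq> \<infinity>" using fin_p[OF that] le by blast
  qed auto
qed

context transport_setup
begin

lemma frontier_null: "emeasure lborel T = 0" "T \<in> sets borel"
proof -
  show T: "T \<in> sets borel" using compact_T by (simp add: borel_compact)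
  have "negligible T" unfolding T_def using Op_Om by (intro negligible_Un negligible_convex_frontier)
  then have "T \<in> null_sets lborel" using T by (simp add: negligible_iff_null_sets null_sets_completion_iff)
  then show "emeasure lborel T = 0" by auto
qed

text \<open>\<open>\<sigma>\<close> lives on the closure of the annulus and the boundary curves have
  area 0, so \<open>h\<close> vanishes almost everywhere outside the open annulus and nothing is
  lost by restriction.\<close>

lemma interior_Lp_if_density:
  assumes h [measurable]: "h \<in> borel_measurable borel" and h0: "\<And>x. 0 \<le> h x"
    and dens: "\<sigma> = density lborel (\<lambda>x. ennreal (h x))" and \<sigma>: "transport_density (annulus Op Om) \<gamma> \<sigma>"
    and fin: "p \<noteq> \<infinity> \<Longrightarrow> (\<integral>\<^sup>+x. ennreal (h x powr enn2real p) \<partial>lborel) < \<infinity>"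
    and inf: "p = \<infinity> \<Longrightarrow> \<exists>L. AE x in lborel. h x \<le> L"
  shows "interior_Lp (annulus Op Om) p \<sigma>"
proof -
  interpret \<sigma>: finite_measure \<sigma> using \<sigma> by (simp add: transport_density_def)
  define U where "U = annulus Op Om"
  have "open U" unfolding U_def annulus_def using Op_Om(1) by (intro open_Diff) auto
  then have U [measurable]: "U \<in> sets borel" by simp
  then have US: "U \<inter> space lborel \<in> sets lborel" by simp
  have sub: "- U \<subseteq> - closure U \<union> T"
    using \<open>open U\<close> unfolding frontier_annulus[symmetric] U_def[symmetric] by (auto simp: frontier_def interior_open)
  have "emeasure \<sigma> T = (\<integral>\<^sup>+x. ennreal (h x) * indicator T x \<partial>lborel)"
    unfolding dens using frontier_null(2) by (intro emeasure_density) auto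
  also have "\<dots> = 0" using frontier_null by (intro nn_integral_null_set) (auto simp: null_sets_def)
  finally have T0: "emeasure \<sigma> T = 0" .
  have "- closure U \<union> T \<in> null_sets \<sigma>"
    using \<sigma> T0 frontier_null(2) by (intro null_sets.Un) (auto simp: null_sets_def transport_density_def U_def)
  from AE_not_in[OF this] have "AE x in \<sigma>. x \<in> U" by eventually_elim (use sub in blast)
  then have AE0: "AE x in lborel. x \<notin> U \<longrightarrow> h x = 0"
    unfolding dens by (subst (asm) AE_density) (auto elim!: eventually_mono intro: antisym h0 simp: not_less)
  have int: "integrable lborel h"
  proof (rule integrableI_bounded)
    have "(\<integral>\<^sup>+x. ennreal (norm (h x)) \<partial>lborel) = emeasure \<sigma> UNIV"
      unfolding dens by (subst emeasure_density) (auto simp: h0)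
    then show "(\<integral>\<^sup>+x. ennreal (norm (h x)) \<partial>lborel) < \<infinity>" by (simp add: \<sigma>.emeasure_eq_measure)
  qed simp
  have "measure \<sigma> A = (LINT x|restrict_space lborel U. indicator A x * h x)" if A [measurable]: "A \<in> sets borel" for A
  proof -
    have "measure \<sigma> A = (LINT x|\<sigma>. indicator A x)" using A dens by simp
    also have "\<dots> = (LINT x|lborel. h x * indicator A x)"
      unfolding dens by (subst integral_density) (auto simp: h0)
    also have "\<dots> = (LINT x|lborel. indicator U x * (indicator A x * h x))"
      using AE0 by (intro integral_cong_AE) (auto elim!: eventually_mono simp: indicator_def)
    finally show ?thesis by (simp add: integral_restrict_space[OF US])
  qed
  moreover have "in_Lp (restrict_space lborel U) p h"
  proof (cases "p = \<infinity>")
    case True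
    then obtain L where "AE x in lborel. h x \<le> L" using inf by blast
    then have "AE x in lborel. x \<in> U \<longrightarrow> \<bar>h x\<bar> \<le> L" by eventually_elim (simp add: h0)
    then show ?thesis using True by (auto simp: in_Lp_def AE_restrict_space_iff[OF US] intro!: measurable_restrict_space1)
  next
    case False
    have "integrable lborel (\<lambda>x. \<bar>h x\<bar> powr enn2real p)"
      using fin[OF False] by (intro integrableI_bounded) (auto simp: h0)
    from integrable_mult_indicator[OF _ this, of U] have "integrable (restrict_space lborel U) (\<lambda>x. \<bar>h x\<bar> powr enn2real p)"
      by (simp add: integrable_restrict_space[OF US])
    then show ?thesis using False by (auto simp: in_Lp_def intro!: measurable_restrict_space1)
  qed
  moreover have "integrable (restrict_space lborel U) h"
    using integrable_mult_indicator[OF _ int, of U] by (simp add: integrable_restrict_space[OF US])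
  ultimately show ?thesis unfolding interior_Lp_def has_Lp_density_def U_def by blast
qed

lemma interior_Lp_if_transversal:
  fixes \<rho>p \<rho>m :: "plane \<Rightarrow> real"
  assumes \<rho>: "\<rho>p \<in> borel_measurable borel" "\<rho>m \<in> borel_measurable borel" "\<And>x. 0 \<le> \<rho>p x" "\<And>x. 0 \<le> \<rho>m x"
    and dens: "fp = density hausdorff1 (\<lambda>x. ennreal (\<rho>p x))" "fm = density hausdorff1 (\<lambda>x. ennreal (\<rho>m x))"
    and fin: "p \<noteq> \<infinity> \<Longrightarrow> (\<integral>\<^sup>+x. ennreal (\<rho>p x powr enn2real p) \<partial>hausdorff1) < \<infinity>"
      "p \<noteq> \<infinity> \<Longrightarrow> (\<integral>\<^sup>+x. ennreal (\<rho>m x powr enn2real p) \<partial>hausdorff1) < \<infinity>"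
    and inf: "p = \<infinity> \<Longrightarrow> \<exists>L\<ge>0. AE x in hausdorff1. \<rho>p x \<le> L \<and> \<rho>m x \<le> L"
    and \<sigma>: "transport_density (annulus Op Om) \<gamma> \<sigma>" and c: "c > 0"
    and good: "AE z in \<gamma>. transversal (c * (if \<kappa> then (dist (fst z) (snd z))\<^sup>2 else 1)) (fst z) (snd z) \<and>
      transversal (c * (if \<kappa> then (dist (fst z) (snd z))\<^sup>2 else 1)) (snd z) (fst z)"
    and p: "1 \<le> p" "\<kappa> \<longrightarrow> p \<le> 2"
  shows "interior_Lp (annulus Op Om) p \<sigma>"
proof -
  obtain h where h: "h \<in> borel_measurable borel" "\<And>x. 0 \<le> h x" "\<sigma> = density lborel (\<lambda>x. ennreal (h x))"
    "\<And>q. 1 \<le> q \<Longrightarrow> \<kappa> \<longrightarrow> q \<le> 2 \<Longrightarrow> (\<integral>\<^sup>+x. ennreal (\<rho>p x powr q) \<partial>hausdorff1) < \<infinity> \<Longrightarrow>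
      (\<integral>\<^sup>+x. ennreal (\<rho>m x powr q) \<partial>hausdorff1) < \<infinity> \<Longrightarrow> (\<integral>\<^sup>+x. ennreal (h x powr q) \<partial>lborel) < \<infinity>"
    "\<And>L. 0 \<le> L \<Longrightarrow> \<not> \<kappa> \<Longrightarrow> AE x in hausdorff1. \<rho>p x \<le> L \<and> \<rho>m x \<le> L \<Longrightarrow> \<exists>L'. AE x in lborel. h x \<le> L'"
    by (rule transport_density_Lp[OF \<rho> dens \<sigma> c good]) (rule that)
  show ?thesis
  proof (rule interior_Lp_if_density[OF h(1,2,3) \<sigma>])
    assume top: "p \<noteq> \<infinity>"
    then obtain r where r: "p = ennreal r" "0 \<le> r" by (cases p) auto
    have "1 \<le> enn2real p" using p(1) r by simp
    moreover have "\<kappa> \<longrightarrow> enn2real p \<le> 2"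
      using p(2) r by (auto simp: ennreal_le_iff2 simp flip: ennreal_numeral)
    ultimately show "(\<integral>\<^sup>+x. ennreal (h x powr enn2real p) \<partial>lborel) < \<infinity>"
      using h(4) fin[OF top] by blast
  next
    assume top: "p = \<infinity>"
    \<comment> \<open>The quadratic weight comes with \<open>p \<le> 2\<close>, which excludes the
      infinite exponent.\<close>
    then have "\<not> \<kappa>" using p(2) by (auto simp: top_unique)
    then show "\<exists>L. AE x in lborel. h x \<le> L" using inf[OF top] h(5) by blast
  qed
qed

end

theorem theorem5p1:
  fixes Op Om :: "plane set" and g :: "plane \<Rightarrow> real"
    and fp fm \<sigma> :: "plane measure" and \<gamma> :: "(plane \<times> plane) measure"
    and D :: decomposition
  assumes "annulus_data Op Om"
    and "tangential_derivative Op Om g fp fm"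
    and "H1 Op Om g"
    and "H2 Op Om g fp fm D"
    and "H3 Op Om D"
    and "H4 g D"
    and "H5 Om D"
    and "optimal_plan (annulus Op Om) fp fm \<gamma>"
    and "\<And>\<gamma>'. optimal_plan (annulus Op Om) fp fm \<gamma>' \<Longrightarrow> \<gamma>' = \<gamma>"
    and "transport_density (annulus Op Om) \<gamma> \<sigma>"
  shows "((\<forall>i\<in>IFp D. g constant_on Fp D i) \<longrightarrow>
            (\<forall>p. 1 \<le> p \<longrightarrow>
               boundary_Lp (annulus Op Om) p fp fm \<longrightarrow> interior_Lp (annulus Op Om) p \<sigma>)) \<and>
         ((\<exists>i\<in>IFp D. \<not> g constant_on Fp D i) \<longrightarrow> uniformly_convex Op \<longrightarrow>
            (\<forall>p. 1 \<le> p \<and> p \<le> 2 \<longrightarrow>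
               boundary_Lp (annulus Op Om) p fp fm \<longrightarrow> interior_Lp (annulus Op Om) p \<sigma>))"
proof -
  have J: "jordan_parts fp fm" using assms(2) by (simp add: tangential_derivative_def Let_def)
  \<comment> \<open>Both parts of the theorem are the same estimate; they differ only in the
    transversality that is available.\<close>
  have main: "interior_Lp (annulus Op Om) p \<sigma>"
    if p: "1 \<le> p" and Lp: "boundary_Lp (annulus Op Om) p fp fm"
      and alt: "(\<forall>i\<in>IFp D. g constant_on Fp D i) \<or> uniformly_convex Op \<and> p \<le> 2" for p
  proof -
    obtain \<rho>p \<rho>m where \<rho>: "\<rho>p \<in> borel_measurable borel" "\<rho>m \<in> borel_measurable borel" "\<And>x. 0 \<le> \<rho>p x" "\<And>x. 0 \<le> \<rho>m x"
      and dens: "fp = density hausdorff1 (\<lambda>x. ennreal (\<rho>p x))" "fm = density hausdorff1 (\<lambda>x. ennreal (\<rho>m x))"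
      and fin_p: "p \<noteq> \<infinity> \<Longrightarrow> (\<integral>\<^sup>+x. ennreal (\<rho>p x powr enn2real p) \<partial>hausdorff1) < \<infinity>"
        "p \<noteq> \<infinity> \<Longrightarrow> (\<integral>\<^sup>+x. ennreal (\<rho>m x powr enn2real p) \<partial>hausdorff1) < \<infinity>"
      and bdd: "p = \<infinity> \<Longrightarrow> \<exists>L\<ge>0. AE x in hausdorff1. \<rho>p x \<le> L \<and> \<rho>m x \<le> L"
      by (rule boundary_Lp_densities[OF Lp J]) (rule that)
    have [measurable]: "\<rho>p \<in> borel_measurable hausdorff1" "\<rho>m \<in> borel_measurable hausdorff1"
      using \<rho> by (simp_all cong: measurable_cong_sets)
    interpret transport_setup Op Om g fp fm \<gamma> D
    proof
      fix A :: "plane set" assume A: "A \<in> sets borel" "emeasure hausdorff1 A = 0"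
      then have "A \<in> null_sets hausdorff1" by (auto simp: null_sets_def)
      then show "emeasure fp A = 0 \<and> emeasure fm A = 0"
        unfolding dens using A by (simp add: emeasure_density nn_integral_null_set)
    qed (rule assms)+
    from alt show ?thesis
    proof
      assume flat: "\<forall>i\<in>IFp D. g constant_on Fp D i"
      obtain c where c: "c > 0" "AE z in \<gamma>. transversal c (fst z) (snd z) \<and> transversal c (snd z) (fst z)"
        by (rule flat_transversal[OF flat])
      show ?thesis
        by (rule interior_Lp_if_transversal[where \<kappa>=False, OF \<rho> dens fin_p bdd assms(10) c(1) _ p]) (use c(2) in auto)
    next
      assume u: "uniformly_convex Op \<and> p \<le> 2"
      obtain c where c: "c > 0" "AE z in \<gamma>. transversal (c * (dist (fst z) (snd z))\<^sup>2) (fst z) (snd z) \<and>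
          transversal (c * (dist (fst z) (snd z))\<^sup>2) (snd z) (fst z)"
        by (rule uniform_transversal[OF conjunct1[OF u]])
      show ?thesis
        by (rule interior_Lp_if_transversal[where \<kappa>=True, OF \<rho> dens fin_p bdd assms(10) c(1) _ p]) (use c(2) u in auto)
    qed
  qed
  show ?thesis using main by blast
qed

end
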